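(* Let $\alpha>0$, $T>0$, and let $(\sigma^V,j^V)\in\mathrm{CE}(0,T;\Omega_1)$, $V\ge1$, satisfy $\sup_{V\ge1}\{\mathrm{Ent}(\sigma^V_0\,|\,\pi)+\mathscr I^V(\sigma^V,j^V)\}\le C$ for some $C>0$, where $\sigma^V_0=\sigma^V|_{t=0}$. Define $$\rho^V(dt\,dx):=\sum_{v\in\{-1,1\}}\sigma^V_t(dx,v)\,dt,\quad \omega^V(dt\,dx):=V\sum_{v\in\{-1,1\}}v\,\sigma^V_t(dx,v)\,dt,\quad J^V(dt\,dx):=\sum_{v\in\{-1,1\}}\frac vV\,j^{2,V}_t(dx,v)\,dt .$$ Suppose that, as $V\to\infty$, $\rho^V\to\bar\rho$, $\omega^V\to\bar\omega$ and $J^V\to\bar J$ narrowly in $\mathcal M((0,T)\times\mathbb T)$, and $\rho^V_t\to\bar\rho_t$ narrowly in $\mathcal P(\mathbb T)$ for every $t\in[0,T]$. Then $$\liminf_{V\to\infty}\mathscr I^V(\sigma^V,j^V)\ge\bar{\mathscr J}(\bar\rho,\bar\omega),$$ where $$\bar{\mathscr J}(\rho,\omega):=\frac1{4\alpha}\int_0^T\int_{\mathbb T}\Bigl|\alpha\frac{dD\rho}{d\rho}(t,x)+\frac{d\omega}{d\rho}(t,x)\Bigr|^2\rho_t(dx)\,dt$$ if $\omega\ll\rho$, $D\rho\ll\rho$ and $(\rho,\omega)\in\mathrm{CE}(0,T;\mathbb T)$, and $\bar{\mathscr J}(\rho,\omega):=+\infty$ otherwise.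
   Context: $\mathbb T=\mathbb R/\mathbb Z$, $\mathcal L_{\mathbb T}$ Lebesgue measure, $\Omega_1:=\mathbb T\times\{-1,1\}$, $\iota(x,v):=(x,-v)$, $\pi:=\mathcal L_{\mathbb T}\otimes\mathrm{Unif}_{\{-1,1\}}$. $\mathcal P$, $\mathcal M$: probability measures and finite signed Borel measures; narrow topology = duality with bounded continuous functions. $C^{1,0}(\Omega_1)$: functions that are $C^1$ in $x$ for each $v$. $(\sigma,j)\in\mathrm{CE}(0,T;\Omega_1)$ means: $\sigma\in C([0,T];\mathcal P(\Omega_1))$ (narrowly continuous); $(j_t)_{t\in(0,T)}\subset\mathcal M(\Omega_1;\mathbb R^2)$, $j_t=(j^1_t,j^2_t)$, is a measurable family with $\int_0^T\|j_t\|_{\mathrm{TV}}\,dt<\infty$; and for all $\varphi\in C^{1,0}(\Omega_1)$, $0\le s\le t\le T$: $\int\varphi\,d\sigma_t-\int\varphi\,d\sigma_s=\int_s^t\int_{\Omega_1}[\partial_x\varphi\,dj^1_r+(\varphi\circ\iota-\varphi)\,dj^2_r]\,dr$. Components of $j^V$ are $j^{1,V},j^{2,V}$. $\mathrm{Ent}(\mu\,|\,\nu):=\int(f\log f-f+1)\,d\nu$ if $\mu\ll\nu$ with $f=d\mu/d\nu\ge0$, $+\infty$ otherwise. $\mathscr I^V(\sigma,j):=\int_0^T\mathscr L^V(\sigma_r,j_r)\,dr$ if $(\sigma,j)\in\mathrm{CE}(0,T;\Omega_1)$, $+\infty$ otherwise, with $\mathscr L^V(\sigma,j):=\mathrm{Ent}\bigl(j^2\,|\,\tfrac{V^2}{2\alpha}\sigma\bigr)$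 if $j^1=V\,v\,\sigma$, $+\infty$ otherwise. The functional $\bar{\mathscr J}$ is defined on $C([0,T];\mathcal P(\mathbb T))\times\mathcal M((0,T)\times\mathbb T)$; a curve $\rho$ is identified with the measure $\rho_t(dx)\,dt$. $(\rho,\omega)\in\mathrm{CE}(0,T;\mathbb T)$ means $\omega(dt\,dx)=\omega_t(dx)\,dt$ and, for all $\psi\in C^1(\mathbb T)$, $0\le s\le t\le T$, $\int_{\mathbb T}\psi\,d\rho_t-\int_{\mathbb T}\psi\,d\rho_s=\int_s^t\int_{\mathbb T}\partial_x\psi\,d\omega_r\,dr$. $D\rho$ is the distributional derivative of $\rho$ in $x$; "$D\rho\ll\rho$" means it is a finite measure on $(0,T)\times\mathbb T$ that is absolutely continuous with respect to $\rho_t(dx)\,dt$. *)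

theory Defs
  imports "HOL-Probability.Probability_Measure"
begin

section \<open>The circle\<close>

quotient_type circle = real / "\<lambda>x y. x - y \<in> \<int>"
proof (rule equivpI)
  show "reflp (\<lambda>x y::real. x - y \<in> \<int>)"
    by (simp add: reflp_def)
  show "symp (\<lambda>x y::real. x - y \<in> \<int>)"
    by (metis (no_types, lifting) Ints_minus minus_diff_eq sympI)
  show "transp (\<lambda>x y::real. x - y \<in> \<int>)"
  proof (rule transpI)
    fix x y z :: real
    assume "x - y \<in> \<int>" "y - z \<in> \<int>"
    then have "(x - y) + (y - z) \<in> \<int>" by (rule Ints_add)
    then show "x - z \<in> \<int>" by simp
  qed
qed

instantiation circle :: topological_space
begin

definition open_circle :: "circle set \<Rightarrow> bool"
  where "open_circle U \<longleftrightarrow> open (abs_circle -` U)"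

instance
proof
  show "open (UNIV :: circle set)" by (simp add: open_circle_def)
  show "open (S \<inter> T)" if "open S" "open T" for S T :: "circle set"
    using that by (simp add: open_circle_def open_Int)
  show "open (\<Union>K)" if "\<forall>S\<in>K. open S" for K :: "circle set set"
    using that by (auto simp: open_circle_def vimage_Union)
qed

end

lemma continuous_abs_circle: "continuous_on UNIV abs_circle"
  by (simp add: continuous_on_open_vimage open_circle_def)

lemma open_image_abs_circle:
  assumes "open S"
  shows "open (abs_circle ` S)"
proof -
  have "abs_circle -` (abs_circle ` S) = (\<Union>k\<in>\<int>. (+) k ` S)" (is "?L = ?R")
  proof
    show "?L \<subseteq> ?R"
    proof
      fix x assume "x \<in> ?L"
      then obtain y where y: "y \<in> S" "x - y \<in> \<int>"
        by (auto simp: circle.abs_eq_iff)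
      then have "x = (x - y) + y" by simp
      with y show "x \<in> ?R" by blast
    qed
    show "?R \<subseteq> ?L"
    proof
      fix x assume "x \<in> ?R"
      then obtain k y where "k \<in> \<int>" "y \<in> S" "x = k + y" by auto
      then have "abs_circle x = abs_circle y"
        by (simp add: circle.abs_eq_iff)
      with \<open>y \<in> S\<close> show "x \<in> ?L" by auto
    qed
  qed
  moreover have "open ((+) k ` S)" for k :: real
    using assms by (rule open_translation)
  ultimately show ?thesis
    by (simp add: open_circle_def open_UN)
qed

lemma surj_abs_circle: "surj abs_circle"
  by (metis Quotient_abs_rep Quotient_circle surjI)

instance circle :: second_countable_topology
proof
  obtain B :: "real set set" where B: "countable B" "topological_basis B"
    using ex_countable_basis by blast
  have "topological_basis ((`) abs_circle ` B)"
  proof (rule topological_basisI)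
    fix U assume "U \<in> (`) abs_circle ` B"
    then show "open U"
      using B topological_basis_open by (auto intro: open_image_abs_circle)
  next
    fix U :: "circle set" and p assume U: "open U" "p \<in> U"
    obtain x where x: "p = abs_circle x" using surj_abs_circle by (meson surjD)
    obtain S where "S \<in> B" "x \<in> S" "S \<subseteq> abs_circle -` U"
      using topological_basisE[OF B(2), of "abs_circle -` U" x] U x
      by (auto simp: open_circle_def)
    then show "\<exists>B'\<in>(`) abs_circle ` B. p \<in> B' \<and> B' \<subseteq> U"
      using x by blast
  qed
  with B(1) show "\<exists>B::circle set set. countable B \<and> open = generate_topology B"
    by (metis countable_image topological_basis_imp_subbasis)
qed

definition circle_C1 :: "(circle \<Rightarrow> real) \<Rightarrow> bool"
  where "circle_C1 f \<longleftrightarrow> (\<lambda>x. f (abs_circle x)) C1_differentiable_on UNIV"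

text \<open>The value does not depend on the representative, by periodicity of the lift.\<close>
definition circle_deriv :: "(circle \<Rightarrow> real) \<Rightarrow> circle \<Rightarrow> real"
  where "circle_deriv f p = deriv (\<lambda>x. f (abs_circle x)) (rep_circle p)"

definition lebesgue_circle :: "circle measure"
  where "lebesgue_circle = distr (restrict_space lborel {0..<1}) borel abs_circle"


section \<open>Velocity space\<close>

text \<open>The discrete space of velocities \<open>{-1, 1}\<close> is encoded by \<^typ>\<open>bool\<close>,
  with \<^const>\<open>True\<close> standing for \<open>1\<close> and \<^const>\<open>False\<close> for \<open>-1\<close>.\<close>
type_synonym omega1 = "circle \<times> bool"

definition vel :: "bool \<Rightarrow> real"
  where "vel v = (if v then 1 else - 1)"

definition flip_vel :: "omega1 \<Rightarrow> omega1"
  where "flip_vel = (\<lambda>(x, v). (x, \<not> v))"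

definition pi_omega1 :: "omega1 measure"
  where "pi_omega1 = lebesgue_circle \<Otimes>\<^sub>M uniform_count_measure UNIV"

instance bool :: second_countable_topology
proof
  let ?B = "range (\<lambda>b::bool. {b})"
  have "topological_basis ?B"
    by (rule topological_basisI) (auto intro: open_discrete)
  then show "\<exists>B::bool set set. countable B \<and> open = generate_topology B"
    by (metis countable_finite finite_imageI finite topological_basis_imp_subbasis)
qed

lemma sets_pi_omega1: "sets pi_omega1 = sets borel"
proof -
  have bool: "sets (uniform_count_measure UNIV :: bool measure) = sets borel"
    by (simp add: sets_uniform_count_measure_count_space sets_borel_eq_count_space)
  have "sets pi_omega1 = sets ((borel :: circle measure) \<Otimes>\<^sub>M (borel :: bool measure))"
    unfolding pi_omega1_def lebesgue_circle_def
    by (rule sets_pair_measure_cong) (simp_all add: bool)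
  also have "\<dots> = sets borel" by (subst borel_prod) (rule refl)
  finally show ?thesis .
qed

definition C10_omega1 :: "(omega1 \<Rightarrow> real) \<Rightarrow> bool"
  where "C10_omega1 \<phi> \<longleftrightarrow> (\<forall>v. circle_C1 (\<lambda>x. \<phi> (x, v)))"

definition dx_omega1 :: "(omega1 \<Rightarrow> real) \<Rightarrow> omega1 \<Rightarrow> real"
  where "dx_omega1 \<phi> = (\<lambda>(x, v). circle_deriv (\<lambda>y. \<phi> (y, v)) x)"


section \<open>Finite signed and vector measures\<close>

text \<open>A finite signed or vector measure on the measurable space \<open>M\<close> is a countably additive
  set function. Only its values on \<open>sets M\<close> matter; the measure carried by \<open>M\<close> is irrelevant.\<close>
definition vector_measure :: "'a measure \<Rightarrow> ('a set \<Rightarrow> 'b::real_normed_vector) \<Rightarrow> bool"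
  where "vector_measure M \<nu> \<longleftrightarrow> \<nu> {} = 0 \<and>
    (\<forall>A::nat \<Rightarrow> 'a set. range A \<subseteq> sets M \<longrightarrow> disjoint_family A \<longrightarrow> (\<lambda>i. \<nu> (A i)) sums \<nu> (\<Union>i. A i))"

definition tv_norm :: "'a measure \<Rightarrow> ('a set \<Rightarrow> 'b::real_normed_vector) \<Rightarrow> ennreal"
  where "tv_norm M \<nu> =
    (SUP P\<in>{P. finite P \<and> P \<subseteq> sets M \<and> disjoint P}. \<Sum>A\<in>P. ennreal (norm (\<nu> A)))"

text \<open>Positive part of the Jordan decomposition; the negative part is the positive part of \<open>-\<nu>\<close>.\<close>
definition pos_part :: "'a measure \<Rightarrow> ('a set \<Rightarrow> real) \<Rightarrow> 'a measure"
  where "pos_part M \<nu> = measure_of (space M) (sets M)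
    (\<lambda>A. SUP B\<in>{B \<in> sets M. B \<subseteq> A}. ennreal (\<nu> B))"

definition neg_part :: "'a measure \<Rightarrow> ('a set \<Rightarrow> real) \<Rightarrow> 'a measure"
  where "neg_part M \<nu> = pos_part M (\<lambda>A. - \<nu> A)"

definition signed_integral :: "'a measure \<Rightarrow> ('a set \<Rightarrow> real) \<Rightarrow> ('a \<Rightarrow> real) \<Rightarrow> real"
  where "signed_integral M \<nu> f = (\<integral>x. f x \<partial>pos_part M \<nu>) - (\<integral>x. f x \<partial>neg_part M \<nu>)"

definition signed_ac :: "'a measure \<Rightarrow> ('a set \<Rightarrow> real) \<Rightarrow> bool"
  where "signed_ac N \<mu> \<longleftrightarrow> (\<forall>A\<in>null_sets N. \<mu> A = 0)"

text \<open>Radon--Nikodym density of a signed measure, meaningful under \<^const>\<open>signed_ac\<close>.\<close>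
definition signed_RN_deriv :: "'a measure \<Rightarrow> ('a set \<Rightarrow> real) \<Rightarrow> 'a \<Rightarrow> real"
  where "signed_RN_deriv N \<mu> x =
    enn2real (RN_deriv N (pos_part N \<mu>) x) - enn2real (RN_deriv N (neg_part N \<mu>) x)"

text \<open>The first argument may be signed. The convention \<open>0 log 0 = 0\<close> holds since \<open>0 * ln 0 = 0\<close>.\<close>
definition Ent :: "('a set \<Rightarrow> real) \<Rightarrow> 'a measure \<Rightarrow> ennreal"
  where "Ent \<mu> N =
    (if signed_ac N \<mu> \<and> (AE x in N. 0 \<le> signed_RN_deriv N \<mu> x)
     then \<integral>\<^sup>+x. ennreal (signed_RN_deriv N \<mu> x * ln (signed_RN_deriv N \<mu> x)
            - signed_RN_deriv N \<mu> x + 1) \<partial>N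
     else \<infinity>)"


section \<open>Narrow topology and curves of measures\<close>

definition narrow_tendsto ::
  "('i \<Rightarrow> 'a::topological_space measure) \<Rightarrow> 'a measure \<Rightarrow> 'i filter \<Rightarrow> bool"
  where "narrow_tendsto \<mu>s \<mu> F \<longleftrightarrow>
    (\<forall>f::'a \<Rightarrow> real. continuous_on (space \<mu>) f \<longrightarrow> bounded (f ` space \<mu>) \<longrightarrow>
       ((\<lambda>i. \<integral>x. f x \<partial>\<mu>s i) \<longlongrightarrow> (\<integral>x. f x \<partial>\<mu>)) F)"

definition signed_narrow_tendsto ::
  "'a::topological_space measure \<Rightarrow> ('i \<Rightarrow> 'a set \<Rightarrow> real) \<Rightarrow> ('a set \<Rightarrow> real) \<Rightarrow> 'i filter \<Rightarrow> bool"
  where "signed_narrow_tendsto M \<nu>s \<nu> F \<longleftrightarrow>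
    (\<forall>f::'a \<Rightarrow> real. continuous_on (space M) f \<longrightarrow> bounded (f ` space M) \<longrightarrow>
       ((\<lambda>i. signed_integral M (\<nu>s i) f) \<longlongrightarrow> signed_integral M \<nu> f) F)"

text \<open>Membership in \<open>C([0,T]; P(X))\<close> for the narrow topology.\<close>
definition narrow_curve :: "real \<Rightarrow> (real \<Rightarrow> 'a::topological_space measure) \<Rightarrow> bool"
  where "narrow_curve T \<mu> \<longleftrightarrow>
    (\<forall>t\<in>{0..T}. prob_space (\<mu> t) \<and> sets (\<mu> t) = sets borel) \<and>
    (\<forall>f::'a \<Rightarrow> real. continuous_on UNIV f \<longrightarrow> bounded (range f) \<longrightarrow>
       continuous_on {0..T} (\<lambda>t. \<integral>x. f x \<partial>\<mu> t))"

text \<open>Measurable families \<open>(\<nu>\<^sub>t)\<close>, \<open>t \<in> (0,T)\<close>, of finite vector measures whose total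
  variation is integrable in time.\<close>
definition integrable_family ::
  "real \<Rightarrow> (real \<Rightarrow> 'a::topological_space set \<Rightarrow> 'b::real_normed_vector) \<Rightarrow> bool"
  where "integrable_family T \<nu> \<longleftrightarrow>
    (\<forall>t\<in>{0<..<T}. vector_measure borel (\<nu> t)) \<and>
    (\<forall>A\<in>sets borel. (\<lambda>t. \<nu> t A) \<in> borel_measurable (restrict_space borel {0<..<T})) \<and>
    (\<integral>\<^sup>+t\<in>{0<..<T}. tv_norm borel (\<nu> t) \<partial>lborel) < \<infinity>"

text \<open>The measurable space \<open>(0,T) \<times> \<T>\<close>.\<close>
definition cyl :: "real \<Rightarrow> (real \<times> circle) measure"
  where "cyl T = restrict_space borel ({0<..<T} \<times> UNIV)"

text \<open>The measures \<open>\<rho>\<^sub>t(dx) dt\<close> and \<open>\<nu>\<^sub>t(dx) dt\<close> on \<open>(0,T) \<times> \<T>\<close>, for positive and signed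
  families.\<close>
definition curve_measure :: "real \<Rightarrow> (real \<Rightarrow> circle measure) \<Rightarrow> (real \<times> circle) measure"
  where "curve_measure T \<rho> = measure_of (space (cyl T)) (sets (cyl T))
    (\<lambda>A. \<integral>\<^sup>+t\<in>{0<..<T}. emeasure (\<rho> t) (Pair t -` A) \<partial>lborel)"

definition signed_curve_measure ::
  "real \<Rightarrow> (real \<Rightarrow> circle set \<Rightarrow> real) \<Rightarrow> (real \<times> circle) set \<Rightarrow> real"
  where "signed_curve_measure T \<nu> A = (LBINT t:{0<..<T}. \<nu> t (Pair t -` A))"


section \<open>The velocity-jump process\<close>

text \<open>Fluxes take values in \<open>\<real>\<^sup>2\<close>: \<open>fst\<close> is the spatial flux \<open>j\<^sup>1\<close>, \<open>snd\<close> the jump flux \<open>j\<^sup>2\<close>.\<close>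
definition CE_omega1 ::
  "real \<Rightarrow> (real \<Rightarrow> omega1 measure) \<Rightarrow> (real \<Rightarrow> omega1 set \<Rightarrow> real \<times> real) \<Rightarrow> bool"
  where "CE_omega1 T \<sigma> j \<longleftrightarrow> narrow_curve T \<sigma> \<and> integrable_family T j \<and>
    (\<forall>\<phi> s t. C10_omega1 \<phi> \<longrightarrow> 0 \<le> s \<longrightarrow> s \<le> t \<longrightarrow> t \<le> T \<longrightarrow>
       (\<integral>z. \<phi> z \<partial>\<sigma> t) - (\<integral>z. \<phi> z \<partial>\<sigma> s) =
       (LBINT r:{s<..<t}. signed_integral borel (\<lambda>A. fst (j r A)) (dx_omega1 \<phi>)
          + signed_integral borel (\<lambda>A. snd (j r A)) (\<lambda>z. \<phi> (flip_vel z) - \<phi> z)))"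

definition lagrangian ::
  "real \<Rightarrow> real \<Rightarrow> omega1 measure \<Rightarrow> (omega1 set \<Rightarrow> real \<times> real) \<Rightarrow> ennreal"
  where "lagrangian \<alpha> V \<sigma> j =
    (if \<forall>A\<in>sets borel. fst (j A) = set_lebesgue_integral \<sigma> A (\<lambda>(x, v). V * vel v)
     then Ent (\<lambda>A. snd (j A)) (scale_measure (ennreal (V\<^sup>2 / (2 * \<alpha>))) \<sigma>)
     else \<infinity>)"

definition rate_functional ::
  "real \<Rightarrow> real \<Rightarrow> real \<Rightarrow> (real \<Rightarrow> omega1 measure) \<Rightarrow> (real \<Rightarrow> omega1 set \<Rightarrow> real \<times> real) \<Rightarrow> ennreal"
  where "rate_functional \<alpha> T V \<sigma> j =
    (if CE_omega1 T \<sigma> j then \<integral>\<^sup>+r\<in>{0<..<T}. lagrangian \<alpha> V (\<sigma> r) (j r) \<partial>lborel else \<infinity>)"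

text \<open>Time slices of the rescaled quantities. The first marginal of \<open>\<sigma>\<^sub>t\<close> is
  \<open>\<Sum>\<^sub>v \<sigma>\<^sub>t(dx, v)\<close>.\<close>
definition density_slice :: "(real \<Rightarrow> omega1 measure) \<Rightarrow> real \<Rightarrow> circle measure"
  where "density_slice \<sigma> t = distr (\<sigma> t) borel fst"

definition momentum_slice :: "real \<Rightarrow> (real \<Rightarrow> omega1 measure) \<Rightarrow> real \<Rightarrow> circle set \<Rightarrow> real"
  where "momentum_slice V \<sigma> t B = V * (\<Sum>v\<in>UNIV. vel v * measure (\<sigma> t) (B \<times> {v}))"

definition jump_slice ::
  "real \<Rightarrow> (real \<Rightarrow> omega1 set \<Rightarrow> real \<times> real) \<Rightarrow> real \<Rightarrow> circle set \<Rightarrow> real"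
  where "jump_slice V j t B = (\<Sum>v\<in>UNIV. vel v / V * snd (j t (B \<times> {v})))"


section \<open>The limit functional\<close>

definition CE_circle ::
  "real \<Rightarrow> (real \<Rightarrow> circle measure) \<Rightarrow> ((real \<times> circle) set \<Rightarrow> real) \<Rightarrow> bool"
  where "CE_circle T \<rho> \<omega> \<longleftrightarrow> narrow_curve T \<rho> \<and>
    (\<exists>w. integrable_family T w \<and>
      (\<forall>A\<in>sets (cyl T). \<omega> A = signed_curve_measure T w A) \<and>
      (\<forall>\<psi> s t. circle_C1 \<psi> \<longrightarrow> 0 \<le> s \<longrightarrow> s \<le> t \<longrightarrow> t \<le> T \<longrightarrow>
         (\<integral>x. \<psi> x \<partial>\<rho> t) - (\<integral>x. \<psi> x \<partial>\<rho> s) =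
         (LBINT r:{s<..<t}. signed_integral borel (w r) (circle_deriv \<psi>))))"

text \<open>\<open>C\<^sup>\<infinity>\<close> functions on \<open>\<real> \<times> \<T>\<close>: \<open>D m n\<close> is the mixed partial derivative of the lift, of order
  \<open>m\<close> in time and \<open>n\<close> in space.\<close>
definition smooth_cyl :: "(real \<times> circle \<Rightarrow> real) \<Rightarrow> bool"
  where "smooth_cyl \<phi> \<longleftrightarrow> (\<exists>D :: nat \<Rightarrow> nat \<Rightarrow> real \<Rightarrow> real \<Rightarrow> real.
    (\<forall>t x. D 0 0 t x = \<phi> (t, abs_circle x)) \<and>
    (\<forall>m n. continuous_on UNIV (\<lambda>(t, x). D m n t x)) \<and>
    (\<forall>m n t x. ((\<lambda>s. D m n s x) has_real_derivative D (Suc m) n t x) (at t) \<and>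
               ((\<lambda>y. D m n t y) has_real_derivative D m (Suc n) t x) (at x)))"

text \<open>Elements of \<open>C\<^sub>c\<^sup>\<infinity>((0,T) \<times> \<T>)\<close>, extended by zero to \<open>\<real> \<times> \<T>\<close>.\<close>
definition test_function :: "real \<Rightarrow> (real \<times> circle \<Rightarrow> real) \<Rightarrow> bool"
  where "test_function T \<phi> \<longleftrightarrow> smooth_cyl \<phi> \<and>
    (\<exists>a b. 0 < a \<and> b < T \<and> (\<forall>t x. t \<notin> {a..b} \<longrightarrow> \<phi> (t, x) = 0))"

definition has_distributional_dx ::
  "real \<Rightarrow> (real \<times> circle) measure \<Rightarrow> ((real \<times> circle) set \<Rightarrow> real) \<Rightarrow> bool"
  where "has_distributional_dx T R \<mu> \<longleftrightarrow> vector_measure (cyl T) \<mu> \<and>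
    (\<forall>\<phi>. test_function T \<phi> \<longrightarrow>
       signed_integral (cyl T) \<mu> \<phi> = - (\<integral>(t, x). circle_deriv (\<lambda>y. \<phi> (t, y)) x \<partial>R))"

text \<open>Unique on \<open>sets (cyl T)\<close> whenever the distributional derivative is a finite measure.\<close>
definition distributional_dx ::
  "real \<Rightarrow> (real \<times> circle) measure \<Rightarrow> (real \<times> circle) set \<Rightarrow> real"
  where "distributional_dx T R = (SOME \<mu>. has_distributional_dx T R \<mu>)"

definition limit_functional ::
  "real \<Rightarrow> real \<Rightarrow> (real \<Rightarrow> circle measure) \<Rightarrow> ((real \<times> circle) set \<Rightarrow> real) \<Rightarrow> ennreal"
  where "limit_functional \<alpha> T \<rho> \<omega> =
    (let R = curve_measure T \<rho>; D = distributional_dx T R in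
     if signed_ac R \<omega> \<and> (\<exists>\<mu>. has_distributional_dx T R \<mu>) \<and> signed_ac R D \<and> CE_circle T \<rho> \<omega>
     then ennreal (1 / (4 * \<alpha>)) *
       (\<integral>\<^sup>+t\<in>{0<..<T}. (\<integral>\<^sup>+x. ennreal (\<bar>\<alpha> * signed_RN_deriv R D (t, x)
          + signed_RN_deriv R \<omega> (t, x)\<bar>\<^sup>2) \<partial>\<rho> t) \<partial>lborel)
     else \<infinity>)"

end

theory Submission
  imports Defs "HOL-Probability.Giry_Monad"
begin

text \<open>Testing the entropy in the Lagrangian with \<open>v \<psi>(t, x) / V\<close> and letting \<open>V \<rightarrow> \<infinity>\<close> gives
  \<open>\<langle>J - \<omega> / (2\<alpha>), \<psi>\<rangle> - \<integral> \<psi>\<^sup>2 d\<rho> / (4\<alpha>) \<le> liminf\<close>, while the continuity equation tested with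
  \<open>v \<phi>(t, x) / V\<close> gives \<open>D\<rho> = - 2J\<close>. Hence \<open>\<omega> + \<alpha> D\<rho> = - 2\<alpha> \<beta> \<rho>\<close> with
  \<open>\<alpha> \<integral> \<beta>\<^sup>2 d\<rho> \<le> liminf\<close>, which is the asserted bound once \<open>D\<rho>\<close> and \<open>\<omega>\<close> are separately known to be
  absolutely continuous. For this, \<open>\<rho>\<close> solves a Fokker--Planck equation with the square integrable drift
  \<open>- 2\<alpha> \<beta>\<close> and has finite initial entropy; the entropy dissipation of its mollification bounds the
  Fisher information of \<open>\<rho>\<close>, and this is dual to a bound on \<open>\<langle>D\<rho>, \<phi>\<rangle> - \<integral> \<phi>\<^sup>2 d\<rho> / 2\<close>.\<close>

section \<open>Bounded measurable functions and signed measures\<close>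

text \<open>The limit functional is infinite unless \<omega> and the derivative of \<rho> are each
  absolutely continuous, while the rate controls only a combination of the two, in which singular
  parts could cancel. Three constraints shape the way this gap is closed. The space-time measures
  converge only against continuous functions, so a time interval cannot be cut out sharply; the
  slices of \<rho> converge at every time, so both endpoints of the interval are averaged over a
  short window, and the window is shrunk only after the limit in V. The initial entropy is used in
  dual form, as a bound on integrals of continuous g by C plus the integral of exp g - 1; this is
  linear in the measure and survives the limit. Finally, the entropy is never differentiated in
  time: on each cell of a time grid convexity bounds its increment by a linear test, and the sum
  over the cells converges to a space-time integral. The same grid argument replaces a time
  derivative in the equation for J. Test functions are dense in L2 of finitely many measures at
  once, which turns quadratic duality bounds into absolute continuity and square integrable
  densities.\<close>

definition bounded_measurable :: "'a measure \<Rightarrow> ('a \<Rightarrow> real) \<Rightarrow> bool"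
  where "bounded_measurable M f \<longleftrightarrow> f \<in> borel_measurable M \<and> (\<exists>B. \<forall>x\<in>space M. \<bar>f x\<bar> \<le> B)"

lemma bounded_measurableI:
  "f \<in> borel_measurable M \<Longrightarrow> (\<And>x. x \<in> space M \<Longrightarrow> \<bar>f x\<bar> \<le> B) \<Longrightarrow> bounded_measurable M f"
  unfolding bounded_measurable_def by blast

lemma bounded_measurableD: "bounded_measurable M f \<Longrightarrow> f \<in> borel_measurable M"
  unfolding bounded_measurable_def by blast

lemma bounded_measurable_bound:
  assumes "bounded_measurable M f"
  obtains B where "B \<ge> 0" "\<And>x. x \<in> space M \<Longrightarrow> \<bar>f x\<bar> \<le> B"
proof -
  obtain B where "\<forall>x\<in>space M. \<bar>f x\<bar> \<le> B" using assms unfolding bounded_measurable_def by blast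
  then show thesis by (intro that[of "max 0 B"]) (auto simp: le_max_iff_disj)
qed

lemma bounded_measurable_indicator: "A \<in> sets M \<Longrightarrow> bounded_measurable M (indicator A)"
  by (rule bounded_measurableI[where B = 1]) (auto simp: indicator_def)

lemma bounded_measurable_const: "bounded_measurable M (\<lambda>x. c)"
  by (rule bounded_measurableI[where B = "\<bar>c\<bar>"]) auto

lemma bounded_measurable_add:
  assumes "bounded_measurable M f" "bounded_measurable M g"
  shows "bounded_measurable M (\<lambda>x. f x + g x)"
proof -
  obtain A where A: "\<And>x. x \<in> space M \<Longrightarrow> \<bar>f x\<bar> \<le> A" using bounded_measurable_bound[OF assms(1)] by blast
  obtain B where B: "\<And>x. x \<in> space M \<Longrightarrow> \<bar>g x\<bar> \<le> B" using bounded_measurable_bound[OF assms(2)] by blast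
  show ?thesis
  proof (rule bounded_measurableI[where B = "A + B"])
    show "(\<lambda>x. f x + g x) \<in> borel_measurable M"
      using assms by (intro borel_measurable_add bounded_measurableD)
    fix x assume "x \<in> space M"
    then show "\<bar>f x + g x\<bar> \<le> A + B" using A[of x] B[of x] by linarith
  qed
qed

lemma bounded_measurable_mult:
  assumes "bounded_measurable M f" "bounded_measurable M g"
  shows "bounded_measurable M (\<lambda>x. f x * g x)"
proof -
  obtain A where A: "A \<ge> 0" "\<And>x. x \<in> space M \<Longrightarrow> \<bar>f x\<bar> \<le> A" using bounded_measurable_bound[OF assms(1)] by blast
  obtain B where B: "B \<ge> 0" "\<And>x. x \<in> space M \<Longrightarrow> \<bar>g x\<bar> \<le> B" using bounded_measurable_bound[OF assms(2)] by blast
  show ?thesis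
  proof (rule bounded_measurableI[where B = "A * B"])
    show "(\<lambda>x. f x * g x) \<in> borel_measurable M"
      using assms by (intro borel_measurable_times bounded_measurableD)
    fix x assume "x \<in> space M"
    then show "\<bar>f x * g x\<bar> \<le> A * B" using A B by (auto simp: abs_mult intro!: mult_mono)
  qed
qed

lemma bounded_measurable_scale:
  "bounded_measurable M f \<Longrightarrow> bounded_measurable M (\<lambda>x. c * f x)"
  by (rule bounded_measurable_mult[OF bounded_measurable_const])

lemma bounded_measurable_diff:
  "bounded_measurable M f \<Longrightarrow> bounded_measurable M g \<Longrightarrow> bounded_measurable M (\<lambda>x. f x - g x)"
  using bounded_measurable_add[OF _ bounded_measurable_scale[of M g "-1"]] by simp

lemma bounded_measurable_power2:
  "bounded_measurable M f \<Longrightarrow> bounded_measurable M (\<lambda>x. (f x)\<^sup>2)"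
  unfolding power2_eq_square by (rule bounded_measurable_mult)

lemma bounded_measurable_exp:
  assumes "bounded_measurable M f"
  shows "bounded_measurable M (\<lambda>x. exp (f x))"
proof -
  obtain A where A: "A \<ge> 0" "\<And>x. x \<in> space M \<Longrightarrow> \<bar>f x\<bar> \<le> A" using bounded_measurable_bound[OF assms(1)] by blast
  have "f \<in> borel_measurable M" using assms by (rule bounded_measurableD)
  then show ?thesis
    using A by (intro bounded_measurableI[where B = "exp A"]) (auto simp: abs_le_iff)
qed

lemma bounded_measurable_sum:
  assumes "\<And>i. i \<in> I \<Longrightarrow> bounded_measurable M (f i)"
  shows "bounded_measurable M (\<lambda>x. \<Sum>i\<in>I. f i x)"
proof (cases "finite I")
  case True
  then show ?thesis using assms
  proof (induction I rule: finite_induct)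
    case empty
    then show ?case using bounded_measurable_const[of M 0] by simp
  next
    case (insert i I)
    then have "bounded_measurable M (\<lambda>x. f i x + (\<Sum>i\<in>I. f i x))"
      by (intro bounded_measurable_add) auto
    then show ?case using insert by simp
  qed
next
  case False
  then show ?thesis using bounded_measurable_const[of M 0] by simp
qed

lemma bounded_measurable_cong_sets:
  "sets M = sets N \<Longrightarrow> bounded_measurable M f \<longleftrightarrow> bounded_measurable N f"
  unfolding bounded_measurable_def
  using measurable_cong_sets[of M N borel borel] sets_eq_imp_space_eq[of M N] by auto

lemma integrable_bounded_measurable:
  assumes "finite_measure N" "sets N = sets M" "bounded_measurable M f"
  shows "integrable N f"
proof -
  interpret finite_measure N by fact
  have f: "bounded_measurable N f" using assms bounded_measurable_cong_sets by blast
  obtain B where "\<And>x. x \<in> space N \<Longrightarrow> \<bar>f x\<bar> \<le> B" using bounded_measurable_bound[OF f] by blast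
  then show ?thesis
    using bounded_measurableD[OF f] by (intro integrable_const_bound[where B = B]) auto
qed

lemma integrable_bounded:
  fixes f :: "'a \<Rightarrow> real"
  assumes "finite_measure M" "f \<in> borel_measurable M" "\<And>x. x \<in> space M \<Longrightarrow> \<bar>f x\<bar> \<le> B"
  shows "integrable M f"
  by (rule finite_measure.integrable_const_bound[OF assms(1) _ assms(2), of B]) (use assms(3) in \<open>auto intro!: AE_I2\<close>)

lemma integral_abs_le_const:
  fixes f :: "'a \<Rightarrow> real"
  assumes M: "prob_space M" and f: "f \<in> borel_measurable M" "\<And>x. x \<in> space M \<Longrightarrow> \<bar>f x\<bar> \<le> B"
  shows "\<bar>LINT x|M. f x\<bar> \<le> B"
proof -
  interpret prob_space M by fact
  have i: "integrable M f" by (rule integrable_bounded[OF finite_measure_axioms f])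
  have "\<bar>LINT x|M. f x\<bar> \<le> (LINT x|M. \<bar>f x\<bar>)" by simp
  also have "... \<le> (LINT x|M. B)" using i f(2) by (intro integral_mono) auto
  finally show ?thesis by (simp add: prob_space)
qed

text \<open>Uniform approximation by finite combinations of indicators takes the place of monotone
  limits: the properties proved with it concern signed integrals and linear functionals, which are
  continuous in the sup norm but not monotone.\<close>

lemma bounded_measurable_induct [consumes 1, case_names indicator add scale approx]:
  assumes f: "bounded_measurable M f"
    and ind: "\<And>A. A \<in> sets M \<Longrightarrow> P (indicator A)"
    and add: "\<And>f g. bounded_measurable M f \<Longrightarrow> bounded_measurable M g \<Longrightarrow> P f \<Longrightarrow> P g \<Longrightarrow> P (\<lambda>x. f x + g x)"
    and scale: "\<And>c f. bounded_measurable M f \<Longrightarrow> P f \<Longrightarrow> P (\<lambda>x. c * f x)"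
    and approx: "\<And>f. bounded_measurable M f \<Longrightarrow>
      (\<And>e. e > 0 \<Longrightarrow> \<exists>g. bounded_measurable M g \<and> P g \<and> (\<forall>x\<in>space M. \<bar>f x - g x\<bar> \<le> e)) \<Longrightarrow> P f"
  shows "P f"
proof (rule approx[OF f])
  fix e :: real assume e: "e > 0"
  obtain B where B: "B \<ge> 0" "\<And>x. x \<in> space M \<Longrightarrow> \<bar>f x\<bar> \<le> B" using bounded_measurable_bound[OF f] by blast
  \<comment> \<open>The approximant rounds f down to a multiple of e. Since f takes values in
    [-B, B], only finitely many levels k occur.\<close>
  define K :: "int set" where "K = {\<lfloor>- B / e\<rfloor>..\<lceil>B / e\<rceil>}"
  define A where "A k = {x\<in>space M. \<lfloor>f x / e\<rfloor> = k}" for k :: int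
  have [measurable]: "f \<in> borel_measurable M" using f by (rule bounded_measurableD)
  have A: "A k \<in> sets M" for k unfolding A_def by measurable
  define g where "g x = (\<Sum>k\<in>K. (of_int k * e) * indicator (A k) x)" for x
  have gen: "P (\<lambda>x. \<Sum>k\<in>L. c k * indicator (A k) x)" if "finite L" for L and c :: "int \<Rightarrow> real"
    using that
  proof (induction L rule: finite_induct)
    case empty
    have "P (\<lambda>x. 0 * indicator {} x)"
      by (intro scale ind bounded_measurable_indicator) auto
    then show ?case by simp
  next
    case (insert k L)
    have "P (\<lambda>x. c k * indicator (A k) x + (\<Sum>k\<in>L. c k * indicator (A k) x))"
      using insert A
      by (intro add scale ind bounded_measurable_indicator bounded_measurable_sum bounded_measurable_scale) auto
    then show ?case using insert.hyps by (simp only: sum.insert not_False_eq_True)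
  qed
  have "P g" unfolding g_def K_def by (rule gen) simp
  moreover have "bounded_measurable M g"
    unfolding g_def using A
    by (intro bounded_measurable_sum bounded_measurable_scale bounded_measurable_indicator)
  moreover have "\<bar>f x - g x\<bar> \<le> e" if x: "x \<in> space M" for x
  proof -
    have "- B \<le> f x" "f x \<le> B" using B(2)[OF x] by auto
    then have "- B / e \<le> f x / e" "f x / e \<le> B / e" using e by (auto simp: divide_simps)
    then have "\<lfloor>f x / e\<rfloor> \<in> K" unfolding K_def
      using floor_mono[of "- B / e" "f x / e"] floor_mono[of "f x / e" "B / e"] by (simp; linarith)
    moreover have "g x = (\<Sum>k\<in>K. if k = \<lfloor>f x / e\<rfloor> then of_int k * e else 0)"
      unfolding g_def A_def using x by (intro sum.cong) (auto simp: indicator_def)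
    ultimately have "g x = of_int \<lfloor>f x / e\<rfloor> * e"
      by (simp add: K_def)
    moreover have "f x = e * (f x / e)" using e by simp
    ultimately have "\<bar>f x - g x\<bar> = \<bar>e * (f x / e - of_int \<lfloor>f x / e\<rfloor>)\<bar>"
      by (metis mult.commute right_diff_distrib)
    also have "... = e * \<bar>f x / e - of_int \<lfloor>f x / e\<rfloor>\<bar>" using e by (simp only: abs_mult)
    also have "... \<le> e * 1" using e by (intro mult_left_mono) (linarith+)
    finally show ?thesis by simp
  qed
  ultimately show "\<exists>g. bounded_measurable M g \<and> P g \<and> (\<forall>x\<in>space M. \<bar>f x - g x\<bar> \<le> e)" by blast
qed

section \<open>Countably additive set functions and the Jordan decomposition\<close>

lemma vector_measure_empty: "vector_measure M \<nu> \<Longrightarrow> \<nu> {} = 0"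
  unfolding vector_measure_def by blast

lemma vector_measure_sums:
  "vector_measure M \<nu> \<Longrightarrow> range A \<subseteq> sets M \<Longrightarrow> disjoint_family A \<Longrightarrow> (\<lambda>i::nat. \<nu> (A i)) sums \<nu> (\<Union>i. A i)"
  unfolding vector_measure_def by blast

lemma vector_measure_Un:
  assumes \<nu>: "vector_measure M \<nu>" and A: "A \<in> sets M" "B \<in> sets M" "A \<inter> B = {}"
  shows "\<nu> (A \<union> B) = \<nu> A + \<nu> B"
proof -
  define F where "F i = (if i = 0 then A else if i = 1 then B else {})" for i :: nat
  have U: "(\<Union>i. F i) = A \<union> B" unfolding F_def by (auto split: if_splits)
  have "(\<lambda>i. \<nu> (F i)) sums \<nu> (\<Union>i. F i)"
    using A by (intro vector_measure_sums[OF \<nu>]) (auto simp: F_def disjoint_family_on_def)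
  moreover have "(\<lambda>i. \<nu> (F i)) sums (\<Sum>i\<in>{0,1}. \<nu> (F i))"
    by (rule sums_finite) (auto simp: F_def vector_measure_empty[OF \<nu>])
  ultimately show ?thesis unfolding U by (simp add: sums_unique2 F_def)
qed

lemma vector_measure_Diff:
  assumes \<nu>: "vector_measure M \<nu>" and A: "A \<in> sets M" "B \<in> sets M" "B \<subseteq> A"
  shows "\<nu> (A - B) = \<nu> A - \<nu> B"
proof -
  have "\<nu> (B \<union> (A - B)) = \<nu> B + \<nu> (A - B)"
    using A by (intro vector_measure_Un[OF \<nu>]) auto
  moreover have "B \<union> (A - B) = A" using A by auto
  ultimately show ?thesis by simp
qed

lemma vector_measure_bounded_linear:
  assumes "bounded_linear f" "vector_measure M \<nu>"
  shows "vector_measure M (\<lambda>A. f (\<nu> A))"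
  using assms(2) bounded_linear.sums[OF assms(1)] linear_0[OF bounded_linear.linear[OF assms(1)]]
  unfolding vector_measure_def by metis

lemma vector_measure_lincomb:
  fixes \<mu> \<nu> :: "'a set \<Rightarrow> real"
  assumes "vector_measure M \<mu>" "vector_measure M \<nu>"
  shows "vector_measure M (\<lambda>A. a * \<mu> A + b * \<nu> A)"
  using assms unfolding vector_measure_def by (auto intro!: sums_add sums_mult)

text \<open>Exhaustion: a set on which \<nu> is unbounded splits into two pieces, one of which is
  again unbounded while the other has |\<nu>| at least 1. Iterating discards infinitely many
  disjoint pieces of this size, which contradicts the convergence of their series.\<close>

lemma vector_measure_bounded_above:
  fixes \<nu> :: "'a set \<Rightarrow> real"
  assumes \<nu>: "vector_measure M \<nu>"
  shows "\<exists>K. \<forall>A\<in>sets M. \<nu> A \<le> K"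
proof (rule ccontr)
  assume contr: "\<not> ?thesis"
  define unb where "unb X \<longleftrightarrow> X \<in> sets M \<and> (\<forall>K. \<exists>B\<in>sets M. B \<subseteq> X \<and> \<nu> B > K)" for X
  have 0: "unb (space M)"
    unfolding unb_def
  proof (intro conjI allI)
    fix K
    obtain B where "B \<in> sets M" "\<nu> B > K" using contr by (meson not_le)
    then show "\<exists>B\<in>sets M. B \<subseteq> space M \<and> \<nu> B > K" using sets.sets_into_space by blast
  qed simp
  have step: "\<exists>Y. unb Y \<and> Y \<subseteq> X \<and> \<bar>\<nu> (X - Y)\<bar> \<ge> 1" if X: "unb X" for X
  proof -
    have Xs: "X \<in> sets M" using X unfolding unb_def by blast
    \<comment> \<open>The margin makes both pieces large: \<nu> B > 1 and \<nu> (X - B) < -1. Hence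
      it does not matter which of them has to be discarded.\<close>
    obtain B where B: "B \<in> sets M" "B \<subseteq> X" "\<nu> B > \<bar>\<nu> X\<bar> + 1"
      using X unfolding unb_def by blast
    have d: "\<nu> (X - B) = \<nu> X - \<nu> B" using vector_measure_Diff[OF \<nu> Xs B(1,2)] .
    have "unb B \<or> unb (X - B)"
    proof (rule ccontr)
      assume "\<not> (unb B \<or> unb (X - B))"
      then obtain K1 K2 where K: "\<And>C. C \<in> sets M \<Longrightarrow> C \<subseteq> B \<Longrightarrow> \<nu> C \<le> K1"
        "\<And>C. C \<in> sets M \<Longrightarrow> C \<subseteq> X - B \<Longrightarrow> \<nu> C \<le> K2"
        using B(1) sets.Diff[OF Xs B(1)] unfolding unb_def by (meson not_less)
      obtain C where C: "C \<in> sets M" "C \<subseteq> X" "\<nu> C > K1 + K2"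
        using X unfolding unb_def by blast
      have "\<nu> (C \<inter> B \<union> (C - B)) = \<nu> (C \<inter> B) + \<nu> (C - B)"
        using B C by (intro vector_measure_Un[OF \<nu>]) auto
      moreover have "C \<inter> B \<union> (C - B) = C" by auto
      moreover have "\<nu> (C \<inter> B) \<le> K1" "\<nu> (C - B) \<le> K2" using B C by (auto intro!: K)
      ultimately show False using C by simp
    qed
    then show ?thesis
    proof
      assume "unb B"
      then show ?thesis using B d by (intro exI[of _ B]) auto
    next
      assume "unb (X - B)"
      moreover have "X - (X - B) = B" using B by auto
      ultimately show ?thesis using B by (intro exI[of _ "X - B"]) auto
    qed
  qed
  obtain X where X: "\<And>n::nat. unb (X n)" "\<And>n. X (Suc n) \<subseteq> X n" "\<And>n. \<bar>\<nu> (X n - X (Suc n))\<bar> \<ge> 1"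
    using dependent_nat_choice[of "\<lambda>_. unb" "\<lambda>_ X Y. Y \<subseteq> X \<and> \<bar>\<nu> (X - Y)\<bar> \<ge> 1"] 0 step by (metis (no_types, lifting))
  have dec: "X n \<subseteq> X m" if "m \<le> n" for m n
    using X(2) that lift_Suc_antimono_le[of X] by blast
  have "disjoint_family (\<lambda>n. X n - X (Suc n))"
    unfolding disjoint_family_on_def
  proof (intro ballI impI)
    fix m n :: nat assume "m \<noteq> n"
    then have "Suc m \<le> n \<or> Suc n \<le> m" by auto
    then show "(X m - X (Suc m)) \<inter> (X n - X (Suc n)) = {}" using dec by blast
  qed
  moreover have "range (\<lambda>n. X n - X (Suc n)) \<subseteq> sets M" using X(1) unfolding unb_def by auto
  ultimately have "(\<lambda>n. \<nu> (X n - X (Suc n))) sums \<nu> (\<Union>n. X n - X (Suc n))"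
    by (intro vector_measure_sums[OF \<nu>])
  then have "(\<lambda>n. \<nu> (X n - X (Suc n))) \<longlonglongrightarrow> 0" by (intro summable_LIMSEQ_zero sums_summable)
  then have "\<forall>\<^sub>F n in sequentially. norm (\<nu> (X n - X (Suc n)) - 0) < 1"
    by (simp add: tendsto_iff dist_norm)
  then obtain n where "\<bar>\<nu> (X n - X (Suc n))\<bar> < 1"
    by (auto simp: eventually_sequentially)
  with X(3)[of n] show False by simp
qed

text \<open>The supremum in \<open>pos_part\<close>, taken in the reals; it is meaningful because
  \<nu> is bounded above.\<close>

definition pos_val :: "'a measure \<Rightarrow> ('a set \<Rightarrow> real) \<Rightarrow> 'a set \<Rightarrow> real"
  where "pos_val M \<nu> A = Sup (\<nu> ` {B \<in> sets M. B \<subseteq> A})"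

lemma pos_val_upper:
  assumes "vector_measure M \<nu>" "B \<in> sets M" "B \<subseteq> A"
  shows "\<nu> B \<le> pos_val M \<nu> A"
  unfolding pos_val_def
proof (rule cSup_upper)
  show "bdd_above (\<nu> ` {B \<in> sets M. B \<subseteq> A})"
    using vector_measure_bounded_above[OF assms(1)] by (auto simp: bdd_above_def)
qed (use assms in auto)

lemma pos_val_least:
  assumes "\<And>B. B \<in> sets M \<Longrightarrow> B \<subseteq> A \<Longrightarrow> \<nu> B \<le> K"
  shows "pos_val M \<nu> A \<le> K"
  unfolding pos_val_def by (rule cSup_least) (use assms in auto)

lemma pos_val_nonneg: "vector_measure M \<nu> \<Longrightarrow> pos_val M \<nu> A \<ge> 0"
  using pos_val_upper[of M \<nu> "{}" A] by (simp add: vector_measure_empty)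

lemma pos_val_Un_ge:
  assumes \<nu>: "vector_measure M \<nu>" and A: "A \<inter> B = {}"
  shows "pos_val M \<nu> A + pos_val M \<nu> B \<le> pos_val M \<nu> (A \<union> B)"
proof -
  have "pos_val M \<nu> A \<le> pos_val M \<nu> (A \<union> B) - pos_val M \<nu> B"
  proof (rule pos_val_least)
    fix C assume C: "C \<in> sets M" "C \<subseteq> A"
    have "pos_val M \<nu> B \<le> pos_val M \<nu> (A \<union> B) - \<nu> C"
    proof (rule pos_val_least)
      fix D assume D: "D \<in> sets M" "D \<subseteq> B"
      have "\<nu> (C \<union> D) = \<nu> C + \<nu> D"
        using A C D by (intro vector_measure_Un[OF \<nu>]) auto
      moreover have "\<nu> (C \<union> D) \<le> pos_val M \<nu> (A \<union> B)"
        using C D by (intro pos_val_upper[OF \<nu>]) auto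
      ultimately show "\<nu> D \<le> pos_val M \<nu> (A \<union> B) - \<nu> C" by simp
    qed
    then show "\<nu> C \<le> pos_val M \<nu> (A \<union> B) - pos_val M \<nu> B" by simp
  qed
  then show ?thesis by simp
qed

lemma pos_val_mono:
  assumes "vector_measure M \<nu>" "A \<subseteq> B" shows "pos_val M \<nu> A \<le> pos_val M \<nu> B"
  by (rule pos_val_least) (use assms in \<open>auto intro: pos_val_upper\<close>)

text \<open>\<open>ennreal\<close> cuts negative values off at 0. The supremum is not affected,
  since the empty set competes with the value 0.\<close>

lemma ennreal_pos_val:
  assumes \<nu>: "vector_measure M \<nu>"
  shows "(SUP B\<in>{B \<in> sets M. B \<subseteq> A}. ennreal (\<nu> B)) = ennreal (pos_val M \<nu> A)" (is "?L = _")
proof (rule antisym)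
  show "?L \<le> ennreal (pos_val M \<nu> A)"
    by (rule SUP_least) (use pos_val_upper[OF \<nu>] in \<open>auto intro: ennreal_leI\<close>)
  then have fin: "?L < top" by (rule le_less_trans) simp
  have "pos_val M \<nu> A \<le> enn2real ?L"
  proof (rule pos_val_least)
    fix B assume "B \<in> sets M" "B \<subseteq> A"
    then have "ennreal (\<nu> B) \<le> ?L" by (intro SUP_upper) auto
    then have "enn2real (ennreal (\<nu> B)) \<le> enn2real ?L"
      using fin by (rule enn2real_mono)
    then show "\<nu> B \<le> enn2real ?L" by (cases "\<nu> B \<ge> 0") (auto intro: order_trans[of _ 0])
  qed
  then have "ennreal (pos_val M \<nu> A) \<le> ennreal (enn2real ?L)" by (rule ennreal_leI)
  also have "... = ?L" using fin by (rule ennreal_enn2real)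
  finally show "ennreal (pos_val M \<nu> A) \<le> ?L" .
qed

text \<open>Superadditivity bounds the partial sums. For the converse, a competitor B in the union
  is cut along the \<open>A i\<close>, and each piece competes in its own
  \<open>A i\<close>.\<close>

lemma pos_val_countable:
  assumes \<nu>: "vector_measure M \<nu>" and A: "range A \<subseteq> sets M" "disjoint_family A"
  shows "(\<Sum>i. ennreal (pos_val M \<nu> (A i))) = ennreal (pos_val M \<nu> (\<Union>i::nat. A i))"
proof (rule antisym)
  have fin: "(\<Sum>i<n. pos_val M \<nu> (A i)) \<le> pos_val M \<nu> (\<Union>i<n. A i)" for n
  proof (induction n)
    case 0
    then show ?case by (simp add: pos_val_nonneg[OF \<nu>])
  next
    case (Suc n)
    have "(\<Union>i<n. A i) \<inter> A n = {}"
      using disjoint_family_onD[OF A(2), of _ n] by (auto simp: disjoint_iff) (metis less_irrefl)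
    then have "pos_val M \<nu> (\<Union>i<n. A i) + pos_val M \<nu> (A n) \<le> pos_val M \<nu> ((\<Union>i<n. A i) \<union> A n)"
      by (rule pos_val_Un_ge[OF \<nu>])
    then show ?case using Suc by (simp add: lessThan_Suc Un_commute)
  qed
  show "(\<Sum>i. ennreal (pos_val M \<nu> (A i))) \<le> ennreal (pos_val M \<nu> (\<Union>i. A i))"
  proof (rule suminf_le_const)
    fix n
    have "(\<Sum>i<n. pos_val M \<nu> (A i)) \<le> pos_val M \<nu> (\<Union>i. A i)"
      using fin[of n] pos_val_mono[OF \<nu>, of "\<Union>i<n. A i" "\<Union>i. A i"] by fastforce
    then show "(\<Sum>i<n. ennreal (pos_val M \<nu> (A i))) \<le> ennreal (pos_val M \<nu> (\<Union>i. A i))"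
      by (subst sum_ennreal) (auto simp: pos_val_nonneg[OF \<nu>] intro: ennreal_leI)
  qed auto
  have sub: "ennreal (\<nu> B) \<le> (\<Sum>i. ennreal (pos_val M \<nu> (A i)))"
    if B: "B \<in> sets M" "B \<subseteq> (\<Union>i. A i)" for B
  proof -
    have "(\<lambda>i. \<nu> (B \<inter> A i)) sums \<nu> (\<Union>i. B \<inter> A i)"
      using A B by (intro vector_measure_sums[OF \<nu>]) (auto simp: disjoint_family_on_def)
    moreover have "(\<Union>i. B \<inter> A i) = B" using B by auto
    ultimately have "(\<lambda>n. ennreal (\<Sum>i<n. \<nu> (B \<inter> A i))) \<longlonglongrightarrow> ennreal (\<nu> B)"
      unfolding sums_def by (intro tendsto_ennrealI) simp
    then show ?thesis
    proof (rule LIMSEQ_le_const2, intro exI allI impI)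
      fix n
      have "(\<Sum>i<n. \<nu> (B \<inter> A i)) \<le> (\<Sum>i<n. pos_val M \<nu> (A i))"
        using A B by (intro sum_mono pos_val_upper[OF \<nu>]) auto
      then have "ennreal (\<Sum>i<n. \<nu> (B \<inter> A i)) \<le> (\<Sum>i<n. ennreal (pos_val M \<nu> (A i)))"
        by (subst sum_ennreal) (auto simp: pos_val_nonneg[OF \<nu>] intro: ennreal_leI)
      also have "... \<le> (\<Sum>i. ennreal (pos_val M \<nu> (A i)))"
        by (rule sum_le_suminf) auto
      finally show "ennreal (\<Sum>i<n. \<nu> (B \<inter> A i)) \<le> (\<Sum>i. ennreal (pos_val M \<nu> (A i)))" .
    qed
  qed
  show "ennreal (pos_val M \<nu> (\<Union>i. A i)) \<le> (\<Sum>i. ennreal (pos_val M \<nu> (A i)))"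
    unfolding ennreal_pos_val[OF \<nu>, symmetric] by (rule SUP_least) (use sub ennreal_pos_val[OF \<nu>] in auto)
qed

lemma sets_pos_part [simp, measurable_cong]: "sets (pos_part M \<nu>) = sets M"
  unfolding pos_part_def by simp

lemma space_pos_part [simp]: "space (pos_part M \<nu>) = space M"
  unfolding pos_part_def by simp

lemma sets_neg_part [simp, measurable_cong]: "sets (neg_part M \<nu>) = sets M"
  unfolding neg_part_def by simp

lemma space_neg_part [simp]: "space (neg_part M \<nu>) = space M"
  unfolding neg_part_def by simp

lemma emeasure_pos_part:
  assumes \<nu>: "vector_measure M \<nu>" and A: "A \<in> sets M"
  shows "emeasure (pos_part M \<nu>) A = ennreal (pos_val M \<nu> A)"
  unfolding pos_part_def ennreal_pos_val[OF \<nu>]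
proof (rule emeasure_measure_of_sigma)
  show "positive (sets M) (\<lambda>A. ennreal (pos_val M \<nu> A))"
    using pos_val_least[of M "{}" \<nu> 0] pos_val_nonneg[OF \<nu>, of "{}"]
    by (auto simp: positive_def vector_measure_empty[OF \<nu>] ennreal_eq_0_iff)
  show "countably_additive (sets M) (\<lambda>A. ennreal (pos_val M \<nu> A))"
    unfolding countably_additive_def using pos_val_countable[OF \<nu>] by blast
qed (use A sets.sigma_algebra_axioms in auto)

lemma vector_measure_uminus:
  fixes \<nu> :: "'a set \<Rightarrow> real"
  shows "vector_measure M \<nu> \<Longrightarrow> vector_measure M (\<lambda>A. - \<nu> A)"
  by (rule vector_measure_bounded_linear[OF bounded_linear_minus[OF bounded_linear_ident]])

lemma finite_measure_pos_part: "vector_measure M \<nu> \<Longrightarrow> finite_measure (pos_part M \<nu>)"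
  by (rule finite_measureI) (simp add: emeasure_pos_part)

lemma finite_measure_neg_part: "vector_measure M \<nu> \<Longrightarrow> finite_measure (neg_part M \<nu>)"
  unfolding neg_part_def by (intro finite_measure_pos_part vector_measure_uminus)

lemma measure_pos_part:
  "vector_measure M \<nu> \<Longrightarrow> A \<in> sets M \<Longrightarrow> measure (pos_part M \<nu>) A = pos_val M \<nu> A"
  by (simp add: measure_def emeasure_pos_part pos_val_nonneg)

lemma measure_neg_part:
  "vector_measure M \<nu> \<Longrightarrow> A \<in> sets M \<Longrightarrow> measure (neg_part M \<nu>) A = pos_val M (\<lambda>A. - \<nu> A) A"
  unfolding neg_part_def by (intro measure_pos_part vector_measure_uminus)

text \<open>No Hahn set is constructed. Complementation in A exchanges the competitors of the two
  suprema, and \<nu> (A - B) = \<nu> A - \<nu> B turns this into one inequality in each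
  direction.\<close>

lemma jordan_decomposition:
  assumes \<nu>: "vector_measure M \<nu>" and A: "A \<in> sets M"
  shows "\<nu> A = measure (pos_part M \<nu>) A - measure (neg_part M \<nu>) A"
proof -
  have \<nu>': "vector_measure M (\<lambda>A. - \<nu> A)" using \<nu> by (rule vector_measure_uminus)
  have "pos_val M \<nu> A \<le> pos_val M (\<lambda>A. - \<nu> A) A + \<nu> A"
  proof (rule pos_val_least)
    fix B assume B: "B \<in> sets M" "B \<subseteq> A"
    then have "- \<nu> (A - B) \<le> pos_val M (\<lambda>A. - \<nu> A) A" using A by (intro pos_val_upper[OF \<nu>']) auto
    then show "\<nu> B \<le> pos_val M (\<lambda>A. - \<nu> A) A + \<nu> A" using vector_measure_Diff[OF \<nu> A B] by simp
  qed
  moreover have "pos_val M (\<lambda>A. - \<nu> A) A \<le> pos_val M \<nu> A - \<nu> A"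
  proof (rule pos_val_least)
    fix B assume B: "B \<in> sets M" "B \<subseteq> A"
    then have "\<nu> (A - B) \<le> pos_val M \<nu> A" using A by (intro pos_val_upper[OF \<nu>]) auto
    then show "- \<nu> B \<le> pos_val M \<nu> A - \<nu> A" using vector_measure_Diff[OF \<nu> A B] by simp
  qed
  ultimately show ?thesis using \<nu> A by (simp add: measure_pos_part measure_neg_part)
qed

section \<open>Functionals continuous in the sup norm, and signed integrals\<close>

definition bounded_functional :: "'a measure \<Rightarrow> (('a \<Rightarrow> real) \<Rightarrow> real) \<Rightarrow> bool"
  where "bounded_functional M \<Lambda> \<longleftrightarrow>
    (\<forall>f g. bounded_measurable M f \<longrightarrow> bounded_measurable M g \<longrightarrow> \<Lambda> (\<lambda>x. f x + g x) = \<Lambda> f + \<Lambda> g) \<and>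
    (\<forall>c f. bounded_measurable M f \<longrightarrow> \<Lambda> (\<lambda>x. c * f x) = c * \<Lambda> f) \<and>
    (\<exists>K. \<forall>f e. bounded_measurable M f \<longrightarrow> (\<forall>x\<in>space M. \<bar>f x\<bar> \<le> e) \<longrightarrow> \<bar>\<Lambda> f\<bar> \<le> K * e)"

lemma bounded_functionalI:
  assumes "\<And>f g. bounded_measurable M f \<Longrightarrow> bounded_measurable M g \<Longrightarrow> \<Lambda> (\<lambda>x. f x + g x) = \<Lambda> f + \<Lambda> g"
    and "\<And>c f. bounded_measurable M f \<Longrightarrow> \<Lambda> (\<lambda>x. c * f x) = c * \<Lambda> f"
    and "\<And>f e. bounded_measurable M f \<Longrightarrow> (\<And>x. x \<in> space M \<Longrightarrow> \<bar>f x\<bar> \<le> e) \<Longrightarrow> \<bar>\<Lambda> f\<bar> \<le> K * e"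
  shows "bounded_functional M \<Lambda>"
  using assms unfolding bounded_functional_def by blast

lemma bounded_functional_add:
  "bounded_functional M \<Lambda> \<Longrightarrow> bounded_measurable M f \<Longrightarrow> bounded_measurable M g \<Longrightarrow> \<Lambda> (\<lambda>x. f x + g x) = \<Lambda> f + \<Lambda> g"
  unfolding bounded_functional_def by blast

lemma bounded_functional_scale:
  "bounded_functional M \<Lambda> \<Longrightarrow> bounded_measurable M f \<Longrightarrow> \<Lambda> (\<lambda>x. c * f x) = c * \<Lambda> f"
  unfolding bounded_functional_def by blast

lemma bounded_functional_diff:
  assumes "bounded_functional M \<Lambda>" "bounded_measurable M f" "bounded_measurable M g"
  shows "\<Lambda> (\<lambda>x. f x - g x) = \<Lambda> f - \<Lambda> g"
  using bounded_functional_add[OF assms(1,2) bounded_measurable_scale[OF assms(3), of "-1"]]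
    bounded_functional_scale[OF assms(1,3), of "-1"] by simp

lemma bounded_functional_bound:
  assumes "bounded_functional M \<Lambda>"
  obtains K where "K \<ge> 0" "\<And>f e. bounded_measurable M f \<Longrightarrow> (\<And>x. x \<in> space M \<Longrightarrow> \<bar>f x\<bar> \<le> e) \<Longrightarrow> e \<ge> 0 \<Longrightarrow> \<bar>\<Lambda> f\<bar> \<le> K * e"
proof -
  obtain K where K: "\<And>f e. bounded_measurable M f \<Longrightarrow> (\<And>x. x \<in> space M \<Longrightarrow> \<bar>f x\<bar> \<le> e) \<Longrightarrow> \<bar>\<Lambda> f\<bar> \<le> K * e"
    using assms unfolding bounded_functional_def by blast
  show thesis
  proof (rule that[of "max 0 K"])
    fix f and e :: real
    assume f: "bounded_measurable M f" "\<And>x. x \<in> space M \<Longrightarrow> \<bar>f x\<bar> \<le> e" and e: "e \<ge> 0"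
    have "\<bar>\<Lambda> f\<bar> \<le> K * e" by (rule K[OF f])
    also have "... \<le> max 0 K * e" using e by (intro mult_right_mono) auto
    finally show "\<bar>\<Lambda> f\<bar> \<le> max 0 K * e" .
  qed simp
qed

lemma bounded_functional_combine:
  assumes "bounded_functional M \<Lambda>" "bounded_functional M \<Gamma>"
  shows "bounded_functional M (\<lambda>f. a * \<Lambda> f + b * \<Gamma> f)"
proof -
  obtain K where K: "\<And>f e. bounded_measurable M f \<Longrightarrow> (\<And>x. x \<in> space M \<Longrightarrow> \<bar>f x\<bar> \<le> e) \<Longrightarrow> \<bar>\<Lambda> f\<bar> \<le> K * e"
    using assms(1) unfolding bounded_functional_def by blast
  obtain L where L: "\<And>f e. bounded_measurable M f \<Longrightarrow> (\<And>x. x \<in> space M \<Longrightarrow> \<bar>f x\<bar> \<le> e) \<Longrightarrow> \<bar>\<Gamma> f\<bar> \<le> L * e"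
    using assms(2) unfolding bounded_functional_def by blast
  show ?thesis
  proof (rule bounded_functionalI[where K = "\<bar>a\<bar> * K + \<bar>b\<bar> * L"])
    fix f and e :: real
    assume f: "bounded_measurable M f" "\<And>x. x \<in> space M \<Longrightarrow> \<bar>f x\<bar> \<le> e"
    have "\<bar>a * \<Lambda> f + b * \<Gamma> f\<bar> \<le> \<bar>a\<bar> * \<bar>\<Lambda> f\<bar> + \<bar>b\<bar> * \<bar>\<Gamma> f\<bar>"
      by (metis abs_mult abs_triangle_ineq)
    also have "... \<le> \<bar>a\<bar> * (K * e) + \<bar>b\<bar> * (L * e)"
      using K[OF f] L[OF f] by (intro add_mono mult_left_mono) auto
    finally show "\<bar>a * \<Lambda> f + b * \<Gamma> f\<bar> \<le> (\<bar>a\<bar> * K + \<bar>b\<bar> * L) * e" by (simp add: algebra_simps)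
  qed (use assms in \<open>simp_all add: bounded_functional_add bounded_functional_scale algebra_simps\<close>)
qed

text \<open>Sup-norm continuity carries equality from indicators to their uniform limits. Identities
  between signed, disintegrated or projected integrals thereby reduce to identities between values
  on sets.\<close>

lemma bounded_functional_eqI:
  assumes L: "bounded_functional M \<Lambda>" "bounded_functional M \<Gamma>"
    and ind: "\<And>A. A \<in> sets M \<Longrightarrow> \<Lambda> (indicator A) = \<Gamma> (indicator A)"
    and f: "bounded_measurable M f"
  shows "\<Lambda> f = \<Gamma> f"
  using f
proof (induction rule: bounded_measurable_induct)
  case (approx f)
  obtain K where K: "K \<ge> 0" "\<And>f e. bounded_measurable M f \<Longrightarrow> (\<And>x. x \<in> space M \<Longrightarrow> \<bar>f x\<bar> \<le> e) \<Longrightarrow> e \<ge> 0 \<Longrightarrow> \<bar>\<Lambda> f\<bar> \<le> K * e"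
    using bounded_functional_bound[OF L(1)] by blast
  obtain H where H: "H \<ge> 0" "\<And>f e. bounded_measurable M f \<Longrightarrow> (\<And>x. x \<in> space M \<Longrightarrow> \<bar>f x\<bar> \<le> e) \<Longrightarrow> e \<ge> 0 \<Longrightarrow> \<bar>\<Gamma> f\<bar> \<le> H * e"
    using bounded_functional_bound[OF L(2)] by blast
  have "\<bar>\<Lambda> f - \<Gamma> f\<bar> \<le> 0 + e" if e: "e > 0" for e
  proof -
    \<comment> \<open>Chosen so that the errors K d and H d of the two functionals add up to at most
      e; the summand 1 keeps the denominator positive.\<close>
    define d where "d = e / (K + H + 1)"
    have d: "d > 0" using e K H by (simp add: d_def)
    obtain g where g: "bounded_measurable M g" "\<Lambda> g = \<Gamma> g" "\<And>x. x \<in> space M \<Longrightarrow> \<bar>f x - g x\<bar> \<le> d"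
      using approx(2)[OF d] by blast
    have fg: "bounded_measurable M (\<lambda>x. f x - g x)" using approx(1) g by (intro bounded_measurable_diff)
    have "\<bar>\<Lambda> (\<lambda>x. f x - g x)\<bar> \<le> K * d" "\<bar>\<Gamma> (\<lambda>x. f x - g x)\<bar> \<le> H * d"
      using d g by (auto intro!: K H fg)
    then have "\<bar>\<Lambda> f - \<Gamma> f\<bar> \<le> K * d + H * d"
      using bounded_functional_diff[OF L(1) approx(1) g(1)] bounded_functional_diff[OF L(2) approx(1) g(1)] g(2)
      by linarith
    also have "... \<le> (K + H + 1) * d" using d by (simp add: algebra_simps)
    also have "... = e" using K H by (simp add: d_def)
    finally show ?thesis by simp
  qed
  then have "\<bar>\<Lambda> f - \<Gamma> f\<bar> \<le> 0" by (rule field_le_epsilon)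
  then show ?case by simp
qed (use assms in \<open>simp_all add: bounded_functional_add bounded_functional_scale\<close>)

lemma integrable_mult_bounded:
  assumes h: "integrable N h" and s: "sets N = sets M" and f: "bounded_measurable M f"
  shows "integrable N (\<lambda>x. f x * h x)"
proof -
  have f': "bounded_measurable N f" using f s bounded_measurable_cong_sets by blast
  obtain B where B: "\<And>x. x \<in> space N \<Longrightarrow> \<bar>f x\<bar> \<le> B" using bounded_measurable_bound[OF f'] by blast
  show ?thesis
  proof (rule Bochner_Integration.integrable_bound[of N "\<lambda>x. B * h x"])
    show "integrable N (\<lambda>x. B * h x)" using h by simp
    show "(\<lambda>x. f x * h x) \<in> borel_measurable N"
      using bounded_measurableD[OF f'] h by measurable
    show "AE x in N. norm (f x * h x) \<le> norm (B * h x)"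
      using B by (intro AE_I2) (force simp: abs_mult intro!: mult_right_mono)
  qed
qed

lemma bounded_functional_integral_weighted:
  assumes h: "integrable N h" and s: "sets N = sets M"
  shows "bounded_functional M (\<lambda>f. LINT x|N. f x * h x)"
proof -
  note int = integrable_mult_bounded[OF h s]
  show ?thesis
  proof (rule bounded_functionalI[where K = "\<integral>x. \<bar>h x\<bar> \<partial>N"])
    fix f and e :: real
    assume f: "bounded_measurable M f" "\<And>x. x \<in> space M \<Longrightarrow> \<bar>f x\<bar> \<le> e"
    have "\<bar>LINT x|N. f x * h x\<bar> \<le> (LINT x|N. \<bar>f x * h x\<bar>)" by simp
    also have "... \<le> (LINT x|N. \<bar>h x\<bar> * e)"
    proof (rule integral_mono)
      show "integrable N (\<lambda>x. \<bar>f x * h x\<bar>)" using int[OF f(1)] by (rule integrable_abs)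
      show "integrable N (\<lambda>x. \<bar>h x\<bar> * e)" using h by simp
      fix x assume "x \<in> space N"
      then have "\<bar>f x\<bar> \<le> e" using f(2) sets_eq_imp_space_eq[OF s] by simp
      then show "\<bar>f x * h x\<bar> \<le> \<bar>h x\<bar> * e"
        by (simp only: abs_mult) (metis abs_ge_zero mult.commute mult_left_mono)
    qed
    finally show "\<bar>LINT x|N. f x * h x\<bar> \<le> (LINT x|N. \<bar>h x\<bar>) * e" by simp
  qed (simp_all add: int distrib_right mult.assoc)
qed

lemma bounded_functional_integral:
  assumes "finite_measure N" "sets N = sets M"
  shows "bounded_functional M (\<lambda>f. LINT x|N. f x)"
proof -
  interpret finite_measure N by fact
  show ?thesis using bounded_functional_integral_weighted[of N "\<lambda>_. 1" M] assms by simp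
qed

lemma bounded_functional_signed_integral:
  assumes "vector_measure M \<nu>"
  shows "bounded_functional M (signed_integral M \<nu>)"
  using bounded_functional_combine[OF bounded_functional_integral[OF finite_measure_pos_part[OF assms], of M]
    bounded_functional_integral[OF finite_measure_neg_part[OF assms], of M], of 1 "-1"]
  unfolding signed_integral_def[abs_def] by simp

lemma signed_integral_indicator:
  assumes "vector_measure M \<nu>" "A \<in> sets M"
  shows "signed_integral M \<nu> (indicator A) = \<nu> A"
  unfolding signed_integral_def jordan_decomposition[OF assms]
  using assms(2) sets.Int_space_eq2[OF assms(2)] by simp

lemma signed_integral_eqI:
  assumes "vector_measure M \<nu>" "bounded_functional M \<Lambda>"
    and "\<And>A. A \<in> sets M \<Longrightarrow> \<Lambda> (indicator A) = \<nu> A"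
    and "bounded_measurable M f"
  shows "signed_integral M \<nu> f = \<Lambda> f"
  by (rule bounded_functional_eqI[OF bounded_functional_signed_integral[OF assms(1)] assms(2) _ assms(4)])
    (simp add: signed_integral_indicator assms)

lemma pos_part_cong:
  assumes "sets M = sets N" "\<And>A. A \<in> sets M \<Longrightarrow> \<mu> A = \<nu> A"
  shows "pos_part M \<mu> = pos_part N \<nu>"
proof -
  have "(\<lambda>A. SUP B\<in>{B \<in> sets M. B \<subseteq> A}. ennreal (\<mu> B)) = (\<lambda>A. SUP B\<in>{B \<in> sets N. B \<subseteq> A}. ennreal (\<nu> B))"
    using assms by (intro ext SUP_cong) auto
  then show ?thesis
    unfolding pos_part_def using assms sets_eq_imp_space_eq[OF assms(1)] by simp
qed

lemma neg_part_cong: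
  assumes "sets M = sets N" "\<And>A. A \<in> sets M \<Longrightarrow> \<mu> A = \<nu> A"
  shows "neg_part M \<mu> = neg_part N \<nu>"
  unfolding neg_part_def using assms by (intro pos_part_cong) auto

lemma signed_integral_cong_measure:
  assumes "sets M = sets N" "\<And>A. A \<in> sets M \<Longrightarrow> \<mu> A = \<nu> A"
  shows "signed_integral M \<mu> = signed_integral N \<nu>"
  unfolding signed_integral_def[abs_def] using pos_part_cong[OF assms] neg_part_cong[OF assms] by simp

lemma vector_measure_cong:
  assumes "sets M = sets N" "\<And>A. A \<in> sets M \<Longrightarrow> \<mu> A = \<nu> A"
  shows "vector_measure M \<mu> \<longleftrightarrow> vector_measure N \<nu>"
proof -
  have "\<mu> (A i) = \<nu> (A i)" "\<mu> (\<Union>i. A i) = \<nu> (\<Union>i. A i)" if "range A \<subseteq> sets N" for A :: "nat \<Rightarrow> _" and i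
    using that assms by (auto intro!: assms(2) sets.countable_UN)
  then show ?thesis
    unfolding vector_measure_def using assms by (auto cong: imp_cong)
qed

lemma signed_integral_lincomb:
  assumes "vector_measure M \<mu>" "vector_measure M \<nu>" "bounded_measurable M f"
  shows "signed_integral M (\<lambda>A. a * \<mu> A + b * \<nu> A) f = a * signed_integral M \<mu> f + b * signed_integral M \<nu> f"
  by (rule signed_integral_eqI[OF vector_measure_lincomb[OF assms(1,2)] _ _ assms(3)])
    (use assms in \<open>auto intro!: bounded_functional_combine bounded_functional_signed_integral simp: signed_integral_indicator\<close>)

section \<open>Signed densities and the dual bound on the entropy\<close>

lemma vector_measure_density:
  fixes h :: "'a \<Rightarrow> real"
  assumes h: "integrable N h" and s: "sets N = sets M"
  shows "vector_measure M (\<lambda>A. LINT x|N. indicator A x * h x)"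
  unfolding vector_measure_def
proof (intro conjI allI impI)
  fix A :: "nat \<Rightarrow> _" assume A: "range A \<subseteq> sets M" "disjoint_family A"
  have A': "A i \<in> sets N" for i using A s by auto
  have si: "set_integrable N (\<Union>i. A i) h"
    unfolding set_integrable_def using A' h by (intro integrable_mult_indicator) auto
  have "(\<lambda>i. set_lebesgue_integral N (A i) h) sums set_lebesgue_integral N (\<Union>i. A i) h"
  proof -
    have "summable (\<lambda>i. set_lebesgue_integral N (A i) h)"
    proof (rule summable_norm_cancel, rule summable_comparison_test')
      \<comment> \<open>Absolute summability is inherited from the finite measure |h| N, whose
        values dominate the terms.\<close>
      have f: "finite_measure (density N (\<lambda>x. ennreal \<bar>h x\<bar>))"
      proof (rule finite_measureI)
        have "integral\<^sup>N N (\<lambda>x. ennreal \<bar>h x\<bar>) < \<infinity>" using h by (auto simp: integrable_iff_bounded)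
        then show "emeasure (density N (\<lambda>x. ennreal \<bar>h x\<bar>)) (space (density N (\<lambda>x. ennreal \<bar>h x\<bar>))) \<noteq> \<infinity>"
          using h by (simp add: emeasure_density cong: nn_integral_cong)
      qed
      interpret f: finite_measure "density N (\<lambda>x. ennreal \<bar>h x\<bar>)" by (rule f)
      show "summable (\<lambda>i. measure (density N (\<lambda>x. ennreal \<bar>h x\<bar>)) (A i))"
        using A' A by (auto intro!: sums_summable[OF f.finite_measure_UNION])
      fix i :: nat
      have "ennreal (norm (norm (set_lebesgue_integral N (A i) h))) \<le> (\<integral>\<^sup>+x. norm (indicator (A i) x *\<^sub>R h x) \<partial>N)"
        unfolding set_lebesgue_integral_def
        using h A' integral_norm_bound_ennreal[OF integrable_mult_indicator[OF A' h]] by simp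
      also have "... = emeasure (density N (\<lambda>x. ennreal \<bar>h x\<bar>)) (A i)"
        using h A' by (subst emeasure_density) (auto intro!: nn_integral_cong simp: indicator_def)
      also have "... = ennreal (measure (density N (\<lambda>x. ennreal \<bar>h x\<bar>)) (A i))"
        by (rule f.emeasure_eq_measure)
      finally show "norm (norm (set_lebesgue_integral N (A i) h)) \<le> measure (density N (\<lambda>x. ennreal \<bar>h x\<bar>)) (A i)"
        by (simp add: ennreal_le_iff)
    qed
    then show ?thesis
      using lebesgue_integral_countable_add[of A N h] A' A(2) si
      by (auto simp: disjoint_family_on_def sums_iff)
  qed
  then show "(\<lambda>i. LINT x|N. indicator (A i) x * h x) sums (LINT x|N. indicator (\<Union>i. A i) x * h x)"
    by (simp add: set_lebesgue_integral_def)
qed simp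

lemma signed_integral_density:
  assumes h: "integrable N h" and s: "sets N = sets M"
    and \<nu>: "\<And>A. A \<in> sets M \<Longrightarrow> \<nu> A = (LINT x|N. indicator A x * h x)"
    and f: "bounded_measurable M f"
  shows "signed_integral M \<nu> f = (LINT x|N. f x * h x)"
proof (rule signed_integral_eqI[OF _ bounded_functional_integral_weighted[OF h s] _ f])
  show "vector_measure M \<nu>"
    using vector_measure_density[OF h s] by (subst vector_measure_cong[OF refl \<nu>])
qed (simp add: \<nu>)

text \<open>Measurable subsets of null sets are null, so absolute continuity passes from \<mu> to
  the suprema that define its Jordan parts, and the Radon-Nikodym theorem for positive measures
  applies to each part.\<close>

lemma signed_RN_deriv:
  assumes N: "finite_measure N" and \<mu>: "vector_measure N \<mu>" and ac: "signed_ac N \<mu>"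
  shows "integrable N (signed_RN_deriv N \<mu>)"
    and "\<And>A. A \<in> sets N \<Longrightarrow> \<mu> A = (LINT x|N. indicator A x * signed_RN_deriv N \<mu> x)"
proof -
  interpret N: finite_measure N by fact
  have acp: "absolutely_continuous N (pos_part N \<nu>)"
    if \<nu>: "vector_measure N \<nu>" "signed_ac N \<nu>" for \<nu>
    unfolding absolutely_continuous_def
  proof
    fix A assume A: "A \<in> null_sets N"
    have "pos_val N \<nu> A \<le> 0"
    proof (rule pos_val_least)
      fix B assume "B \<in> sets N" "B \<subseteq> A"
      then have "B \<in> null_sets N" using A null_sets_subset by blast
      then show "\<nu> B \<le> 0" using \<nu>(2) unfolding signed_ac_def by auto
    qed
    then show "A \<in> null_sets (pos_part N \<nu>)"
      using A \<nu> by (auto simp: null_sets_def emeasure_pos_part ennreal_eq_0_iff)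
  qed
  have \<mu>': "vector_measure N (\<lambda>A. - \<mu> A)" using \<mu> by (rule vector_measure_uminus)
  have ac': "signed_ac N (\<lambda>A. - \<mu> A)" using ac unfolding signed_ac_def by auto
  interpret P: finite_measure "pos_part N \<mu>" by (rule finite_measure_pos_part[OF \<mu>])
  interpret Q: finite_measure "pos_part N (\<lambda>A. - \<mu> A)" by (rule finite_measure_pos_part[OF \<mu>'])
  note RP = N.RN_deriv_integrable[OF P.sigma_finite_measure_axioms acp[OF \<mu> ac] sets_pos_part]
    N.RN_deriv_integral[OF P.sigma_finite_measure_axioms acp[OF \<mu> ac] sets_pos_part]
  note RQ = N.RN_deriv_integrable[OF Q.sigma_finite_measure_axioms acp[OF \<mu>' ac'] sets_pos_part]
    N.RN_deriv_integral[OF Q.sigma_finite_measure_axioms acp[OF \<mu>' ac'] sets_pos_part]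
  have iP: "integrable N (\<lambda>x. enn2real (RN_deriv N (pos_part N \<mu>) x) * indicator A x)" if "A \<in> sets N" for A
    using that P.emeasure_finite by (subst RP(1)[symmetric]) (auto simp: integrable_indicator_iff top.not_eq_extremum[symmetric])
  have iQ: "integrable N (\<lambda>x. enn2real (RN_deriv N (pos_part N (\<lambda>A. - \<mu> A)) x) * indicator A x)" if "A \<in> sets N" for A
    using that Q.emeasure_finite by (subst RQ(1)[symmetric]) (auto simp: integrable_indicator_iff top.not_eq_extremum[symmetric])
  have i: "integrable N (\<lambda>x. enn2real (RN_deriv N (pos_part N \<mu>) x) * indicator (space N) x
      - enn2real (RN_deriv N (pos_part N (\<lambda>A. - \<mu> A)) x) * indicator (space N) x)"
    by (intro Bochner_Integration.integrable_diff iP iQ) auto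
  show "integrable N (signed_RN_deriv N \<mu>)"
    by (rule Bochner_Integration.integrable_cong[THEN iffD1, OF refl _ i]) (simp add: signed_RN_deriv_def neg_part_def)
  fix A assume A: "A \<in> sets N"
  have "\<mu> A = measure (pos_part N \<mu>) A - measure (neg_part N \<mu>) A"
    by (rule jordan_decomposition[OF \<mu> A])
  also have "... = (LINT x|pos_part N \<mu>. indicator A x) - (LINT x|pos_part N (\<lambda>A. - \<mu> A). indicator A x)"
    using A sets.Int_space_eq2[OF A] by (simp add: neg_part_def)
  also have "... = (LINT x|N. enn2real (RN_deriv N (pos_part N \<mu>) x) * indicator A x
      - enn2real (RN_deriv N (pos_part N (\<lambda>A. - \<mu> A)) x) * indicator A x)"
    using A RP(2)[of "indicator A"] RQ(2)[of "indicator A"]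
    by (subst Bochner_Integration.integral_diff[OF iP[OF A] iQ[OF A]]) simp
  also have "... = (LINT x|N. indicator A x * signed_RN_deriv N \<mu> x)"
    by (rule Bochner_Integration.integral_cong) (auto simp: signed_RN_deriv_def neg_part_def indicator_def)
  finally show "\<mu> A = (LINT x|N. indicator A x * signed_RN_deriv N \<mu> x)" .
qed

lemma signed_RN_deriv_unique:
  assumes N: "finite_measure N" and \<mu>: "vector_measure N \<mu>" and h: "integrable N h"
    and eq: "\<And>A. A \<in> sets N \<Longrightarrow> \<mu> A = (LINT x|N. indicator A x * h x)"
  shows "AE x in N. signed_RN_deriv N \<mu> x = h x"
proof -
  have ac: "signed_ac N \<mu>"
    unfolding signed_ac_def
  proof
    fix A assume A: "A \<in> null_sets N"
    have "AE x in N. indicator A x * h x = 0"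
      by (rule eventually_mono[OF AE_not_in[OF A]]) simp
    then have "(LINT x|N. indicator A x * h x) = 0" by (rule integral_eq_zero_AE)
    then show "\<mu> A = 0" using eq A by auto
  qed
  show ?thesis
    by (rule density_unique_real[OF signed_RN_deriv(1)[OF N \<mu> ac] h])
      (simp add: set_lebesgue_integral_def signed_RN_deriv(2)[OF N \<mu> ac, symmetric] eq)
qed

text \<open>The Fenchel inequality for f ln f - f + 1, whose convex conjugate is exp a - 1. It is
  the inequality 1 + y \<le> exp y at y = a - ln f.\<close>

lemma entropy_young:
  fixes f a :: real
  assumes "f \<ge> 0"
  shows "a * f - (exp a - 1) \<le> f * ln f - f + 1" "0 \<le> f * ln f - f + 1"
proof -
  have *: "a * f - (exp a - 1) \<le> f * ln f - f + 1" for a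
  proof (cases "f = 0")
    case False
    then have f: "f > 0" using assms by simp
    have "1 + (a - ln f) \<le> exp (a - ln f)" by (rule exp_ge_add_one_self)
    then have "f * (1 + (a - ln f)) \<le> f * exp (a - ln f)" using f by simp
    also have "... = exp a" using f by (simp add: exp_diff)
    finally show ?thesis by (simp add: algebra_simps)
  qed simp
  show "a * f - (exp a - 1) \<le> f * ln f - f + 1" by (rule *)
  show "0 \<le> f * ln f - f + 1" using *[of 0] by simp
qed

lemma ennreal_integral_le_nn_integral:
  assumes "integrable N f"
  shows "ennreal (LINT x|N. f x) \<le> (\<integral>\<^sup>+x. ennreal (f x) \<partial>N)"
proof -
  have "ennreal (LINT x|N. f x) \<le> ennreal (LINT x|N. max 0 (f x))"
    using assms by (intro ennreal_leI integral_mono) auto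
  also have "... = (\<integral>\<^sup>+x. ennreal (max 0 (f x)) \<partial>N)"
    using assms by (intro nn_integral_eq_integral[symmetric]) auto
  also have "... = (\<integral>\<^sup>+x. ennreal (f x) \<partial>N)"
    by (rule nn_integral_cong) (auto simp: max_def ennreal_neg)
  finally show ?thesis .
qed

text \<open>Young's inequality under the integral. The resulting lower bound is affine in \<mu> for
  fixed \<phi>, which is the form that can be combined with convergence of measures.\<close>

lemma Ent_dual:
  assumes N: "finite_measure N" and \<mu>: "vector_measure N \<mu>" and \<phi>: "bounded_measurable N \<phi>"
  shows "ennreal (signed_integral N \<mu> \<phi> - (LINT x|N. exp (\<phi> x) - 1)) \<le> Ent \<mu> N"
proof (cases "signed_ac N \<mu> \<and> (AE x in N. 0 \<le> signed_RN_deriv N \<mu> x)")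
  case True
  let ?f = "signed_RN_deriv N \<mu>"
  have ac: "signed_ac N \<mu>" and pos: "AE x in N. 0 \<le> ?f x" using True by auto
  have f: "integrable N ?f" by (rule signed_RN_deriv(1)[OF N \<mu> ac])
  have e: "integrable N (\<lambda>x. exp (\<phi> x) - 1)"
    by (rule integrable_bounded_measurable[OF N refl])
      (intro bounded_measurable_diff bounded_measurable_exp bounded_measurable_const \<phi>)
  have pf: "integrable N (\<lambda>x. \<phi> x * ?f x)"
  proof -
    obtain B where B: "\<And>x. x \<in> space N \<Longrightarrow> \<bar>\<phi> x\<bar> \<le> B" using bounded_measurable_bound[OF \<phi>] by blast
    show ?thesis
    proof (rule Bochner_Integration.integrable_bound[of N "\<lambda>x. B * ?f x"])
      show "(\<lambda>x. \<phi> x * ?f x) \<in> borel_measurable N" using f bounded_measurableD[OF \<phi>] by measurable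
      show "AE x in N. norm (\<phi> x * ?f x) \<le> norm (B * ?f x)"
        using B by (intro AE_I2) (force simp: abs_mult intro!: mult_right_mono)
    qed (use f in simp)
  qed
  have "signed_integral N \<mu> \<phi> = (LINT x|N. \<phi> x * ?f x)"
    by (rule signed_integral_density[OF f refl signed_RN_deriv(2)[OF N \<mu> ac] \<phi>])
  then have "signed_integral N \<mu> \<phi> - (LINT x|N. exp (\<phi> x) - 1) = (LINT x|N. \<phi> x * ?f x - (exp (\<phi> x) - 1))"
    by (simp only: Bochner_Integration.integral_diff[OF pf e])
  also have "ennreal ... \<le> (\<integral>\<^sup>+x. ennreal (\<phi> x * ?f x - (exp (\<phi> x) - 1)) \<partial>N)"
    by (intro ennreal_integral_le_nn_integral Bochner_Integration.integrable_diff pf e)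
  also have "... \<le> (\<integral>\<^sup>+x. ennreal (?f x * ln (?f x) - ?f x + 1) \<partial>N)"
    using pos by (intro nn_integral_mono_AE) (auto elim!: eventually_mono intro!: ennreal_leI entropy_young)
  finally show ?thesis unfolding Ent_def using True by simp
qed (simp only: Ent_def if_False infinity_ennreal_def top_greatest)

section \<open>Smooth functions on the circle\<close>

text \<open>The standard flat function exp (-1/x) divided by x^k. Differentiation stays within the
  span of this family and only shifts k, so smoothness at 0 is settled once for all orders.\<close>

definition flat :: "nat \<Rightarrow> real \<Rightarrow> real"
  where "flat k x = (if x > 0 then exp (- (1 / x)) / x ^ k else 0)"

lemma flat_tendsto_0: "(flat k \<longlongrightarrow> 0) (at 0)"
proof -
  have "((\<lambda>y::real. y ^ k / exp y) \<longlongrightarrow> 0) at_top" by (rule tendsto_power_div_exp_0)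
  then have "((\<lambda>x::real. inverse x ^ k / exp (inverse x)) \<longlongrightarrow> 0) (at_right 0)"
    by (rule filterlim_compose[OF _ filterlim_inverse_at_top_right])
  then have r: "(flat k \<longlongrightarrow> 0) (at_right 0)"
  proof (rule Lim_transform_eventually)
    show "\<forall>\<^sub>F x in at_right 0. inverse x ^ k / exp (inverse x) = flat k x"
      using eventually_at_right_less[of 0]
      by eventually_elim (simp add: flat_def exp_minus field_simps)
  qed
  have "\<forall>\<^sub>F x in at_left 0. flat k x = 0"
    using eventually_at_left_real[of "-1" 0] by (auto elim!: eventually_mono simp: flat_def)
  then have l: "(flat k \<longlongrightarrow> 0) (at_left 0)" by (rule tendsto_eventually)
  show ?thesis using filterlim_at_split[of "flat k" "nhds 0" 0] l r by blast
qed

lemma flat_deriv: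
  "(flat k has_real_derivative (flat (k + 2) x - real k * flat (k + 1) x)) (at x)"
proof -
  consider "x > 0" | "x < 0" | "x = 0" by linarith
  then show ?thesis
  proof cases
    case 1
    have "((\<lambda>x. exp (- (1 / x)) * inverse (x ^ k)) has_real_derivative
        (exp (- (1 / x)) * (1 / x\<^sup>2) * inverse (x ^ k) + exp (- (1 / x)) * (- (real k * x ^ (k - 1) / (x ^ k)\<^sup>2)))) (at x)"
      using 1 by (auto intro!: derivative_eq_intros simp: field_simps power2_eq_square)
    moreover have "exp (- (1 / x)) * (1 / x\<^sup>2) * inverse (x ^ k) + exp (- (1 / x)) * (- (real k * x ^ (k - 1) / (x ^ k)\<^sup>2))
      = flat (k + 2) x - real k * flat (k + 1) x"
      using 1 by (cases k) (simp_all add: flat_def field_simps power2_eq_square)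
    ultimately have "((\<lambda>x. exp (- (1 / x)) * inverse (x ^ k)) has_real_derivative
        (flat (k + 2) x - real k * flat (k + 1) x)) (at x)" by simp
    then show ?thesis
      by (rule has_field_derivative_transform_within_open[where S = "{0<..}"])
        (use 1 in \<open>auto simp: flat_def field_simps\<close>)
  next
    case 2
    have "((\<lambda>x. 0) has_real_derivative (flat (k + 2) x - real k * flat (k + 1) x)) (at x)"
      using 2 by (simp add: flat_def)
    then show ?thesis
      by (rule has_field_derivative_transform_within_open[where S = "{..<0}"])
        (use 2 in \<open>auto simp: flat_def\<close>)
  next
    case 3
    \<comment> \<open>The difference quotient of \<open>flat k\<close> at 0 is
      \<open>flat (Suc k)\<close>, which tends to 0 as well.\<close>
    have "((\<lambda>h. flat k h / h) \<longlongrightarrow> 0) (at 0)"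
      by (rule Lim_transform_eventually[OF flat_tendsto_0[of "Suc k"]])
        (simp add: flat_def field_simps eventually_at_filter)
    then show ?thesis using 3 by (simp add: has_field_derivative_iff flat_def)
  qed
qed

text \<open>A class closed under differentiation, rich enough for cutoffs and periodic bumps. The
  derivatives of all orders demanded by \<open>smooth_cyl\<close> are obtained by iterating
  \<open>smooth_real_deriv\<close>.\<close>

inductive_set smooth_real :: "(real \<Rightarrow> real) set" where
  const: "(\<lambda>x. c) \<in> smooth_real"
| ident: "(\<lambda>x. x) \<in> smooth_real"
| sin: "sin \<in> smooth_real"
| cos: "cos \<in> smooth_real"
| flat: "flat k \<in> smooth_real"
| add: "f \<in> smooth_real \<Longrightarrow> g \<in> smooth_real \<Longrightarrow> (\<lambda>x. f x + g x) \<in> smooth_real"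
| mult: "f \<in> smooth_real \<Longrightarrow> g \<in> smooth_real \<Longrightarrow> (\<lambda>x. f x * g x) \<in> smooth_real"
| comp: "f \<in> smooth_real \<Longrightarrow> g \<in> smooth_real \<Longrightarrow> (\<lambda>x. f (g x)) \<in> smooth_real"

lemma smooth_real_scale: "f \<in> smooth_real \<Longrightarrow> (\<lambda>x. c * f x) \<in> smooth_real"
  by (intro smooth_real.mult smooth_real.const)

lemma smooth_real_diff: "f \<in> smooth_real \<Longrightarrow> g \<in> smooth_real \<Longrightarrow> (\<lambda>x. f x - g x) \<in> smooth_real"
  using smooth_real.add[OF _ smooth_real_scale[of g "-1"]] by simp

lemma smooth_real_deriv:
  "f \<in> smooth_real \<Longrightarrow> \<exists>f'\<in>smooth_real. \<forall>x. (f has_real_derivative f' x) (at x)"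
proof (induction rule: smooth_real.induct)
  case (const c)
  show ?case by (rule bexI[of _ "\<lambda>x. 0"]) (auto intro: smooth_real.intros)
next
  case ident
  show ?case by (rule bexI[of _ "\<lambda>x. 1"]) (auto intro: smooth_real.intros)
next
  case sin
  show ?case by (rule bexI[of _ cos]) (auto intro: smooth_real.intros DERIV_sin)
next
  case cos
  have "(\<lambda>x. - 1 * sin x) \<in> smooth_real" by (intro smooth_real_scale smooth_real.sin)
  then show ?case using DERIV_cos by (intro bexI[of _ "\<lambda>x. - 1 * sin x"]) simp_all
next
  case (flat k)
  have "(\<lambda>x. flat (k + 2) x - real k * flat (k + 1) x) \<in> smooth_real"
    by (intro smooth_real_scale smooth_real_diff smooth_real.flat)
  then show ?case by (rule bexI[rotated]) (intro allI flat_deriv)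
next
  case (add f g)
  then obtain f' g' where d: "f' \<in> smooth_real" "g' \<in> smooth_real"
    "\<And>x. (f has_real_derivative f' x) (at x)" "\<And>x. (g has_real_derivative g' x) (at x)" by blast
  show ?case
    by (rule bexI[of _ "\<lambda>x. f' x + g' x"]) (use d in \<open>auto intro: smooth_real.add DERIV_add\<close>)
next
  case (mult f g)
  then obtain f' g' where d: "f' \<in> smooth_real" "g' \<in> smooth_real"
    "\<And>x. (f has_real_derivative f' x) (at x)" "\<And>x. (g has_real_derivative g' x) (at x)" by blast
  show ?case
    by (rule bexI[of _ "\<lambda>x. f' x * g x + g' x * f x"])
      (use d mult.hyps in \<open>auto intro!: smooth_real.add smooth_real.mult DERIV_mult\<close>)
next
  case (comp f g)
  then obtain f' g' where d: "f' \<in> smooth_real" "g' \<in> smooth_real"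
    "\<And>x. (f has_real_derivative f' x) (at x)" "\<And>x. (g has_real_derivative g' x) (at x)" by blast
  have "(\<lambda>x. f' (g x) * g' x) \<in> smooth_real"
    by (intro smooth_real.mult[OF smooth_real.comp[OF d(1) comp.hyps(2)] d(2)])
  then show ?case by (rule bexI[rotated]) (intro allI DERIV_chain2 d)
qed

lemma smooth_real_continuous: "f \<in> smooth_real \<Longrightarrow> continuous_on S f"
  using smooth_real_deriv[of f] by (meson DERIV_isCont continuous_at_imp_continuous_on)

lemma smooth_real_derivs:
  assumes "f \<in> smooth_real"
  obtains D :: "nat \<Rightarrow> real \<Rightarrow> real" where "D 0 = f" "\<And>n. D n \<in> smooth_real"
    "\<And>n x. (D n has_real_derivative D (Suc n) x) (at x)"
proof -
  have "\<exists>D. \<forall>n. (D n \<in> smooth_real \<and> (n = 0 \<longrightarrow> D n = f)) \<and> (\<forall>x. (D n has_real_derivative D (Suc n) x) (at x))"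
    by (rule dependent_nat_choice) (use assms smooth_real_deriv in auto)
  then show thesis using that by blast
qed

section \<open>Periodic lifts and the topology of the circle\<close>

lemma circle_surj: obtains x where "p = abs_circle x"
  using surj_abs_circle by (meson surjD)

lemma abs_rep_circle [simp]: "abs_circle (rep_circle p) = p"
  using Quotient_circle by (rule Quotient_abs_rep)

lemma rep_abs_circle: obtains k :: int where "rep_circle (abs_circle x) = x + of_int k"
proof -
  have "abs_circle (rep_circle (abs_circle x)) = abs_circle x" by simp
  then have "rep_circle (abs_circle x) - x \<in> \<int>" by (simp only: circle.abs_eq_iff)
  then obtain k where "rep_circle (abs_circle x) - x = of_int k" by (auto elim: Ints_cases)
  then show thesis using that[of k] by simp
qed

lemma periodic_int:
  fixes g :: "real \<Rightarrow> 'a"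
  assumes "\<And>x. g (x + 1) = g x"
  shows "g (x + of_int k) = g x"
proof -
  have n: "g (y + real n) = g y" for y n
  proof (induction n)
    case (Suc n)
    have "g (y + real (Suc n)) = g ((y + real n) + 1)" by (simp add: add_ac)
    then show ?case using assms Suc by simp
  qed simp
  show ?thesis
  proof (cases "k \<ge> 0")
    case True
    then show ?thesis using n[of x "nat k"] by simp
  next
    case False
    then show ?thesis using n[of "x + of_int k" "nat (- k)"] by simp
  qed
qed

lemma periodic_rep_abs:
  fixes g :: "real \<Rightarrow> 'a"
  assumes "\<And>x. g (x + 1) = g x"
  shows "g (rep_circle (abs_circle x)) = g x"
  using rep_abs_circle[of x] periodic_int[of g, OF assms] by metis

lemma abs_circle_plus_1: "abs_circle (x + 1) = abs_circle x"
  by (simp add: circle.abs_eq_iff)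

lemma continuous_on_circle:
  fixes f :: "circle \<Rightarrow> 'a::topological_space"
  assumes "continuous_on UNIV (\<lambda>x. f (abs_circle x))"
  shows "continuous_on UNIV f"
  using assms by (simp add: continuous_on_open_vimage open_circle_def vimage_def)

lemma continuous_abs_circle' [continuous_intros]:
  "continuous_on S f \<Longrightarrow> continuous_on S (\<lambda>x. abs_circle (f x))"
  using continuous_on_compose2[OF continuous_abs_circle] by auto

text \<open>The product of the identity with \<open>abs_circle\<close> is open and onto, so a
  preimage under F is open as the image of the corresponding open preimage under the lift.\<close>

lemma continuous_on_prod_circle:
  fixes F :: "real \<times> circle \<Rightarrow> 'a::topological_space"
  assumes "continuous_on UNIV (\<lambda>(t, x). F (t, abs_circle x))"
  shows "continuous_on UNIV F"
  unfolding continuous_on_open_vimage[OF open_UNIV]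
proof (intro allI impI)
  fix V :: "'a set" assume V: "open V"
  let ?W = "(\<lambda>(t, x). F (t, abs_circle x)) -` V"
  have W: "open ?W" using assms V by (auto simp: continuous_on_open_vimage)
  have "open (map_prod id abs_circle ` ?W)"
  proof (subst open_subopen, intro ballI)
    fix z assume "z \<in> map_prod id abs_circle ` ?W"
    then obtain t x where z: "z = (t, abs_circle x)" "(t, x) \<in> ?W" by auto
    obtain A B where AB: "open A" "open B" "(t, x) \<in> A \<times> B" "A \<times> B \<subseteq> ?W"
      using open_prod_elim[OF W z(2)] by blast
    have "open (A \<times> abs_circle ` B)" using AB by (intro open_Times open_image_abs_circle)
    moreover have "z \<in> A \<times> abs_circle ` B" using z AB by auto
    moreover have "A \<times> abs_circle ` B \<subseteq> map_prod id abs_circle ` ?W" using AB(4) by force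
    ultimately show "\<exists>T. open T \<and> z \<in> T \<and> T \<subseteq> map_prod id abs_circle ` ?W" by blast
  qed
  moreover have "map_prod id abs_circle ` ?W = F -` V"
  proof -
    have "z \<in> map_prod id abs_circle ` ?W" if "F z \<in> V" for z
      using that by (intro image_eqI[of _ _ "(fst z, rep_circle (snd z))"]) auto
    then show ?thesis by auto
  qed
  ultimately show "open (F -` V \<inter> UNIV)" by simp
qed

lemma smooth_cyl_product:
  assumes f: "f \<in> smooth_real" and g: "g \<in> smooth_real" "\<And>x. g (x + 1) = g x"
  shows "smooth_cyl (\<lambda>(t, p). f t * g (rep_circle p))"
proof -
  obtain D where D: "D 0 = f" "\<And>n. D n \<in> smooth_real" "\<And>n x. (D n has_real_derivative D (Suc n) x) (at x)"
    using smooth_real_derivs[OF f] by blast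
  obtain E where E: "E 0 = g" "\<And>n. E n \<in> smooth_real" "\<And>n x. (E n has_real_derivative E (Suc n) x) (at x)"
    using smooth_real_derivs[OF g(1)] by blast
  show ?thesis
    unfolding smooth_cyl_def
  proof (intro exI[of _ "\<lambda>m n t x. D m t * E n x"] conjI allI)
    fix t x show "D 0 t * E 0 x = (case (t, abs_circle x) of (t, p) \<Rightarrow> f t * g (rep_circle p))"
      using D E periodic_rep_abs[of g, OF g(2)] by simp
  next
    fix m n
    show "continuous_on UNIV (\<lambda>(t, x). D m t * E n x)"
      unfolding case_prod_beta
      by (intro continuous_on_mult continuous_on_compose2[OF smooth_real_continuous[OF D(2)], of UNIV]
          continuous_on_compose2[OF smooth_real_continuous[OF E(2)], of UNIV] continuous_intros) auto
  next
    fix m n t x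
    show "((\<lambda>s. D m s * E n x) has_real_derivative D (Suc m) t * E n x) (at t)"
      by (rule DERIV_cmult_right[OF D(3)])
    show "((\<lambda>y. D m t * E n y) has_real_derivative D m t * E (Suc n) x) (at x)"
      by (rule DERIV_cmult[OF E(3)])
  qed
qed

text \<open>These sets form an intersection-stable generator of the Borel sets of the circle. They
  serve twice: for the measurability of narrowly continuous curves as kernels, and for the density
  of test functions in L2.\<close>

definition smooth_approx :: "circle set \<Rightarrow> bool"
  where "smooth_approx U \<longleftrightarrow> (\<exists>g::nat \<Rightarrow> real \<Rightarrow> real.
    (\<forall>n. g n \<in> smooth_real \<and> (\<forall>x. g n (x + 1) = g n x) \<and> (\<forall>x. 0 \<le> g n x \<and> g n x \<le> 1)) \<and>
    (\<forall>x. (\<lambda>n. g n x) \<longlonglongrightarrow> indicator U (abs_circle x)))"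

lemma flat_0_bounds: "0 \<le> flat 0 x" "flat 0 x \<le> 1"
  by (auto simp: flat_def)

lemma flat_0_tendsto: "(\<lambda>n. flat 0 (real n * x)) \<longlonglongrightarrow> (if x > 0 then 1 else 0)"
proof (cases "x > 0")
  case True
  have "(\<lambda>n. exp (- (1 / x * (1 / real n)))) \<longlonglongrightarrow> exp (- (1 / x * 0))"
    by (intro tendsto_intros lim_1_over_n)
  then have "(\<lambda>n. exp (- (1 / x * (1 / real n)))) \<longlonglongrightarrow> 1" by simp
  then have "(\<lambda>n. flat 0 (real n * x)) \<longlonglongrightarrow> 1"
    by (rule Lim_transform_eventually)
      (use True in \<open>auto intro!: eventually_mono[OF eventually_gt_at_top[of 0]] simp: flat_def mult.commute\<close>)
  then show ?thesis using True by simp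
next
  case False
  then have "flat 0 (real n * x) = 0" for n by (auto simp: flat_def zero_less_mult_iff)
  then show ?thesis using False by simp
qed

lemma smooth_approx_UNIV: "smooth_approx UNIV"
  unfolding smooth_approx_def
  by (rule exI[of _ "\<lambda>n x. 1"]) (auto intro: smooth_real.const)

lemma smooth_approx_Int:
  assumes "smooth_approx U" "smooth_approx V"
  shows "smooth_approx (U \<inter> V)"
proof -
  obtain g where g: "\<And>n. g n \<in> smooth_real" "\<And>n x. g n (x + 1) = g n x" "\<And>n x. 0 \<le> g n x \<and> g n x \<le> 1"
    "\<And>x. (\<lambda>n::nat. g n x) \<longlonglongrightarrow> indicator U (abs_circle x)" using assms(1) unfolding smooth_approx_def by blast
  obtain h where h: "\<And>n. h n \<in> smooth_real" "\<And>n x. h n (x + 1) = h n x" "\<And>n x. 0 \<le> h n x \<and> h n x \<le> 1"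
    "\<And>x. (\<lambda>n::nat. h n x) \<longlonglongrightarrow> indicator V (abs_circle x)" using assms(2) unfolding smooth_approx_def by blast
  show ?thesis
    unfolding smooth_approx_def
    by (rule exI[of _ "\<lambda>n x. g n x * h n x"])
      (use g h in \<open>auto simp: indicator_inter_arith intro!: smooth_real.mult tendsto_mult mult_le_one\<close>)
qed

text \<open>For 0 < d < 1/2 this is the open arc with centre c and half-length d. The cosine makes
  the description independent of the representative and exhibits the arc as a superlevel set of a
  smooth periodic function.\<close>

definition arc :: "real \<Rightarrow> real \<Rightarrow> circle set"
  where "arc c d = {p. cos (2 * pi * (rep_circle p - c)) > cos (2 * pi * d)}"

lemma cos_periodic_1: "cos (2 * pi * (x + 1 - c)) = cos (2 * pi * (x - c))"
proof -
  have "2 * pi * (x + 1 - c) = 2 * pi * (x - c) + 2 * pi" by (simp add: algebra_simps)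
  then show ?thesis by (simp only: cos_periodic)
qed

lemma abs_in_arc: "abs_circle x \<in> arc c d \<longleftrightarrow> cos (2 * pi * (x - c)) > cos (2 * pi * d)"
  unfolding arc_def using periodic_rep_abs[of "\<lambda>x. cos (2 * pi * (x - c))", OF cos_periodic_1] by simp

lemma smooth_cos_scaled: "(\<lambda>x. cos (2 * pi * (x - c))) \<in> smooth_real"
  by (intro smooth_real.comp[OF smooth_real.cos] smooth_real_scale smooth_real_diff smooth_real.ident smooth_real.const)

lemma smooth_approx_arc: "smooth_approx (arc c d)"
  unfolding smooth_approx_def
proof (intro exI[of _ "\<lambda>n x. flat 0 (real n * (cos (2 * pi * (x - c)) - cos (2 * pi * d)))"] conjI allI)
  fix n :: nat
  show "(\<lambda>x. flat 0 (real n * (cos (2 * pi * (x - c)) - cos (2 * pi * d)))) \<in> smooth_real"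
    by (intro smooth_real.comp[OF smooth_real.flat] smooth_real_scale smooth_real_diff smooth_cos_scaled smooth_real.const)
next
  fix x show "(\<lambda>n. flat 0 (real n * (cos (2 * pi * (x - c)) - cos (2 * pi * d)))) \<longlonglongrightarrow> indicator (arc c d) (abs_circle x)"
    using flat_0_tendsto[of "cos (2 * pi * (x - c)) - cos (2 * pi * d)"]
    by (cases "abs_circle x \<in> arc c d") (simp_all add: abs_in_arc)
qed (simp_all add: flat_0_bounds cos_periodic_1)

lemma cos_gt_iff_small:
  assumes z: "\<bar>z\<bar> \<le> 1 / 2" and d: "0 < d" "d < 1 / 2"
  shows "cos (2 * pi * z) > cos (2 * pi * d) \<longleftrightarrow> \<bar>z\<bar> < d"
proof -
  have "cos (2 * pi * z) = cos \<bar>2 * pi * z\<bar>" by simp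
  then have z': "cos (2 * pi * z) = cos (2 * pi * \<bar>z\<bar>)" by (simp add: abs_mult)
  have pz: "2 * pi * \<bar>z\<bar> \<le> pi" using z pi_gt_zero by (simp add: field_simps)
  have pd: "2 * pi * d \<le> pi" using d pi_gt_zero by (simp add: field_simps)
  have m: "2 * pi * a < 2 * pi * b" if "a < b" for a b :: real
    using that pi_gt_zero by simp
  consider "\<bar>z\<bar> < d" | "\<bar>z\<bar> = d" | "\<bar>z\<bar> > d" by linarith
  then show ?thesis
  proof cases
    case 1
    then show ?thesis using cos_monotone_0_pi[OF _ m[OF 1] pd] z' by simp
  next
    case 3
    then show ?thesis using cos_monotone_0_pi[OF _ m[OF 3] pz] d z' by simp
  qed (use z' in simp)
qed

lemma arc_basis:
  assumes U: "open U" and p: "p \<in> U"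
  obtains c d where "c \<in> \<rat>" "d \<in> \<rat>" "p \<in> arc c d" "arc c d \<subseteq> U"
proof -
  obtain x where x: "p = abs_circle x" using circle_surj .
  have "open (abs_circle -` U)" "x \<in> abs_circle -` U" using U p x by (auto simp: open_circle_def)
  then obtain e where e: "e > 0" "ball x e \<subseteq> abs_circle -` U"
    unfolding open_contains_ball by blast
  \<comment> \<open>d < e / 2 keeps an arc whose centre is within d of x inside the e-ball; d < 1 /
    2 is the range in which the cosine detects |z| < d.\<close>
  obtain d where d: "d \<in> \<rat>" "0 < d" "d < min (e / 2) (1 / 2)"
    using Rats_dense_in_real[of 0 "min (e / 2) (1 / 2)"] e by auto
  obtain c where c: "c \<in> \<rat>" "x - d < c" "c < x + d"
    using Rats_dense_in_real[of "x - d" "x + d"] d by auto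
  have xc: "\<bar>x - c\<bar> < d" using c by linarith
  have "p \<in> arc c d"
    unfolding x abs_in_arc using xc d by (subst cos_gt_iff_small) simp_all
  moreover have "arc c d \<subseteq> U"
  proof
    fix q assume q: "q \<in> arc c d"
    obtain y where y: "q = abs_circle y" using circle_surj .
    \<comment> \<open>Subtracting the nearest integer brings y - c into [-1/2, 1/2], where
      \<open>cos_gt_iff_small\<close> applies.\<close>
    define k where "k = round (y - c)"
    define z where "z = y - of_int k - c"
    have z: "\<bar>z\<bar> \<le> 1 / 2"
      unfolding z_def k_def using of_int_round_abs_le[of "y - c"] by (simp add: abs_minus_commute diff_diff_eq add.commute)
    have "cos (2 * pi * (y - c)) > cos (2 * pi * d)" using q unfolding y abs_in_arc .
    moreover have "cos (2 * pi * (y - c)) = cos (2 * pi * z)"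
      using periodic_int[of "\<lambda>x. cos (2 * pi * (x - c))" "y" "- k", OF cos_periodic_1] by (simp add: z_def)
    ultimately have "\<bar>z\<bar> < d" using cos_gt_iff_small[OF z] d by simp
    then have "\<bar>x - (y - of_int k)\<bar> < e" using c d unfolding z_def by linarith
    then have "y - of_int k \<in> ball x e" by (simp add: dist_real_def)
    then have "abs_circle (y - of_int k) \<in> U" using e by auto
    moreover have "abs_circle (y - of_int k) = q" unfolding y by (simp add: circle.abs_eq_iff)
    ultimately show "q \<in> U" by simp
  qed
  ultimately show thesis using that c d by blast
qed

lemma continuous_periodic_circle:
  assumes "continuous_on UNIV g" "\<And>x. g (x + 1) = (g x :: real)"
  shows "continuous_on UNIV (\<lambda>p. g (rep_circle p))"
  by (rule continuous_on_circle) (simp add: periodic_rep_abs[of g, OF assms(2)] assms(1))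

lemma smooth_approx_borel:
  assumes "smooth_approx U" shows "U \<in> sets borel"
proof -
  obtain g where g: "\<And>n. g n \<in> smooth_real" "\<And>n x. g n (x + 1) = g n x"
    "\<And>x. (\<lambda>n::nat. g n x) \<longlonglongrightarrow> indicator U (abs_circle x)" using assms unfolding smooth_approx_def by blast
  have "indicat_real U \<in> borel_measurable borel"
  proof (rule borel_measurable_LIMSEQ_real)
    fix p show "(\<lambda>n. g n (rep_circle p)) \<longlonglongrightarrow> indicat_real U p" using g(3)[of "rep_circle p"] by simp
  next
    fix n show "(\<lambda>p. g n (rep_circle p)) \<in> borel_measurable borel"
      by (intro borel_measurable_continuous_onI continuous_periodic_circle g smooth_real_continuous)
  qed
  then show ?thesis by (simp add: borel_measurable_indicator_iff)
qed

lemma borel_circle_eq: "sets (borel :: circle measure) = sigma_sets UNIV (Collect smooth_approx)"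
proof
  show "sigma_sets UNIV (Collect smooth_approx) \<subseteq> sets borel"
    using smooth_approx_borel by (intro sets.sigma_sets_subset') auto
  show "sets (borel :: circle measure) \<subseteq> sigma_sets UNIV (Collect smooth_approx)"
  proof -
    interpret sigma_algebra UNIV "sigma_sets UNIV (Collect smooth_approx)"
      by (rule sigma_algebra_sigma_sets) simp
    have "U \<in> sigma_sets UNIV (Collect smooth_approx)" if U: "open U" for U :: "circle set"
    proof -
      let ?I = "{(c, d). c \<in> \<rat> \<and> d \<in> \<rat> \<and> arc c d \<subseteq> U}"
      have "?I \<subseteq> \<rat> \<times> \<rat>" by auto
      then have "countable ?I" by (rule countable_subset) (intro countable_SIGMA countable_rat)
      then have "(\<Union>(c, d)\<in>?I. arc c d) \<in> sigma_sets UNIV (Collect smooth_approx)"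
        by (intro countable_UN'') (auto intro: sigma_sets.Basic smooth_approx_arc)
      moreover have "(\<Union>(c, d)\<in>?I. arc c d) = U"
        using arc_basis[OF U] by (auto; metis)
      ultimately show ?thesis by simp
    qed
    then have "Collect open \<subseteq> sigma_sets UNIV (Collect smooth_approx)" by blast
    then show ?thesis unfolding borel_def
      using sigma_sets_mono[of "Collect open" UNIV "Collect smooth_approx"] by simp
  qed
qed

section \<open>Families of measures on the space-time strip\<close>

abbreviation time :: "real \<Rightarrow> real measure"
  where "time T \<equiv> restrict_space lborel {0<..<T}"

text \<open>\<open>cyl\<close> over an arbitrary fibre: the fluxes live over \<open>omega1\<close>,
  the limit objects over the circle.\<close>

definition strip :: "real \<Rightarrow> (real \<times> 'a::topological_space) measure"
  where "strip T = restrict_space borel ({0<..<T} \<times> UNIV)"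

lemma cyl_eq_strip: "cyl T = strip T"
  by (simp add: cyl_def strip_def)

lemma space_strip [simp]: "space (strip T) = {0<..<T} \<times> UNIV"
  by (simp add: strip_def space_restrict_space)

lemma space_cyl [simp]: "space (cyl T) = {0<..<T} \<times> UNIV"
  by (simp add: cyl_eq_strip)

lemma space_time_measure [simp]: "space (time T) = {0<..<T}"
  by (simp add: space_restrict_space)

lemma open_strip: "open ({0<..<T} \<times> (UNIV :: 'a::topological_space set) :: (real \<times> 'a) set)"
  by (intro open_Times) auto

lemma strip_measurable_borel: "f \<in> borel_measurable borel \<Longrightarrow> f \<in> borel_measurable (strip T)"
  unfolding strip_def by (rule measurable_restrict_space1)

lemma sets_strip: "A \<in> sets (strip T) \<longleftrightarrow> A \<in> sets borel \<and> A \<subseteq> {0<..<T} \<times> UNIV"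
proof -
  have "{0<..<T} \<times> UNIV \<inter> space borel \<in> sets (borel :: (real \<times> 'a) measure)"
    using open_strip by (auto intro: borel_open)
  then show ?thesis unfolding strip_def using sets_restrict_space_iff by blast
qed

lemma Pair_measurable_strip:
  "t \<in> {0<..<T} \<Longrightarrow> Pair t \<in> measurable borel (strip T :: (real \<times> 'a::second_countable_topology) measure)"
  unfolding strip_def borel_prod[symmetric]
  by (intro measurable_restrict_space2) auto

lemma measurable_section:
  fixes f :: "real \<times> 'a::second_countable_topology \<Rightarrow> 'b"
  assumes "f \<in> measurable (strip T) N" "t \<in> {0<..<T}"
  shows "(\<lambda>x. f (t, x)) \<in> measurable borel N"
  using measurable_compose[OF Pair_measurable_strip[OF assms(2)] assms(1)] .

lemma bounded_measurable_section:
  fixes f :: "real \<times> 'a::second_countable_topology \<Rightarrow> real"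
  assumes "bounded_measurable (strip T) f" "t \<in> {0<..<T}"
  shows "bounded_measurable borel (\<lambda>x. f (t, x))"
proof -
  obtain B where "\<And>x. x \<in> space (strip T) \<Longrightarrow> \<bar>f x\<bar> \<le> B" using bounded_measurable_bound[OF assms(1)] by blast
  then show ?thesis
    using measurable_section[OF bounded_measurableD[OF assms(1)] assms(2)] assms(2)
    by (intro bounded_measurableI[where B = B]) auto
qed

lemma sets_section:
  fixes A :: "(real \<times> 'a::second_countable_topology) set"
  assumes "A \<in> sets borel" shows "Pair t -` A \<in> sets borel"
proof -
  have "Pair t \<in> measurable (borel :: 'a measure) (borel :: (real \<times> 'a) measure)"
    unfolding borel_prod[symmetric] by simp
  from measurable_sets[OF this assms] show ?thesis by simp
qed

lemma strip_induct [consumes 1, case_names rect compl union]: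
  fixes A :: "(real \<times> 'a::second_countable_topology) set"
  assumes "A \<in> sets borel"
    and "\<And>a b. a \<in> sets borel \<Longrightarrow> b \<in> sets borel \<Longrightarrow> P (a \<times> b)"
    and "\<And>A. A \<in> sets borel \<Longrightarrow> P A \<Longrightarrow> P (UNIV - A)"
    and "\<And>A. disjoint_family A \<Longrightarrow> range A \<subseteq> sets borel \<Longrightarrow> (\<And>i. P (A i)) \<Longrightarrow> P (\<Union>i::nat. A i)"
  shows "P A"
proof -
  have s: "sets (borel :: (real \<times> 'a) measure) = sigma_sets UNIV {a \<times> b | a b. a \<in> sets (borel::real measure) \<and> b \<in> sets (borel::'a measure)}"
    unfolding borel_prod[symmetric] sets_pair_measure by simp
  have A: "A \<in> sigma_sets UNIV {a \<times> b | a b. a \<in> sets (borel::real measure) \<and> b \<in> sets (borel::'a measure)}"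
    using assms(1) s by simp
  show ?thesis
    using Int_stable_pair_measure_generator _ A
  proof (rule sigma_sets_induct_disjoint)
    show "P {}" using assms(2)[of "{}" "{}"] by simp
  qed (use assms s in auto)
qed

lemma set_integral_time:
  "(LBINT t:{0<..<T}. f t) = (LINT t|time T. f t)" for f :: "real \<Rightarrow> real"
  by (simp add: set_lebesgue_integral_def integral_restrict_space)

lemma set_nn_integral_time:
  "(\<integral>\<^sup>+t\<in>{0<..<T}. f t \<partial>lborel) = (\<integral>\<^sup>+t. f t \<partial>time T)"
  by (simp add: nn_integral_restrict_space)

lemma measurable_time_measure: "measurable (time T) N = measurable (restrict_space borel {0<..<T}) N"
  by (intro measurable_cong_sets sets_restrict_space_cong) auto

text \<open>The total variation read off from the Jordan parts, as a real number; bounds on signed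
  integrals are stated with it.\<close>

definition mass :: "'a measure \<Rightarrow> ('a set \<Rightarrow> real) \<Rightarrow> real"
  where "mass M \<nu> = measure (pos_part M \<nu>) (space M) + measure (neg_part M \<nu>) (space M)"

lemma sum_measure_le:
  assumes N: "finite_measure N" "sets N = sets M"
    and A: "finite I" "\<And>i. i \<in> I \<Longrightarrow> A i \<in> sets M" "disjoint_family_on A I"
  shows "(\<Sum>i\<in>I. measure N (A i)) \<le> measure N (space M)"
proof -
  interpret finite_measure N by fact
  have "(\<Sum>i\<in>I. measure N (A i)) = measure N (\<Union>i\<in>I. A i)"
    using A N by (intro finite_measure_finite_Union[symmetric]) auto
  also have "... \<le> measure N (space N)" by (rule bounded_measure)
  finally show ?thesis using sets_eq_imp_space_eq[OF N(2)] by simp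
qed

text \<open>Removing the intersection from A and B leaves \<nu> A - \<nu> B unchanged and makes the
  sets disjoint, so a partition into two sets bounds both Jordan suprema together.\<close>

lemma mass_le_tv:
  assumes \<nu>: "vector_measure M \<nu>"
  shows "ennreal (mass M \<nu>) \<le> tv_norm M \<nu>"
proof (cases "tv_norm M \<nu>")
  case (real k)
  have le: "\<bar>\<nu> A\<bar> + \<bar>\<nu> B\<bar> \<le> k" if AB: "A \<in> sets M" "B \<in> sets M" "A \<inter> B = {}" for A B
  proof (cases "A = B")
    case True
    then show ?thesis using AB real by (simp add: vector_measure_empty[OF \<nu>])
  next
    case False
    have "(\<Sum>A\<in>{A, B}. ennreal (norm (\<nu> A))) \<le> tv_norm M \<nu>"
      unfolding tv_norm_def using AB by (intro SUP_upper) (auto simp: disjoint_def)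
    then have "ennreal (\<bar>\<nu> A\<bar> + \<bar>\<nu> B\<bar>) \<le> ennreal k" using False real by simp
    then show ?thesis using real by (simp only: ennreal_le_iff)
  qed
  have "pos_val M \<nu> (space M) \<le> k - pos_val M (\<lambda>A. - \<nu> A) (space M)"
  proof (rule pos_val_least)
    fix A assume A: "A \<in> sets M"
    have "pos_val M (\<lambda>A. - \<nu> A) (space M) \<le> k - \<nu> A"
    proof (rule pos_val_least)
      fix B assume B: "B \<in> sets M"
      have "\<nu> (A - A \<inter> B) = \<nu> A - \<nu> (A \<inter> B)" "\<nu> (B - A \<inter> B) = \<nu> B - \<nu> (A \<inter> B)"
        using A B by (auto intro!: vector_measure_Diff[OF \<nu>])
      moreover have "\<bar>\<nu> (A - A \<inter> B)\<bar> + \<bar>\<nu> (B - A \<inter> B)\<bar> \<le> k"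
        using A B by (intro le) auto
      ultimately show "- \<nu> B \<le> k - \<nu> A" by linarith
    qed
    then show "\<nu> A \<le> k - pos_val M (\<lambda>A. - \<nu> A) (space M)" by simp
  qed
  then show ?thesis using real \<nu> unfolding mass_def by (simp add: measure_pos_part measure_neg_part)
qed simp

lemma mass_nonneg: "0 \<le> mass M \<nu>"
  by (simp add: mass_def)

lemma signed_integral_le_mass:
  assumes \<nu>: "vector_measure M \<nu>" and f: "bounded_measurable M f" "\<And>x. x \<in> space M \<Longrightarrow> \<bar>f x\<bar> \<le> e"
  shows "\<bar>signed_integral M \<nu> f\<bar> \<le> e * mass M \<nu>"
proof -
  have *: "\<bar>LINT x|N. f x\<bar> \<le> e * measure N (space M)" if N: "finite_measure N" "sets N = sets M" for N
  proof -
    interpret finite_measure N by fact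
    have i: "integrable N f" by (rule integrable_bounded_measurable[OF N f(1)])
    have "\<bar>LINT x|N. f x\<bar> \<le> (LINT x|N. \<bar>f x\<bar>)" by simp
    also have "... \<le> (LINT x|N. e)"
      using f(2) i sets_eq_imp_space_eq[OF N(2)] by (intro integral_mono) auto
    finally show ?thesis using sets_eq_imp_space_eq[OF N(2)] by (simp add: mult.commute)
  qed
  have "\<bar>signed_integral M \<nu> f\<bar> \<le> \<bar>LINT x|pos_part M \<nu>. f x\<bar> + \<bar>LINT x|neg_part M \<nu>. f x\<bar>"
    unfolding signed_integral_def by linarith
  also have "... \<le> e * measure (pos_part M \<nu>) (space M) + e * measure (neg_part M \<nu>) (space M)"
    by (intro add_mono * finite_measure_pos_part finite_measure_neg_part \<nu>) auto
  finally show ?thesis by (simp add: mass_def distrib_left)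
qed

lemma sum_abs_le_mass:
  assumes \<nu>: "vector_measure M \<nu>" and A: "range A \<subseteq> sets M" "disjoint_family A"
  shows "(\<Sum>i<n::nat. \<bar>\<nu> (A i)\<bar>) \<le> mass M \<nu>"
proof -
  have *: "(\<Sum>i<n. measure N (A i)) \<le> measure N (space M)" if "finite_measure N" "sets N = sets M" for N
    using that A by (intro sum_measure_le) (auto simp: disjoint_family_on_def)
  have "(\<Sum>i<n. \<bar>\<nu> (A i)\<bar>) \<le> (\<Sum>i<n. measure (pos_part M \<nu>) (A i) + measure (neg_part M \<nu>) (A i))"
  proof (rule sum_mono)
    fix i show "\<bar>\<nu> (A i)\<bar> \<le> measure (pos_part M \<nu>) (A i) + measure (neg_part M \<nu>) (A i)"
      using jordan_decomposition[OF \<nu>, of "A i"] A measure_nonneg[of "pos_part M \<nu>" "A i"] measure_nonneg[of "neg_part M \<nu>" "A i"]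
        range_subsetD[OF A(1), of i] by linarith
  qed
  also have "... \<le> mass M \<nu>" unfolding mass_def sum.distrib
    by (intro add_mono * finite_measure_pos_part finite_measure_neg_part \<nu>) auto
  finally show ?thesis .
qed

section \<open>Integrable families of signed measures and their space-time integral\<close>

lemma integrable_familyD:
  fixes \<nu> :: "real \<Rightarrow> 'a::topological_space set \<Rightarrow> real"
  assumes "integrable_family T \<nu>"
  shows "t \<in> {0<..<T} \<Longrightarrow> vector_measure borel (\<nu> t)"
    and "A \<in> sets borel \<Longrightarrow> (\<lambda>t. \<nu> t A) \<in> borel_measurable (time T)"
    and "(\<integral>\<^sup>+t. ennreal (mass borel (\<nu> t)) \<partial>time T) < \<infinity>"
proof -
  show v: "t \<in> {0<..<T} \<Longrightarrow> vector_measure borel (\<nu> t)" for t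
    using assms unfolding integrable_family_def by blast
  show "A \<in> sets borel \<Longrightarrow> (\<lambda>t. \<nu> t A) \<in> borel_measurable (time T)"
    using assms unfolding integrable_family_def measurable_time_measure by blast
  have "(\<integral>\<^sup>+t. ennreal (mass borel (\<nu> t)) \<partial>time T) \<le> (\<integral>\<^sup>+t. tv_norm borel (\<nu> t) \<partial>time T)"
    by (intro nn_integral_mono mass_le_tv v) simp
  also have "... < \<infinity>" using assms unfolding integrable_family_def set_nn_integral_time by blast
  finally show "(\<integral>\<^sup>+t. ennreal (mass borel (\<nu> t)) \<partial>time T) < \<infinity>" .
qed

text \<open>\<open>signed_curve_measure\<close> over an arbitrary fibre.\<close>

definition space_time_val :: "real \<Rightarrow> (real \<Rightarrow> 'a set \<Rightarrow> real) \<Rightarrow> (real \<times> 'a) set \<Rightarrow> real"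
  where "space_time_val T \<nu> A = (LBINT t:{0<..<T}. \<nu> t (Pair t -` A))"

context
  fixes T :: real and \<nu> :: "real \<Rightarrow> 'a::second_countable_topology set \<Rightarrow> real"
  assumes fam: "integrable_family T \<nu>"
begin

abbreviation slice_integral :: "(real \<times> 'a \<Rightarrow> real) \<Rightarrow> real \<Rightarrow> real"
  where "slice_integral f t \<equiv> signed_integral borel (\<nu> t) (\<lambda>x. f (t, x))"

abbreviation total_mass :: real
  where "total_mass \<equiv> enn2real (\<integral>\<^sup>+t. ennreal (mass borel (\<nu> t)) \<partial>time T)"

lemma family_section_measurable:
  assumes "A \<in> sets borel"
  shows "(\<lambda>t. \<nu> t (Pair t -` A)) \<in> borel_measurable (time T)"
  using assms
proof (induction rule: strip_induct)
  case (rect a b)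
  have "indicat_real a \<in> borel_measurable (time T)"
    unfolding measurable_time_measure using rect by (intro measurable_restrict_space1 borel_measurable_indicator)
  then have "(\<lambda>t. indicator a t * \<nu> t b) \<in> borel_measurable (time T)"
    using rect integrable_familyD(2)[OF fam] by (intro borel_measurable_times) auto
  then show ?case
  proof (rule measurable_cong[THEN iffD1, rotated])
    fix t assume "t \<in> space (time T)"
    then show "indicator a t * \<nu> t b = \<nu> t (Pair t -` (a \<times> b))"
      using integrable_familyD(1)[OF fam, of t] by (auto simp: indicator_def vector_measure_empty)
  qed
next
  case (compl A)
  have "(\<lambda>t. \<nu> t UNIV - \<nu> t (Pair t -` A)) \<in> borel_measurable (time T)"
    using compl integrable_familyD(2)[OF fam] by (intro borel_measurable_diff) auto
  then show ?case
  proof (rule measurable_cong[THEN iffD1, rotated])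
    fix t assume "t \<in> space (time T)"
    then show "\<nu> t UNIV - \<nu> t (Pair t -` A) = \<nu> t (Pair t -` (UNIV - A))"
      using integrable_familyD(1)[OF fam, of t] compl sets_section[of A t]
      by (simp add: vector_measure_Diff vimage_Diff)
  qed
next
  case (union A)
  show ?case
  proof (rule borel_measurable_LIMSEQ_real)
    show "(\<lambda>t. \<Sum>i<n. \<nu> t (Pair t -` A i)) \<in> borel_measurable (time T)" for n :: nat
      using union by (intro borel_measurable_sum) auto
    fix t assume t: "t \<in> space (time T)"
    have "A i \<in> sets borel" for i using union by blast
    then have "(\<lambda>i. \<nu> t (Pair t -` A i)) sums \<nu> t (\<Union>i. Pair t -` A i)"
      using union(1) t by (intro vector_measure_sums[OF integrable_familyD(1)[OF fam]])
        (auto simp: disjoint_family_on_def intro!: sets_section)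
    then show "(\<lambda>n. \<Sum>i<n. \<nu> t (Pair t -` A i)) \<longlonglongrightarrow> \<nu> t (Pair t -` (\<Union>i. A i))"
      unfolding sums_def vimage_UN .
  qed
qed

text \<open>The mass of \<nu> t is a supremum over uncountably many sets, and its measurability in t
  is not established. The factor e is therefore divided over to the measurable side f, where it can
  be pulled out of the integral; this is why e = 0 is a separate case.\<close>

lemma family_le_mass_integral:
  assumes f: "f \<in> borel_measurable (time T)"
    and le: "\<And>t. t \<in> {0<..<T} \<Longrightarrow> \<bar>f t\<bar> \<le> e * mass borel (\<nu> t)" and e: "e \<ge> 0"
  shows "integrable (time T) f"
    and "(LINT t|time T. \<bar>f t\<bar>) \<le> e * total_mass"
proof -
  let ?K = "\<integral>\<^sup>+t. ennreal (mass borel (\<nu> t)) \<partial>time T"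
  have K: "?K < top" using integrable_familyD(3)[OF fam] by simp
  have ge: "(\<integral>\<^sup>+t. ennreal \<bar>f t\<bar> \<partial>time T) \<le> ennreal e * ?K"
  proof (cases "e = 0")
    case True
    then have "(\<integral>\<^sup>+t. ennreal \<bar>f t\<bar> \<partial>time T) = (\<integral>\<^sup>+t. 0 \<partial>time T)"
      using le by (intro nn_integral_cong) auto
    then show ?thesis by simp
  next
    case False
    then have e0: "e > 0" using e by simp
    have "(\<integral>\<^sup>+t. ennreal (1 / e) * ennreal \<bar>f t\<bar> \<partial>time T) \<le> ?K"
    proof (rule nn_integral_mono)
      fix t assume "t \<in> space (time T)"
      then have "\<bar>f t\<bar> \<le> e * mass borel (\<nu> t)" using le by simp
      then have "1 / e * \<bar>f t\<bar> \<le> mass borel (\<nu> t)" using e0 by (simp add: field_simps)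
      then show "ennreal (1 / e) * ennreal \<bar>f t\<bar> \<le> ennreal (mass borel (\<nu> t))"
        using e0 by (subst ennreal_mult[symmetric]) (auto intro: ennreal_leI)
    qed
    then have "ennreal (1 / e) * (\<integral>\<^sup>+t. ennreal \<bar>f t\<bar> \<partial>time T) \<le> ?K"
      using f by (subst (asm) nn_integral_cmult) auto
    then have "ennreal e * (ennreal (1 / e) * (\<integral>\<^sup>+t. ennreal \<bar>f t\<bar> \<partial>time T)) \<le> ennreal e * ?K"
      by (rule mult_left_mono) simp
    moreover have "ennreal e * ennreal (1 / e) = 1" using e0 by (subst ennreal_mult[symmetric]) auto
    ultimately show ?thesis by (simp add: mult.assoc[symmetric])
  qed
  also have "... < top" using K by (simp add: ennreal_mult_less_top)
  finally have "(\<integral>\<^sup>+t. ennreal (norm (f t)) \<partial>time T) < \<infinity>" by simp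
  then show "integrable (time T) f" using f by (simp add: integrable_iff_bounded)
  have "(LINT t|time T. \<bar>f t\<bar>) = enn2real (\<integral>\<^sup>+t. ennreal \<bar>f t\<bar> \<partial>time T)"
    using f by (intro integral_eq_nn_integral) auto
  also have "... \<le> enn2real (ennreal e * ?K)"
    using ge K by (intro enn2real_mono) (auto simp: ennreal_mult_less_top)
  also have "... = e * enn2real ?K" using e by (simp add: enn2real_mult)
  finally show "(LINT t|time T. \<bar>f t\<bar>) \<le> e * enn2real ?K" .
qed

lemma family_integral_measurable:
  assumes "bounded_measurable (strip T) f"
  shows "(\<lambda>t. slice_integral f t) \<in> borel_measurable (time T)"
  using assms
proof (induction rule: bounded_measurable_induct)
  case (indicator A)
  then have "A \<in> sets borel" by (simp add: sets_strip)
  from family_section_measurable[OF this] show ?case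
  proof (rule measurable_cong[THEN iffD1, rotated])
    fix t assume "t \<in> space (time T)"
    then have "signed_integral borel (\<nu> t) (indicator (Pair t -` A)) = \<nu> t (Pair t -` A)"
      using \<open>A \<in> sets borel\<close> by (intro signed_integral_indicator integrable_familyD(1)[OF fam] sets_section) auto
    moreover have "indicator (Pair t -` A) = (\<lambda>x. indicat_real A (t, x))" by (auto simp: indicator_def)
    ultimately show "\<nu> t (Pair t -` A) = signed_integral borel (\<nu> t) (\<lambda>x. indicat_real A (t, x))" by simp
  qed
next
  case (add f g)
  have "(\<lambda>t. slice_integral f t + slice_integral g t) \<in> borel_measurable (time T)"
    by (intro borel_measurable_add add)
  then show ?case
    by (rule measurable_cong[THEN iffD1, rotated])
      (simp add: bounded_functional_add[OF bounded_functional_signed_integral[OF integrable_familyD(1)[OF fam]]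
           bounded_measurable_section[OF add(1)] bounded_measurable_section[OF add(2)]])
next
  case (scale c f)
  have "(\<lambda>t. c * slice_integral f t) \<in> borel_measurable (time T)"
    by (intro borel_measurable_times scale) auto
  then show ?case
    by (rule measurable_cong[THEN iffD1, rotated])
      (simp add: bounded_functional_scale[OF bounded_functional_signed_integral[OF integrable_familyD(1)[OF fam]]
          bounded_measurable_section[OF scale(1)]])
next
  case (approx f)
  have "\<forall>n. \<exists>g. bounded_measurable (strip T) g \<and> (\<lambda>t. slice_integral g t) \<in> borel_measurable (time T)
      \<and> (\<forall>x\<in>space (strip T). \<bar>f x - g x\<bar> \<le> 1 / Suc n)"
    using approx(2) by simp
  then obtain g where g: "\<And>n. bounded_measurable (strip T) (g n)"
    "\<And>n. (\<lambda>t. slice_integral (g n) t) \<in> borel_measurable (time T)"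
    "\<And>n x. x \<in> space (strip T) \<Longrightarrow> \<bar>f x - g n x\<bar> \<le> 1 / Suc n"
    by metis
  show ?case
  proof (rule borel_measurable_LIMSEQ_real[OF _ g(2)])
    fix t assume "t \<in> space (time T)"
    then have t: "t \<in> {0<..<T}" by simp
    note v = integrable_familyD(1)[OF fam t]
    note bf = bounded_functional_signed_integral[OF v]
    have le: "\<bar>slice_integral (g n) t - slice_integral f t\<bar> \<le> 1 / Suc n * mass borel (\<nu> t)" for n
      unfolding bounded_functional_diff[OF bf bounded_measurable_section[OF g(1) t] bounded_measurable_section[OF approx(1) t], symmetric]
      using g(3)[of "(t, _)" n] t
      by (intro signed_integral_le_mass[OF v] bounded_measurable_diff bounded_measurable_section[OF g(1) t] bounded_measurable_section[OF approx(1) t])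
        (auto simp: abs_minus_commute)
    have "(\<lambda>n. slice_integral (g n) t - slice_integral f t) \<longlonglongrightarrow> 0"
    proof (rule Lim_null_comparison[where g = "\<lambda>n. 1 / real (Suc n) * mass borel (\<nu> t)"])
      show "(\<lambda>n. 1 / real (Suc n) * mass borel (\<nu> t)) \<longlonglongrightarrow> 0"
        by (rule tendsto_mult_left_zero[OF LIMSEQ_Suc[OF lim_1_over_n]])
    qed (use le in simp)
    then show "(\<lambda>n. slice_integral (g n) t) \<longlonglongrightarrow> slice_integral f t"
      by (rule LIM_zero_cancel)
  qed
qed

lemma family_integral_integrable:
  assumes f: "bounded_measurable (strip T) f"
  shows "integrable (time T) (\<lambda>t. slice_integral f t)"
proof -
  obtain B where B: "B \<ge> 0" "\<And>x. x \<in> space (strip T) \<Longrightarrow> \<bar>f x\<bar> \<le> B" using bounded_measurable_bound[OF f] by blast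
  show ?thesis
    by (rule family_le_mass_integral(1)[OF family_integral_measurable[OF f], of B])
      (use B in \<open>auto intro!: signed_integral_le_mass integrable_familyD(1)[OF fam] bounded_measurable_section[OF f]\<close>)
qed

lemma vector_measure_space_time: "vector_measure (strip T) (space_time_val T \<nu>)"
  unfolding vector_measure_def space_time_val_def set_integral_time
proof (intro conjI allI impI)
  have "(LINT t|time T. \<nu> t (Pair t -` {})) = (LINT t|time T. 0)"
    by (intro Bochner_Integration.integral_cong) (auto simp: vector_measure_empty[OF integrable_familyD(1)[OF fam]])
  then show "(LINT t|time T. \<nu> t (Pair t -` {})) = 0" by simp
next
  fix A :: "nat \<Rightarrow> (real \<times> 'a) set" assume A: "range A \<subseteq> sets (strip T)" "disjoint_family A"
  have A': "A i \<in> sets borel" for i using A(1) sets_strip by blast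
  have sec: "range (\<lambda>i. Pair t -` A i) \<subseteq> sets borel" "disjoint_family (\<lambda>i. Pair t -` A i)" for t
    using A' A(2) by (auto simp: disjoint_family_on_def intro!: sets_section)
  note v = integrable_familyD(1)[OF fam]
  have le: "(\<Sum>i<n. \<bar>\<nu> t (Pair t -` A i)\<bar>) \<le> mass borel (\<nu> t)" if "t \<in> {0<..<T}" for t n
    by (rule sum_abs_le_mass[OF v[OF that] sec])
  have m: "(\<lambda>t. \<nu> t (Pair t -` A i)) \<in> borel_measurable (time T)" for i
    by (rule family_section_measurable[OF A'])
  have i: "integrable (time T) (\<lambda>t. \<nu> t (Pair t -` A i))" for i
  proof (rule family_le_mass_integral(1)[OF m, of _ 1])
    fix t assume t: "t \<in> {0<..<T}"
    have "\<bar>\<nu> t (Pair t -` A i)\<bar> \<le> (\<Sum>i<Suc i. \<bar>\<nu> t (Pair t -` A i)\<bar>)" by (simp add: sum_nonneg)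
    also have "... \<le> mass borel (\<nu> t)" by (rule le[OF t])
    finally show "\<bar>\<nu> t (Pair t -` A i)\<bar> \<le> 1 * mass borel (\<nu> t)" by simp
  qed simp
  have "(\<lambda>i. LINT t|time T. \<nu> t (Pair t -` A i)) sums (LINT t|time T. (\<Sum>i. \<nu> t (Pair t -` A i)))"
  proof (rule sums_integral[OF i])
    show "AE t in time T. summable (\<lambda>i. norm (\<nu> t (Pair t -` A i)))"
      by (rule AE_I2) (use le in \<open>auto intro!: summableI_nonneg_bounded\<close>)
    show "summable (\<lambda>i. LINT t|time T. norm (\<nu> t (Pair t -` A i)))"
    proof (rule summableI_nonneg_bounded)
      fix n
      have "(\<Sum>i<n. \<integral>t. norm (\<nu> t (Pair t -` A i)) \<partial>time T) = (LINT t|time T. \<bar>\<Sum>i<n. \<bar>\<nu> t (Pair t -` A i)\<bar>\<bar>)"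
        using i by (subst Bochner_Integration.integral_sum[symmetric]) (auto intro!: integrable_abs simp: abs_of_nonneg sum_nonneg)
      also have "... \<le> 1 * total_mass"
        by (rule family_le_mass_integral(2)) (use m le in \<open>auto intro!: borel_measurable_sum borel_measurable_abs simp: sum_nonneg\<close>)
      finally show "(\<Sum>i<n. \<integral>t. norm (\<nu> t (Pair t -` A i)) \<partial>time T) \<le> total_mass"
        by simp
    qed simp
  qed
  moreover have "(LINT t|time T. (\<Sum>i. \<nu> t (Pair t -` A i))) = (LINT t|time T. \<nu> t (Pair t -` (\<Union>i. A i)))"
    by (intro Bochner_Integration.integral_cong)
      (use vector_measure_sums[OF v sec] in \<open>auto simp: sums_iff vimage_UN\<close>)
  ultimately show "(\<lambda>i. LINT t|time T. \<nu> t (Pair t -` A i)) sums (LINT t|time T. \<nu> t (Pair t -` (\<Union>i. A i)))"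
    by simp
qed

text \<open>Fubini for a signed kernel. Splitting each slice into its Jordan parts would not give
  the Jordan parts on the strip; instead both sides are treated as bounded functionals and compared
  on indicators.\<close>

lemma signed_integral_space_time:
  assumes f: "bounded_measurable (strip T) f"
  shows "signed_integral (strip T) (space_time_val T \<nu>) f = (LBINT t:{0<..<T}. slice_integral f t)"
  unfolding set_integral_time
proof (rule signed_integral_eqI[OF vector_measure_space_time _ _ f])
  show "bounded_functional (strip T) (\<lambda>f. LINT t|time T. slice_integral f t)"
  proof (rule bounded_functionalI[where K = "total_mass"])
    fix f g :: "real \<times> 'a \<Rightarrow> real" assume fg: "bounded_measurable (strip T) f" "bounded_measurable (strip T) g"
    have "(LINT t|time T. signed_integral borel (\<nu> t) (\<lambda>x. f (t, x) + g (t, x)))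
      = (LINT t|time T. slice_integral f t + slice_integral g t)"
      by (intro Bochner_Integration.integral_cong)
        (auto intro!: bounded_functional_add[OF bounded_functional_signed_integral[OF integrable_familyD(1)[OF fam]]] bounded_measurable_section fg)
    then show "(LINT t|time T. signed_integral borel (\<nu> t) (\<lambda>x. f (t, x) + g (t, x))) =
       (LINT t|time T. slice_integral f t) + (LINT t|time T. slice_integral g t)"
      by (simp add: family_integral_integrable fg)
  next
    fix c and f :: "real \<times> 'a \<Rightarrow> real" assume f: "bounded_measurable (strip T) f"
    have "(LINT t|time T. signed_integral borel (\<nu> t) (\<lambda>x. c * f (t, x)))
      = (LINT t|time T. c * slice_integral f t)"
      by (intro Bochner_Integration.integral_cong)
        (auto intro!: bounded_functional_scale[OF bounded_functional_signed_integral[OF integrable_familyD(1)[OF fam]]] bounded_measurable_section f)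
    then show "(LINT t|time T. signed_integral borel (\<nu> t) (\<lambda>x. c * f (t, x)))
      = c * (LINT t|time T. slice_integral f t)" by simp
  next
    fix f :: "real \<times> 'a \<Rightarrow> real" and e :: real
    assume f: "bounded_measurable (strip T) f" "\<And>x. x \<in> space (strip T) \<Longrightarrow> \<bar>f x\<bar> \<le> e"
    show "\<bar>LINT t|time T. slice_integral f t\<bar>
      \<le> total_mass * e"
    proof (cases "T > 0")
      case True
      then have e: "e \<ge> 0" using f(2)[of "(T / 2, undefined)"] by auto
      have "\<bar>LINT t|time T. slice_integral f t\<bar> \<le> (LINT t|time T. \<bar>slice_integral f t\<bar>)"
        by simp
      also have "... \<le> e * total_mass"
        by (rule family_le_mass_integral(2)[OF family_integral_measurable[OF f(1)] _ e])
          (use f in \<open>auto intro!: signed_integral_le_mass integrable_familyD(1)[OF fam] bounded_measurable_section\<close>)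
      finally show ?thesis by (simp add: mult.commute)
    next
      \<comment> \<open>The strip is empty here, so the sup bound e may be negative; both sides have
        to be seen to vanish.\<close>
      case False
      then have "time T = restrict_space lborel {}" by simp
      then have "space (time T) = {}" by (simp add: space_restrict_space)
      then show ?thesis by (simp add: Bochner_Integration.integral_empty nn_integral_empty)
    qed
  qed
next
  fix A :: "(real \<times> 'a) set" assume A: "A \<in> sets (strip T)"
  show "(LINT t|time T. signed_integral borel (\<nu> t) (\<lambda>x. indicat_real A (t, x))) = space_time_val T \<nu> A"
    unfolding space_time_val_def set_integral_time
  proof (intro Bochner_Integration.integral_cong refl)
    fix t assume "t \<in> space (time T)"
    then have "signed_integral borel (\<nu> t) (indicator (Pair t -` A)) = \<nu> t (Pair t -` A)"
      using A by (intro signed_integral_indicator integrable_familyD(1)[OF fam] sets_section) (auto simp: sets_strip)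
    moreover have "indicator (Pair t -` A) = (\<lambda>x. indicat_real A (t, x))" by (auto simp: indicator_def)
    ultimately show "signed_integral borel (\<nu> t) (\<lambda>x. indicat_real A (t, x)) = \<nu> t (Pair t -` A)" by simp
  qed
qed

end

lemma signed_curve_measure_eq: "signed_curve_measure T \<nu> = space_time_val T \<nu>"
  by (simp add: fun_eq_iff signed_curve_measure_def space_time_val_def)

lemma signed_curve_measure_vector_measure:
  "integrable_family T \<nu> \<Longrightarrow> vector_measure (cyl T) (signed_curve_measure T \<nu>)"
  by (simp add: signed_curve_measure_eq cyl_eq_strip vector_measure_space_time)

lemma signed_integral_curve_measure:
  "integrable_family T \<nu> \<Longrightarrow> bounded_measurable (cyl T) f \<Longrightarrow>
    signed_integral (cyl T) (signed_curve_measure T \<nu>) f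
      = (LBINT t:{0<..<T}. signed_integral borel (\<nu> t) (\<lambda>x. f (t, x)))"
  by (simp add: signed_curve_measure_eq cyl_eq_strip signed_integral_space_time)

section \<open>Positive kernels and the space-time measure of a curve\<close>

lemma narrow_curveD:
  assumes "narrow_curve T \<mu>" "t \<in> {0..T}"
  shows "prob_space (\<mu> t)" "sets (\<mu> t) = sets borel" "space (\<mu> t) = UNIV"
  using assms sets_eq_imp_space_eq[of "\<mu> t" borel] unfolding narrow_curve_def by auto

text \<open>Narrow continuity makes the integrals of continuous functions continuous in t.
  Indicators of the generator are pointwise limits of such functions, and intersection stability
  extends measurability to all Borel sets.\<close>

lemma narrow_curve_kernel:
  fixes \<mu> :: "real \<Rightarrow> 'a::topological_space measure"
  assumes \<mu>: "narrow_curve T \<mu>"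
    and G: "sets (borel :: 'a measure) = sigma_sets UNIV G" "Int_stable G"
    and f: "\<And>U. U \<in> G \<Longrightarrow> \<exists>f::nat \<Rightarrow> 'a \<Rightarrow> real. (\<forall>n. continuous_on UNIV (f n) \<and> (\<forall>x. 0 \<le> f n x \<and> f n x \<le> 1))
      \<and> (\<forall>x. (\<lambda>n. f n x) \<longlonglongrightarrow> indicator U x)"
  shows "\<mu> \<in> measurable (time T) (subprob_algebra borel)"
proof (rule measurable_subprob_algebra_generated[OF G])
  fix t assume "t \<in> space (time T)"
  then have t: "t \<in> {0..T}" by auto
  show "subprob_space (\<mu> t)" by (rule prob_space_imp_subprob_space[OF narrow_curveD(1)[OF \<mu> t]])
  show "sets (\<mu> t) = sets borel" by (rule narrow_curveD(2)[OF \<mu> t])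
next
  have "(\<lambda>t. 1::ennreal) \<in> borel_measurable (time T)" by simp
  then show "(\<lambda>t. emeasure (\<mu> t) UNIV) \<in> borel_measurable (time T)"
  proof (rule measurable_cong[THEN iffD1, rotated])
    fix t assume "t \<in> space (time T)"
    then have t: "t \<in> {0..T}" by auto
    show "1 = emeasure (\<mu> t) UNIV"
      using prob_space.emeasure_space_1[OF narrow_curveD(1)[OF \<mu> t]] narrow_curveD(3)[OF \<mu> t] by simp
  qed
next
  fix U assume U: "U \<in> G"
  obtain f :: "nat \<Rightarrow> 'a \<Rightarrow> real" where f: "\<And>n. continuous_on UNIV (f n)" "\<And>n x. 0 \<le> f n x \<and> f n x \<le> 1"
    "\<And>x. (\<lambda>n. f n x) \<longlonglongrightarrow> indicator U x" using assms(4)[OF U] by blast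
  have U': "U \<in> sets borel" using U G by auto
  have "(\<lambda>t. measure (\<mu> t) U) \<in> borel_measurable (time T)"
  proof (rule borel_measurable_LIMSEQ_real)
    fix n :: nat
    have "bounded (range (f n))" using f(2) by (intro boundedI[where B = 1]) (auto simp: abs_le_iff intro: order_trans[of _ 0])
    then have "continuous_on {0..T} (\<lambda>t. LINT x|\<mu> t. f n x)"
      using \<mu> f(1) unfolding narrow_curve_def by blast
    then have "continuous_on {0<..<T} (\<lambda>t. LINT x|\<mu> t. f n x)" by (rule continuous_on_subset) auto
    then show "(\<lambda>t. LINT x|\<mu> t. f n x) \<in> borel_measurable (time T)"
      unfolding measurable_time_measure by (rule borel_measurable_continuous_on_restrict)
  next
    fix t assume "t \<in> space (time T)"
    then have t: "t \<in> {0..T}" by auto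
    interpret prob_space "\<mu> t" by (rule narrow_curveD(1)[OF \<mu> t])
    note s = narrow_curveD(2)[OF \<mu> t]
    have "(\<lambda>n. LINT x|\<mu> t. f n x) \<longlonglongrightarrow> (LINT x|\<mu> t. indicator U x)"
    proof (rule integral_dominated_convergence[where w = "\<lambda>_. 1"])
      show "f n \<in> borel_measurable (\<mu> t)" for n
        using borel_measurable_continuous_onI[OF f(1)] measurable_cong_sets[OF s refl] by blast
      show "indicat_real U \<in> borel_measurable (\<mu> t)" using U' s by auto
    qed (use f in \<open>auto intro!: AE_I2\<close>)
    then show "(\<lambda>n. LINT x|\<mu> t. f n x) \<longlonglongrightarrow> measure (\<mu> t) U" using U' s narrow_curveD(3)[OF \<mu> t] by simp
  qed
  then have "(\<lambda>t. ennreal (measure (\<mu> t) U)) \<in> borel_measurable (time T)" by simp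
  then show "(\<lambda>t. emeasure (\<mu> t) U) \<in> borel_measurable (time T)"
  proof (rule measurable_cong[THEN iffD1, rotated])
    fix t assume "t \<in> space (time T)"
    then interpret prob_space "\<mu> t" by (intro narrow_curveD(1)[OF \<mu>]) auto
    show "ennreal (measure (\<mu> t) U) = emeasure (\<mu> t) U" by (simp add: emeasure_eq_measure)
  qed
qed simp

lemma narrow_curve_kernel_circle:
  fixes \<rho> :: "real \<Rightarrow> circle measure"
  assumes "narrow_curve T \<rho>"
  shows "\<rho> \<in> measurable (time T) (subprob_algebra borel)"
proof (rule narrow_curve_kernel[OF assms borel_circle_eq])
  show "Int_stable (Collect smooth_approx)" by (auto simp: Int_stable_def smooth_approx_Int)
  fix U assume "U \<in> Collect smooth_approx"
  then obtain g where g: "\<And>n. g n \<in> smooth_real" "\<And>n x. g n (x + 1) = g n x" "\<And>n x. 0 \<le> g n x \<and> g n x \<le> 1"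
    "\<And>x. (\<lambda>n::nat. g n x) \<longlonglongrightarrow> indicator U (abs_circle x)" unfolding smooth_approx_def by blast
  show "\<exists>f::nat \<Rightarrow> circle \<Rightarrow> real. (\<forall>n. continuous_on UNIV (f n) \<and> (\<forall>x. 0 \<le> f n x \<and> f n x \<le> 1))
      \<and> (\<forall>x. (\<lambda>n. f n x) \<longlonglongrightarrow> indicator U x)"
    by (rule exI[of _ "\<lambda>n p. g n (rep_circle p)"])
      (use g g(4)[of "rep_circle _"] in \<open>auto intro!: continuous_periodic_circle smooth_real_continuous\<close>)
qed

lemma narrow_curve_kernel_omega1:
  fixes \<sigma> :: "real \<Rightarrow> omega1 measure"
  assumes "narrow_curve T \<sigma>"
  shows "\<sigma> \<in> measurable (time T) (subprob_algebra borel)"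
proof (rule narrow_curve_kernel[OF assms])
  let ?G = "{U \<times> S | U S. U \<in> Collect smooth_approx \<and> S \<in> (UNIV :: bool set set)}"
  have "sets (borel \<Otimes>\<^sub>M borel :: omega1 measure) = sets (sigma (space (borel :: circle measure) \<times> space (borel :: bool measure)) ?G)"
  proof (rule sets_pair_eq[where Ca = "{UNIV}" and Cb = "{UNIV}"])
    show "sets (borel :: circle measure) = sigma_sets (space borel) (Collect smooth_approx)"
      using borel_circle_eq by simp
    have "sets (borel :: bool measure) = UNIV" by (simp add: sets_borel_eq_count_space)
    moreover have "sigma_sets UNIV (UNIV :: bool set set) = UNIV" by (auto intro: sigma_sets.Basic)
    ultimately show "sets (borel :: bool measure) = sigma_sets (space borel) UNIV" by simp
  qed (auto simp: smooth_approx_UNIV)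
  then show "sets (borel :: omega1 measure) = sigma_sets UNIV ?G"
    unfolding borel_prod by simp
  show "Int_stable ?G"
    unfolding Int_stable_def
  proof (intro ballI)
    fix A B assume "A \<in> ?G" "B \<in> ?G"
    then obtain U S V R where "A = U \<times> S" "B = V \<times> R" "smooth_approx U" "smooth_approx V" by auto
    then show "A \<inter> B \<in> ?G"
      by (auto simp: Times_Int_Times intro!: exI[of _ "U \<inter> V"] exI[of _ "S \<inter> R"] smooth_approx_Int)
  qed
  fix A assume "A \<in> ?G"
  then obtain U S where A: "A = U \<times> S" "smooth_approx U" by blast
  then obtain g where g: "\<And>n. g n \<in> smooth_real" "\<And>n x. g n (x + 1) = g n x" "\<And>n x. 0 \<le> g n x \<and> g n x \<le> 1"
    "\<And>x. (\<lambda>n::nat. g n x) \<longlonglongrightarrow> indicator U (abs_circle x)" unfolding smooth_approx_def by blast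
  have ind: "continuous_on UNIV (\<lambda>z :: omega1. indicat_real S (snd z))"
    by (rule continuous_on_compose2[of UNIV "indicat_real S" _ snd]) (auto intro: continuous_intros)
  have c: "continuous_on UNIV (\<lambda>z :: omega1. g n (rep_circle (fst z)))" for n
    by (rule continuous_on_compose2[OF continuous_periodic_circle[OF smooth_real_continuous[OF g(1)] g(2)]])
      (auto intro: continuous_intros)
  show "\<exists>f::nat \<Rightarrow> omega1 \<Rightarrow> real. (\<forall>n. continuous_on UNIV (f n) \<and> (\<forall>x. 0 \<le> f n x \<and> f n x \<le> 1))
      \<and> (\<forall>x. (\<lambda>n. f n x) \<longlonglongrightarrow> indicator A x)"
  proof (rule exI[of _ "\<lambda>n z. g n (rep_circle (fst z)) * indicator S (snd z)"], intro conjI allI)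
    fix n show "continuous_on UNIV (\<lambda>z. g n (rep_circle (fst z)) * indicat_real S (snd z))"
      by (intro continuous_on_mult c ind)
  next
    fix z show "(\<lambda>n. g n (rep_circle (fst z)) * indicat_real S (snd z)) \<longlonglongrightarrow> indicat_real A z"
      using tendsto_mult_right[OF g(4)[of "rep_circle (fst z)"], of "indicat_real S (snd z)"]
      by (cases "fst z \<in> U"; cases "snd z \<in> S") (simp_all add: A indicator_def mem_Times_iff)
  qed (use g in \<open>auto simp: indicator_def\<close>)
qed

lemma narrow_curve_density_slice:
  assumes \<sigma>: "narrow_curve T \<sigma>"
  shows "narrow_curve T (density_slice \<sigma>)"
  unfolding narrow_curve_def
proof (intro conjI ballI allI impI)
  fix t assume t: "t \<in> {0..T}"
  have m: "fst \<in> measurable (\<sigma> t) (borel :: circle measure)"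
    using measurable_fst[of "borel :: circle measure" "borel :: bool measure"]
    unfolding borel_prod measurable_cong_sets[OF narrow_curveD(2)[OF \<sigma> t] refl] .
  show "prob_space (density_slice \<sigma> t)"
    unfolding density_slice_def by (rule prob_space.prob_space_distr[OF narrow_curveD(1)[OF \<sigma> t] m])
  show "sets (density_slice \<sigma> t) = sets borel" by (simp add: density_slice_def)
next
  fix f :: "circle \<Rightarrow> real" assume f: "continuous_on UNIV f" "bounded (range f)"
  have "continuous_on {0..T} (\<lambda>t. LINT z|\<sigma> t. f (fst z))"
    using \<sigma> unfolding narrow_curve_def
  proof (elim conjE allE impE)
    show "continuous_on UNIV (\<lambda>z :: omega1. f (fst z))"
      by (rule continuous_on_compose2[OF f(1)]) (auto intro: continuous_intros)
    show "bounded (range (\<lambda>z :: omega1. f (fst z)))" by (rule bounded_subset[OF f(2)]) auto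
  qed
  moreover have eq: "(LINT x|density_slice \<sigma> t. f x) = (LINT z|\<sigma> t. f (fst z))" if t: "t \<in> {0..T}" for t
  proof -
    have m: "fst \<in> measurable (\<sigma> t) (borel :: circle measure)"
      using measurable_fst[of "borel :: circle measure" "borel :: bool measure"]
      unfolding borel_prod measurable_cong_sets[OF narrow_curveD(2)[OF \<sigma> t] refl] .
    show ?thesis unfolding density_slice_def
      by (rule integral_distr[OF m borel_measurable_continuous_onI[OF f(1)]])
  qed
  ultimately show "continuous_on {0..T} (\<lambda>t. LINT x|density_slice \<sigma> t. f x)"
    by (subst continuous_on_cong[OF refl eq])
qed

section \<open>The space-time measure of a curve and its Fubini theorem\<close>

context
  fixes T :: real and \<rho> :: "real \<Rightarrow> circle measure"
  assumes T: "T > 0" and \<rho>: "narrow_curve T \<rho>"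
begin

lemma curve_kernel: "(\<lambda>t. distr (\<rho> t) (cyl T) (Pair t)) \<in> measurable (time T) (subprob_algebra (cyl T))"
proof (rule measurable_distr2[OF _ narrow_curve_kernel_circle[OF \<rho>]])
  have "id \<in> measurable (time T \<Otimes>\<^sub>M borel) (borel \<Otimes>\<^sub>M (borel :: circle measure))"
    by (rule measurable_pair)
      (auto simp: comp_def measurable_time_measure intro!: measurable_compose[OF measurable_fst] measurable_restrict_space1)
  then have "id \<in> measurable (time T \<Otimes>\<^sub>M borel) (cyl T)"
    unfolding cyl_def borel_prod by (intro measurable_restrict_space2) (auto simp: space_pair_measure)
  moreover have "(\<lambda>(x, y). (x, y)) = (id :: real \<times> circle \<Rightarrow> _)" by auto
  ultimately show "(\<lambda>(x, y). (x, y)) \<in> measurable (time T \<Otimes>\<^sub>M borel) (cyl T)" by simp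
qed

lemma slice_measurable: "t \<in> {0<..<T} \<Longrightarrow> Pair t \<in> measurable (\<rho> t) (cyl T)"
  using Pair_measurable_strip[of t T] measurable_cong_sets[OF narrow_curveD(2)[OF \<rho>, of t] refl]
  unfolding cyl_eq_strip by auto

text \<open>\<open>curve_measure\<close> is built by \<open>measure_of\<close> from a set function,
  so its values are available only once that function is known to be a measure. Recognising it as a
  Giry bind settles this and brings the iterated integral formula.\<close>

lemma curve_measure_eq_bind: "curve_measure T \<rho> = time T \<bind> (\<lambda>t. distr (\<rho> t) (cyl T) (Pair t))"
  (is "_ = ?B")
proof -
  have ne: "space (time T) \<noteq> {}" using T by (auto intro!: exI[of _ "T/2"])
  have s: "sets ?B = sets (cyl T)" using sets_bind_measurable[OF curve_kernel ne] .
  have e: "emeasure ?B A = (\<integral>\<^sup>+t\<in>{0<..<T}. emeasure (\<rho> t) (Pair t -` A) \<partial>lborel)" if A: "A \<in> sets (cyl T)" for A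
  proof -
    have "emeasure ?B A = (\<integral>\<^sup>+t. emeasure (distr (\<rho> t) (cyl T) (Pair t)) A \<partial>time T)"
      by (rule emeasure_bind[OF ne curve_kernel A])
    also have "... = (\<integral>\<^sup>+t. emeasure (\<rho> t) (Pair t -` A) \<partial>time T)"
      using A narrow_curveD(3)[OF \<rho>] by (intro nn_integral_cong) (simp add: emeasure_distr[OF slice_measurable])
    finally show ?thesis unfolding set_nn_integral_time .
  qed
  have "curve_measure T \<rho> = measure_of (space ?B) (sets ?B) (emeasure ?B)"
    unfolding curve_measure_def s sets_eq_imp_space_eq[OF s]
  proof (rule measure_of_eq[OF sets.space_closed])
    fix A assume "A \<in> sigma_sets (space (cyl T)) (sets (cyl T))"
    then have "A \<in> sets (cyl T)" by (simp only: sets.sigma_sets_eq)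
    then show "(\<integral>\<^sup>+t\<in>{0<..<T}. emeasure (\<rho> t) (Pair t -` A) \<partial>lborel) = emeasure ?B A" by (rule e[symmetric])
  qed
  then show ?thesis by (simp add: measure_of_of_measure)
qed

lemma sets_curve_measure: "sets (curve_measure T \<rho>) = sets (cyl T)"
  unfolding curve_measure_def by (simp only: sets_measure_of[OF sets.space_closed] sets.sigma_sets_eq)

lemma space_curve_measure: "space (curve_measure T \<rho>) = {0<..<T} \<times> UNIV"
  using sets_eq_imp_space_eq[OF sets_curve_measure] by simp

lemma nn_integral_curve_measure:
  assumes f: "f \<in> borel_measurable (cyl T)"
  shows "(\<integral>\<^sup>+z. f z \<partial>curve_measure T \<rho>) = (\<integral>\<^sup>+t. (\<integral>\<^sup>+x. f (t, x) \<partial>\<rho> t) \<partial>time T)"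
  unfolding curve_measure_eq_bind nn_integral_bind[OF f curve_kernel]
  by (intro nn_integral_cong) (simp add: nn_integral_distr[OF slice_measurable] f)

lemma nn_integral_slice_measurable:
  assumes f: "f \<in> borel_measurable (cyl T)"
  shows "(\<lambda>t. \<integral>\<^sup>+x. f (t, x) \<partial>\<rho> t) \<in> borel_measurable (time T)"
proof -
  have "(\<lambda>t. \<integral>\<^sup>+x. f x \<partial>distr (\<rho> t) (cyl T) (Pair t)) \<in> borel_measurable (time T)"
    by (rule measurable_compose[OF curve_kernel nn_integral_measurable_subprob_algebra[OF f]])
  then show ?thesis
    by (rule measurable_cong[THEN iffD1, rotated]) (simp add: nn_integral_distr[OF slice_measurable] f)
qed

lemma finite_curve_measure: "finite_measure (curve_measure T \<rho>)"
proof (rule finite_measureI)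
  have "emeasure (curve_measure T \<rho>) (space (curve_measure T \<rho>)) = (\<integral>\<^sup>+t. (\<integral>\<^sup>+x. 1 \<partial>\<rho> t) \<partial>time T)"
    using nn_integral_curve_measure[of "\<lambda>_. 1"] by simp
  also have "... = (\<integral>\<^sup>+t. 1 \<partial>time T)"
    by (intro nn_integral_cong) (simp add: prob_space.emeasure_space_1[OF narrow_curveD(1)[OF \<rho>]])
  also have "... = ennreal T" using T by (simp add: emeasure_restrict_space)
  finally show "emeasure (curve_measure T \<rho>) (space (curve_measure T \<rho>)) \<noteq> \<infinity>" by simp
qed

lemma measurable_curve_measure: "measurable (curve_measure T \<rho>) N = measurable (cyl T) N"
  by (rule measurable_cong_sets[OF sets_curve_measure refl])

lemma integral_curve_slice_measurable:
  fixes f :: "real \<times> circle \<Rightarrow> real"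
  assumes f: "f \<in> borel_measurable (cyl T)"
  shows "(\<lambda>t. LINT x|\<rho> t. f (t, x)) \<in> borel_measurable (time T)"
proof -
  have "(\<lambda>t. LINT x|distr (\<rho> t) (cyl T) (Pair t). f x) \<in> borel_measurable (time T)"
    by (rule measurable_compose[OF curve_kernel integral_measurable_subprob_algebra[OF f]])
  then show ?thesis
    by (rule measurable_cong[THEN iffD1, rotated]) (simp add: integral_distr[OF slice_measurable f])
qed

text \<open>Slices need not be integrable for every t. On the exceptional ones the Bochner integral
  and \<open>enn2real\<close> of an infinite integral are both 0, so the slice integral equals
  \<open>enn2real (G t)\<close> at every t of the interval.\<close>

lemma curve_measure_fubini_nonneg:
  fixes f :: "real \<times> circle \<Rightarrow> real"
  assumes f: "integrable (curve_measure T \<rho>) f" and pos: "\<And>z. f z \<ge> 0"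
  shows "AE t in time T. integrable (\<rho> t) (\<lambda>x. f (t, x))"
    and "integrable (time T) (\<lambda>t. LINT x|\<rho> t. f (t, x))"
    and "(LINT t|time T. (LINT x|\<rho> t. f (t, x))) = (LINT z|curve_measure T \<rho>. f z)"
proof -
  have m: "f \<in> borel_measurable (cyl T)"
    using f measurable_curve_measure by blast
  then have m': "(\<lambda>z. ennreal (f z)) \<in> borel_measurable (cyl T)" by simp
  define G where "G t = (\<integral>\<^sup>+x. ennreal (f (t, x)) \<partial>\<rho> t)" for t
  have Gm: "G \<in> borel_measurable (time T)" unfolding G_def by (rule nn_integral_slice_measurable[OF m'])
  have GI: "(\<integral>\<^sup>+t. G t \<partial>time T) = (\<integral>\<^sup>+z. ennreal (f z) \<partial>curve_measure T \<rho>)"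
    unfolding G_def by (rule nn_integral_curve_measure[OF m', symmetric])
  also have "... = ennreal (LINT z|curve_measure T \<rho>. f z)"
    using f pos by (intro nn_integral_eq_integral) auto
  finally have Gfin: "(\<integral>\<^sup>+t. G t \<partial>time T) = ennreal (LINT z|curve_measure T \<rho>. f z)" .
  have AEG: "AE t in time T. G t \<noteq> \<infinity>"
    using Gm Gfin by (intro nn_integral_PInf_AE) auto
  have sm: "(\<lambda>x. f (t, x)) \<in> borel_measurable (\<rho> t)" if "t \<in> {0<..<T}" for t
    using measurable_compose[OF slice_measurable[OF that] m] .
  have int: "(LINT x|\<rho> t. f (t, x)) = enn2real (G t)" if "t \<in> {0<..<T}" for t
    unfolding G_def using sm[OF that] pos by (intro integral_eq_nn_integral) auto
  show "AE t in time T. integrable (\<rho> t) (\<lambda>x. f (t, x))"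
    using AEG AE_space
  proof eventually_elim
    case (elim t)
    then show ?case using sm[of t] pos unfolding G_def
      by (auto intro!: integrableI_nonneg simp: top.not_eq_extremum)
  qed
  have Ge: "AE t in time T. ennreal (enn2real (G t)) = G t"
    using AEG by eventually_elim (simp add: top.not_eq_extremum)
  have nn: "(\<integral>\<^sup>+t. ennreal (enn2real (G t)) \<partial>time T) = ennreal (LINT z|curve_measure T \<rho>. f z)"
    using nn_integral_cong_AE[OF Ge] Gfin by simp
  have i: "integrable (time T) (\<lambda>t. enn2real (G t))"
    using Gm nn by (intro integrableI_nonneg) auto
  then show "integrable (time T) (\<lambda>t. LINT x|\<rho> t. f (t, x))"
    by (rule Bochner_Integration.integrable_cong[THEN iffD1, OF refl, rotated]) (simp add: int)
  have "(LINT t|time T. (LINT x|\<rho> t. f (t, x))) = (LINT t|time T. enn2real (G t))"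
    by (intro Bochner_Integration.integral_cong) (simp_all add: int)
  also have "... = enn2real (\<integral>\<^sup>+t. ennreal (enn2real (G t)) \<partial>time T)"
    using Gm by (intro integral_eq_nn_integral) auto
  also have "... = (LINT z|curve_measure T \<rho>. f z)" unfolding nn using pos by simp
  finally show "(LINT t|time T. (LINT x|\<rho> t. f (t, x))) = (LINT z|curve_measure T \<rho>. f z)" .
qed

lemma curve_measure_fubini:
  fixes f :: "real \<times> circle \<Rightarrow> real"
  assumes f: "integrable (curve_measure T \<rho>) f"
  shows "AE t in time T. integrable (\<rho> t) (\<lambda>x. f (t, x))" (is ?ae)
    and "integrable (time T) (\<lambda>t. LINT x|\<rho> t. f (t, x))" (is ?int)
    and "(LINT t|time T. (LINT x|\<rho> t. f (t, x))) = (LINT z|curve_measure T \<rho>. f z)" (is "?L = ?R")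
proof -
  define p where "p z = max 0 (f z)" for z
  define n where "n z = max 0 (- f z)" for z
  have p: "integrable (curve_measure T \<rho>) p" and n: "integrable (curve_measure T \<rho>) n"
    using f unfolding p_def n_def by auto
  have fpn: "f z = p z - n z" for z by (simp add: p_def n_def max_def)
  have pn: "p z \<ge> 0" "n z \<ge> 0" for z by (auto simp: p_def n_def)
  note P = curve_measure_fubini_nonneg[OF p pn(1)] and N = curve_measure_fubini_nonneg[OF n pn(2)]
  show ?ae using P(1) N(1) by eventually_elim (simp add: fpn)
  have ae: "AE t in time T. (LINT x|\<rho> t. p (t, x)) - (LINT x|\<rho> t. n (t, x)) = (LINT x|\<rho> t. f (t, x))"
    using P(1) N(1) by eventually_elim (simp add: fpn)
  note i = Bochner_Integration.integrable_diff[OF P(2) N(2)]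
  have m: "(\<lambda>t. LINT x|\<rho> t. f (t, x)) \<in> borel_measurable (time T)"
    using integral_curve_slice_measurable f measurable_curve_measure by blast
  show ?int by (rule integrable_cong_AE_imp[OF i m]) (use ae in \<open>auto elim: eventually_mono\<close>)
  have "?L = (LINT t|time T. (LINT x|\<rho> t. p (t, x)) - (LINT x|\<rho> t. n (t, x)))"
    by (rule integral_cong_AE[symmetric, OF borel_measurable_integrable[OF i] m ae])
  also have "... = ?R" using P(2,3) N(2,3) p n by (simp add: fpn)
  finally show "?L = ?R" .
qed

end

section \<open>Test functions and duality\<close>

lemma periodic_deriv:
  fixes g g' :: "real \<Rightarrow> real"
  assumes "\<And>x. (g has_real_derivative g' x) (at x)" "\<And>x. g (x + 1) = g x"
  shows "g' (x + 1) = g' x"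
proof -
  have "((\<lambda>x. g (x + 1)) has_real_derivative g' (x + 1)) (at x)"
    using assms(1)[of "x + 1"] by (simp only: DERIV_shift)
  then have "(g has_real_derivative g' (x + 1)) (at x)" by (simp only: assms(2))
  then show ?thesis using assms(1)[of x] by (rule DERIV_unique)
qed

lemma circle_C1I:
  assumes "\<And>x. ((\<lambda>x. f (abs_circle x)) has_real_derivative f' x) (at x)" "continuous_on UNIV f'"
  shows "circle_C1 f" "circle_deriv f p = f' (rep_circle p)" "circle_deriv f (abs_circle x) = f' x"
proof -
  show "circle_C1 f"
    unfolding circle_C1_def C1_differentiable_on_def using assms
    by (auto simp: has_real_derivative_iff_has_vector_derivative)
  show *: "circle_deriv f p = f' (rep_circle p)" for p
    unfolding circle_deriv_def by (rule DERIV_imp_deriv[OF assms(1)])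
  show "circle_deriv f (abs_circle x) = f' x"
    unfolding * by (rule periodic_rep_abs, rule periodic_deriv[OF assms(1)]) (simp add: abs_circle_plus_1)
qed

lemma circle_C1D:
  assumes "circle_C1 f"
  shows "\<And>x. ((\<lambda>x. f (abs_circle x)) has_real_derivative circle_deriv f (abs_circle x)) (at x)"
    and "continuous_on UNIV (circle_deriv f)"
proof -
  obtain D where D: "\<And>x. ((\<lambda>x. f (abs_circle x)) has_real_derivative D x) (at x)" "continuous_on UNIV D"
    using assms unfolding circle_C1_def C1_differentiable_on_def
    by (auto simp: has_real_derivative_iff_has_vector_derivative)
  note * = circle_C1I(3)[of f D, OF D]
  show "((\<lambda>x. f (abs_circle x)) has_real_derivative circle_deriv f (abs_circle x)) (at x)" for x
    unfolding * by (rule D(1))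
  show "continuous_on UNIV (circle_deriv f)"
    by (rule continuous_on_circle) (simp add: * D(2))
qed

lemma circle_continuous_bounded:
  fixes f :: "circle \<Rightarrow> real"
  assumes "continuous_on UNIV f"
  obtains B where "B \<ge> 0" "\<And>p. \<bar>f p\<bar> \<le> B"
proof -
  have "continuous_on {0..1} (\<lambda>x. f (abs_circle x))"
    by (rule continuous_on_compose2[OF assms]) (auto intro: continuous_intros)
  then have "compact ((\<lambda>x. f (abs_circle x)) ` {0..1})" by (intro compact_continuous_image) auto
  then obtain B where B: "\<And>x. x \<in> {0..1} \<Longrightarrow> \<bar>f (abs_circle x)\<bar> \<le> B"
    using compact_imp_bounded by (force simp: bounded_iff)
  show thesis
  proof (rule that[of "max 0 B"])
    fix p obtain x where x: "p = abs_circle x" using circle_surj .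
    have "abs_circle (frac x) = p" unfolding x by (simp add: circle.abs_eq_iff frac_def)
    moreover have "frac x \<in> {0..1}" using frac_lt_1[of x] by simp
    ultimately show "\<bar>f p\<bar> \<le> max 0 B" using B[of "frac x"] by auto
  qed simp
qed

lemma periodic_strip_bounded:
  fixes F :: "real \<Rightarrow> real \<Rightarrow> real"
  assumes c: "continuous_on UNIV (\<lambda>(t, x). F t x)" and per: "\<And>t x. F t (x + 1) = F t x"
    and z: "\<And>t x. t \<notin> {a..b} \<Longrightarrow> F t x = 0"
  obtains B where "B \<ge> 0" "\<And>t x. \<bar>F t x\<bar> \<le> B"
proof -
  have "compact ((\<lambda>(t, x). F t x) ` ({a..b} \<times> {0..1}))"
    by (intro compact_continuous_image compact_Times continuous_on_subset[OF c]) auto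
  then obtain B where B: "\<And>t x. t \<in> {a..b} \<Longrightarrow> x \<in> {0..1} \<Longrightarrow> \<bar>F t x\<bar> \<le> B"
    using compact_imp_bounded by (force simp: bounded_iff)
  show thesis
  proof (rule that[of "max 0 B"])
    fix t x
    have "F t (frac x + of_int \<lfloor>x\<rfloor>) = F t (frac x)" by (rule periodic_int[of "F t", OF per])
    then have "F t x = F t (frac x)" by (simp add: frac_def)
    moreover have "frac x \<in> {0..1}" using frac_lt_1[of x] by simp
    ultimately show "\<bar>F t x\<bar> \<le> max 0 B" using B[of t "frac x"] z[of t] by (cases "t \<in> {a..b}") auto
  qed simp
qed

text \<open>A common home for smooth test functions and for products of a ramp in time with a
  function of x. The time regularity is only Lipschitz because ramps have kinks, and no compact
  support in time is asked for.\<close>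

definition lipschitz_C1 :: "(real \<times> circle \<Rightarrow> real) \<Rightarrow> (real \<times> circle \<Rightarrow> real) \<Rightarrow> bool"
  where "lipschitz_C1 \<phi> \<phi>x \<longleftrightarrow> continuous_on UNIV \<phi> \<and> continuous_on UNIV \<phi>x \<and>
    (\<exists>B. \<forall>z. \<bar>\<phi> z\<bar> \<le> B \<and> \<bar>\<phi>x z\<bar> \<le> B) \<and>
    (\<forall>t. circle_C1 (\<lambda>p. \<phi> (t, p)) \<and> (\<forall>p. circle_deriv (\<lambda>p. \<phi> (t, p)) p = \<phi>x (t, p))) \<and>
    (\<exists>L\<ge>0. \<forall>s t p. \<bar>\<phi> (t, p) - \<phi> (s, p)\<bar> \<le> L * \<bar>t - s\<bar>)"

text \<open>Names the derivatives and the support interval hidden in the existential quantifiers of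
  \<open>test_function\<close>.\<close>

definition test_jet :: "real \<Rightarrow> (real \<times> circle \<Rightarrow> real) \<Rightarrow> (nat \<Rightarrow> nat \<Rightarrow> real \<Rightarrow> real \<Rightarrow> real) \<Rightarrow> real \<Rightarrow> real \<Rightarrow> bool"
  where "test_jet T \<phi> D a b \<longleftrightarrow> (\<forall>t x. D 0 0 t x = \<phi> (t, abs_circle x)) \<and>
    (\<forall>m n. continuous_on UNIV (\<lambda>(t, x). D m n t x)) \<and>
    (\<forall>m n t x. ((\<lambda>s. D m n s x) has_real_derivative D (Suc m) n t x) (at t) \<and>
      ((\<lambda>y. D m n t y) has_real_derivative D m (Suc n) t x) (at x)) \<and>
    0 < a \<and> b < T \<and> (\<forall>t x. t \<notin> {a..b} \<longrightarrow> \<phi> (t, x) = 0)"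

lemma test_function_jet: "test_function T \<phi> \<longleftrightarrow> (\<exists>D a b. test_jet T \<phi> D a b)"
  unfolding test_function_def smooth_cyl_def test_jet_def by (rule iffI; elim exE conjE; intro exI conjI; assumption)

lemma test_jetD:
  assumes "test_jet T \<phi> D a b"
  shows "D 0 0 t x = \<phi> (t, abs_circle x)" "continuous_on UNIV (\<lambda>(t, x). D m n t x)"
    "((\<lambda>s. D m n s x) has_real_derivative D (Suc m) n t x) (at t)"
    "((\<lambda>y. D m n t y) has_real_derivative D m (Suc n) t x) (at x)"
    "0 < a" "b < T" "t \<notin> {a..b} \<Longrightarrow> \<phi> (t, p) = 0"
  using assms unfolding test_jet_def by simp_all

text \<open>Compact support in time and periodicity in space reduce each derivative to a compact
  rectangle, where it is bounded; the bound on the time derivative is the Lipschitz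
  constant.\<close>

lemma test_function_lipschitz_C1:
  assumes "test_function T \<phi>"
  shows "lipschitz_C1 \<phi> (\<lambda>(t, x). circle_deriv (\<lambda>y. \<phi> (t, y)) x)"
proof -
  obtain D a b where J: "test_jet T \<phi> D a b" using assms test_function_jet by blast
  note D0 = test_jetD(1)[OF J] and Dc = test_jetD(2)[OF J] and Dt = test_jetD(3)[OF J] and Dx = test_jetD(4)[OF J]
    and z = test_jetD(7)[OF J]
  have per: "D 0 0 t (x + 1) = D 0 0 t x" for t x by (simp add: D0 abs_circle_plus_1)
  have per1: "D 0 1 t (x + 1) = D 0 1 t x" for t x
    using periodic_deriv[of "D 0 0 t" "D 0 1 t", OF _ per] Dx[of 0 0] by simp
  have per2: "D 1 0 t (x + 1) = D 1 0 t x" for t x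
  proof -
    have "((\<lambda>s. D 0 0 s (x + 1)) has_real_derivative D 1 0 t (x + 1)) (at t)" using Dt[of 0 0] by simp
    then have "((\<lambda>s. D 0 0 s x) has_real_derivative D 1 0 t (x + 1)) (at t)" by (simp only: per)
    then show ?thesis using DERIV_unique Dt[of 0 0 x t] by simp
  qed
  have z0: "D 0 0 t x = 0" if "t \<notin> {a..b}" for t x using z[OF that] by (simp add: D0)
  have z1: "D 0 1 t x = 0" if "t \<notin> {a..b}" for t x
  proof -
    have "D 0 0 t = (\<lambda>x. 0)" using z0[OF that] by auto
    then have "((\<lambda>x. 0) has_real_derivative D 0 1 t x) (at x)" using Dx[of 0 0 t x] by simp
    then show ?thesis by (simp add: DERIV_unique)
  qed
  \<comment> \<open>The complement of [a, b] is open, so near t the function vanishes identically in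
    time.\<close>
  have z2: "D 1 0 t x = 0" if t: "t \<notin> {a..b}" for t x
  proof -
    have "((\<lambda>s. D 0 0 s x) has_real_derivative D 1 0 t x) (at t)" using Dt[of 0 0 x t] by simp
    then have "((\<lambda>s. 0) has_real_derivative D 1 0 t x) (at t)"
      by (rule has_field_derivative_transform_within_open[where S = "- {a..b}"]) (use t z0 in \<open>auto simp: closed_atLeastAtMost\<close>)
    then show ?thesis by (simp add: DERIV_unique)
  qed
  obtain B0 where B0: "B0 \<ge> 0" "\<And>t x. \<bar>D 0 0 t x\<bar> \<le> B0" using periodic_strip_bounded[OF Dc per z0] by blast
  obtain B1 where B1: "B1 \<ge> 0" "\<And>t x. \<bar>D 0 1 t x\<bar> \<le> B1" using periodic_strip_bounded[OF Dc per1 z1] by blast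
  obtain B2 where B2: "B2 \<ge> 0" "\<And>t x. \<bar>D 1 0 t x\<bar> \<le> B2" using periodic_strip_bounded[OF Dc per2 z2] by blast
  have dx: "((\<lambda>x. \<phi> (t, abs_circle x)) has_real_derivative D 0 1 t x) (at x)" for t x
    using Dx[of 0 0 t x] by (simp add: D0)
  have Dxc: "continuous_on UNIV (D 0 1 t)" for t
  proof -
    have "continuous_on UNIV (\<lambda>x. (\<lambda>(t, x). D 0 1 t x) (t, x))"
      by (rule continuous_on_compose2[OF Dc]) (auto intro!: continuous_intros)
    then show ?thesis by simp
  qed
  note C = circle_C1I[of "\<lambda>y. \<phi> (_, y)", OF dx Dxc]
  show ?thesis
    unfolding lipschitz_C1_def
  proof (intro conjI allI)
    show "continuous_on UNIV \<phi>"
      by (rule continuous_on_prod_circle) (use Dc[of 0 0] in \<open>simp add: D0\<close>)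
    show "continuous_on UNIV (\<lambda>(t, x). circle_deriv (\<lambda>y. \<phi> (t, y)) x)"
      by (rule continuous_on_prod_circle) (use Dc[of 0 1] in \<open>simp add: C(3)\<close>)
    show "\<exists>B. \<forall>z. \<bar>\<phi> z\<bar> \<le> B \<and> \<bar>case z of (t, x) \<Rightarrow> circle_deriv (\<lambda>y. \<phi> (t, y)) x\<bar> \<le> B"
    proof (intro exI[of _ "max B0 B1"] allI)
      fix z :: "real \<times> circle"
      obtain t x where z: "z = (t, abs_circle x)" by (metis circle_surj surj_pair)
      show "\<bar>\<phi> z\<bar> \<le> max B0 B1 \<and> \<bar>case z of (t, x) \<Rightarrow> circle_deriv (\<lambda>y. \<phi> (t, y)) x\<bar> \<le> max B0 B1"
        using B0(2)[of t x] B1(2)[of t x] by (auto simp: z C(3) D0 le_max_iff_disj)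
    qed
    show "\<exists>L\<ge>0. \<forall>s t p. \<bar>\<phi> (t, p) - \<phi> (s, p)\<bar> \<le> L * \<bar>t - s\<bar>"
    proof (intro exI[of _ B2] conjI allI B2(1))
      fix s t p
      obtain x where x: "p = abs_circle x" using circle_surj .
      have "norm (D 0 0 t x - D 0 0 s x) \<le> B2 * norm (t - s)"
        by (rule field_differentiable_bound[of UNIV _ "\<lambda>t. D 1 0 t x"])
          (use Dt[of 0 0 x] B2 in auto)
      then show "\<bar>\<phi> (t, p) - \<phi> (s, p)\<bar> \<le> B2 * \<bar>t - s\<bar>" by (simp add: x D0)
    qed
  qed (simp_all add: C)
qed

lemma continuous_bounded_measurable_strip:
  assumes "continuous_on UNIV f" "\<And>z. \<bar>f z\<bar> \<le> B"
  shows "bounded_measurable (cyl T) f"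
  using assms unfolding cyl_eq_strip
  by (intro bounded_measurableI[where B = B] strip_measurable_borel borel_measurable_continuous_onI) auto

lemma lipschitz_C1_bounded_measurable:
  assumes "lipschitz_C1 \<phi> \<phi>x"
  shows "bounded_measurable (cyl T) \<phi>" "bounded_measurable (cyl T) \<phi>x"
proof -
  obtain B where "\<And>z. \<bar>\<phi> z\<bar> \<le> B" "\<And>z. \<bar>\<phi>x z\<bar> \<le> B"
    using assms unfolding lipschitz_C1_def by blast
  then show "bounded_measurable (cyl T) \<phi>" "bounded_measurable (cyl T) \<phi>x"
    using assms unfolding lipschitz_C1_def by (blast intro: continuous_bounded_measurable_strip)+
qed

lemma test_function_bounded_measurable:
  "test_function T \<phi> \<Longrightarrow> bounded_measurable (cyl T) \<phi>"
  by (rule lipschitz_C1_bounded_measurable(1)[OF test_function_lipschitz_C1])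

lemma test_function_add:
  assumes "test_function T \<phi>" "test_function T \<psi>"
  shows "test_function T (\<lambda>z. \<phi> z + \<psi> z)"
proof -
  obtain D a b E c d where J: "test_jet T \<phi> D a b" "test_jet T \<psi> E c d" using assms test_function_jet by meson
  note D = test_jetD[OF J(1)] and E = test_jetD[OF J(2)]
  have "test_jet T (\<lambda>z. \<phi> z + \<psi> z) (\<lambda>m n t x. D m n t x + E m n t x) (min a c) (max b d)"
    unfolding test_jet_def
  proof (intro conjI allI)
    show "continuous_on UNIV (\<lambda>(t, x). D m n t x + E m n t x)" for m n
      using continuous_on_add[OF D(2)[of m n] E(2)[of m n]] by (simp add: case_prod_beta)
  qed (use D E in \<open>auto intro!: DERIV_add simp: min_le_iff_disj le_max_iff_disj\<close>)
  then show ?thesis unfolding test_function_jet by blast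
qed

lemma test_function_scale:
  assumes "test_function T \<phi>"
  shows "test_function T (\<lambda>z. c * \<phi> z)"
proof -
  obtain D a b where J: "test_jet T \<phi> D a b" using assms test_function_jet by meson
  note D = test_jetD[OF J]
  have "test_jet T (\<lambda>z. c * \<phi> z) (\<lambda>m n t x. c * D m n t x) a b"
    unfolding test_jet_def
  proof (intro conjI allI)
    show "continuous_on UNIV (\<lambda>(t, x). c * D m n t x)" for m n
      using continuous_on_mult_left[OF D(2)[of m n], of c] by (simp add: case_prod_beta)
  qed (use D in \<open>auto intro!: DERIV_cmult\<close>)
  then show ?thesis unfolding test_function_jet by blast
qed

text \<open>Smooth approximation of the indicator of x > 0. The shift by -1 makes it vanish up to 1
  / (n + 1), which gives products of two steps compact support; the outer factor n + 1 drives the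
  argument to infinity for x > 0.\<close>

definition step :: "nat \<Rightarrow> real \<Rightarrow> real"
  where "step n x = flat 0 (real (Suc n) * (real (Suc n) * x - 1))"

lemma step_bounds: "0 \<le> step n x" "step n x \<le> 1"
  by (simp_all add: step_def flat_0_bounds)

lemma step_zero: "x \<le> 1 / real (Suc n) \<Longrightarrow> step n x = 0"
proof -
  assume "x \<le> 1 / real (Suc n)"
  then have "real (Suc n) * x - 1 \<le> 0" by (simp add: field_simps)
  then have "real (Suc n) * (real (Suc n) * x - 1) \<le> 0" by (intro mult_nonneg_nonpos) auto
  then show ?thesis unfolding step_def flat_def by simp
qed

lemma step_tendsto: "(\<lambda>n. step n x) \<longlonglongrightarrow> (if x > 0 then 1 else 0)"
proof (cases "x > 0")
  case True
  have S: "filterlim (\<lambda>n. real (Suc n)) at_top sequentially"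
    by (rule filterlim_compose[OF filterlim_real_sequentially filterlim_Suc])
  have "filterlim (\<lambda>n. - 1 + x * real (Suc n)) at_top sequentially"
    by (intro filterlim_tendsto_add_at_top[OF tendsto_const] filterlim_tendsto_pos_mult_at_top[OF tendsto_const True] S)
  then have "filterlim (\<lambda>n. real (Suc n) * (- 1 + x * real (Suc n))) at_top sequentially"
    by (rule filterlim_at_top_mult_at_top[OF S])
  then have lim: "filterlim (\<lambda>n. real (Suc n) * (real (Suc n) * x - 1)) at_top sequentially"
    by (simp add: mult.commute)
  have "((\<lambda>y::real. exp (- (1 / y))) \<longlongrightarrow> exp (- 0)) at_top"
    by (intro tendsto_intros real_tendsto_divide_at_top[OF tendsto_const filterlim_ident])
  then have "((\<lambda>y::real. exp (- (1 / y))) \<longlongrightarrow> 1) at_top" by simp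
  then have "(flat 0 \<longlongrightarrow> 1) at_top"
    by (rule Lim_transform_eventually) (auto intro!: eventually_mono[OF eventually_gt_at_top[of 0]] simp: flat_def)
  from filterlim_compose[OF this lim] show ?thesis using True by (simp add: step_def)
next
  case False
  then have "step n x = 0" for n by (intro step_zero) (auto intro: order_trans[of _ 0])
  then show ?thesis using False by simp
qed

lemma step_smooth: "(\<lambda>x. step n (x - a)) \<in> smooth_real" "(\<lambda>x. step n (a - x)) \<in> smooth_real"
  unfolding step_def
  by (intro smooth_real.comp[OF smooth_real.flat] smooth_real_scale smooth_real_diff smooth_real.ident smooth_real.const)+

text \<open>One test function has to work for all measures of the family at once: the duality
  argument approximates in L2 of both Jordan parts of \<mu> and of the reference measure
  simultaneously.\<close>

definition l2_approximable :: "real \<Rightarrow> (real \<times> circle) measure set \<Rightarrow> (real \<times> circle \<Rightarrow> real) \<Rightarrow> bool"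
  where "l2_approximable T \<N> f \<longleftrightarrow>
    (\<forall>e>0. \<exists>\<phi>. test_function T \<phi> \<and> (\<forall>N\<in>\<N>. (LINT z|N. (f z - \<phi> z)\<^sup>2) < e))"

context
  fixes T :: real and \<N> :: "(real \<times> circle) measure set"
  assumes fin: "finite \<N>" and \<N>: "\<And>N. N \<in> \<N> \<Longrightarrow> finite_measure N" "\<And>N. N \<in> \<N> \<Longrightarrow> sets N = sets (cyl T)"
begin

lemma l2_integrable: "N \<in> \<N> \<Longrightarrow> bounded_measurable (cyl T) f \<Longrightarrow> integrable N f"
  by (rule integrable_bounded_measurable[OF \<N>])

lemma l2_triangle:
  assumes "N \<in> \<N>" "bounded_measurable (cyl T) f" "bounded_measurable (cyl T) g" "bounded_measurable (cyl T) h"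
    and "\<And>z. z \<in> space (cyl T) \<Longrightarrow> h z = f z + g z"
  shows "(LINT z|N. (h z)\<^sup>2) \<le> 2 * (LINT z|N. (f z)\<^sup>2) + 2 * (LINT z|N. (g z)\<^sup>2)"
proof -
  have i: "integrable N (\<lambda>z. (k z)\<^sup>2)" if "bounded_measurable (cyl T) k" for k
    using that by (intro l2_integrable[OF assms(1)] bounded_measurable_power2)
  have "(LINT z|N. (h z)\<^sup>2) \<le> (LINT z|N. 2 * (f z)\<^sup>2 + 2 * (g z)\<^sup>2)"
  proof (rule integral_mono)
    fix z assume "z \<in> space N"
    then have "h z = f z + g z" using assms(5) sets_eq_imp_space_eq[OF \<N>(2)[OF assms(1)]] by simp
    moreover have "0 \<le> (f z - g z)\<^sup>2" by simp
    ultimately show "(h z)\<^sup>2 \<le> 2 * (f z)\<^sup>2 + 2 * (g z)\<^sup>2" by (simp add: power2_eq_square algebra_simps)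
  qed (use i assms in auto)
  also have "... = 2 * (LINT z|N. (f z)\<^sup>2) + 2 * (LINT z|N. (g z)\<^sup>2)"
    using i assms by simp
  finally show ?thesis .
qed

lemma l2_add:
  assumes f: "bounded_measurable (cyl T) f" "l2_approximable T \<N> f"
    and g: "bounded_measurable (cyl T) g" "l2_approximable T \<N> g"
  shows "l2_approximable T \<N> (\<lambda>z. f z + g z)"
  unfolding l2_approximable_def
proof (intro allI impI)
  fix e :: real assume e: "e > 0"
  then obtain \<phi> where \<phi>: "test_function T \<phi>" "\<And>N. N \<in> \<N> \<Longrightarrow> (LINT z|N. (f z - \<phi> z)\<^sup>2) < e / 4"
    using f(2) unfolding l2_approximable_def by (meson zero_less_divide_iff zero_less_numeral)
  obtain \<gamma> where \<gamma>: "test_function T \<gamma>" "\<And>N. N \<in> \<N> \<Longrightarrow> (LINT z|N. (g z - \<gamma> z)\<^sup>2) < e / 4"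
    using e g(2) unfolding l2_approximable_def by (meson zero_less_divide_iff zero_less_numeral)
  have "(LINT z|N. (f z + g z - (\<phi> z + \<gamma> z))\<^sup>2) < e" if N: "N \<in> \<N>" for N
  proof -
    have "(LINT z|N. (f z + g z - (\<phi> z + \<gamma> z))\<^sup>2) \<le> 2 * (LINT z|N. (f z - \<phi> z)\<^sup>2) + 2 * (LINT z|N. (g z - \<gamma> z)\<^sup>2)"
      by (rule l2_triangle[OF N])
        (simp_all add: bounded_measurable_diff bounded_measurable_add f g test_function_bounded_measurable \<phi> \<gamma>)
    then show ?thesis using \<phi>(2)[OF N] \<gamma>(2)[OF N] by linarith
  qed
  then show "\<exists>\<phi>. test_function T \<phi> \<and> (\<forall>N\<in>\<N>. (LINT z|N. (f z + g z - \<phi> z)\<^sup>2) < e)"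
    using test_function_add[OF \<phi>(1) \<gamma>(1)] by blast
qed

lemma l2_scale:
  assumes f: "bounded_measurable (cyl T) f" "l2_approximable T \<N> f"
  shows "l2_approximable T \<N> (\<lambda>z. c * f z)"
  unfolding l2_approximable_def
proof (intro allI impI)
  fix e :: real assume e: "e > 0"
  have c: "c\<^sup>2 + 1 > 0" by (simp add: add_nonneg_pos)
  then obtain \<phi> where \<phi>: "test_function T \<phi>" "\<And>N. N \<in> \<N> \<Longrightarrow> (LINT z|N. (f z - \<phi> z)\<^sup>2) < e / (c\<^sup>2 + 1)"
    using f(2) e unfolding l2_approximable_def by (meson zero_less_divide_iff)
  have "(LINT z|N. (c * f z - c * \<phi> z)\<^sup>2) < e" if N: "N \<in> \<N>" for N
  proof -
    have "(LINT z|N. (c * f z - c * \<phi> z)\<^sup>2) = c\<^sup>2 * (LINT z|N. (f z - \<phi> z)\<^sup>2)"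
      by (simp add: right_diff_distrib[symmetric] power_mult_distrib)
    also have "... \<le> (c\<^sup>2 + 1) * (LINT z|N. (f z - \<phi> z)\<^sup>2)" by (intro mult_right_mono) auto
    also have "... < e" using \<phi>(2)[OF N] c by (simp add: pos_less_divide_eq mult.commute)
    finally show ?thesis .
  qed
  then show "\<exists>\<phi>. test_function T \<phi> \<and> (\<forall>N\<in>\<N>. (LINT z|N. (c * f z - \<phi> z)\<^sup>2) < e)"
    using test_function_scale[OF \<phi>(1)] by blast
qed

lemma l2_test: "test_function T \<phi> \<Longrightarrow> l2_approximable T \<N> \<phi>"
  unfolding l2_approximable_def by (auto intro!: exI[of _ \<phi>])

lemma l2_close:
  assumes f: "bounded_measurable (cyl T) f"
    and app: "\<And>e. e > 0 \<Longrightarrow> \<exists>g. bounded_measurable (cyl T) g \<and> l2_approximable T \<N> g \<and> (\<forall>N\<in>\<N>. (LINT z|N. (f z - g z)\<^sup>2) < e)"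
  shows "l2_approximable T \<N> f"
  unfolding l2_approximable_def
proof (intro allI impI)
  fix e :: real assume e: "e > 0"
  then obtain g where g: "bounded_measurable (cyl T) g" "l2_approximable T \<N> g"
    "\<And>N. N \<in> \<N> \<Longrightarrow> (LINT z|N. (f z - g z)\<^sup>2) < e / 4" using app[of "e / 4"] by auto
  obtain \<phi> where \<phi>: "test_function T \<phi>" "\<And>N. N \<in> \<N> \<Longrightarrow> (LINT z|N. (g z - \<phi> z)\<^sup>2) < e / 4"
    using g(2) e unfolding l2_approximable_def by (meson zero_less_divide_iff zero_less_numeral)
  have "(LINT z|N. (f z - \<phi> z)\<^sup>2) < e" if N: "N \<in> \<N>" for N
  proof -
    have "(LINT z|N. (f z - \<phi> z)\<^sup>2) \<le> 2 * (LINT z|N. (f z - g z)\<^sup>2) + 2 * (LINT z|N. (g z - \<phi> z)\<^sup>2)"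
      by (rule l2_triangle[OF N]) (simp_all add: bounded_measurable_diff f g test_function_bounded_measurable \<phi>)
    then show ?thesis using \<phi>(2)[OF N] g(3)[OF N] by linarith
  qed
  then show "\<exists>\<phi>. test_function T \<phi> \<and> (\<forall>N\<in>\<N>. (LINT z|N. (f z - \<phi> z)\<^sup>2) < e)" using \<phi>(1) by blast
qed

text \<open>Dominated convergence applies to each N separately; since the family is finite, one
  index serves all of them.\<close>

lemma l2_limit:
  assumes f: "bounded_measurable (cyl T) f"
    and g: "\<And>n. bounded_measurable (cyl T) (g n)" "\<And>n. l2_approximable T \<N> (g n)"
    and B: "\<And>n z. z \<in> space (cyl T) \<Longrightarrow> \<bar>f z - g n z\<bar> \<le> B"
    and lim: "\<And>z. z \<in> space (cyl T) \<Longrightarrow> (\<lambda>n::nat. g n z) \<longlonglongrightarrow> f z"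
  shows "l2_approximable T \<N> f"
proof (rule l2_close[OF f])
  fix e :: real assume e: "e > 0"
  have "\<forall>N\<in>\<N>. eventually (\<lambda>n. (LINT z|N. (f z - g n z)\<^sup>2) < e) sequentially"
  proof
    fix N assume N: "N \<in> \<N>"
    interpret finite_measure N by (rule \<N>(1)[OF N])
    have sp: "space N = space (cyl T)" by (rule sets_eq_imp_space_eq[OF \<N>(2)[OF N]])
    have m: "(\<lambda>z. (f z - g n z)\<^sup>2) \<in> borel_measurable N" for n
      using bounded_measurableD[OF bounded_measurable_power2[OF bounded_measurable_diff[OF f g(1)]]]
        measurable_cong_sets[OF \<N>(2)[OF N] refl] by blast
    have "(\<lambda>n. LINT z|N. (f z - g n z)\<^sup>2) \<longlonglongrightarrow> (LINT z|N. 0)"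
    proof (rule integral_dominated_convergence[where w = "\<lambda>_. B\<^sup>2"])
      show "AE z in N. (\<lambda>n. (f z - g n z)\<^sup>2) \<longlonglongrightarrow> 0"
      proof (rule AE_I2)
        fix z assume "z \<in> space N"
        then have "(\<lambda>n. (f z - g n z)\<^sup>2) \<longlonglongrightarrow> (f z - f z)\<^sup>2"
          using lim sp by (intro tendsto_intros) auto
        then show "(\<lambda>n. (f z - g n z)\<^sup>2) \<longlonglongrightarrow> 0" by simp
      qed
      show "AE z in N. norm ((f z - g n z)\<^sup>2) \<le> B\<^sup>2" for n
        using B sp by (intro AE_I2) (auto simp: abs_le_square_iff[symmetric] intro: order_trans[OF _ abs_ge_self])
    qed (use m in auto)
    then show "eventually (\<lambda>n. (LINT z|N. (f z - g n z)\<^sup>2) < e) sequentially"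
      using e by (intro order_tendstoD(2)) auto
  qed
  then have "eventually (\<lambda>n. \<forall>N\<in>\<N>. (LINT z|N. (f z - g n z)\<^sup>2) < e) sequentially"
    using fin by (simp add: eventually_ball_finite_distrib)
  then obtain n where "\<forall>N\<in>\<N>. (LINT z|N. (f z - g n z)\<^sup>2) < e"
    using eventually_happens'[OF sequentially_bot] by blast
  then show "\<exists>g. bounded_measurable (cyl T) g \<and> l2_approximable T \<N> g \<and> (\<forall>N\<in>\<N>. (LINT z|N. (f z - g z)\<^sup>2) < e)"
    using g by blast
qed

abbreviation cyl_ind :: "(real \<times> circle) set \<Rightarrow> real \<times> circle \<Rightarrow> real"
  where "cyl_ind A \<equiv> indicator (A \<inter> space (cyl T))"

lemma l2_rect:
  assumes U: "smooth_approx U"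
  shows "l2_approximable T \<N> (cyl_ind ({a<..<b} \<times> U))"
proof -
  obtain g where g: "\<And>n. g n \<in> smooth_real" "\<And>n x. g n (x + 1) = g n x" "\<And>n x. 0 \<le> g n x \<and> g n x \<le> 1"
    "\<And>x. (\<lambda>n::nat. g n x) \<longlonglongrightarrow> indicator U (abs_circle x)" using U unfolding smooth_approx_def by blast
  \<comment> \<open>Clipping to (0, T) makes \<phi> n vanish outside [a' + 1/(n+1), b' - 1/(n+1)], a
    compact subset of the open time interval.\<close>
  define a' b' where "a' = max a 0" and "b' = min b T"
  define \<phi> where "\<phi> n = (\<lambda>(t, p). step n (t - a') * step n (b' - t) * g n (rep_circle p))" for n
  have \<phi>01: "0 \<le> \<phi> n z \<and> \<phi> n z \<le> 1" for n z
    unfolding \<phi>_def using step_bounds g(3) by (auto simp: case_prod_beta intro!: mult_le_one)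
  have test: "test_function T (\<phi> n)" for n
    unfolding test_function_def
  proof
    show "smooth_cyl (\<phi> n)"
      unfolding \<phi>_def
      by (rule smooth_cyl_product[OF smooth_real.mult[OF step_smooth] g(1,2)])
    show "\<exists>a b. 0 < a \<and> b < T \<and> (\<forall>t x. t \<notin> {a..b} \<longrightarrow> \<phi> n (t, x) = 0)"
    proof (rule exI[of _ "a' + 1 / real (Suc n)"], rule exI[of _ "b' - 1 / real (Suc n)"], intro conjI allI impI)
      have "a' \<ge> 0" "b' \<le> T" "1 / real (Suc n) > 0" by (auto simp: a'_def b'_def)
      then show "0 < a' + 1 / real (Suc n)" "b' - 1 / real (Suc n) < T" by linarith+
      fix t x assume "t \<notin> {a' + 1 / real (Suc n)..b' - 1 / real (Suc n)}"
      then have "t - a' \<le> 1 / real (Suc n) \<or> b' - t \<le> 1 / real (Suc n)" unfolding atLeastAtMost_iff by linarith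
      then have "step n (t - a') = 0 \<or> step n (b' - t) = 0" using step_zero by blast
      then show "\<phi> n (t, x) = 0" by (auto simp: \<phi>_def)
    qed
  qed
  have m: "{a<..<b} \<times> U \<inter> space (cyl T) \<in> sets (cyl T)"
  proof -
    have "{a<..<b} \<times> U \<in> sets (borel :: (real \<times> circle) measure)"
      unfolding borel_prod[symmetric] using smooth_approx_borel[OF U] by (intro pair_measureI) auto
    moreover have "space (cyl T) \<in> sets (borel :: (real \<times> circle) measure)"
      using open_strip[of T, where 'a=circle] by simp
    ultimately show ?thesis unfolding cyl_eq_strip sets_strip by auto
  qed
  show ?thesis
  proof (rule l2_limit[of _ \<phi> 1])
    show "bounded_measurable (cyl T) (cyl_ind ({a<..<b} \<times> U))"
      using m by (rule bounded_measurable_indicator)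
    show "\<bar>cyl_ind ({a<..<b} \<times> U) z - \<phi> n z\<bar> \<le> 1" for n z
      using \<phi>01[of n z] by (auto simp: indicator_def)
    fix z :: "real \<times> circle" assume z: "z \<in> space (cyl T)"
    obtain t p where tp: "z = (t, p)" by force
    have "(\<lambda>n. \<phi> n z) \<longlonglongrightarrow> (if t - a' > 0 then 1 else 0) * (if b' - t > 0 then 1 else 0) * indicator U (abs_circle (rep_circle p))"
      unfolding \<phi>_def tp prod.case by (intro tendsto_mult step_tendsto g(4))
    then show "(\<lambda>n. \<phi> n z) \<longlonglongrightarrow> cyl_ind ({a<..<b} \<times> U) z"
      using z by (cases "p \<in> U") (simp_all add: tp indicator_def a'_def b'_def split: if_splits)
  qed (auto intro: test l2_test test_function_bounded_measurable)
qed

lemma borel_strip_generator: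
  "sets (borel :: (real \<times> circle) measure) = sigma_sets UNIV {I \<times> U | I U. I \<in> range (\<lambda>(a, b). {a<..<b}) \<and> smooth_approx U}"
proof -
  have "sets (borel \<Otimes>\<^sub>M borel) = sets (sigma (space (borel :: real measure) \<times> space (borel :: circle measure))
      {I \<times> U | I U. I \<in> range (\<lambda>(a, b). {a<..<b::real}) \<and> U \<in> Collect smooth_approx})"
  proof (rule sets_pair_eq[where Ca = "range (\<lambda>n. {- real n<..<real n})" and Cb = "{UNIV}"])
    show "sets (borel :: real measure) = sigma_sets (space borel) (range (\<lambda>(a, b). {a<..<b}))"
      using arg_cong[OF borel_eq_box[where 'a = real], of sets] by simp
    show "\<Union>(range (\<lambda>n. {- real n<..<real n})) = space borel"
    proof -
      have "\<exists>n. - real n < x \<and> x < real n" for x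
        using reals_Archimedean2[of "\<bar>x\<bar>"] by (metis abs_less_iff minus_less_iff)
      then show ?thesis by auto
    qed
    show "sets (borel :: circle measure) = sigma_sets (space borel) (Collect smooth_approx)"
      using borel_circle_eq by simp
  qed (auto simp: smooth_approx_UNIV)
  then show ?thesis unfolding borel_prod by simp
qed

text \<open>Dynkin argument over products of open intervals with smoothly approximable sets.
  Everything is intersected with the strip, so complements are taken inside it.\<close>

lemma l2_indicator:
  assumes "A \<in> sets borel"
  shows "l2_approximable T \<N> (cyl_ind A)"
proof -
  let ?G = "{I \<times> U | I U. I \<in> range (\<lambda>(a, b). {a<..<b::real}) \<and> smooth_approx U}"
  have st: "Int_stable ?G"
    unfolding Int_stable_def
  proof (intro ballI)
    fix A B assume "A \<in> ?G" "B \<in> ?G"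
    then obtain a b c d U V where AB: "A = {a<..<b} \<times> U" "B = {c<..<d} \<times> V" "smooth_approx U" "smooth_approx V" by auto
    have "A \<inter> B = {max a c<..<min b d} \<times> (U \<inter> V)" unfolding AB by auto
    then show "A \<inter> B \<in> ?G" using smooth_approx_Int[OF AB(3,4)] by auto
  qed
  have A: "A \<in> sigma_sets UNIV ?G" using assms borel_strip_generator by simp
  have sp: "space (cyl T) \<in> sets (cyl T)" by (rule sets.top)
  have bm: "bounded_measurable (cyl T) (cyl_ind A)" if "A \<in> sigma_sets UNIV ?G" for A
  proof -
    have "A \<in> sets borel" using that borel_strip_generator by simp
    then have "A \<inter> space (cyl T) \<in> sets (cyl T)"
      using open_strip[of T, where 'a=circle] unfolding cyl_eq_strip sets_strip by auto
    then show ?thesis by (rule bounded_measurable_indicator)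
  qed
  show ?thesis
    using st _ A
  proof (rule sigma_sets_induct_disjoint)
    fix A assume "A \<in> ?G"
    then show "l2_approximable T \<N> (cyl_ind A)" using l2_rect by auto
  next
    show "l2_approximable T \<N> (cyl_ind {})"
      using l2_rect[OF smooth_approx_UNIV, of 0 0] by simp
  next
    fix A assume A: "A \<in> sigma_sets UNIV ?G" "l2_approximable T \<N> (cyl_ind A)"
    have U: "l2_approximable T \<N> (cyl_ind UNIV)"
      using l2_rect[OF smooth_approx_UNIV, of 0 T] by (simp add: Int_absorb1)
    have "l2_approximable T \<N> (\<lambda>z. cyl_ind UNIV z + (- 1) * cyl_ind A z)"
      by (intro l2_add l2_scale bounded_measurable_scale bm A U) (auto intro: sigma_sets_top)
    moreover have "(\<lambda>z. cyl_ind UNIV z + (- 1) * cyl_ind A z)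
      = cyl_ind (UNIV - A)" by (auto simp: indicator_def)
    ultimately show "l2_approximable T \<N> (cyl_ind (UNIV - A))" by simp
  next
    fix A :: "nat \<Rightarrow> _" assume A: "disjoint_family A" "range A \<subseteq> sigma_sets UNIV ?G"
      "\<And>i. l2_approximable T \<N> (cyl_ind (A i))"
    have Ai: "A i \<in> sigma_sets UNIV ?G" for i using A(2) by blast
    have UA: "(\<Union>i. A i) \<in> sigma_sets UNIV ?G" using Ai by (rule sigma_sets.Union)
    have dis: "disjoint_family (\<lambda>i. A i \<inter> space (cyl T))" using A(1) by (auto simp: disjoint_family_on_def)
    have part: "l2_approximable T \<N> (\<lambda>z. \<Sum>i<n. cyl_ind (A i) z)" for n
    proof (induction n)
      case 0
      have "cyl_ind ({0<..<0} \<times> UNIV) = (\<lambda>z. 0)" by auto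
      then show ?case using l2_rect[OF smooth_approx_UNIV, of 0 0] by simp
    next
      case (Suc n)
      have "l2_approximable T \<N> (\<lambda>z. (\<Sum>i<n. cyl_ind (A i) z) + cyl_ind (A n) z)"
        by (intro l2_add Suc A(3) bounded_measurable_sum bm Ai)
      then show ?case by simp
    qed
    have "(\<Union>i. A i) \<inter> space (cyl T) = (\<Union>i. A i \<inter> space (cyl T))" by auto
    then have sums: "(\<lambda>i. cyl_ind (A i) z) sums cyl_ind (\<Union>i. A i) z" for z
      by (simp only:) (rule indicator_sums, use dis in \<open>auto simp: disjoint_family_on_def\<close>)
    have ps: "0 \<le> (\<Sum>i<n. cyl_ind (A i) z)"
      "(\<Sum>i<n. cyl_ind (A i) z) \<le> cyl_ind (\<Union>i. A i) z" for n z
      using sums[of z] sum_le_suminf[of "\<lambda>i. cyl_ind (A i) z" "{..<n}"]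
      by (auto simp: sums_iff intro!: sum_nonneg)
    show "l2_approximable T \<N> (cyl_ind (\<Union>i. A i))"
    proof (rule l2_limit[where B = 1, OF bm[OF UA] _ part])
      show "\<bar>cyl_ind (\<Union>i. A i) z - (\<Sum>i<n. cyl_ind (A i) z)\<bar> \<le> 1" for n z
        using ps(1)[where n=n and z=z] ps(2)[where n=n and z=z]
        by (auto simp: indicator_def split: if_splits)
      show "(\<lambda>n. \<Sum>i<n. cyl_ind (A i) z) \<longlonglongrightarrow> cyl_ind (\<Union>i. A i) z" for z
        using sums[of z] unfolding sums_def .
    qed (intro bounded_measurable_sum bm Ai)
  qed auto
qed

lemma l2_approximable_bounded_measurable:
  assumes "bounded_measurable (cyl T) f"
  shows "l2_approximable T \<N> f"
  using assms
proof (induction rule: bounded_measurable_induct)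
  case (indicator A)
  then have "A \<in> sets borel" "A \<inter> space (cyl T) = A" unfolding cyl_eq_strip sets_strip by auto
  then show ?case using l2_indicator[of A] by simp
next
  case (approx f)
  have "\<forall>n. \<exists>g. bounded_measurable (cyl T) g \<and> l2_approximable T \<N> g \<and> (\<forall>x\<in>space (cyl T). \<bar>f x - g x\<bar> \<le> 1 / real (Suc n))"
    using approx(2) by simp
  then obtain g where g: "\<And>n. bounded_measurable (cyl T) (g n)" "\<And>n. l2_approximable T \<N> (g n)"
    "\<And>n x. x \<in> space (cyl T) \<Longrightarrow> \<bar>f x - g n x\<bar> \<le> 1 / real (Suc n)" by metis
  show ?case
  proof (rule l2_limit[where B = 1, OF approx(1) g(1,2)])
    fix n and z :: "real \<times> circle" assume "z \<in> space (cyl T)"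
    then have "\<bar>f z - g n z\<bar> \<le> 1 / real (Suc n)" by (rule g(3))
    also have "... \<le> 1" by simp
    finally show "\<bar>f z - g n z\<bar> \<le> 1" .
  next
    fix z :: "real \<times> circle" assume z: "z \<in> space (cyl T)"
    have "(\<lambda>n. g n z - f z) \<longlonglongrightarrow> 0"
      by (rule Lim_null_comparison[OF _ LIMSEQ_Suc[OF lim_1_over_n]])
        (use g(3)[OF z] in \<open>simp add: abs_minus_commute\<close>)
    then show "(\<lambda>n. g n z) \<longlonglongrightarrow> f z" by (rule LIM_zero_cancel)
  qed
qed (simp_all add: l2_add l2_scale)

end

text \<open>Density of the test functions, used in a quantitative form: both terms on the left are
  continuous along an approximation that is good in L2 of the Jordan parts of \<mu> and of
  R.\<close>

lemma duality_extend:
  assumes \<mu>: "vector_measure (cyl T) \<mu>" and R: "finite_measure R" "sets R = sets (cyl T)" and a: "a \<ge> 0"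
    and le: "\<And>\<phi>. test_function T \<phi> \<Longrightarrow> signed_integral (cyl T) \<mu> \<phi> - a * (LINT z|R. (\<phi> z)\<^sup>2) \<le> M"
    and g: "bounded_measurable (cyl T) g"
  shows "signed_integral (cyl T) \<mu> g - a * (LINT z|R. (g z)\<^sup>2) \<le> M"
proof -
  define P where "P = pos_part (cyl T) \<mu>"
  define N where "N = neg_part (cyl T) \<mu>"
  obtain B where B: "B \<ge> 0" "\<And>z. z \<in> space (cyl T) \<Longrightarrow> \<bar>g z\<bar> \<le> B" using bounded_measurable_bound[OF g] by blast
  define m where "m K = measure K (space (cyl T))" for K :: "(real \<times> circle) measure"
  \<comment> \<open>Collects the error coefficients: one for each Jordan part, and one for the
    quadratic term, whose variation is at most 2 B |h| + h^2.\<close>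
  define C where "C = (m P + 1) + (m N + 1) + a * (2 * B * (m R + 1) + 1)"
  have C: "C \<ge> 1" unfolding C_def m_def using a B by (simp add: add_increasing)
  have fam: "finite_measure K" "sets K = sets (cyl T)" if "K \<in> {P, N, R}" for K
    using that R finite_measure_pos_part[OF \<mu>] finite_measure_neg_part[OF \<mu>]
      sets_pos_part[of "cyl T" \<mu>] sets_neg_part[of "cyl T" \<mu>] unfolding P_def N_def by blast+
  have main: "signed_integral (cyl T) \<mu> g - a * (LINT z|R. (g z)\<^sup>2) \<le> M + C * e" if e: "0 < e" "e \<le> 1" for e
  proof -
    have "l2_approximable T {P, N, R} g"
      by (rule l2_approximable_bounded_measurable[OF _ fam g]) auto
    then obtain \<phi> where \<phi>: "test_function T \<phi>" "\<And>K. K \<in> {P, N, R} \<Longrightarrow> (LINT z|K. (g z - \<phi> z)\<^sup>2) < e\<^sup>2"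
      using e unfolding l2_approximable_def by (meson zero_less_power)
    define h where "h z = g z - \<phi> z" for z
    have bm: "bounded_measurable (cyl T) \<phi>" "bounded_measurable (cyl T) h"
      unfolding h_def[abs_def] by (intro bounded_measurable_diff g test_function_bounded_measurable[OF \<phi>(1)])+
    have i: "integrable K f" if "K \<in> {P, N, R}" "bounded_measurable (cyl T) f" for K f
      using integrable_bounded_measurable[OF fam[OF that(1)] that(2)] .
    have h1: "(LINT z|K. \<bar>h z\<bar>) \<le> e * (m K + 1)" if K: "K \<in> {P, N, R}" for K
    proof -
      interpret finite_measure K by (rule fam(1)[OF K])
      have sp: "space K = space (cyl T)" by (rule sets_eq_imp_space_eq[OF fam(2)[OF K]])
      \<comment> \<open>The weighted inequality |h| \<le> e + h^2 / e replaces Cauchy-Schwarz; with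
        an L2 error below e^2 both summands are of order e.\<close>
      have "(LINT z|K. \<bar>h z\<bar>) \<le> (LINT z|K. e + 1 / e * (h z)\<^sup>2)"
      proof (rule integral_mono)
        show "integrable K (\<lambda>z. \<bar>h z\<bar>)" using i[OF K bm(2)] by simp
        show "integrable K (\<lambda>z. e + 1 / e * (h z)\<^sup>2)" using i[OF K bounded_measurable_power2[OF bm(2)]] by simp
        fix z
        have "0 \<le> (\<bar>h z\<bar> - e)\<^sup>2 + e * \<bar>h z\<bar>" using e by simp
        then have "e * \<bar>h z\<bar> \<le> e * (e + 1 / e * (h z)\<^sup>2)" using e by (simp add: power2_eq_square algebra_simps)
        then show "\<bar>h z\<bar> \<le> e + 1 / e * (h z)\<^sup>2" using e by simp
      qed
      also have "... = e * m K + 1 / e * (LINT z|K. (h z)\<^sup>2)"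
        using i[OF K bounded_measurable_power2[OF bm(2)]] by (simp add: m_def sp mult.commute)
      also have "... \<le> e * m K + 1 / e * e\<^sup>2"
        using \<phi>(2)[OF K] e by (intro add_left_mono mult_left_mono) (auto simp: h_def)
      also have "... = e * (m K + 1)" using e by (simp add: power2_eq_square algebra_simps)
      finally show ?thesis .
    qed
    have "signed_integral (cyl T) \<mu> g - signed_integral (cyl T) \<mu> \<phi> = signed_integral (cyl T) \<mu> h"
      unfolding h_def[abs_def] by (rule bounded_functional_diff[OF bounded_functional_signed_integral[OF \<mu>] g bm(1), symmetric])
    also have "... \<le> \<bar>LINT z|P. h z\<bar> + \<bar>LINT z|N. h z\<bar>"
      unfolding signed_integral_def P_def N_def by linarith
    also have "... \<le> (LINT z|P. \<bar>h z\<bar>) + (LINT z|N. \<bar>h z\<bar>)" by (intro add_mono integral_abs_bound)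
    also have "... \<le> e * (m P + 1) + e * (m N + 1)" by (intro add_mono h1) auto
    finally have s: "signed_integral (cyl T) \<mu> g - signed_integral (cyl T) \<mu> \<phi> \<le> e * (m P + 1) + e * (m N + 1)" .
    have "(LINT z|R. (\<phi> z)\<^sup>2) - (LINT z|R. (g z)\<^sup>2) = (LINT z|R. (\<phi> z)\<^sup>2 - (g z)\<^sup>2)"
      by (rule Bochner_Integration.integral_diff[symmetric]) (auto intro!: i bounded_measurable_power2 bm g)
    also have "... \<le> (LINT z|R. 2 * B * \<bar>h z\<bar> + (h z)\<^sup>2)"
    proof (rule integral_mono)
      show "integrable R (\<lambda>z. (\<phi> z)\<^sup>2 - (g z)\<^sup>2)"
        by (intro i bounded_measurable_diff bounded_measurable_power2 bm g) auto
      show "integrable R (\<lambda>z. 2 * B * \<bar>h z\<bar> + (h z)\<^sup>2)"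
        using i[OF _ bm(2), of R] i[OF _ bounded_measurable_power2[OF bm(2)], of R] by simp
      fix z assume "z \<in> space R"
      then have gB: "\<bar>g z\<bar> \<le> B" using B sets_eq_imp_space_eq[OF R(2)] by simp
      have "(\<phi> z)\<^sup>2 - (g z)\<^sup>2 = (h z)\<^sup>2 - 2 * g z * h z" unfolding h_def by (simp add: power2_eq_square algebra_simps)
      moreover have "- (2 * g z * h z) \<le> 2 * (\<bar>g z\<bar> * \<bar>h z\<bar>)" using abs_ge_minus_self[of "2 * g z * h z"] by (simp add: abs_mult)
      moreover have "\<bar>g z\<bar> * \<bar>h z\<bar> \<le> B * \<bar>h z\<bar>" using gB by (intro mult_right_mono) auto
      ultimately show "(\<phi> z)\<^sup>2 - (g z)\<^sup>2 \<le> 2 * B * \<bar>h z\<bar> + (h z)\<^sup>2" by simp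
    qed
    also have "... = 2 * B * (LINT z|R. \<bar>h z\<bar>) + (LINT z|R. (h z)\<^sup>2)"
      using i[OF _ bm(2), of R] i[OF _ bounded_measurable_power2[OF bm(2)], of R] by simp
    also have "... \<le> 2 * B * (e * (m R + 1)) + e * 1"
    proof (intro add_mono mult_left_mono h1)
      have "(LINT z|R. (h z)\<^sup>2) \<le> e * e" using \<phi>(2)[of R] by (simp add: h_def power2_eq_square)
      also have "... \<le> e * 1" using e by (intro mult_left_mono) auto
      finally show "(LINT z|R. (h z)\<^sup>2) \<le> e * 1" .
    qed (use B in auto)
    finally have r: "(LINT z|R. (\<phi> z)\<^sup>2) - (LINT z|R. (g z)\<^sup>2) \<le> e * (2 * B * (m R + 1) + 1)"
      by (simp add: algebra_simps)
    have "a * (LINT z|R. (\<phi> z)\<^sup>2) - a * (LINT z|R. (g z)\<^sup>2) \<le> a * (e * (2 * B * (m R + 1) + 1))"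
      using mult_left_mono[OF r a] by (simp add: right_diff_distrib)
    then show ?thesis using s le[OF \<phi>(1)] unfolding C_def by (simp add: algebra_simps)
  qed
  show ?thesis
  proof (rule field_le_epsilon)
    fix d :: real assume d: "d > 0"
    have "signed_integral (cyl T) \<mu> g - a * (LINT z|R. (g z)\<^sup>2) \<le> M + C * min 1 (d / C)"
      using d C by (intro main) auto
    also have "C * min 1 (d / C) \<le> C * (d / C)" using C by (intro mult_left_mono) auto
    also have "... = d" using C by simp
    finally show "signed_integral (cyl T) \<mu> g - a * (LINT z|R. (g z)\<^sup>2) \<le> M + d" by simp
  qed
qed

text \<open>Tested with c times the indicator of an R-null set, the quadratic term vanishes while
  the linear one is c \<mu> A. It is bounded in c of either sign, so \<mu> A = 0.\<close>

lemma duality_ac: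
  assumes \<mu>: "vector_measure (cyl T) \<mu>" and R: "finite_measure R" "sets R = sets (cyl T)" and a: "a \<ge> 0"
    and le: "\<And>\<phi>. test_function T \<phi> \<Longrightarrow> signed_integral (cyl T) \<mu> \<phi> - a * (LINT z|R. (\<phi> z)\<^sup>2) \<le> M"
  shows "signed_ac R \<mu>"
  unfolding signed_ac_def
proof
  fix A assume A: "A \<in> null_sets R"
  then have As: "A \<in> sets (cyl T)" using R by auto
  have *: "c * \<mu> A \<le> M" for c
  proof -
    have "signed_integral (cyl T) \<mu> (\<lambda>z. c * indicator A z) - a * (LINT z|R. (c * indicator A z)\<^sup>2) \<le> M"
      by (rule duality_extend[OF \<mu> R a le]) (assumption, intro bounded_measurable_scale bounded_measurable_indicator As)
    moreover have "(LINT z|R. (c * indicator A z)\<^sup>2) = 0"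
      by (rule integral_eq_zero_AE, rule eventually_mono[OF AE_not_in[OF A]]) simp
    moreover have "signed_integral (cyl T) \<mu> (\<lambda>z. c * indicator A z) = c * \<mu> A"
      using bounded_functional_scale[OF bounded_functional_signed_integral[OF \<mu>] bounded_measurable_indicator[OF As]]
        signed_integral_indicator[OF \<mu> As] by simp
    ultimately show ?thesis by simp
  qed
  show "\<mu> A = 0"
  proof (rule ccontr)
    assume n: "\<mu> A \<noteq> 0"
    \<comment> \<open>This choice of c yields M + 1 \<le> M.\<close>
    have "(M + 1) / \<mu> A * \<mu> A \<le> M" by (rule *)
    then show False using n by simp
  qed
qed

text \<open>The pointwise maximiser of s f - a s^2 is s = f / (2 a), with value f^2 / (4 a). It is
  tested after truncation at height n, and Fatou's lemma removes the truncation.\<close>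

lemma duality_density:
  assumes \<mu>: "vector_measure (cyl T) \<mu>" and R: "finite_measure R" "sets R = sets (cyl T)" and a: "a > 0"
    and le: "\<And>\<phi>. test_function T \<phi> \<Longrightarrow> signed_integral (cyl T) \<mu> \<phi> - a * (LINT z|R. (\<phi> z)\<^sup>2) \<le> M"
    and f: "integrable R f" "\<And>A. A \<in> sets (cyl T) \<Longrightarrow> \<mu> A = (LINT z|R. indicator A z * f z)"
  shows "(\<integral>\<^sup>+z. ennreal ((f z)\<^sup>2) \<partial>R) \<le> ennreal (4 * a * M)"
proof -
  define F where "F n z = (if \<bar>f z\<bar> \<le> real n then f z else 0)" for n :: nat and z
  have fm: "f \<in> borel_measurable (cyl T)" using f(1) measurable_cong_sets[OF R(2) refl] by blast
  have Fm: "F n \<in> borel_measurable (cyl T)" for n unfolding F_def using fm by measurable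
  have FB: "\<bar>F n z\<bar> \<le> real n" for n z by (simp add: F_def)
  have Fb: "bounded_measurable (cyl T) (F n)" for n by (rule bounded_measurableI[OF Fm FB])
  have Fi: "integrable R (\<lambda>z. (F n z)\<^sup>2)" for n
    by (rule integrable_bounded_measurable[OF R bounded_measurable_power2[OF Fb]])
  have bound: "(LINT z|R. (F n z)\<^sup>2) \<le> 4 * a * M" for n
  proof -
    have "signed_integral (cyl T) \<mu> (\<lambda>z. 1 / (2 * a) * F n z) - a * (LINT z|R. (1 / (2 * a) * F n z)\<^sup>2) \<le> M"
      by (rule duality_extend[OF \<mu> R less_imp_le[OF a] le]) (assumption, intro bounded_measurable_scale Fb)
    moreover have "signed_integral (cyl T) \<mu> (\<lambda>z. 1 / (2 * a) * F n z) = (LINT z|R. (1 / (2 * a) * F n z) * f z)"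
      by (rule signed_integral_density[OF f(1) R(2) f(2)]) (assumption, rule bounded_measurable_scale[OF Fb])
    moreover have "(LINT z|R. (1 / (2 * a) * F n z) * f z) = (LINT z|R. 1 / (2 * a) * (F n z)\<^sup>2)"
      by (intro Bochner_Integration.integral_cong) (auto simp: F_def power2_eq_square)
    moreover have "(LINT z|R. (1 / (2 * a) * F n z)\<^sup>2) = (1 / (2 * a))\<^sup>2 * (LINT z|R. (F n z)\<^sup>2)"
      by (simp only: power_mult_distrib Bochner_Integration.integral_mult_right_zero)
    ultimately have "1 / (2 * a) * (LINT z|R. (F n z)\<^sup>2) - a * ((1 / (2 * a))\<^sup>2 * (LINT z|R. (F n z)\<^sup>2)) \<le> M" using a by simp
    moreover have "1 / (2 * a) * X - a * ((1 / (2 * a))\<^sup>2 * X) = X / (4 * a)" for X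
      using a by (simp add: field_simps power2_eq_square)
    ultimately have "(LINT z|R. (F n z)\<^sup>2) / (4 * a) \<le> M" by simp
    then show ?thesis using a by (simp add: field_simps)
  qed
  have "(\<integral>\<^sup>+z. ennreal ((f z)\<^sup>2) \<partial>R) = (\<integral>\<^sup>+z. liminf (\<lambda>n. ennreal ((F n z)\<^sup>2)) \<partial>R)"
  proof (rule nn_integral_cong)
    fix z
    obtain k where k: "\<bar>f z\<bar> \<le> real k" using real_arch_simple by blast
    have "eventually (\<lambda>n. ennreal ((F n z)\<^sup>2) = ennreal ((f z)\<^sup>2)) sequentially"
      using eventually_ge_at_top[of k] by eventually_elim (use k in \<open>auto simp: F_def\<close>)
    then have "(\<lambda>n. ennreal ((F n z)\<^sup>2)) \<longlonglongrightarrow> ennreal ((f z)\<^sup>2)" by (rule tendsto_eventually)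
    then show "ennreal ((f z)\<^sup>2) = liminf (\<lambda>n. ennreal ((F n z)\<^sup>2))"
      using lim_imp_Liminf[OF sequentially_bot] by metis
  qed
  also have "... \<le> liminf (\<lambda>n. \<integral>\<^sup>+z. ennreal ((F n z)\<^sup>2) \<partial>R)"
  proof (rule nn_integral_liminf)
    show "(\<lambda>z. ennreal ((F n z)\<^sup>2)) \<in> borel_measurable R" for n using Fi[of n] by auto
  qed
  also have "... \<le> liminf (\<lambda>n. ennreal (4 * a * M))"
  proof (rule Liminf_mono, rule always_eventually, rule allI)
    fix n show "(\<integral>\<^sup>+z. ennreal ((F n z)\<^sup>2) \<partial>R) \<le> ennreal (4 * a * M)"
      using bound[of n] by (subst nn_integral_eq_integral[OF Fi]) (auto intro: ennreal_leI)
  qed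
  finally show ?thesis by (simp add: Liminf_const)
qed

text \<open>The difference of the two measures annihilates test functions;
  \<open>duality_extend\<close> with a = 0 and M = 0 carries this to indicators, and exchanging the
  measures gives the reverse inequality.\<close>

lemma vector_measure_unique:
  assumes \<mu>: "vector_measure (cyl T) \<mu>" and \<nu>: "vector_measure (cyl T) \<nu>"
    and eq: "\<And>\<phi>. test_function T \<phi> \<Longrightarrow> signed_integral (cyl T) \<mu> \<phi> = signed_integral (cyl T) \<nu> \<phi>"
    and A: "A \<in> sets (cyl T)"
  shows "\<mu> A = \<nu> A"
proof -
  have *: "\<mu> A \<le> \<nu> A" if \<mu>: "vector_measure (cyl T) \<mu>" and \<nu>: "vector_measure (cyl T) \<nu>"
    and eq: "\<And>\<phi>. test_function T \<phi> \<Longrightarrow> signed_integral (cyl T) \<mu> \<phi> = signed_integral (cyl T) \<nu> \<phi>" for \<mu> \<nu>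
  proof -
    let ?d = "\<lambda>A. 1 * \<mu> A + (-1) * \<nu> A"
    have d: "vector_measure (cyl T) ?d" by (rule vector_measure_lincomb[OF \<mu> \<nu>])
    have "signed_integral (cyl T) ?d (indicator A) - 0 * (LINT z|pos_part (cyl T) \<mu>. (indicator A z)\<^sup>2) \<le> 0"
    proof (rule duality_extend[OF d finite_measure_pos_part[OF \<mu>]])
      fix \<phi> assume "test_function T \<phi>"
      then show "signed_integral (cyl T) ?d \<phi> - 0 * (LINT z|pos_part (cyl T) \<mu>. (\<phi> z)\<^sup>2) \<le> 0"
        using signed_integral_lincomb[OF \<mu> \<nu> test_function_bounded_measurable, of \<phi> 1 "-1"] eq by simp
    qed (auto intro: bounded_measurable_indicator A)
    then show ?thesis using signed_integral_indicator[OF d A] by simp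
  qed
  show ?thesis using *[OF \<mu> \<nu> eq] *[OF \<nu> \<mu>] eq by (simp add: antisym)
qed

section \<open>Slices of the velocity-jump process\<close>

lemma vector_measure_measure:
  assumes "finite_measure N" "sets N = sets M"
  shows "vector_measure M (measure N)"
  unfolding vector_measure_def using finite_measure.finite_measure_UNION[OF assms(1)] assms(2) by auto

lemma signed_integral_measure:
  assumes "finite_measure N" "sets N = sets M" "bounded_measurable M f"
  shows "signed_integral M (measure N) f = (LINT x|N. f x)"
proof (rule signed_integral_eqI[OF vector_measure_measure[OF assms(1,2)] bounded_functional_integral[OF assms(1,2)] _ assms(3)])
  fix A assume A: "A \<in> sets M"
  then have "A \<inter> space N = A" using assms(2) sets.Int_space_eq2 by metis
  then show "(LINT x|N. indicator A x) = measure N A" by simp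
qed

lemma tv_norm_leI:
  fixes \<nu> :: "'a set \<Rightarrow> real"
  assumes Q: "finite_measure P" "sets P = sets M" "finite_measure Q" "sets Q = sets M"
    and le: "\<And>A. A \<in> sets M \<Longrightarrow> \<bar>\<nu> A\<bar> \<le> c * (measure P A + measure Q A)" and c: "c \<ge> 0"
  shows "tv_norm M \<nu> \<le> ennreal (c * (measure P (space M) + measure Q (space M)))"
  unfolding tv_norm_def
proof (rule SUP_least)
  fix S assume "S \<in> {P. finite P \<and> P \<subseteq> sets M \<and> disjoint P}"
  then have S: "finite S" "S \<subseteq> sets M" "disjoint S" by auto
  have *: "(\<Sum>A\<in>S. measure K A) \<le> measure K (space M)" if "finite_measure K" "sets K = sets M" for K
    using that S by (intro sum_measure_le) (auto simp: disjoint_family_on_def disjoint_def)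
  have "(\<Sum>A\<in>S. \<bar>\<nu> A\<bar>) \<le> (\<Sum>A\<in>S. c * (measure P A + measure Q A))" using S le by (intro sum_mono) auto
  also have "... = c * ((\<Sum>A\<in>S. measure P A) + (\<Sum>A\<in>S. measure Q A))"
    by (simp add: sum_distrib_left[symmetric] sum.distrib)
  also have "... \<le> c * (measure P (space M) + measure Q (space M))"
    using c by (intro mult_left_mono add_mono * Q)
  finally have "(\<Sum>A\<in>S. \<bar>\<nu> A\<bar>) \<le> c * (measure P (space M) + measure Q (space M))" .
  then show "(\<Sum>A\<in>S. ennreal (norm (\<nu> A))) \<le> ennreal (c * (measure P (space M) + measure Q (space M)))"
    by (simp add: sum_ennreal ennreal_leI)
qed

text \<open>The first velocity moment scaled by c. Momentum is the case c = V for \<sigma>, and the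
  rescaled jump flux the case c = 1 / V for the second flux component.\<close>

definition velocity_slice :: "real \<Rightarrow> (omega1 set \<Rightarrow> real) \<Rightarrow> circle set \<Rightarrow> real"
  where "velocity_slice c \<nu> B = c * (\<nu> (B \<times> {True}) - \<nu> (B \<times> {False}))"

lemma momentum_slice_eq: "momentum_slice V \<sigma> t = velocity_slice V (measure (\<sigma> t))"
  by (auto simp: momentum_slice_def velocity_slice_def vel_def UNIV_bool fun_eq_iff)

lemma jump_slice_eq: "jump_slice V j t = velocity_slice (1 / V) (\<lambda>A. snd (j t A))"
  by (auto simp: jump_slice_def velocity_slice_def vel_def UNIV_bool fun_eq_iff right_diff_distrib)

lemma sets_circle_times_bool: "B \<in> sets borel \<Longrightarrow> B \<times> S \<in> sets (borel :: omega1 measure)" for B :: "circle set"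
  unfolding borel_prod[symmetric] by (intro pair_measureI) (auto simp: sets_borel_eq_count_space)

lemma measurable_fst_omega1: "fst \<in> measurable (borel :: omega1 measure) borel"
  unfolding borel_prod[symmetric] by simp

lemma vel_cases: "vel v = 1 \<or> vel v = - 1" "\<bar>vel v\<bar> = 1" "(vel v)\<^sup>2 = 1"
  by (auto simp: vel_def)

lemma bounded_measurable_vel: "bounded_measurable (borel :: omega1 measure) (\<lambda>z. vel (snd z))"
proof (rule bounded_measurableI[where B = 1])
  have "continuous_on UNIV (\<lambda>z :: omega1. vel (snd z))"
    by (rule continuous_on_compose2[of UNIV vel _ snd]) (auto intro: continuous_intros)
  then show "(\<lambda>z. vel (snd z)) \<in> borel_measurable (borel :: omega1 measure)" by (rule borel_measurable_continuous_onI)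
qed (simp add: vel_cases)

lemma bounded_measurable_fst:
  assumes "bounded_measurable borel g"
  shows "bounded_measurable (borel :: omega1 measure) (\<lambda>z. g (fst z))"
proof -
  obtain B where "\<And>x. \<bar>g x\<bar> \<le> B" using bounded_measurable_bound[OF assms] by auto
  then show ?thesis
    using measurable_compose[OF measurable_fst_omega1 bounded_measurableD[OF assms]]
    by (intro bounded_measurableI[where B = B]) auto
qed

context
  fixes \<nu> :: "omega1 set \<Rightarrow> real"
  assumes \<nu>: "vector_measure borel \<nu>"
begin

lemma velocity_slice_functional:
  "bounded_functional borel (\<lambda>g. c * signed_integral borel \<nu> (\<lambda>z. vel (snd z) * g (fst z)))"
proof -
  note bf = bounded_functional_signed_integral[OF \<nu>]
  have bm: "bounded_measurable borel (\<lambda>z. vel (snd z) * g (fst z))" if "bounded_measurable borel g" for g :: "circle \<Rightarrow> real"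
    using that by (intro bounded_measurable_mult bounded_measurable_vel bounded_measurable_fst)
  have "bounded_functional borel (\<lambda>g. signed_integral borel \<nu> (\<lambda>z. vel (snd z) * g (fst z)))"
  proof (rule bounded_functionalI[where K = "mass borel \<nu>"])
    fix f g :: "circle \<Rightarrow> real" assume fg: "bounded_measurable borel f" "bounded_measurable borel g"
    show "signed_integral borel \<nu> (\<lambda>z. vel (snd z) * (f (fst z) + g (fst z)))
      = signed_integral borel \<nu> (\<lambda>z. vel (snd z) * f (fst z)) + signed_integral borel \<nu> (\<lambda>z. vel (snd z) * g (fst z))"
      using bounded_functional_add[OF bf bm[OF fg(1)] bm[OF fg(2)]] by (simp add: distrib_left)
  next
    fix c and f :: "circle \<Rightarrow> real" assume f: "bounded_measurable borel f"
    show "signed_integral borel \<nu> (\<lambda>z. vel (snd z) * (c * f (fst z))) = c * signed_integral borel \<nu> (\<lambda>z. vel (snd z) * f (fst z))"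
      using bounded_functional_scale[OF bf bm[OF f], of c] by (simp add: mult.left_commute)
  next
    fix f :: "circle \<Rightarrow> real" and e assume f: "bounded_measurable borel f" "\<And>x. x \<in> space borel \<Longrightarrow> \<bar>f x\<bar> \<le> e"
    show "\<bar>signed_integral borel \<nu> (\<lambda>z. vel (snd z) * f (fst z))\<bar> \<le> mass borel \<nu> * e"
      using signed_integral_le_mass[OF \<nu> bm[OF f(1)], of e] f(2) by (simp add: abs_mult vel_cases mult.commute)
  qed
  from bounded_functional_combine[OF this this, of c 0] show ?thesis by simp
qed

lemma velocity_slice_indicator:
  assumes B: "B \<in> sets borel"
  shows "c * signed_integral borel \<nu> (\<lambda>z. vel (snd z) * indicator B (fst z)) = velocity_slice c \<nu> B"
proof -
  have "(\<lambda>z :: omega1. vel (snd z) * indicator B (fst z)) = (\<lambda>z. indicator (B \<times> {True}) z - indicator (B \<times> {False}) z)"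
    by (auto simp: vel_def indicator_def fun_eq_iff)
  then have "signed_integral borel \<nu> (\<lambda>z. vel (snd z) * indicator B (fst z)) = \<nu> (B \<times> {True}) - \<nu> (B \<times> {False})"
    using B by (simp add: bounded_functional_diff[OF bounded_functional_signed_integral[OF \<nu>]]
        bounded_measurable_indicator sets_circle_times_bool signed_integral_indicator[OF \<nu>])
  then show ?thesis by (simp add: velocity_slice_def)
qed

lemma vector_measure_velocity_slice: "vector_measure borel (velocity_slice c \<nu>)"
  unfolding vector_measure_def
proof (intro conjI allI impI)
  fix A :: "nat \<Rightarrow> circle set" assume A: "range A \<subseteq> sets borel" "disjoint_family A"
  have "(\<lambda>i. \<nu> (A i \<times> {v})) sums \<nu> (\<Union>i. A i \<times> {v})" for v
    using A by (intro vector_measure_sums[OF \<nu>]) (auto simp: disjoint_family_on_def intro!: sets_circle_times_bool)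
  moreover have "(\<Union>i. A i \<times> {v}) = (\<Union>i. A i) \<times> {v}" for v :: bool by auto
  ultimately show "(\<lambda>i. velocity_slice c \<nu> (A i)) sums velocity_slice c \<nu> (\<Union>i. A i)"
    unfolding velocity_slice_def by (intro sums_mult sums_diff) auto
qed (simp add: velocity_slice_def vector_measure_empty[OF \<nu>])

lemma signed_integral_velocity_slice:
  assumes "bounded_measurable borel g"
  shows "signed_integral borel (velocity_slice c \<nu>) g = c * signed_integral borel \<nu> (\<lambda>z. vel (snd z) * g (fst z))"
  by (rule signed_integral_eqI[OF vector_measure_velocity_slice velocity_slice_functional velocity_slice_indicator assms])

lemma tv_norm_velocity_slice:
  "tv_norm borel (velocity_slice c \<nu>) \<le> ennreal (\<bar>c\<bar> * mass borel \<nu>)"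
proof -
  let ?P = "pos_part borel \<nu>" and ?N = "neg_part borel \<nu>"
  have m: "fst \<in> measurable ?P (borel :: circle measure)" "fst \<in> measurable ?N (borel :: circle measure)"
    using measurable_fst_omega1 measurable_cong_sets[OF sets_pos_part refl] measurable_cong_sets[OF sets_neg_part refl] by blast+
  have "tv_norm borel (velocity_slice c \<nu>) \<le> ennreal (\<bar>c\<bar> * (measure (distr ?P borel fst) (space borel) + measure (distr ?N borel fst) (space borel)))"
  proof (rule tv_norm_leI)
    fix B :: "circle set" assume B: "B \<in> sets borel"
    have split: "measure (distr K borel fst) B = measure K (B \<times> {True}) + measure K (B \<times> {False})"
      if K: "finite_measure K" "sets K = sets (borel :: omega1 measure)" for K :: "omega1 measure"
    proof -
      interpret finite_measure K by fact
      have "fst \<in> measurable K (borel :: circle measure)"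
        using measurable_fst_omega1 measurable_cong_sets[OF K(2) refl] by blast
      then have "measure (distr K borel fst) B = measure K (fst -` B \<inter> space K)" using B by (intro measure_distr)
      also have "fst -` B \<inter> space K = B \<times> {True} \<union> B \<times> {False}" using sets_eq_imp_space_eq[OF K(2)] by auto
      also have "measure K ... = measure K (B \<times> {True}) + measure K (B \<times> {False})"
        using B K by (intro finite_measure_Union) (auto intro!: sets_circle_times_bool)
      finally show ?thesis .
    qed
    have J: "\<bar>\<nu> (B \<times> {v})\<bar> \<le> measure ?P (B \<times> {v}) + measure ?N (B \<times> {v})" for v
      using jordan_decomposition[OF \<nu> sets_circle_times_bool[OF B], of "{v}"]
        measure_nonneg[of ?P "B \<times> {v}"] measure_nonneg[of ?N "B \<times> {v}"] by linarith
    have "\<bar>velocity_slice c \<nu> B\<bar> = \<bar>c\<bar> * \<bar>\<nu> (B \<times> {True}) - \<nu> (B \<times> {False})\<bar>" by (simp add: velocity_slice_def abs_mult)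
    also have "... \<le> \<bar>c\<bar> * (measure (distr ?P borel fst) B + measure (distr ?N borel fst) B)"
      unfolding split[OF finite_measure_pos_part[OF \<nu>] sets_pos_part] split[OF finite_measure_neg_part[OF \<nu>] sets_neg_part]
      using J[of True] J[of False] by (intro mult_left_mono) linarith+
    finally show "\<bar>velocity_slice c \<nu> B\<bar> \<le> \<bar>c\<bar> * (measure (distr ?P borel fst) B + measure (distr ?N borel fst) B)" .
  qed (use m in \<open>auto intro!: finite_measure.finite_measure_distr finite_measure_pos_part finite_measure_neg_part \<nu>\<close>)
  also have "measure (distr ?P borel fst) (space borel) + measure (distr ?N borel fst) (space borel) = mass borel \<nu>"
    using m by (simp add: mass_def measure_distr)
  finally show ?thesis .
qed

end

lemma integrable_family_component:
  fixes j :: "real \<Rightarrow> 'a::topological_space set \<Rightarrow> real \<times> real"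
  assumes j: "integrable_family T j" and p: "bounded_linear p" "\<And>x. \<bar>p x\<bar> \<le> norm x" "p \<in> borel_measurable borel"
  shows "integrable_family T (\<lambda>t A. p (j t A) :: real)"
  unfolding integrable_family_def
proof (intro conjI ballI)
  fix t assume "t \<in> {0<..<T}"
  then show "vector_measure borel (\<lambda>A. p (j t A))"
    using j p(1) unfolding integrable_family_def by (blast intro: vector_measure_bounded_linear)
next
  fix A :: "'a set" assume "A \<in> sets borel"
  then show "(\<lambda>t. p (j t A)) \<in> borel_measurable (restrict_space borel {0<..<T})"
    using j unfolding integrable_family_def by (intro measurable_compose[OF _ p(3)]) blast
next
  have "tv_norm borel (\<lambda>A. p (j t A)) \<le> tv_norm borel (j t)" for t
    unfolding tv_norm_def using p(2) by (intro SUP_mono') (intro sum_mono ennreal_leI, simp)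
  then have "(\<integral>\<^sup>+t\<in>{0<..<T}. tv_norm borel (\<lambda>A. p (j t A)) \<partial>lborel) \<le> (\<integral>\<^sup>+t\<in>{0<..<T}. tv_norm borel (j t) \<partial>lborel)"
    by (intro nn_integral_mono mult_right_mono) auto
  then show "(\<integral>\<^sup>+t\<in>{0<..<T}. tv_norm borel (\<lambda>A. p (j t A)) \<partial>lborel) < \<infinity>"
    using j unfolding integrable_family_def by (auto intro: le_less_trans)
qed

lemma integrable_family_fst:
  fixes j :: "real \<Rightarrow> 'a::topological_space set \<Rightarrow> real \<times> real"
  shows "integrable_family T j \<Longrightarrow> integrable_family T (\<lambda>t A. fst (j t A))"
  by (rule integrable_family_component[OF _ bounded_linear_fst])
    (auto simp: norm_Pair intro!: borel_measurable_continuous_onI continuous_on_fst[OF continuous_on_id])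

lemma integrable_family_snd:
  fixes j :: "real \<Rightarrow> 'a::topological_space set \<Rightarrow> real \<times> real"
  shows "integrable_family T j \<Longrightarrow> integrable_family T (\<lambda>t A. snd (j t A))"
  by (rule integrable_family_component[OF _ bounded_linear_snd])
    (auto simp: norm_Pair intro!: borel_measurable_continuous_onI continuous_on_snd[OF continuous_on_id])

lemma integrable_family_jump:
  assumes "integrable_family T j" "V \<ge> 1"
  shows "integrable_family T (jump_slice V j)"
  unfolding integrable_family_def jump_slice_eq
proof (intro conjI ballI)
  note js = integrable_family_snd[OF assms(1)]
  note v = integrable_familyD(1)[OF js]
  fix t assume "t \<in> {0<..<T}"
  then show "vector_measure borel (velocity_slice (1 / V) (\<lambda>A. snd (j t A)))"
    by (intro vector_measure_velocity_slice v)
next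
  note js = integrable_family_snd[OF assms(1)]
  fix B :: "circle set" assume "B \<in> sets borel"
  then have "(\<lambda>t. snd (j t (B \<times> {v}))) \<in> borel_measurable (time T)" for v
    by (intro integrable_familyD(2)[OF js] sets_circle_times_bool)
  then show "(\<lambda>t. velocity_slice (1 / V) (\<lambda>A. snd (j t A)) B) \<in> borel_measurable (restrict_space borel {0<..<T})"
    unfolding velocity_slice_def measurable_time_measure[symmetric] by (intro borel_measurable_times borel_measurable_diff) auto
next
  note js = integrable_family_snd[OF assms(1)]
  note v = integrable_familyD(1)[OF js]
  have "(\<integral>\<^sup>+t. tv_norm borel (velocity_slice (1 / V) (\<lambda>A. snd (j t A))) \<partial>time T) \<le> (\<integral>\<^sup>+t. ennreal (mass borel (\<lambda>A. snd (j t A))) \<partial>time T)"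
  proof (rule nn_integral_mono)
    fix t assume "t \<in> space (time T)"
    then have t: "t \<in> {0<..<T}" by simp
    have "tv_norm borel (velocity_slice (1 / V) (\<lambda>A. snd (j t A))) \<le> ennreal (\<bar>1 / V\<bar> * mass borel (\<lambda>A. snd (j t A)))"
      by (rule tv_norm_velocity_slice[OF v[OF t]])
    also have "... \<le> ennreal (mass borel (\<lambda>A. snd (j t A)))"
      using assms(2) mass_nonneg[of borel "\<lambda>A. snd (j t A)"] by (intro ennreal_leI mult_left_le_one_le) auto
    finally show "tv_norm borel (velocity_slice (1 / V) (\<lambda>A. snd (j t A))) \<le> ennreal (mass borel (\<lambda>A. snd (j t A)))" .
  qed
  also have "... < \<infinity>" by (rule integrable_familyD(3)[OF js])
  finally show "(\<integral>\<^sup>+t\<in>{0<..<T}. tv_norm borel (velocity_slice (1 / V) (\<lambda>A. snd (j t A))) \<partial>lborel) < \<infinity>"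
    unfolding set_nn_integral_time .
qed

lemma mass_prob_space:
  assumes "prob_space N" "sets N = sets M"
  shows "mass M (measure N) = 1"
proof -
  interpret prob_space N by fact
  have v: "vector_measure M (measure N)" by (rule vector_measure_measure[OF finite_measure_axioms assms(2)])
  have sp: "space M = space N" using sets_eq_imp_space_eq[OF assms(2)] by simp
  have "pos_val M (\<lambda>A. - measure N A) (space M) \<le> 0" by (rule pos_val_least) simp
  then have "measure (neg_part M (measure N)) (space M) = 0"
    using measure_neg_part[OF v sets.top] measure_nonneg[of "neg_part M (measure N)" "space M"] by linarith
  then show ?thesis
    unfolding mass_def using jordan_decomposition[OF v sets.top] prob_space sp by simp
qed

lemma integrable_family_momentum:
  assumes \<sigma>: "narrow_curve T \<sigma>" and V: "V \<ge> 1"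
  shows "integrable_family T (momentum_slice V \<sigma>)"
  unfolding integrable_family_def momentum_slice_eq
proof (intro conjI ballI)
  fix t assume "t \<in> {0<..<T}"
  then have t: "t \<in> {0..T}" by auto
  show "vector_measure borel (velocity_slice V (measure (\<sigma> t)))"
    by (intro vector_measure_velocity_slice vector_measure_measure narrow_curveD(2)[OF \<sigma> t]
        prob_space.finite_measure narrow_curveD(1)[OF \<sigma> t])
next
  fix B :: "circle set" assume "B \<in> sets borel"
  then have "(\<lambda>t. emeasure (\<sigma> t) (B \<times> {v})) \<in> borel_measurable (time T)" for v
    by (intro measurable_compose[OF narrow_curve_kernel_omega1[OF \<sigma>] measurable_emeasure_subprob_algebra] sets_circle_times_bool)
  then have "(\<lambda>t. measure (\<sigma> t) (B \<times> {v})) \<in> borel_measurable (time T)" for v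
    unfolding measure_def by (rule borel_measurable_enn2real)
  then show "(\<lambda>t. velocity_slice V (measure (\<sigma> t)) B) \<in> borel_measurable (restrict_space borel {0<..<T})"
    unfolding velocity_slice_def measurable_time_measure[symmetric] by (intro borel_measurable_times borel_measurable_diff) auto
next
  have "(\<integral>\<^sup>+t. tv_norm borel (velocity_slice V (measure (\<sigma> t))) \<partial>time T) \<le> (\<integral>\<^sup>+t. ennreal V \<partial>time T)"
  proof (rule nn_integral_mono)
    fix t assume "t \<in> space (time T)"
    then have t: "t \<in> {0..T}" by auto
    have "tv_norm borel (velocity_slice V (measure (\<sigma> t))) \<le> ennreal (\<bar>V\<bar> * mass borel (measure (\<sigma> t)))"
      by (intro tv_norm_velocity_slice vector_measure_measure narrow_curveD(2)[OF \<sigma> t]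
          prob_space.finite_measure narrow_curveD(1)[OF \<sigma> t])
    then show "tv_norm borel (velocity_slice V (measure (\<sigma> t))) \<le> ennreal V"
      using mass_prob_space[OF narrow_curveD(1,2)[OF \<sigma> t]] V by simp
  qed
  also have "... < \<infinity>" by (cases "T \<ge> 0") (simp_all add: emeasure_restrict_space ennreal_mult_less_top)
  finally show "(\<integral>\<^sup>+t\<in>{0<..<T}. tv_norm borel (velocity_slice V (measure (\<sigma> t))) \<partial>lborel) < \<infinity>"
    unfolding set_nn_integral_time .
qed

section \<open>Estimates at fixed velocity\<close>

text \<open>Taylor with remainder of third order; exp b absorbs the factor exp t / 6 at the
  intermediate point t.\<close>

lemma exp_quadratic_bound:
  fixes y b :: real
  assumes "\<bar>y\<bar> \<le> b"
  shows "exp y - 1 \<le> y + y\<^sup>2 / 2 + exp b * \<bar>y\<bar> ^ 3"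
proof -
  obtain t where t: "\<bar>t\<bar> \<le> \<bar>y\<bar>" "exp y = (\<Sum>m<3. (y ^ m) / fact m) + (exp t / fact 3) * y ^ 3"
    using Maclaurin_exp_le[of y 3] by blast
  have "(exp t / fact 3) * y ^ 3 \<le> (exp t / fact 3) * \<bar>y\<bar> ^ 3"
    by (intro mult_left_mono) (simp_all add: power_abs[symmetric])
  also have "... \<le> exp b * \<bar>y\<bar> ^ 3"
  proof (rule mult_right_mono)
    have "exp t \<le> exp b" using t(1) assms by simp
    moreover have "exp t / fact 3 \<le> exp t / 1" by (intro divide_left_mono) auto
    ultimately show "exp t / fact 3 \<le> exp b" by linarith
  qed simp
  finally show ?thesis unfolding t(2) by (simp add: numeral_3_eq_3 power2_eq_square)
qed

lemma integral_scale_measure_bounded: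
  assumes N: "finite_measure N" and c: "c \<ge> 0" and f: "bounded_measurable N f"
  shows "(LINT x|scale_measure (ennreal c) N. f x) = c * (LINT x|N. f x)"
proof (rule bounded_functional_eqI[of N "\<lambda>f. \<integral>x. f x \<partial>scale_measure (ennreal c) N" "\<lambda>f. c * (LINT x|N. f x)"])
  interpret finite_measure N by fact
  have fin: "finite_measure (scale_measure (ennreal c) N)"
    by (rule finite_measureI) (simp add: space_scale_measure ennreal_mult_eq_top_iff)
  show "bounded_functional N (\<lambda>f. LINT x|scale_measure (ennreal c) N. f x)"
    by (rule bounded_functional_integral[OF fin]) simp
  show "bounded_functional N (\<lambda>f. c * (LINT x|N. f x))"
    using bounded_functional_combine[OF bounded_functional_integral[OF N refl] bounded_functional_integral[OF N refl], of c 0] by simp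
  fix A assume A: "A \<in> sets N"
  then show "(LINT x|scale_measure (ennreal c) N. indicator A x) = c * (LINT x|N. indicator A x)"
    using c sets.Int_space_eq2[OF A] by (simp add: space_scale_measure measure_def enn2real_mult)
qed (rule f)

lemma integral_density_slice:
  fixes g :: "circle \<Rightarrow> real"
  assumes "narrow_curve T \<sigma>" "t \<in> {0..T}" "g \<in> borel_measurable borel"
  shows "(LINT x|density_slice \<sigma> t. g x) = (LINT z|\<sigma> t. g (fst z))"
  unfolding density_slice_def
proof (rule integral_distr[OF _ assms(3)])
  show "fst \<in> measurable (\<sigma> t) borel"
    using measurable_fst_omega1 measurable_cong_sets[OF narrow_curveD(2)[OF assms(1,2)] refl] by blast
qed

lemma signed_integral_bounded_convergence:
  assumes \<nu>: "vector_measure M \<nu>" and f: "bounded_measurable M f"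
    and F: "\<And>n. bounded_measurable M (F n)" "\<And>n x. x \<in> space M \<Longrightarrow> \<bar>F n x\<bar> \<le> B"
    and lim: "\<And>x. x \<in> space M \<Longrightarrow> (\<lambda>n::nat. F n x) \<longlonglongrightarrow> f x"
  shows "(\<lambda>n. signed_integral M \<nu> (F n)) \<longlonglongrightarrow> signed_integral M \<nu> f"
proof -
  have *: "(\<lambda>n. LINT x|N. F n x) \<longlonglongrightarrow> (LINT x|N. f x)" if N: "finite_measure N" "sets N = sets M" for N
  proof (rule integral_dominated_convergence[where w = "\<lambda>_. B"])
    interpret finite_measure N by fact
    show "f \<in> borel_measurable N" "\<And>n. F n \<in> borel_measurable N"
      using bounded_measurableD[OF f] bounded_measurableD[OF F(1)] measurable_cong_sets[OF N(2) refl] by blast+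
    show "integrable N (\<lambda>_. B)" by simp
    show "AE x in N. norm (F n x) \<le> B" for n using F(2) sets_eq_imp_space_eq[OF N(2)] by (intro AE_I2) auto
    show "AE x in N. (\<lambda>n. F n x) \<longlonglongrightarrow> f x" using lim sets_eq_imp_space_eq[OF N(2)] by (intro AE_I2) auto
  qed
  show ?thesis
    unfolding signed_integral_def
    by (intro tendsto_diff * finite_measure_pos_part finite_measure_neg_part \<nu>) auto
qed

abbreviation (input) "density_measure T \<sigma> \<equiv> curve_measure T (density_slice \<sigma>)"
abbreviation (input) "momentum_measure T V \<sigma> \<equiv> signed_curve_measure T (momentum_slice V \<sigma>)"
abbreviation (input) "jump_measure T V j \<equiv> signed_curve_measure T (jump_slice V j)"

lemma set_integral_subinterval:
  fixes f :: "real \<Rightarrow> real"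
  assumes "0 \<le> s" "t \<le> T"
  shows "(LBINT r:{s<..<t}. f r) = (LINT r|time T. indicator {s<..<t} r * f r)"
proof -
  have "{s<..<t} \<subseteq> {0<..<T}" using assms by auto
  then show ?thesis
    unfolding set_lebesgue_integral_def
    by (subst integral_restrict_space, simp, intro Bochner_Integration.integral_cong) (auto simp: indicator_def)
qed

lemma circle_C1_continuous:
  assumes "circle_C1 g"
  shows "continuous_on UNIV g"
proof (rule continuous_on_circle)
  show "continuous_on UNIV (\<lambda>x. g (abs_circle x))"
    using circle_C1D(1)[OF assms] by (meson DERIV_isCont continuous_at_imp_continuous_on)
qed

lemma circle_C1_bounded:
  assumes "circle_C1 g"
  shows "bounded_measurable borel g" "bounded_measurable borel (circle_deriv g)"
proof -
  note c = circle_C1_continuous[OF assms]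
  obtain B where "\<And>p. \<bar>g p\<bar> \<le> B" using circle_continuous_bounded[OF c] by blast
  then show "bounded_measurable borel g"
    by (intro bounded_measurableI borel_measurable_continuous_onI c)
  obtain B where "\<And>p. \<bar>circle_deriv g p\<bar> \<le> B" using circle_continuous_bounded[OF circle_C1D(2)[OF assms]] by blast
  then show "bounded_measurable borel (circle_deriv g)"
    by (intro bounded_measurableI borel_measurable_continuous_onI circle_C1D(2)[OF assms])
qed

lemma circle_C1_scale:
  assumes "circle_C1 g"
  shows "circle_C1 (\<lambda>x. c * g x)" "circle_deriv (\<lambda>x. c * g x) p = c * circle_deriv g p"
proof -
  have d: "((\<lambda>x. c * g (abs_circle x)) has_real_derivative c * circle_deriv g (abs_circle x)) (at x)" for x
    by (rule DERIV_cmult[OF circle_C1D(1)[OF assms]])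
  have k: "continuous_on UNIV (\<lambda>x. c * circle_deriv g (abs_circle x))"
    by (intro continuous_on_mult_left continuous_on_compose2[OF circle_C1D(2)[OF assms] continuous_abs_circle]) simp
  note * = circle_C1I[of "\<lambda>x. c * g x", OF d k]
  show "circle_C1 (\<lambda>x. c * g x)" by (rule *(1))
  show "circle_deriv (\<lambda>x. c * g x) p = c * circle_deriv g p" by (simp add: *(2))
qed

context
  fixes \<alpha> T V :: real and \<sigma> :: "real \<Rightarrow> omega1 measure" and j :: "real \<Rightarrow> omega1 set \<Rightarrow> real \<times> real"
  assumes \<alpha>: "\<alpha> > 0" and T: "T > 0" and V: "V \<ge> 1" and CE: "CE_omega1 T \<sigma> j"
begin

lemma CE_curve: "narrow_curve T \<sigma>" and CE_family: "integrable_family T j"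
  using CE unfolding CE_omega1_def by auto

lemma CE_prob: "t \<in> {0..T} \<Longrightarrow> prob_space (\<sigma> t)" "t \<in> {0..T} \<Longrightarrow> sets (\<sigma> t) = sets borel"
  by (rule narrow_curveD[OF CE_curve], assumption)+

lemma CE_integrable: "t \<in> {0..T} \<Longrightarrow> bounded_measurable borel f \<Longrightarrow> integrable (\<sigma> t) f"
  by (rule integrable_bounded_measurable[OF prob_space.finite_measure[OF CE_prob(1)] CE_prob(2)])

lemma signed_integral_momentum:
  assumes t: "t \<in> {0..T}" and g: "bounded_measurable borel g"
  shows "signed_integral borel (momentum_slice V \<sigma> t) g = V * (LINT z|\<sigma> t. vel (snd z) * g (fst z))"
proof -
  have fm: "finite_measure (\<sigma> t)" by (rule prob_space.finite_measure[OF CE_prob(1)[OF t]])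
  show ?thesis
    unfolding momentum_slice_eq
      signed_integral_velocity_slice[OF vector_measure_measure[OF fm CE_prob(2)[OF t]] g]
    by (subst signed_integral_measure[OF fm CE_prob(2)[OF t]])
      (auto intro!: bounded_measurable_mult bounded_measurable_vel bounded_measurable_fst g)
qed

lemma signed_integral_jump:
  assumes t: "t \<in> {0<..<T}" and g: "bounded_measurable borel g"
  shows "signed_integral borel (jump_slice V j t) g
    = 1 / V * signed_integral borel (\<lambda>A. snd (j t A)) (\<lambda>z. vel (snd z) * g (fst z))"
  unfolding jump_slice_eq
  by (rule signed_integral_velocity_slice[OF integrable_familyD(1)[OF integrable_family_snd[OF CE_family] t] g])

text \<open>The Young inequality tested with \<open>\<phi>(x, v) = v g(x) / V\<close>; the error comes from the third
  order Taylor term of the exponential.\<close>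
lemma lagrangian_lower:
  assumes t: "t \<in> {0<..<T}" and g: "bounded_measurable borel g" "\<And>x. \<bar>g x\<bar> \<le> B"
  shows "ennreal (signed_integral borel (jump_slice V j t) g
      - 1 / (2 * \<alpha>) * signed_integral borel (momentum_slice V \<sigma> t) g
      - 1 / (4 * \<alpha>) * (LINT x|density_slice \<sigma> t. (g x)\<^sup>2) - exp B * B ^ 3 / (2 * \<alpha> * V))
    \<le> lagrangian \<alpha> V (\<sigma> t) (j t)" (is "ennreal ?lhs \<le> _")
proof (cases "\<forall>A\<in>sets borel. fst (j t A) = set_lebesgue_integral (\<sigma> t) A (\<lambda>(x, v). V * vel v)")
  case True
  have t': "t \<in> {0..T}" using t by auto
  interpret prob_space "\<sigma> t" by (rule CE_prob(1)[OF t'])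
  \<comment> \<open>The total jump rate. With \<phi> of size 1 / V, c \<phi> integrates to the
    momentum term with factor 1 / (2 \<alpha>), c \<phi>^2 / 2 to the term with 1 / (4 \<alpha>),
    and the cubic remainder c / V^3 is of order 1 / V.\<close>
  define c where "c = V\<^sup>2 / (2 * \<alpha>)"
  have c: "c > 0" using V \<alpha> by (simp add: c_def)
  define \<phi> where "\<phi> z = vel (snd z) * (1 / V * g (fst z))" for z :: omega1
  let ?N = "scale_measure (ennreal c) (\<sigma> t)"
  let ?j = "\<lambda>A. snd (j t A)"
  have v: "vector_measure borel ?j" by (rule integrable_familyD(1)[OF integrable_family_snd[OF CE_family] t])
  have s: "sets ?N = sets borel" using CE_prob(2)[OF t'] by simp
  have B0: "B \<ge> 0" using g(2)[of undefined] by linarith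
  have fin: "finite_measure ?N"
    by (rule finite_measureI) (simp add: space_scale_measure emeasure_space_1)
  have bg: "bounded_measurable borel (\<lambda>z :: omega1. g (fst z))" by (rule bounded_measurable_fst[OF g(1)])
  have b\<phi>: "bounded_measurable borel \<phi>"
    unfolding \<phi>_def[abs_def] by (intro bounded_measurable_mult bounded_measurable_vel bounded_measurable_const bg)
  have "ennreal (signed_integral ?N ?j \<phi> - (LINT z|?N. exp (\<phi> z) - 1)) \<le> Ent ?j ?N"
  proof (rule Ent_dual[OF fin])
    show "vector_measure ?N ?j" using v vector_measure_cong[OF s refl] by blast
    show "bounded_measurable ?N \<phi>" using b\<phi> bounded_measurable_cong_sets[OF s] by blast
  qed
  moreover have "?lhs \<le> signed_integral ?N ?j \<phi> - (LINT z|?N. exp (\<phi> z) - 1)"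
  proof -
    have "signed_integral ?N ?j \<phi> = signed_integral borel ?j \<phi>"
      using signed_integral_cong_measure[OF s, of ?j ?j] by simp
    also have "... = signed_integral borel ?j (\<lambda>z. 1 / V * (vel (snd z) * g (fst z)))"
      unfolding \<phi>_def[abs_def] by (simp add: mult.left_commute)
    also have "... = signed_integral borel (jump_slice V j t) g"
      unfolding signed_integral_jump[OF t g(1)]
      by (rule bounded_functional_scale[OF bounded_functional_signed_integral[OF v]])
        (intro bounded_measurable_mult bounded_measurable_vel bg)
    finally have 1: "signed_integral ?N ?j \<phi> = signed_integral borel (jump_slice V j t) g" .
    have bexp: "bounded_measurable borel (\<lambda>z. exp (\<phi> z) - 1)"
      by (intro bounded_measurable_diff bounded_measurable_exp b\<phi> bounded_measurable_const)
    have "(LINT z|?N. exp (\<phi> z) - 1) = c * (LINT z|\<sigma> t. exp (\<phi> z) - 1)"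
      using c bexp bounded_measurable_cong_sets[OF CE_prob(2)[OF t']]
      by (intro integral_scale_measure_bounded[OF finite_measure_axioms]) auto
    also have "... \<le> c * (LINT z|\<sigma> t. \<phi> z + (\<phi> z)\<^sup>2 / 2 + exp B * (B / V) ^ 3)"
    proof (intro mult_left_mono integral_mono)
      show "integrable (\<sigma> t) (\<lambda>z. exp (\<phi> z) - 1)" by (rule CE_integrable[OF t' bexp])
      show "integrable (\<sigma> t) (\<lambda>z. \<phi> z + (\<phi> z)\<^sup>2 / 2 + exp B * (B / V) ^ 3)"
        using CE_integrable[OF t' b\<phi>] CE_integrable[OF t' bounded_measurable_power2[OF b\<phi>]] by simp
      fix z
      have "\<bar>\<phi> z\<bar> = 1 / V * \<bar>g (fst z)\<bar>" using V by (simp add: \<phi>_def abs_mult vel_cases)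
      also have "... \<le> 1 / V * B" using V g(2) by (intro mult_left_mono) auto
      finally have le: "\<bar>\<phi> z\<bar> \<le> B / V" by simp
      also have "B / V \<le> B / 1" using V B0 by (intro divide_left_mono) auto
      finally have "exp (\<phi> z) - 1 \<le> \<phi> z + (\<phi> z)\<^sup>2 / 2 + exp B * \<bar>\<phi> z\<bar> ^ 3"
        by (intro exp_quadratic_bound) simp
      also have "... \<le> \<phi> z + (\<phi> z)\<^sup>2 / 2 + exp B * (B / V) ^ 3"
        using le by (intro add_left_mono mult_left_mono power_mono) auto
      finally show "exp (\<phi> z) - 1 \<le> \<phi> z + (\<phi> z)\<^sup>2 / 2 + exp B * (B / V) ^ 3" .
    qed (use c in simp)
    also have "... = c * (LINT z|\<sigma> t. \<phi> z) + c / 2 * (LINT z|\<sigma> t. (\<phi> z)\<^sup>2) + c * (exp B * (B / V) ^ 3)"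
      using CE_integrable[OF t' b\<phi>] CE_integrable[OF t' bounded_measurable_power2[OF b\<phi>]] prob_space
      by (simp add: algebra_simps)
    also have "(LINT z|\<sigma> t. \<phi> z) = 1 / V * (LINT z|\<sigma> t. vel (snd z) * g (fst z))"
      unfolding \<phi>_def by (simp only: mult.left_commute[of _ "1 / V"] Bochner_Integration.integral_mult_right_zero)
    also have "(LINT z|\<sigma> t. (\<phi> z)\<^sup>2) = 1 / V\<^sup>2 * (LINT x|density_slice \<sigma> t. (g x)\<^sup>2)"
      using integral_density_slice[OF CE_curve t', of "\<lambda>x. (g x)\<^sup>2"] bounded_measurableD[OF bounded_measurable_power2[OF g(1)]]
      by (simp add: \<phi>_def power_mult_distrib vel_cases power_divide)
    also have "c * (1 / V * (LINT z|\<sigma> t. vel (snd z) * g (fst z))) = 1 / (2 * \<alpha>) * signed_integral borel (momentum_slice V \<sigma> t) g"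
      unfolding signed_integral_momentum[OF t' g(1)] c_def using V by (simp add: power2_eq_square)
    also have "c / 2 * (1 / V\<^sup>2 * (LINT x|density_slice \<sigma> t. (g x)\<^sup>2)) = 1 / (4 * \<alpha>) * (LINT x|density_slice \<sigma> t. (g x)\<^sup>2)"
      unfolding c_def using V by simp
    also have "c * (exp B * (B / V) ^ 3) = exp B * B ^ 3 / (2 * \<alpha> * V)"
      unfolding c_def using V by (simp add: power2_eq_square power3_eq_cube)
    finally show ?thesis unfolding 1 by linarith
  qed
  ultimately show ?thesis
    unfolding lagrangian_def c_def using True by (auto intro: order_trans[OF ennreal_leI])
qed (simp only: lagrangian_def if_False infinity_ennreal_def top_greatest)

lemma rate_functional_eq: "rate_functional \<alpha> T V \<sigma> j = (\<integral>\<^sup>+r. lagrangian \<alpha> V (\<sigma> r) (j r) \<partial>time T)"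
  unfolding rate_functional_def using CE by (simp add: set_nn_integral_time)

lemma CE_density_curve: "narrow_curve T (density_slice \<sigma>)"
  by (rule narrow_curve_density_slice[OF CE_curve])

text \<open>\<open>lagrangian_lower\<close> integrated in time; the Fubini formulas turn its three
  slice integrals into integrals against the space-time measures whose narrow limits are
  prescribed.\<close>

lemma rate_functional_lower:
  assumes \<psi>: "bounded_measurable (cyl T) \<psi>" "\<And>z. z \<in> space (cyl T) \<Longrightarrow> \<bar>\<psi> z\<bar> \<le> B"
  shows "ennreal (signed_integral (cyl T) (jump_measure T V j) \<psi>
      - 1 / (2 * \<alpha>) * signed_integral (cyl T) (momentum_measure T V \<sigma>) \<psi>
      - 1 / (4 * \<alpha>) * (LINT z|density_measure T \<sigma>. (\<psi> z)\<^sup>2)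
      - T * (exp B * B ^ 3 / (2 * \<alpha> * V))) \<le> rate_functional \<alpha> T V \<sigma> j"
proof -
  note fj = integrable_family_jump[OF CE_family V]
  note fm = integrable_family_momentum[OF CE_curve V]
  define J where "J t = signed_integral borel (jump_slice V j t) (\<lambda>x. \<psi> (t, x))" for t
  define Q where "Q t = signed_integral borel (momentum_slice V \<sigma> t) (\<lambda>x. \<psi> (t, x))" for t
  define S where "S t = (LINT x|density_slice \<sigma> t. (\<psi> (t, x))\<^sup>2)" for t
  let ?E = "exp B * B ^ 3 / (2 * \<alpha> * V)"
  have i2: "integrable (density_measure T \<sigma>) (\<lambda>z. (\<psi> z)\<^sup>2)"
    by (rule integrable_bounded_measurable[OF finite_curve_measure[OF T CE_density_curve] sets_curve_measure[OF T CE_density_curve]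
          bounded_measurable_power2[OF \<psi>(1)]])
  have iJ: "integrable (time T) J" unfolding J_def
    using family_integral_integrable[OF fj] \<psi>(1) by (simp add: cyl_eq_strip)
  have iQ: "integrable (time T) Q" unfolding Q_def
    using family_integral_integrable[OF fm] \<psi>(1) by (simp add: cyl_eq_strip)
  have iS: "integrable (time T) S" unfolding S_def
    by (rule curve_measure_fubini(2)[OF T CE_density_curve i2])
  have fT: "finite_measure (time T)"
    by (rule finite_measureI) (use T in \<open>simp add: emeasure_restrict_space\<close>)
  interpret fT: finite_measure "time T" by (rule fT)
  have mT: "measure (time T) {0<..<T} = T"
    using T by (simp add: measure_restrict_space)
  have "signed_integral (cyl T) (jump_measure T V j) \<psi> = (LINT t|time T. J t)"
    unfolding signed_integral_curve_measure[OF fj \<psi>(1)] J_def set_integral_time ..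
  moreover have "signed_integral (cyl T) (momentum_measure T V \<sigma>) \<psi> = (LINT t|time T. Q t)"
    unfolding signed_integral_curve_measure[OF fm \<psi>(1)] Q_def set_integral_time ..
  moreover have "(LINT z|density_measure T \<sigma>. (\<psi> z)\<^sup>2) = (LINT t|time T. S t)"
    unfolding S_def by (rule curve_measure_fubini(3)[OF T CE_density_curve i2, symmetric])
  moreover have "(LINT t|time T. J t - 1 / (2 * \<alpha>) * Q t - 1 / (4 * \<alpha>) * S t - ?E)
    = (LINT t|time T. J t) - 1 / (2 * \<alpha>) * (LINT t|time T. Q t) - 1 / (4 * \<alpha>) * (LINT t|time T. S t) - T * ?E"
    using iJ iQ iS mT by simp
  moreover have "ennreal (LINT t|time T. J t - 1 / (2 * \<alpha>) * Q t - 1 / (4 * \<alpha>) * S t - ?E)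
    \<le> (\<integral>\<^sup>+t. ennreal (J t - 1 / (2 * \<alpha>) * Q t - 1 / (4 * \<alpha>) * S t - ?E) \<partial>time T)"
    using iJ iQ iS by (intro ennreal_integral_le_nn_integral) simp
  moreover have "... \<le> rate_functional \<alpha> T V \<sigma> j"
    unfolding rate_functional_eq
  proof (rule nn_integral_mono)
    fix t assume "t \<in> space (time T)"
    then have t: "t \<in> {0<..<T}" by simp
    have "bounded_measurable borel (\<lambda>x. \<psi> (t, x))"
      using bounded_measurable_section[OF _ t] \<psi>(1) unfolding cyl_eq_strip by blast
    then show "ennreal (J t - 1 / (2 * \<alpha>) * Q t - 1 / (4 * \<alpha>) * S t - ?E) \<le> lagrangian \<alpha> V (\<sigma> t) (j t)"
      unfolding J_def Q_def S_def using \<psi>(2) t by (intro lagrangian_lower) auto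
  qed
  ultimately show ?thesis by simp
qed

section \<open>Velocity moments of the continuity equation\<close>

lemma slice_integral_measurable:
  assumes g: "bounded_measurable borel g"
  shows "(\<lambda>t. LINT z|\<sigma> t. g z) \<in> borel_measurable (time T)"
  by (rule measurable_compose[OF narrow_curve_kernel_omega1[OF CE_curve]
        integral_measurable_subprob_algebra[OF bounded_measurableD[OF g]]])

lemma family_fixed_measurable:
  fixes \<nu> :: "real \<Rightarrow> omega1 set \<Rightarrow> real"
  assumes \<nu>: "integrable_family T \<nu>" and g: "bounded_measurable borel g"
  shows "integrable (time T) (\<lambda>t. signed_integral borel (\<nu> t) g)"
proof -
  obtain B where B: "\<And>z. \<bar>g z\<bar> \<le> B" using bounded_measurable_bound[OF g] by (metis UNIV_I space_borel)
  have "snd \<in> measurable (borel :: (real \<times> omega1) measure) borel"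
    by (intro borel_measurable_continuous_onI continuous_on_snd continuous_on_id)
  then have "(\<lambda>z :: real \<times> omega1. g (snd z)) \<in> borel_measurable (strip T)"
    by (intro strip_measurable_borel measurable_compose[OF _ bounded_measurableD[OF g]])
  then have "bounded_measurable (strip T) (\<lambda>z :: real \<times> omega1. g (snd z))"
    using B by (intro bounded_measurableI) auto
  from family_integral_integrable[OF \<nu> this] show ?thesis by simp
qed

text \<open>The Lagrangian is infinite wherever the flux constraint fails, so a finite rate enforces
  the constraint at almost every time. It is recorded for one g at a time because measurability in t
  is available for each fixed g.\<close>

lemma flux_identification:
  assumes fin: "rate_functional \<alpha> T V \<sigma> j < \<infinity>" and g: "bounded_measurable borel g"
  shows "AE t in time T. signed_integral borel (\<lambda>A. fst (j t A)) g = V * (LINT z|\<sigma> t. vel (snd z) * g z)"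
proof -
  note ff = integrable_family_fst[OF CE_family]
  let ?D = "\<lambda>t. signed_integral borel (\<lambda>A. fst (j t A)) g - V * (LINT z|\<sigma> t. vel (snd z) * g z)"
  have vg: "bounded_measurable borel (\<lambda>z. vel (snd z) * g z)"
    by (intro bounded_measurable_mult bounded_measurable_vel g)
  have m: "?D \<in> borel_measurable (time T)"
    using family_fixed_measurable[OF ff g] slice_integral_measurable[OF vg]
    by (intro borel_measurable_diff borel_measurable_times) auto
  \<comment> \<open>On A the constraint fails, so the rate functional dominates infinity times the
    length of A.\<close>
  define A where "A = {t \<in> space (time T). ?D t \<noteq> 0}"
  have A: "A \<in> sets (time T)" unfolding A_def using m by measurable
  have "(\<integral>\<^sup>+t. \<infinity> * indicator A t \<partial>time T) \<le> rate_functional \<alpha> T V \<sigma> j"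
    unfolding rate_functional_eq
  proof (rule nn_integral_mono)
    fix t assume "t \<in> space (time T)"
    then have t: "t \<in> {0<..<T}" by simp
    then have t': "t \<in> {0..T}" by auto
    show "\<infinity> * indicator A t \<le> lagrangian \<alpha> V (\<sigma> t) (j t)"
    proof (cases "t \<in> A")
      case True
      have "\<not> (\<forall>A\<in>sets borel. fst (j t A) = set_lebesgue_integral (\<sigma> t) A (\<lambda>(x, v). V * vel v))"
      proof
        assume eq: "\<forall>A\<in>sets borel. fst (j t A) = set_lebesgue_integral (\<sigma> t) A (\<lambda>(x, v). V * vel v)"
        have "signed_integral borel (\<lambda>A. fst (j t A)) g = (LINT z|\<sigma> t. g z * (V * vel (snd z)))"
        proof (rule signed_integral_density[OF _ CE_prob(2)[OF t'] _ g])
          show "integrable (\<sigma> t) (\<lambda>z. V * vel (snd z))"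
            using CE_integrable[OF t' bounded_measurable_vel] by simp
          show "fst (j t A) = (LINT z|\<sigma> t. indicator A z * (V * vel (snd z)))" if "A \<in> sets borel" for A
            using eq that by (simp add: set_lebesgue_integral_def case_prod_beta)
        qed
        also have "... = V * (LINT z|\<sigma> t. vel (snd z) * g z)"
          by (simp add: mult.commute mult.left_commute)
        finally show False using True unfolding A_def by simp
      qed
      then have "lagrangian \<alpha> V (\<sigma> t) (j t) = \<infinity>" unfolding lagrangian_def by (rule if_not_P)
      then show ?thesis by simp
    qed simp
  qed
  then have "\<infinity> * emeasure (time T) A < \<infinity>"
    using fin A by (simp add: nn_integral_cmult_indicator)
  then have "emeasure (time T) A = 0" by (simp add: ennreal_top_mult split: if_splits)
  then have "A \<in> null_sets (time T)" using A by (simp add: null_sets_def)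
  from AE_not_in[OF this] AE_space show ?thesis
    by eventually_elim (simp add: A_def)
qed

text \<open>A test function independent of v is invariant under the flip, so the jump flux drops out
  and only the transport by the momentum remains.\<close>

lemma CE_space:
  assumes fin: "rate_functional \<alpha> T V \<sigma> j < \<infinity>" and g: "circle_C1 g" and st: "0 \<le> s" "s \<le> t" "t \<le> T"
  shows "(LINT x|density_slice \<sigma> t. g x) - (LINT x|density_slice \<sigma> s. g x)
    = (LINT r|time T. indicator {s<..<t} r * signed_integral borel (momentum_slice V \<sigma> r) (circle_deriv g))"
proof -
  let ?\<phi> = "\<lambda>z :: omega1. g (fst z)"
  note gb = circle_C1_bounded[OF g]
  have dx: "dx_omega1 ?\<phi> = (\<lambda>z. circle_deriv g (fst z))" by (auto simp: dx_omega1_def)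
  have "(LINT x|density_slice \<sigma> t. g x) - (LINT x|density_slice \<sigma> s. g x) = (LINT z|\<sigma> t. ?\<phi> z) - (LINT z|\<sigma> s. ?\<phi> z)"
    using st bounded_measurableD[OF gb(1)] by (simp add: integral_density_slice[OF CE_curve])
  also have "... = (LBINT r:{s<..<t}. signed_integral borel (\<lambda>A. fst (j r A)) (dx_omega1 ?\<phi>)
          + signed_integral borel (\<lambda>A. snd (j r A)) (\<lambda>z. ?\<phi> (flip_vel z) - ?\<phi> z))"
    using CE st g unfolding CE_omega1_def C10_omega1_def by auto
  also have "(\<lambda>z. ?\<phi> (flip_vel z) - ?\<phi> z) = (\<lambda>z. 0)" by (auto simp: flip_vel_def)
  also have "(LBINT r:{s<..<t}. signed_integral borel (\<lambda>A. fst (j r A)) (dx_omega1 ?\<phi>) + signed_integral borel (\<lambda>A. snd (j r A)) (\<lambda>z. 0))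
    = (LINT r|time T. indicator {s<..<t} r * signed_integral borel (\<lambda>A. fst (j r A)) (\<lambda>z. circle_deriv g (fst z)))"
    unfolding set_integral_subinterval[OF st(1,3)] dx by (simp add: signed_integral_def)
  also have "... = (LINT r|time T. indicator {s<..<t} r * signed_integral borel (momentum_slice V \<sigma> r) (circle_deriv g))"
  proof (rule integral_cong_AE)
    have bm: "bounded_measurable borel (\<lambda>z :: omega1. circle_deriv g (fst z))" by (rule bounded_measurable_fst[OF gb(2)])
    have ind: "indicat_real {s<..<t} \<in> borel_measurable (time T)"
      unfolding measurable_time_measure by (intro measurable_restrict_space1) simp
    show "(\<lambda>r. indicator {s<..<t} r * signed_integral borel (\<lambda>A. fst (j r A)) (\<lambda>z. circle_deriv g (fst z))) \<in> borel_measurable (time T)"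
      using family_fixed_measurable[OF integrable_family_fst[OF CE_family] bm] ind by (intro borel_measurable_times) auto
    have "(\<lambda>r. V * (LINT z|\<sigma> r. vel (snd z) * circle_deriv g (fst z))) \<in> borel_measurable (time T)"
      by (intro borel_measurable_times slice_integral_measurable bounded_measurable_mult bounded_measurable_vel bm) auto
    then have "(\<lambda>r. signed_integral borel (momentum_slice V \<sigma> r) (circle_deriv g)) \<in> borel_measurable (time T)"
      by (rule measurable_cong[THEN iffD1, rotated]) (simp add: signed_integral_momentum gb)
    then show "(\<lambda>r. indicator {s<..<t} r * signed_integral borel (momentum_slice V \<sigma> r) (circle_deriv g)) \<in> borel_measurable (time T)"
      using ind by (intro borel_measurable_times)
    show "AE r in time T. indicator {s<..<t} r * signed_integral borel (\<lambda>A. fst (j r A)) (\<lambda>z. circle_deriv g (fst z))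
      = indicator {s<..<t} r * signed_integral borel (momentum_slice V \<sigma> r) (circle_deriv g)"
      using flux_identification[OF fin bm] AE_space
      by eventually_elim (simp add: signed_integral_momentum gb)
  qed
  finally show ?thesis .
qed

text \<open>Tested with v g(x): since v^2 = 1, the flux V v \<sigma> contributes V times the
  density, and the flip contributes -2 v g. Dividing by V leaves the density and the jump flux at
  order one and the time increment at order 1 / V.\<close>

lemma CE_velocity:
  assumes fin: "rate_functional \<alpha> T V \<sigma> j < \<infinity>" and g: "circle_C1 g" and st: "0 \<le> s" "s \<le> t" "t \<le> T"
  shows "1 / V * ((LINT z|\<sigma> t. vel (snd z) * g (fst z)) - (LINT z|\<sigma> s. vel (snd z) * g (fst z)))
    = (LINT r|time T. indicator {s<..<t} r * ((LINT x|density_slice \<sigma> r. circle_deriv g x)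
        - 2 * signed_integral borel (jump_slice V j r) g))"
proof -
  let ?\<phi> = "\<lambda>z :: omega1. vel (snd z) * g (fst z)"
  note gb = circle_C1_bounded[OF g]
  let ?d = "\<lambda>z :: omega1. vel (snd z) * circle_deriv g (fst z)"
  have bd: "bounded_measurable borel ?d" and b\<phi>: "bounded_measurable borel ?\<phi>"
    by (intro bounded_measurable_mult bounded_measurable_vel bounded_measurable_fst gb)+
  have dx: "dx_omega1 ?\<phi> = ?d" by (auto simp: dx_omega1_def circle_C1_scale[OF g])
  have flip: "(\<lambda>z. ?\<phi> (flip_vel z) - ?\<phi> z) = (\<lambda>z. - 2 * ?\<phi> z)" by (auto simp: flip_vel_def vel_def)
  have "C10_omega1 ?\<phi>" unfolding C10_omega1_def by (simp add: circle_C1_scale[OF g])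
  then have "(LINT z|\<sigma> t. ?\<phi> z) - (LINT z|\<sigma> s. ?\<phi> z) = (LBINT r:{s<..<t}. signed_integral borel (\<lambda>A. fst (j r A)) (dx_omega1 ?\<phi>)
          + signed_integral borel (\<lambda>A. snd (j r A)) (\<lambda>z. ?\<phi> (flip_vel z) - ?\<phi> z))"
    using CE st unfolding CE_omega1_def by blast
  also have "... = (LINT r|time T. indicator {s<..<t} r * (signed_integral borel (\<lambda>A. fst (j r A)) ?d
          + signed_integral borel (\<lambda>A. snd (j r A)) (\<lambda>z. - 2 * ?\<phi> z)))"
    unfolding set_integral_subinterval[OF st(1,3)] dx flip ..
  also have "... = (LINT r|time T. V * (indicator {s<..<t} r * ((LINT x|density_slice \<sigma> r. circle_deriv g x)
        - 2 * signed_integral borel (jump_slice V j r) g)))"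
  proof (rule integral_cong_AE)
    have ind: "indicat_real {s<..<t} \<in> borel_measurable (time T)"
      unfolding measurable_time_measure by (intro measurable_restrict_space1) simp
    have m2: "(\<lambda>r. signed_integral borel (\<lambda>A. snd (j r A)) h) \<in> borel_measurable (time T)" if "bounded_measurable borel h" for h
      using family_fixed_measurable[OF integrable_family_snd[OF CE_family] that] by auto
    show "(\<lambda>r. indicator {s<..<t} r * (signed_integral borel (\<lambda>A. fst (j r A)) ?d
          + signed_integral borel (\<lambda>A. snd (j r A)) (\<lambda>z. - 2 * ?\<phi> z))) \<in> borel_measurable (time T)"
      by (intro borel_measurable_times borel_measurable_add ind m2 bounded_measurable_scale b\<phi>
          borel_measurable_integrable[OF family_fixed_measurable[OF integrable_family_fst[OF CE_family] bd]])
    have "(\<lambda>r. LINT z|\<sigma> r. circle_deriv g (fst z)) \<in> borel_measurable (time T)"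
      by (intro slice_integral_measurable bounded_measurable_fst gb)
    then have "(\<lambda>r. LINT x|density_slice \<sigma> r. circle_deriv g x) \<in> borel_measurable (time T)"
      by (rule measurable_cong[THEN iffD1, rotated])
        (simp add: integral_density_slice[OF CE_curve] bounded_measurableD[OF gb(2)])
    moreover have "(\<lambda>r. 1 / V * signed_integral borel (\<lambda>A. snd (j r A)) ?\<phi>) \<in> borel_measurable (time T)"
      by (intro borel_measurable_times m2 b\<phi>) auto
    then have "(\<lambda>r. signed_integral borel (jump_slice V j r) g) \<in> borel_measurable (time T)"
      by (rule measurable_cong[THEN iffD1, rotated]) (simp add: signed_integral_jump gb)
    ultimately show "(\<lambda>r. V * (indicator {s<..<t} r * ((LINT x|density_slice \<sigma> r. circle_deriv g x)
        - 2 * signed_integral borel (jump_slice V j r) g))) \<in> borel_measurable (time T)"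
      using ind by (intro borel_measurable_times borel_measurable_diff) auto
    show "AE r in time T. indicator {s<..<t} r * (signed_integral borel (\<lambda>A. fst (j r A)) ?d
          + signed_integral borel (\<lambda>A. snd (j r A)) (\<lambda>z. - 2 * ?\<phi> z))
      = V * (indicator {s<..<t} r * ((LINT x|density_slice \<sigma> r. circle_deriv g x)
        - 2 * signed_integral borel (jump_slice V j r) g))"
      using flux_identification[OF fin bd] AE_space
    proof eventually_elim
      case (elim r)
      then have r: "r \<in> {0<..<T}" "r \<in> {0..T}" by auto
      have "signed_integral borel (\<lambda>A. snd (j r A)) (\<lambda>z. - 2 * ?\<phi> z) = - 2 * signed_integral borel (\<lambda>A. snd (j r A)) ?\<phi>"
        by (rule bounded_functional_scale[OF bounded_functional_signed_integral[OF integrable_familyD(1)[OF integrable_family_snd[OF CE_family] r(1)]] b\<phi>])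
      moreover have "(LINT z|\<sigma> r. vel (snd z) * ?d z) = (LINT x|density_slice \<sigma> r. circle_deriv g x)"
        unfolding integral_density_slice[OF CE_curve r(2) bounded_measurableD[OF gb(2)]]
        by (simp add: mult.assoc[symmetric] vel_cases power2_eq_square[symmetric])
      ultimately show ?case
        using elim V by (simp add: signed_integral_jump[OF r(1) gb(1)] algebra_simps)
    qed
  qed
  finally show ?thesis using V by simp
qed

end

lemma prob_space_lebesgue_circle: "prob_space lebesgue_circle"
  unfolding lebesgue_circle_def
proof (rule prob_space.prob_space_distr)
  show "prob_space (restrict_space lborel {0..<1::real})"
    by (rule prob_spaceI) (simp add: emeasure_restrict_space space_restrict_space)
  show "abs_circle \<in> measurable (restrict_space lborel {0..<1}) borel"
    using borel_measurable_continuous_onI[OF continuous_abs_circle] by (intro measurable_restrict_space1) simp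
qed

lemma sets_lebesgue_circle: "sets lebesgue_circle = sets borel"
  by (simp add: lebesgue_circle_def)

section \<open>Time grids and continuous cutoffs in time\<close>

lemma grid_sum:
  fixes c :: "nat \<Rightarrow> real"
  assumes r: "0 < r" "r < T" and n: "n > 0"
  shows "(\<Sum>k<n. indicator {real k * T / real n<..real (Suc k) * T / real n} r * c k) = c (nat (\<lceil>r * real n / T\<rceil> - 1))"
proof -
  \<comment> \<open>Cells are open on the left, which matches the ceiling: r lies in cell k exactly
    if the ceiling of r n / T is k + 1.\<close>
  define K where "K = nat (\<lceil>r * real n / T\<rceil> - 1)"
  have T: "T > 0" using r by simp
  have pos: "r * real n / T > 0" using r n T by simp
  then have K: "real K = of_int \<lceil>r * real n / T\<rceil> - 1" unfolding K_def by simp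
  have "r * real n / T < real n" using r n T by (simp add: field_simps)
  then have "\<lceil>r * real n / T\<rceil> \<le> int n" by (simp add: ceiling_le_iff)
  then have Kn: "K < n" using n unfolding K_def by linarith
  have ind: "indicator {real k * T / real n<..real (Suc k) * T / real n} r = (if k = K then 1 else (0::real))" for k
  proof -
    have "r \<in> {real k * T / real n<..real (Suc k) * T / real n} \<longleftrightarrow> real k < r * real n / T \<and> r * real n / T \<le> real k + 1"
      using T n by (simp add: field_simps)
    also have "... \<longleftrightarrow> \<lceil>r * real n / T\<rceil> = int k + 1"
      by (auto simp: ceiling_eq_iff)
    also have "... \<longleftrightarrow> k = K" using pos unfolding K_def by auto
    finally show ?thesis by (auto simp: indicator_def)
  qed
  have "(\<Sum>k<n. indicator {real k * T / real n<..real (Suc k) * T / real n} r * c k) = (\<Sum>k<n. if k = K then c k else 0)"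
    by (intro sum.cong refl) (simp only: ind if_distrib[of "\<lambda>x. x * _"] mult_1 mult_zero_left)
  also have "... = c K" using Kn by simp
  finally show ?thesis unfolding K_def .
qed

text \<open>Both ends of the cell containing r tend to r. The left end is where test functions are
  frozen for the jump measure, the right end where they are frozen for the entropy.\<close>

lemma grid_tendsto:
  fixes T r :: real
  defines "K n \<equiv> real (nat (\<lceil>r * real (Suc n) / T\<rceil> - 1))"
  assumes r: "0 < r" "r < T"
  shows "(\<lambda>n. K n * T / real (Suc n)) \<longlonglongrightarrow> r" "(\<lambda>n. (K n + 1) * T / real (Suc n)) \<longlonglongrightarrow> r"
proof -
  have T: "T > 0" using r by simp
  let ?d = "\<lambda>n. T * (1 / real (Suc n))"
  have lim: "?d \<longlonglongrightarrow> 0" by (rule tendsto_mult_right_zero[OF LIMSEQ_Suc[OF lim_1_over_n]])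
  have b: "r - ?d n \<le> K n * T / real (Suc n)" "K n * T / real (Suc n) \<le> r"
    "r \<le> (K n + 1) * T / real (Suc n)" "(K n + 1) * T / real (Suc n) \<le> r + ?d n" for n
  proof -
    define x where "x = r * real (Suc n) / T"
    have x: "x > 0" using r T by (simp add: x_def)
    then have "K n = of_int \<lceil>x\<rceil> - 1" unfolding K_def x_def[symmetric] by simp
    then have le: "x - 1 \<le> K n" "K n \<le> x" by linarith+
    define d where "d = T / real (Suc n)"
    have d: "d \<ge> 0" "r = x * d" "?d n = d" "K n * T / real (Suc n) = K n * d" "(K n + 1) * T / real (Suc n) = K n * d + d"
      using T by (simp_all add: x_def d_def add_divide_distrib distrib_right)
    have "(x - 1) * d \<le> K n * d" "K n * d \<le> x * d" using le d(1) by (intro mult_right_mono; simp)+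
    then show "r - ?d n \<le> K n * T / real (Suc n)" "K n * T / real (Suc n) \<le> r"
      "r \<le> (K n + 1) * T / real (Suc n)" "(K n + 1) * T / real (Suc n) \<le> r + ?d n"
      unfolding d(2-5) by (simp_all add: left_diff_distrib)
  qed
  show "(\<lambda>n. K n * T / real (Suc n)) \<longlonglongrightarrow> r"
    by (rule real_tendsto_sandwich[of "\<lambda>n. r - ?d n" _ _ "\<lambda>n. r"])
      (use b tendsto_diff[OF tendsto_const lim, of r] in auto)
  show "(\<lambda>n. (K n + 1) * T / real (Suc n)) \<longlonglongrightarrow> r"
    by (rule real_tendsto_sandwich[of "\<lambda>n. r" _ _ "\<lambda>n. r + ?d n"])
      (use b tendsto_add[OF tendsto_const lim, of r] in auto)
qed

lemma grid_points:
  assumes T: "(T :: real) > 0"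
  shows "k \<le> Suc n \<Longrightarrow> real k * T / real (Suc n) \<in> {0..T}"
    and "real k * T / real (Suc n) \<le> real (Suc k) * T / real (Suc n)"
proof -
  show "real k * T / real (Suc n) \<le> real (Suc k) * T / real (Suc n)"
    using T by (intro divide_right_mono mult_right_mono) auto
  show "real k * T / real (Suc n) \<in> {0..T}" if "k \<le> Suc n"
  proof -
    have "real k * T / real (Suc n) \<le> real (Suc n) * T / real (Suc n)"
      using that T by (intro divide_right_mono mult_right_mono) auto
    then show ?thesis using T by simp
  qed
qed

definition clamp01 :: "real \<Rightarrow> real"
  where "clamp01 z = max 0 (min 1 z)"

text \<open>The average of the indicators of \<open>(s + \<epsilon>u, t + \<epsilon>u)\<close> over \<open>u \<in> [0, 1]\<close>: a cutoff in time that is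
  continuous, so that it survives the narrow limit.\<close>
definition ramp :: "real \<Rightarrow> real \<Rightarrow> real \<Rightarrow> real \<Rightarrow> real"
  where "ramp s t \<epsilon> r = clamp01 ((r - s) / \<epsilon>) - clamp01 ((r - t) / \<epsilon>)"

lemma ramp_continuous: "\<epsilon> > 0 \<Longrightarrow> continuous_on S (ramp s t \<epsilon>)"
  unfolding ramp_def clamp01_def by (intro continuous_intros) auto

lemma ramp_bound: "\<bar>ramp s t \<epsilon> r\<bar> \<le> 1"
  unfolding ramp_def clamp01_def by (auto simp: max_def min_def)

lemma integral_ramp:
  assumes "s \<le> t" "\<epsilon> > 0"
  shows "(LINT u|lborel. indicator {0..1} u * indicator {s + \<epsilon> * u<..<t + \<epsilon> * u} r) = ramp s t \<epsilon> r"
proof -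
  define l where "l = (r - t) / \<epsilon>"
  define m where "m = (r - s) / \<epsilon>"
  have lm: "l \<le> m" using assms unfolding l_def m_def by (intro divide_right_mono) auto
  \<comment> \<open>Solved for u, the condition on r says that u lies strictly between (r - t) /
    \<epsilon> and (r - s) / \<epsilon>; the integral is the length of this interval clipped to
    [0, 1].\<close>
  have "indicator {0..1} u * indicator {s + \<epsilon> * u<..<t + \<epsilon> * u} r = indicat_real ({0..1} \<inter> {l<..<m}) u" for u
    using assms(2) unfolding l_def m_def by (auto simp: indicator_def field_simps)
  then have "(LINT u|lborel. indicator {0..1} u * indicator {s + \<epsilon> * u<..<t + \<epsilon> * u} r) = measure lborel ({0..1} \<inter> {l<..<m})"
    by simp
  also have "... = clamp01 m - clamp01 l"
  proof -
    have sub: "{0..1} \<inter> {l<..<m} \<subseteq> {max 0 l..min 1 m}" "{max 0 l<..<min 1 m} \<subseteq> {0..1} \<inter> {l<..<m}" by auto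
    have fm: "{max 0 l..min 1 m} \<in> fmeasurable lborel"
      by (rule fmeasurableI) (simp_all add: emeasure_lborel_Icc_eq)
    have "measure lborel {a..b} = max 0 (b - a)" "measure lborel {a<..<b} = max 0 (b - a)" for a b :: real
      by (cases "a \<le> b", auto)+
    note this[of "max 0 l" "min 1 m"]
    moreover have "measure lborel ({0..1} \<inter> {l<..<m}) \<le> measure lborel {max 0 l..min 1 m}"
      "measure lborel {max 0 l<..<min 1 m} \<le> measure lborel ({0..1} \<inter> {l<..<m})"
      by (rule measure_mono_fmeasurable[OF sub(1) _ fm], simp)
        (rule measure_mono_fmeasurable[OF sub(2) _ fmeasurableI2[OF fm sub(1)]], simp_all)
    ultimately have "measure lborel ({0..1} \<inter> {l<..<m}) = max 0 (min 1 m - max 0 l)" by linarith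
    also have "... = clamp01 m - clamp01 l" using lm by (auto simp: clamp01_def max_def min_def)
    finally show ?thesis .
  qed
  finally show ?thesis unfolding ramp_def l_def m_def .
qed

text \<open>As the scale shrinks, \<open>clamp01\<close> of x over the scale tends to the indicator
  of x > 0, which is 0 at x = 0. This produces an interval that is open at s and closed at
  t.\<close>

lemma ramp_tendsto:
  "(\<lambda>n. ramp s t (\<epsilon> / real (Suc n)) r) \<longlonglongrightarrow> indicator {s<..t} r" if st: "s \<le> t" and e: "\<epsilon> > 0"
proof -
  have c: "(\<lambda>n. clamp01 (x / (\<epsilon> / real (Suc n)))) \<longlonglongrightarrow> (if x > 0 then 1 else 0)" for x
  proof (cases "x > 0")
    case True
    have "eventually (\<lambda>n. clamp01 (x / (\<epsilon> / real (Suc n))) = 1) sequentially"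
    proof -
      obtain N where N: "\<epsilon> / x < real N" using reals_Archimedean2 by blast
      show ?thesis
      proof (rule eventually_mono[OF eventually_ge_at_top[of N]])
        fix n assume "N \<le> n"
        then have "\<epsilon> / x < real (Suc n)" using N by linarith
        then have "\<epsilon> < x * real (Suc n)" using True by (simp add: field_simps)
        then have "1 \<le> x / (\<epsilon> / real (Suc n))" using e by (simp add: field_simps)
        then show "clamp01 (x / (\<epsilon> / real (Suc n))) = 1" by (simp add: clamp01_def)
      qed
    qed
    then show ?thesis using True by (simp add: tendsto_eventually)
  next
    case False
    then have "x / (\<epsilon> / real (Suc n)) \<le> 0" for n using e by (intro divide_nonpos_pos) auto
    moreover have "clamp01 z = 0" if "z \<le> 0" for z using that by (simp add: clamp01_def min_def)
    ultimately have "clamp01 (x / (\<epsilon> / real (Suc n))) = 0" for n by blast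
    then show ?thesis using False by simp
  qed
  have "(\<lambda>n. ramp s t (\<epsilon> / real (Suc n)) r) \<longlonglongrightarrow> (if r - s > 0 then 1 else 0) - (if r - t > 0 then 1 else 0)"
    unfolding ramp_def by (intro tendsto_diff c)
  moreover have "(if r - s > 0 then 1 else 0) - (if r - t > 0 then 1 else 0) = indicat_real {s<..t} r"
    using st by (auto simp: indicator_def)
  ultimately show ?thesis by simp
qed

lemma strip_product_measurable:
  assumes "f \<in> borel_measurable borel" "g \<in> borel_measurable (borel :: circle measure)"
  shows "(\<lambda>z. f (fst z) * g (snd z) :: real) \<in> borel_measurable (cyl T)"
proof -
  have m: "fst \<in> measurable (borel :: (real \<times> circle) measure) borel" "snd \<in> measurable (borel :: (real \<times> circle) measure) borel"
    by (intro borel_measurable_continuous_onI continuous_on_fst continuous_on_snd continuous_on_id)+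
  show ?thesis
    unfolding cyl_eq_strip
    by (intro strip_measurable_borel borel_measurable_times measurable_compose[OF m(1) assms(1)] measurable_compose[OF m(2) assms(2)])
qed

lemma strip_product_bounded:
  assumes "f \<in> borel_measurable borel" "\<And>r. \<bar>f r\<bar> \<le> A" "bounded_measurable (borel :: circle measure) g"
  shows "bounded_measurable (cyl T) (\<lambda>z. f (fst z) * g (snd z) :: real)"
proof -
  obtain B where B: "B \<ge> 0" "\<And>x. \<bar>g x\<bar> \<le> B" using bounded_measurable_bound[OF assms(3)] by (metis UNIV_I space_borel)
  have "\<bar>f (fst z) * g (snd z)\<bar> \<le> A * B" for z
    unfolding abs_mult using assms(2)[of "fst z"] B abs_ge_zero order_trans by (intro mult_mono) blast+
  then show ?thesis
    using strip_product_measurable[OF assms(1) bounded_measurableD[OF assms(3)]] by (intro bounded_measurableI) auto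
qed

section \<open>Moment equations against space-time test functions\<close>

context
  fixes \<alpha> T V :: real and \<sigma> :: "real \<Rightarrow> omega1 measure" and j :: "real \<Rightarrow> omega1 set \<Rightarrow> real \<times> real"
  assumes \<alpha>: "\<alpha> > 0" and T: "T > 0" and V: "V \<ge> 1" and CE: "CE_omega1 T \<sigma> j"
    and fin: "rate_functional \<alpha> T V \<sigma> j < \<infinity>"
begin

lemmas curve = CE_curve[OF \<alpha> T V CE]
lemmas family = CE_family[OF \<alpha> T V CE]
lemmas dcurve = CE_density_curve[OF \<alpha> T V CE]

text \<open>\<open>CE_velocity\<close> on one grid cell, in terms of the space-time measures. The
  cells are half-open so that they tile the time interval; including the endpoint t changes the time
  integral by a null set.\<close>

lemma CE_velocity_cell:
  assumes g: "circle_C1 g" and st: "0 \<le> s" "s \<le> t" "t \<le> T"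
  shows "(LINT z|density_measure T \<sigma>. indicator {s<..t} (fst z) * circle_deriv g (snd z))
      - 2 * signed_integral (cyl T) (jump_measure T V j) (\<lambda>z. indicator {s<..t} (fst z) * g (snd z))
    = 1 / V * ((LINT z|\<sigma> t. vel (snd z) * g (fst z)) - (LINT z|\<sigma> s. vel (snd z) * g (fst z)))"
proof -
  note gb = circle_C1_bounded[OF g]
  note fj = integrable_family_jump[OF family V]
  have b1: "bounded_measurable (cyl T) (\<lambda>z. indicator {s<..t} (fst z) * circle_deriv g (snd z))"
    and b2: "bounded_measurable (cyl T) (\<lambda>z. indicator {s<..t} (fst z) * g (snd z))"
    by (rule strip_product_bounded[where A = 1]; use gb in \<open>auto simp: indicator_def\<close>)+
  have i1: "integrable (density_measure T \<sigma>) (\<lambda>z. indicator {s<..t} (fst z) * circle_deriv g (snd z))"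
    by (rule integrable_bounded_measurable[OF finite_curve_measure[OF T dcurve] sets_curve_measure[OF T dcurve] b1])
  define a where "a r = (LINT x|density_slice \<sigma> r. circle_deriv g x)" for r
  define b where "b r = signed_integral borel (jump_slice V j r) g" for r
  have jump: "signed_integral borel (jump_slice V j r) (\<lambda>x. indicator {s<..t} r * g x) = indicator {s<..t} r * b r" if "r \<in> {0<..<T}" for r
    unfolding b_def
    by (rule bounded_functional_scale[OF bounded_functional_signed_integral[OF integrable_familyD(1)[OF fj that]] gb(1)])
  have ms: "(\<lambda>r. signed_integral borel (jump_slice V j r) (\<lambda>x. indicator {s<..t} r * g x)) \<in> borel_measurable (time T)"
    using family_integral_measurable[OF fj b2[unfolded cyl_eq_strip]] by simp
  have isl: "integrable (time T) (\<lambda>r. signed_integral borel (jump_slice V j r) (\<lambda>x. indicator {s<..t} r * g x))"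
    using family_integral_integrable[OF fj b2[unfolded cyl_eq_strip]] by simp
  have isr: "integrable (time T) (\<lambda>r. indicator {s<..t} r * b r)"
    by (rule Bochner_Integration.integrable_cong[THEN iffD1, OF refl _ isl]) (simp add: jump)
  have ma: "integrable (time T) (\<lambda>r. indicator {s<..t} r * a r)"
    using curve_measure_fubini(2)[OF T dcurve i1] by (simp add: a_def)
  have "(LINT z|density_measure T \<sigma>. indicator {s<..t} (fst z) * circle_deriv g (snd z))
    = (LINT r|time T. (LINT x|density_slice \<sigma> r. indicator {s<..t} r * circle_deriv g x))"
    using curve_measure_fubini(3)[OF T dcurve i1] by simp
  also have "... = (LINT r|time T. indicator {s<..t} r * a r)" by (simp add: a_def)
  finally have e1: "(LINT z|density_measure T \<sigma>. indicator {s<..t} (fst z) * circle_deriv g (snd z))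
    = (LINT r|time T. indicator {s<..t} r * a r)" .
  have "signed_integral (cyl T) (jump_measure T V j) (\<lambda>z. indicator {s<..t} (fst z) * g (snd z))
    = (LINT r|time T. signed_integral borel (jump_slice V j r) (\<lambda>x. indicator {s<..t} r * g x))"
    unfolding signed_integral_curve_measure[OF fj b2] set_integral_time by simp
  also have "... = (LINT r|time T. indicator {s<..t} r * b r)"
    by (intro Bochner_Integration.integral_cong) (simp_all add: jump)
  finally have e2: "signed_integral (cyl T) (jump_measure T V j) (\<lambda>z. indicator {s<..t} (fst z) * g (snd z))
    = (LINT r|time T. indicator {s<..t} r * b r)" .
  have "(LINT r|time T. indicator {s<..t} r * a r) - 2 * (LINT r|time T. indicator {s<..t} r * b r)
    = (LINT r|time T. indicator {s<..t} r * a r - 2 * (indicator {s<..t} r * b r))"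
    using ma isr by simp
  also have "... = (LINT r|time T. indicator {s<..<t} r * (a r - 2 * b r))"
  proof (rule integral_cong_AE)
    show m: "(\<lambda>r. indicator {s<..t} r * a r - 2 * (indicator {s<..t} r * b r)) \<in> borel_measurable (time T)"
      by (intro borel_measurable_diff borel_measurable_integrable[OF ma] borel_measurable_times[OF borel_measurable_const borel_measurable_integrable[OF isr]])
    have "indicat_real {s<..<t} \<in> borel_measurable (time T)"
      unfolding measurable_time_measure by (intro measurable_restrict_space1) simp
    then have "(\<lambda>r. indicator {s<..<t} r * (indicator {s<..t} r * a r - 2 * (indicator {s<..t} r * b r))) \<in> borel_measurable (time T)"
      using m by (intro borel_measurable_times)
    moreover have "indicator {s<..<t} r * (indicator {s<..t} r * a r - 2 * (indicator {s<..t} r * b r)) = indicator {s<..<t} r * (a r - 2 * b r)" for r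
      by (auto simp: indicator_def)
    ultimately show "(\<lambda>r. indicator {s<..<t} r * (a r - 2 * b r)) \<in> borel_measurable (time T)" by simp
    have "AE r in lborel. r \<noteq> t" by (rule AE_lborel_singleton)
    then have "AE r in time T. r \<noteq> t" by (auto simp: AE_restrict_space_iff elim: eventually_mono)
    then show "AE r in time T. indicator {s<..t} r * a r - 2 * (indicator {s<..t} r * b r) = indicator {s<..<t} r * (a r - 2 * b r)"
      by eventually_elim (auto simp: indicator_def)
  qed
  finally show ?thesis
    unfolding e1 e2 CE_velocity[OF \<alpha> T V CE fin g st] a_def b_def .
qed

text \<open>The test function is frozen in time on each grid cell, where
  \<open>CE_velocity_cell\<close> applies. Summation by parts shifts the time increments onto
  \<phi>, where they total at most L T, and leaves boundary terms of size at most 2 B; all of this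
  carries the factor 1 / V.\<close>

lemma jump_divergence:
  assumes \<phi>: "lipschitz_C1 \<phi> \<phi>x" and B: "\<And>z. \<bar>\<phi> z\<bar> \<le> B" and L: "\<And>s t p. \<bar>\<phi> (t, p) - \<phi> (s, p)\<bar> \<le> L * \<bar>t - s\<bar>" "L \<ge> 0"
  shows "\<bar>(LINT z|density_measure T \<sigma>. \<phi>x z)
    - 2 * signed_integral (cyl T) (jump_measure T V j) \<phi>\<bar> \<le> (L * T + 2 * B) / V"
proof -
  let ?R = "density_measure T \<sigma>"
  let ?J = "jump_measure T V j"
  note fj = integrable_family_jump[OF family V]
  have vJ: "vector_measure (cyl T) ?J" by (rule signed_curve_measure_vector_measure[OF fj])
  have C1: "circle_C1 (\<lambda>p. \<phi> (t, p))" "circle_deriv (\<lambda>p. \<phi> (t, p)) = (\<lambda>p. \<phi>x (t, p))" for t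
    using \<phi> unfolding lipschitz_C1_def by auto
  have cont: "continuous_on UNIV \<phi>" "continuous_on UNIV \<phi>x" using \<phi> unfolding lipschitz_C1_def by auto
  obtain B' where B': "\<And>z. \<bar>\<phi>x z\<bar> \<le> B'" using \<phi> unfolding lipschitz_C1_def by blast
  have gb: "bounded_measurable borel (\<lambda>p. \<phi> (t, p))" "bounded_measurable borel (\<lambda>p. \<phi>x (t, p))" for t
    using circle_C1_bounded[OF C1(1)[of t]] unfolding C1(2) by auto
  define tk where "tk n k = real k * T / real (Suc n)" for n k :: nat
  \<comment> \<open>Frozen at the left endpoint of each cell; continuity of \<phi> in time gives
    pointwise convergence as the grid is refined.\<close>
  define \<Phi> where "\<Phi> n z = (\<Sum>k<Suc n. indicator {tk n k<..tk n (Suc k)} (fst z) * \<phi> (tk n k, snd z))" for n and z :: "real \<times> circle"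
  define \<Phi>x where "\<Phi>x n z = (\<Sum>k<Suc n. indicator {tk n k<..tk n (Suc k)} (fst z) * \<phi>x (tk n k, snd z))" for n and z :: "real \<times> circle"
  have cellb: "bounded_measurable (cyl T) (\<lambda>z. indicator {s<..t} (fst z) * \<phi> (u, snd z))"
    "bounded_measurable (cyl T) (\<lambda>z. indicator {s<..t} (fst z) * \<phi>x (u, snd z))" for s t u
    by (rule strip_product_bounded[where A = 1]; use gb in \<open>auto simp: indicator_def\<close>)+
  have \<Phi>b: "bounded_measurable (cyl T) (\<Phi> n)" "bounded_measurable (cyl T) (\<Phi>x n)" for n
    unfolding \<Phi>_def \<Phi>x_def by (intro bounded_measurable_sum cellb)+
  have grid: "\<Phi> n (r, p) = \<phi> (tk n (nat (\<lceil>r * real (Suc n) / T\<rceil> - 1)), p)"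
    "\<Phi>x n (r, p) = \<phi>x (tk n (nat (\<lceil>r * real (Suc n) / T\<rceil> - 1)), p)" if "r \<in> {0<..<T}" for r p n
    unfolding \<Phi>_def \<Phi>x_def fst_conv snd_conv tk_def
    using grid_sum[of r T "Suc n" "\<lambda>k. \<phi> (real k * T / real (Suc n), p)"]
      grid_sum[of r T "Suc n" "\<lambda>k. \<phi>x (real k * T / real (Suc n), p)"] that by auto
  have lim: "(\<lambda>n. f (tk n (nat (\<lceil>r * real (Suc n) / T\<rceil> - 1)), p)) \<longlonglongrightarrow> f (r, p)"
    if r: "r \<in> {0<..<T}" and f: "continuous_on UNIV f" for r p and f :: "real \<times> circle \<Rightarrow> real"
  proof -
    have lim: "(\<lambda>n. tk n (nat (\<lceil>r * real (Suc n) / T\<rceil> - 1))) \<longlonglongrightarrow> r"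
      unfolding tk_def by (rule grid_tendsto(1)) (use r in auto)
    have "continuous_on UNIV (\<lambda>u. f (u, p))"
      by (rule continuous_on_compose2[OF f]) (auto intro!: continuous_intros)
    then have "isCont (\<lambda>u. f (u, p)) r" by (simp add: continuous_on_eq_continuous_at)
    from isCont_tendsto_compose[OF this lim] show ?thesis .
  qed
  define X where "X n = (LINT z|?R. \<Phi>x n z) - 2 * signed_integral (cyl T) ?J (\<Phi> n)" for n
  have X: "X \<longlonglongrightarrow> (LINT z|?R. \<phi>x z) - 2 * signed_integral (cyl T) ?J \<phi>"
    unfolding X_def
  proof (intro tendsto_diff tendsto_mult_left)
    show "(\<lambda>n. signed_integral (cyl T) ?J (\<Phi> n)) \<longlonglongrightarrow> signed_integral (cyl T) ?J \<phi>"
      by (rule signed_integral_bounded_convergence[where B = B, OF vJ lipschitz_C1_bounded_measurable(1)[OF \<phi>] \<Phi>b(1)])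
        (use B lim cont grid in auto)
    have "(\<lambda>n. signed_integral (cyl T) (measure ?R) (\<Phi>x n)) \<longlonglongrightarrow> signed_integral (cyl T) (measure ?R) \<phi>x"
      by (rule signed_integral_bounded_convergence[where B = B', OF vector_measure_measure[OF finite_curve_measure[OF T dcurve] sets_curve_measure[OF T dcurve]]
            lipschitz_C1_bounded_measurable(2)[OF \<phi>] \<Phi>b(2)])
        (use B' lim cont grid in auto)
    then show "(\<lambda>n. LINT z|?R. \<Phi>x n z) \<longlonglongrightarrow> (LINT z|?R. \<phi>x z)"
      by (simp add: signed_integral_measure[OF finite_curve_measure[OF T dcurve] sets_curve_measure[OF T dcurve]]
          \<Phi>b lipschitz_C1_bounded_measurable(2)[OF \<phi>])
  qed
  have bound: "\<bar>X n\<bar> \<le> (L * T + 2 * B) / V" for n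
  proof -
    define a where "a k t = (LINT z|\<sigma> t. vel (snd z) * \<phi> (tk n k, fst z))" for k t
    have tk01: "tk n k \<in> {0..T}" if "k \<le> Suc n" for k unfolding tk_def by (rule grid_points(1)[OF T that])
    have tkm: "tk n k \<le> tk n (Suc k)" for k unfolding tk_def by (rule grid_points(2)[OF T])
    have i: "integrable (\<sigma> t) (\<lambda>z. vel (snd z) * \<phi> (u, fst z))" if "t \<in> {0..T}" for t u
      by (intro CE_integrable[OF \<alpha> T V CE that] bounded_measurable_mult bounded_measurable_vel bounded_measurable_fst gb)
    have aB: "\<bar>a k t\<bar> \<le> B" if "t \<in> {0..T}" for k t
      unfolding a_def
      by (rule integral_abs_le_const[OF narrow_curveD(1)[OF curve that] borel_measurable_integrable[OF i[OF that]]])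
        (use B in \<open>simp add: abs_mult vel_cases\<close>)
    have aL: "\<bar>a k t - a (Suc k) t\<bar> \<le> L * (T / real (Suc n))" if t: "t \<in> {0..T}" for k t
    proof -
      have "a k t - a (Suc k) t = (LINT z|\<sigma> t. vel (snd z) * \<phi> (tk n k, fst z) - vel (snd z) * \<phi> (tk n (Suc k), fst z))"
        unfolding a_def by (rule Bochner_Integration.integral_diff[OF i[OF t] i[OF t], symmetric])
      also have "\<bar>...\<bar> \<le> L * (T / real (Suc n))"
      proof (rule integral_abs_le_const[OF narrow_curveD(1)[OF curve t]])
        show "(\<lambda>z. vel (snd z) * \<phi> (tk n k, fst z) - vel (snd z) * \<phi> (tk n (Suc k), fst z)) \<in> borel_measurable (\<sigma> t)"
          by (intro borel_measurable_integrable Bochner_Integration.integrable_diff i t)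
        fix z
        have "\<bar>vel (snd z) * \<phi> (tk n k, fst z) - vel (snd z) * \<phi> (tk n (Suc k), fst z)\<bar> = \<bar>\<phi> (tk n k, fst z) - \<phi> (tk n (Suc k), fst z)\<bar>"
          unfolding right_diff_distrib[symmetric] abs_mult vel_cases by simp
        also have "... \<le> L * \<bar>tk n k - tk n (Suc k)\<bar>" by (rule L(1))
        also have "\<bar>tk n k - tk n (Suc k)\<bar> = T / real (Suc n)"
          using T by (simp add: tk_def diff_divide_distrib[symmetric] algebra_simps)
        finally show "\<bar>vel (snd z) * \<phi> (tk n k, fst z) - vel (snd z) * \<phi> (tk n (Suc k), fst z)\<bar> \<le> L * (T / real (Suc n))" .
      qed
      finally show ?thesis .
    qed
    have "X n = (\<Sum>k<Suc n. (LINT z|?R. indicator {tk n k<..tk n (Suc k)} (fst z) * \<phi>x (tk n k, snd z))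
        - 2 * signed_integral (cyl T) ?J (\<lambda>z. indicator {tk n k<..tk n (Suc k)} (fst z) * \<phi> (tk n k, snd z)))"
    proof -
      have s1: "(LINT z|?R. \<Phi>x n z) = (\<Sum>k<Suc n. \<integral>z. indicator {tk n k<..tk n (Suc k)} (fst z) * \<phi>x (tk n k, snd z) \<partial>?R)"
        unfolding \<Phi>x_def
        by (rule Bochner_Integration.integral_sum)
          (rule integrable_bounded_measurable[OF finite_curve_measure[OF T dcurve] sets_curve_measure[OF T dcurve] cellb(2)])
      have s2: "signed_integral (cyl T) ?J (\<lambda>z. \<Sum>k<m. indicator {tk n k<..tk n (Suc k)} (fst z) * \<phi> (tk n k, snd z))
        = (\<Sum>k<m. signed_integral (cyl T) ?J (\<lambda>z. indicator {tk n k<..tk n (Suc k)} (fst z) * \<phi> (tk n k, snd z)))" for m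
      proof (induction m)
        case 0
        then show ?case by (simp add: signed_integral_def)
      next
        case (Suc m)
        then show ?case
          using bounded_functional_add[OF bounded_functional_signed_integral[OF vJ] bounded_measurable_sum[of "{..<m}", OF cellb(1)] cellb(1)]
          by simp
      qed
      show ?thesis unfolding X_def s1 \<Phi>_def s2 sum_subtractf sum_distrib_left ..
    qed
    also have "... = (\<Sum>k<Suc n. 1 / V * (a k (tk n (Suc k)) - a k (tk n k)))"
    proof (rule sum.cong[OF refl])
      fix k assume "k \<in> {..<Suc n}"
      then have "0 \<le> tk n k" "tk n (Suc k) \<le> T" using tk01[of k] tk01[of "Suc k"] by auto
      from CE_velocity_cell[OF C1(1)[of "tk n k"] this(1) tkm this(2), unfolded C1(2)]
      show "(LINT z|?R. indicator {tk n k<..tk n (Suc k)} (fst z) * \<phi>x (tk n k, snd z))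
        - 2 * signed_integral (cyl T) ?J (\<lambda>z. indicator {tk n k<..tk n (Suc k)} (fst z) * \<phi> (tk n k, snd z))
        = 1 / V * (a k (tk n (Suc k)) - a k (tk n k))" unfolding a_def .
    qed
    also have "... = 1 / V * (\<Sum>k<Suc n. a k (tk n (Suc k)) - a k (tk n k))" by (rule sum_distrib_left[symmetric])
    finally have Xn: "X n = 1 / V * (\<Sum>k<Suc n. a k (tk n (Suc k)) - a k (tk n k))" .
    \<comment> \<open>Replacing \<open>a k\<close> by \<open>a (Suc k)\<close> at the grid point
      \<open>tk n (Suc k)\<close> costs the Lipschitz error L T / (n + 1). After these replacements
      the sum telescopes to the two boundary terms.\<close>
    have abel: "\<bar>(\<Sum>k<m. a k (tk n (Suc k)) - a k (tk n k)) - a m (tk n m) + a 0 (tk n 0)\<bar> \<le> real m * (L * (T / real (Suc n)))"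
      if "m \<le> Suc n" for m
      using that
    proof (induction m)
      case (Suc m)
      have "\<bar>a m (tk n (Suc m)) - a (Suc m) (tk n (Suc m))\<bar> \<le> L * (T / real (Suc n))"
        by (rule aL[OF tk01[OF Suc.prems]])
      moreover have "\<bar>(\<Sum>k<m. a k (tk n (Suc k)) - a k (tk n k)) - a m (tk n m) + a 0 (tk n 0)\<bar> \<le> real m * (L * (T / real (Suc n)))"
        using Suc by simp
      moreover have "real (Suc m) * (L * (T / real (Suc n))) = real m * (L * (T / real (Suc n))) + L * (T / real (Suc n))"
        by (simp only: of_nat_Suc distrib_right mult_1 add.commute)
      ultimately show ?case unfolding sum.lessThan_Suc by linarith
    qed simp
    have "\<bar>\<Sum>k<Suc n. a k (tk n (Suc k)) - a k (tk n k)\<bar> \<le> real (Suc n) * (L * (T / real (Suc n))) + B + B"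
      using abel[of "Suc n"] aB[OF tk01[of "Suc n"], of "Suc n"] aB[OF tk01[of 0], of 0] by linarith
    also have "real (Suc n) * (L * (T / real (Suc n))) = L * T" by simp
    finally show ?thesis unfolding Xn using V by (simp add: abs_mult divide_right_mono)
  qed
  show ?thesis
    using X bound by (intro LIMSEQ_le_const2[OF tendsto_rabs[OF X]]) auto
qed

text \<open>\<open>CE_space\<close> holds on each shifted interval, and Fubini in the shift u turns
  the sharp cutoff into the continuous ramp. The left side involves time slices only, so both sides
  are stable under the available convergences.\<close>

lemma CE_space_averaged:
  assumes g: "circle_C1 g" and st: "0 \<le> s" "s \<le> t" and e: "\<epsilon> > 0" "t + \<epsilon> \<le> T"
  shows "(LINT u|lborel. indicator {0..1} u * ((LINT x|density_slice \<sigma> (t + \<epsilon> * u). g x) - (LINT x|density_slice \<sigma> (s + \<epsilon> * u). g x)))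
    = signed_integral (cyl T) (momentum_measure T V \<sigma>) (\<lambda>z. ramp s t \<epsilon> (fst z) * circle_deriv g (snd z))"
proof -
  note gb = circle_C1_bounded[OF g]
  note fm = integrable_family_momentum[OF curve V]
  define H where "H r = signed_integral borel (momentum_slice V \<sigma> r) (circle_deriv g)" for r
  have bs: "bounded_measurable (cyl T) (\<lambda>z. f (fst z) * circle_deriv g (snd z))" if "f \<in> borel_measurable borel" "\<And>r. \<bar>f r\<bar> \<le> 1" for f
    using that by (rule strip_product_bounded) (rule gb)
  have iH: "integrable (time T) H"
    unfolding H_def
    using family_integral_integrable[OF fm, of "\<lambda>z. circle_deriv g (snd z)"] bs[of "\<lambda>_. 1"] by (simp add: cyl_eq_strip)
  have Hm[measurable]: "H \<in> borel_measurable (time T)" using iH by auto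
  have idm[measurable]: "(\<lambda>r. r) \<in> borel_measurable (time T)"
    unfolding measurable_time_measure by (intro measurable_restrict_space1) simp
  define f where "f u r = indicator {0..1} u * (indicator {s + \<epsilon> * u<..<t + \<epsilon> * u} r * H r)" for u r
  have rm: "ramp s t \<epsilon> \<in> borel_measurable borel"
    by (intro borel_measurable_continuous_onI ramp_continuous e)
  interpret fT: finite_measure "time T"
    by (rule finite_measureI) (use T in \<open>simp add: emeasure_restrict_space\<close>)
  interpret pair_sigma_finite lborel "time T"
    by (intro pair_sigma_finite.intro sigma_finite_lborel fT.sigma_finite_measure_axioms)
  have fm': "(\<lambda>(u, r). f u r) \<in> borel_measurable (lborel \<Otimes>\<^sub>M time T)"
  proof -
    have "(\<lambda>z. indicator {0..1} (fst z) * (if s + \<epsilon> * fst z < snd z \<and> snd z < t + \<epsilon> * fst z then H (snd z) else 0))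
      \<in> borel_measurable (lborel \<Otimes>\<^sub>M time T)" by measurable
    then show ?thesis
      by (rule measurable_cong[THEN iffD1, rotated]) (auto simp: f_def indicator_def)
  qed
  have fi: "integrable (lborel \<Otimes>\<^sub>M time T) (\<lambda>(u, r). f u r)"
  proof (rule Fubini_integrable)
    have int: "integrable (time T) (f u)" for u
    proof (rule Bochner_Integration.integrable_bound[OF iH])
      show "f u \<in> borel_measurable (time T)"
      proof -
        have "Pair u \<in> measurable (time T) (lborel \<Otimes>\<^sub>M time T)" by (rule measurable_Pair1') simp
        from measurable_compose[OF this fm'] show ?thesis by simp
      qed
    qed (auto simp: f_def indicator_def)
    then show "AE u in lborel. integrable (time T) (\<lambda>r. case (u, r) of (u, r) \<Rightarrow> f u r)" by simp
    show "integrable lborel (\<lambda>u. LINT r|time T. norm (case (u, r) of (u, r) \<Rightarrow> f u r))"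
    proof (rule Bochner_Integration.integrable_bound[of _ "\<lambda>u. indicator {0..1} u * (LINT r|time T. \<bar>H r\<bar>)"])
      show "integrable lborel (\<lambda>u. indicator {0..1::real} u * (LINT r|time T. \<bar>H r\<bar>))"
        by (intro integrable_mult_left integrable_real_indicator) auto
      have "(\<lambda>(u, r). norm (f u r)) \<in> borel_measurable (lborel \<Otimes>\<^sub>M time T)"
        using measurable_compose[OF fm' borel_measurable_norm] by (simp add: case_prod_beta)
      from fT.borel_measurable_lebesgue_integral[OF this]
      show "(\<lambda>u. LINT r|time T. norm (case (u, r) of (u, r) \<Rightarrow> f u r)) \<in> borel_measurable lborel" by simp
      show "AE u in lborel. norm (LINT r|time T. norm (case (u, r) of (u, r) \<Rightarrow> f u r)) \<le> norm (indicator {0..1} u * (LINT r|time T. \<bar>H r\<bar>))"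
      proof (rule AE_I2)
        fix u :: real
        have "(LINT r|time T. \<bar>f u r\<bar>) \<le> (LINT r|time T. indicator {0..1} u * \<bar>H r\<bar>)"
        proof (rule integral_mono)
          show "integrable (time T) (\<lambda>r. \<bar>f u r\<bar>)" using int[of u] by (rule integrable_abs)
          show "integrable (time T) (\<lambda>r. indicator {0..1} u * \<bar>H r\<bar>)" using iH by simp
        qed (auto simp: f_def indicator_def)
        then show "norm (LINT r|time T. norm (case (u, r) of (u, r) \<Rightarrow> f u r)) \<le> norm (indicator {0..1} u * (LINT r|time T. \<bar>H r\<bar>))"
          by (simp add: abs_mult)
      qed
    qed
  qed (rule fm')
  have "(LINT u|lborel. indicator {0..1} u * ((LINT x|density_slice \<sigma> (t + \<epsilon> * u). g x) - (LINT x|density_slice \<sigma> (s + \<epsilon> * u). g x)))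
    = (LINT u|lborel. (LINT r|time T. f u r))"
  proof (rule Bochner_Integration.integral_cong[OF refl])
    fix u :: real
    show "indicator {0..1} u * ((LINT x|density_slice \<sigma> (t + \<epsilon> * u). g x) - (LINT x|density_slice \<sigma> (s + \<epsilon> * u). g x)) = (LINT r|time T. f u r)"
    proof (cases "u \<in> {0..1}")
      case True
      then have "\<epsilon> * u \<ge> 0" "\<epsilon> * u \<le> \<epsilon>" using e by (auto intro: mult_left_le)
      then have "(LINT x|density_slice \<sigma> (t + \<epsilon> * u). g x) - (LINT x|density_slice \<sigma> (s + \<epsilon> * u). g x)
        = (LINT r|time T. indicator {s + \<epsilon> * u<..<t + \<epsilon> * u} r * H r)"
        unfolding H_def using st e by (intro CE_space[OF \<alpha> T V CE fin g]; linarith)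
      then show ?thesis using True by (simp add: f_def)
    qed (simp add: f_def)
  qed
  also have "... = (LINT r|time T. (LINT u|lborel. f u r))"
    by (rule Fubini_integral[OF fi, symmetric])
  also have "... = (LINT r|time T. signed_integral borel (momentum_slice V \<sigma> r) (\<lambda>x. ramp s t \<epsilon> r * circle_deriv g x))"
  proof (rule Bochner_Integration.integral_cong[OF refl])
    fix r assume "r \<in> space (time T)"
    then have r: "r \<in> {0<..<T}" by simp
    have "(LINT u|lborel. f u r) = (LINT u|lborel. indicator {0..1} u * indicator {s + \<epsilon> * u<..<t + \<epsilon> * u} r * H r)"
      by (simp add: f_def mult.assoc)
    also have "... = ramp s t \<epsilon> r * H r"
      by (simp only: Bochner_Integration.integral_mult_left_zero integral_ramp[OF st(2) e(1)])
    also have "... = signed_integral borel (momentum_slice V \<sigma> r) (\<lambda>x. ramp s t \<epsilon> r * circle_deriv g x)"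
      unfolding H_def
      by (rule bounded_functional_scale[OF bounded_functional_signed_integral[OF integrable_familyD(1)[OF fm r]] gb(2), symmetric])
    finally show "(LINT u|lborel. f u r) = signed_integral borel (momentum_slice V \<sigma> r) (\<lambda>x. ramp s t \<epsilon> r * circle_deriv g x)" .
  qed
  also have "... = signed_integral (cyl T) (momentum_measure T V \<sigma>) (\<lambda>z. ramp s t \<epsilon> (fst z) * circle_deriv g (snd z))"
    unfolding signed_integral_curve_measure[OF fm bs[OF rm ramp_bound]] set_integral_time by simp
  finally show ?thesis .
qed

text \<open>The entropy duality is applied to a function of x alone. The left integral then sees
  only the spatial density, and the exponential integral sees only the marginal of the product
  reference measure.\<close>

lemma initial_entropy:
  assumes ent: "Ent (measure (\<sigma> 0)) pi_omega1 \<le> ennreal C" and C: "C \<ge> 0" and g: "continuous_on UNIV g"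
  shows "(LINT x|density_slice \<sigma> 0. g x) \<le> C + (LINT x|lebesgue_circle. exp (g x) - 1)"
proof -
  have T0: "0 \<in> {0..T}" using T by simp
  obtain B where B: "\<And>p. \<bar>g p\<bar> \<le> B" using circle_continuous_bounded[OF g] by blast
  have gb: "bounded_measurable borel g"
    using B by (intro bounded_measurableI borel_measurable_continuous_onI g)
  interpret U: prob_space "uniform_count_measure (UNIV :: bool set)"
    by (rule prob_space_uniform_count_measure) auto
  interpret Lc: prob_space lebesgue_circle by (rule prob_space_lebesgue_circle)
  interpret P: pair_prob_space lebesgue_circle "uniform_count_measure (UNIV :: bool set)" ..
  have fpi: "finite_measure pi_omega1" unfolding pi_omega1_def by (rule P.finite_measure_axioms)
  have s\<sigma>: "sets (\<sigma> 0) = sets borel" by (rule narrow_curveD(2)[OF curve T0])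
  have spi: "sets (\<sigma> 0) = sets pi_omega1" using s\<sigma> sets_pi_omega1 by simp
  have f\<sigma>: "finite_measure (\<sigma> 0)" by (rule prob_space.finite_measure[OF narrow_curveD(1)[OF curve T0]])
  have b: "bounded_measurable pi_omega1 (\<lambda>z. g (fst z))"
    using bounded_measurable_fst[OF gb] bounded_measurable_cong_sets[OF sets_pi_omega1] by blast
  have "ennreal (signed_integral pi_omega1 (measure (\<sigma> 0)) (\<lambda>z. g (fst z)) - (LINT z|pi_omega1. exp (g (fst z)) - 1)) \<le> Ent (measure (\<sigma> 0)) pi_omega1"
    by (rule Ent_dual[OF fpi vector_measure_measure[OF f\<sigma> spi] b])
  also note ent
  finally have "signed_integral pi_omega1 (measure (\<sigma> 0)) (\<lambda>z. g (fst z)) - (LINT z|pi_omega1. exp (g (fst z)) - 1) \<le> C"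
    using C by (simp add: ennreal_le_iff)
  moreover have "signed_integral pi_omega1 (measure (\<sigma> 0)) (\<lambda>z. g (fst z)) = (LINT x|density_slice \<sigma> 0. g x)"
    using signed_integral_measure[OF f\<sigma> spi b] integral_density_slice[OF curve T0 bounded_measurableD[OF gb]] by simp
  moreover have "(LINT z|pi_omega1. exp (g (fst z)) - 1) = (LINT x|lebesgue_circle. exp (g x) - 1)"
  proof -
    have m: "(\<lambda>x. exp (g x) - 1) \<in> borel_measurable lebesgue_circle"
      using bounded_measurableD[OF gb] by (simp add: lebesgue_circle_def)
    have "(LINT x|distr (lebesgue_circle \<Otimes>\<^sub>M uniform_count_measure (UNIV :: bool set)) lebesgue_circle fst. exp (g x) - 1)
      = (LINT z|(lebesgue_circle \<Otimes>\<^sub>M uniform_count_measure (UNIV :: bool set)). exp (g (fst z)) - 1)"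
      by (rule integral_distr[OF measurable_fst m])
    then show ?thesis unfolding U.distr_pair_fst pi_omega1_def by simp
  qed
  ultimately show ?thesis by simp
qed

end

section \<open>Mollification on the circle\<close>

abbreviation unit_interval :: "real measure"
  where "unit_interval \<equiv> restrict_space lborel {0..1}"

lemma prob_space_unit_interval: "prob_space unit_interval"
  by (rule prob_spaceI) (simp add: emeasure_restrict_space space_restrict_space)

lemma measurable_unit_interval: "f \<in> borel_measurable borel \<Longrightarrow> f \<in> borel_measurable unit_interval"
  by (rule measurable_restrict_space1) simp

lemma continuous_measurable_unit_interval:
  "continuous_on UNIV f \<Longrightarrow> f \<in> borel_measurable unit_interval" for f :: "real \<Rightarrow> real"
  by (intro measurable_unit_interval borel_measurable_continuous_onI)

lemma integrable_unit_interval: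
  fixes f :: "real \<Rightarrow> real"
  assumes c: "continuous_on UNIV f"
  shows "integrable unit_interval f"
proof -
  have "compact (f ` {0..1})" by (intro compact_continuous_image continuous_on_subset[OF c]) auto
  then obtain B where "\<And>x. x \<in> {0..1} \<Longrightarrow> \<bar>f x\<bar> \<le> B"
    using compact_imp_bounded by (force simp: bounded_iff)
  then show ?thesis
    by (intro integrable_bounded[OF prob_space.finite_measure[OF prob_space_unit_interval] continuous_measurable_unit_interval[OF c]])
      (auto simp: space_restrict_space)
qed

lemma periodic_bounded:
  fixes f :: "real \<Rightarrow> real"
  assumes c: "continuous_on UNIV f" and per: "\<And>x. f (x + 1) = f x"
  obtains B where "B > 0" "\<And>x. \<bar>f x\<bar> \<le> B"
proof -
  obtain B where B: "B \<ge> 0" "\<And>p. \<bar>f (rep_circle p)\<bar> \<le> B"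
    using circle_continuous_bounded[OF continuous_periodic_circle[OF c per]] by blast
  have "\<bar>f x\<bar> \<le> B" for x using B(2)[of "abs_circle x"] periodic_rep_abs[of f, OF per] by simp
  then have "\<bar>f x\<bar> \<le> B + 1" for x by (rule order_trans) simp
  then show thesis using B(1) by (intro that[of "B + 1"]) auto
qed

lemma parametric_integral_continuous:
  fixes f :: "'p::metric_space \<Rightarrow> 'a \<Rightarrow> real"
  assumes M: "finite_measure M" and f: "\<And>p. f p \<in> borel_measurable M"
    and B: "\<And>p x. x \<in> space M \<Longrightarrow> \<bar>f p x\<bar> \<le> B"
    and c: "\<And>x. x \<in> space M \<Longrightarrow> continuous_on UNIV (\<lambda>p. f p x)"
  shows "continuous_on UNIV (\<lambda>p. LINT x|M. f p x)"
  unfolding continuous_on_sequentially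
proof (intro ballI allI impI)
  fix p and X :: "nat \<Rightarrow> 'p" assume X: "(\<forall>n. X n \<in> UNIV) \<and> X \<longlonglongrightarrow> p"
  interpret finite_measure M by fact
  have "(\<lambda>n. LINT x|M. f (X n) x) \<longlonglongrightarrow> (LINT x|M. f p x)"
  proof (rule integral_dominated_convergence[where w = "\<lambda>_. B"])
    show "AE x in M. (\<lambda>n. f (X n) x) \<longlonglongrightarrow> f p x"
    proof (rule AE_I2)
      fix x assume "x \<in> space M"
      then have "continuous_on UNIV (\<lambda>p. f p x)" by (rule c)
      then show "(\<lambda>n. f (X n) x) \<longlonglongrightarrow> f p x"
        using X unfolding continuous_on_sequentially comp_def by blast
    qed
    show "AE x in M. norm (f (X n) x) \<le> B" for n using B by (intro AE_I2) auto
  qed (use f in auto)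
  then show "((\<lambda>p. LINT x|M. f p x) \<circ> X) \<longlonglongrightarrow> (LINT x|M. f p x)" by (simp add: comp_def)
qed

text \<open>The difference quotients are dominated by B W through the mean value inequality. The
  shift a and the weight w make both convolutions below instances: weight f on the unit interval for
  \<open>smear\<close>, weight 1 and shift \<open>rep_circle\<close> for
  \<open>mollify\<close>.\<close>

lemma convolution_deriv:
  fixes \<kappa> \<kappa>' :: "real \<Rightarrow> real" and a w :: "'a \<Rightarrow> real"
  assumes M: "finite_measure M" and d: "\<And>z. (\<kappa> has_real_derivative \<kappa>' z) (at z)"
    and m: "\<And>z. (\<lambda>x. \<kappa> (z - a x) * w x) \<in> borel_measurable M"
    and A: "\<And>z. \<bar>\<kappa> z\<bar> \<le> A" and B: "\<And>z. \<bar>\<kappa>' z\<bar> \<le> B" and W: "\<And>x. x \<in> space M \<Longrightarrow> \<bar>w x\<bar> \<le> W"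
  shows "((\<lambda>z. LINT x|M. \<kappa> (z - a x) * w x) has_real_derivative (LINT x|M. \<kappa>' (z - a x) * w x)) (at z)"
  unfolding DERIV_def tendsto_at_iff_sequentially
proof (intro allI impI)
  interpret finite_measure M by fact
  fix H :: "nat \<Rightarrow> real" assume "\<forall>i. H i \<in> UNIV - {0}" and H: "H \<longlonglongrightarrow> 0"
  then have H0: "H i \<noteq> 0" for i by auto
  have B0: "B \<ge> 0" using B[of 0] by linarith
  have A0: "A \<ge> 0" using A[of 0] by linarith
  define q where "q n x = (\<kappa> (z + H n - a x) * w x - \<kappa> (z - a x) * w x) / H n" for n x
  have qm: "q n \<in> borel_measurable M" for n
    unfolding q_def by (intro borel_measurable_divide borel_measurable_diff m) auto
  have ql: "(\<lambda>n. q n x) \<longlonglongrightarrow> \<kappa>' (z - a x) * w x" for x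
  proof -
    have "((\<lambda>h. (\<kappa> (z - a x + h) - \<kappa> (z - a x)) / h) \<longlongrightarrow> \<kappa>' (z - a x)) (at 0)"
      using d[of "z - a x"] unfolding DERIV_def .
    then have "(\<lambda>n. (\<kappa> (z - a x + H n) - \<kappa> (z - a x)) / H n) \<longlonglongrightarrow> \<kappa>' (z - a x)"
      using H H0 unfolding tendsto_at_iff_sequentially by (auto simp: comp_def)
    from tendsto_mult_right[OF this, of "w x"] show ?thesis
      by (simp add: q_def left_diff_distrib[symmetric] algebra_simps)
  qed
  have "(\<lambda>n. LINT x|M. q n x) \<longlonglongrightarrow> (LINT x|M. \<kappa>' (z - a x) * w x)"
  proof (rule integral_dominated_convergence[where w = "\<lambda>_. B * W"])
    show "(\<lambda>x. \<kappa>' (z - a x) * w x) \<in> borel_measurable M"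
      by (rule borel_measurable_LIMSEQ_real[OF ql qm])
    show "AE x in M. norm (q n x) \<le> B * W" for n
    proof (rule AE_I2)
      fix x assume x: "x \<in> space M"
      have "norm (\<kappa> (z + H n - a x) - \<kappa> (z - a x)) \<le> B * norm ((z + H n - a x) - (z - a x))"
        by (rule field_differentiable_bound[of UNIV _ \<kappa>']) (use d B in auto)
      then have "\<bar>\<kappa> (z + H n - a x) - \<kappa> (z - a x)\<bar> / \<bar>H n\<bar> \<le> B" using H0[of n] by (simp add: field_simps)
      moreover have "\<bar>q n x\<bar> = \<bar>\<kappa> (z + H n - a x) - \<kappa> (z - a x)\<bar> / \<bar>H n\<bar> * \<bar>w x\<bar>"
        by (simp add: q_def left_diff_distrib[symmetric] abs_mult)
      moreover have "\<bar>\<kappa> (z + H n - a x) - \<kappa> (z - a x)\<bar> / \<bar>H n\<bar> * \<bar>w x\<bar> \<le> B * W"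
        using calculation(1) W[OF x] B0 by (intro mult_mono) auto
      ultimately show "norm (q n x) \<le> B * W" by simp
    qed
  qed (use qm ql in auto)
  moreover have "(LINT x|M. q n x) = ((LINT x|M. \<kappa> (z + H n - a x) * w x) - (LINT x|M. \<kappa> (z - a x) * w x)) / H n" for n
  proof -
    have i: "integrable M (\<lambda>x. \<kappa> (y - a x) * w x)" for y
    proof (rule integrable_bounded[OF M m])
      fix x assume "x \<in> space M"
      then show "\<bar>\<kappa> (y - a x) * w x\<bar> \<le> A * W" using A W A0 by (auto simp: abs_mult intro!: mult_mono)
    qed
    show ?thesis unfolding q_def using i by simp
  qed
  ultimately show "((\<lambda>h. ((LINT x|M. \<kappa> (z + h - a x) * w x) - (LINT x|M. \<kappa> (z - a x) * w x)) / h) \<circ> H) \<longlonglongrightarrow> (LINT x|M. \<kappa>' (z - a x) * w x)"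
    by (simp add: comp_def)
qed

lemma integral_periodic_deriv:
  fixes F f :: "real \<Rightarrow> real"
  assumes d: "\<And>x. (F has_real_derivative f x) (at x)" and c: "continuous_on UNIV f" and per: "\<And>x. F (x + 1) = F x"
  shows "(LINT x|unit_interval. f x) = 0"
proof -
  have "(LINT x|unit_interval. f x) = (LINT x|lborel. f x * indicator {0..1} x)"
    by (simp add: integral_restrict_space mult.commute)
  also have "... = F 1 - F 0"
    by (rule integral_FTC_Icc_real) (use d c in \<open>auto simp: continuous_on_eq_continuous_at\<close>)
  finally show ?thesis using per[of 0] by simp
qed

text \<open>Convolution with the reflected kernel, so that \<open>smear\<close> on functions is dual
  to \<open>mollify\<close> on measures, as made precise in \<open>mollify_fubini\<close>; no
  symmetry of k enters.\<close>

definition smear :: "(real \<Rightarrow> real) \<Rightarrow> (real \<Rightarrow> real) \<Rightarrow> real \<Rightarrow> real"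
  where "smear k f y = (LINT x|unit_interval. k (x - y) * f x)"

definition mollify :: "(real \<Rightarrow> real) \<Rightarrow> circle measure \<Rightarrow> real \<Rightarrow> real"
  where "mollify k m x = (LINT y|m. k (x - rep_circle y))"

lemma periodic_shift:
  fixes k :: "real \<Rightarrow> real"
  assumes "\<And>x. k (x + 1) = k x"
  shows "k (x - (y + 1)) = k (x - y)"
  using assms[of "x - y - 1"] by (simp add: algebra_simps)

lemma smear_periodic:
  assumes "\<And>x. k (x + 1) = k x"
  shows "smear k f (y + 1) = smear k f y"
  unfolding smear_def periodic_shift[of k, OF assms] ..

lemma mollify_periodic:
  assumes "\<And>x. k (x + 1) = k x"
  shows "mollify k m (x + 1) = mollify k m x"
  unfolding mollify_def using assms by (simp add: diff_add_eq[symmetric])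

lemma smear_deriv:
  assumes k: "\<And>x. (k has_real_derivative k' x) (at x)" "continuous_on UNIV k'" "\<And>x. k (x + 1) = k x"
    and f: "continuous_on UNIV f" "\<And>x. \<bar>f x\<bar> \<le> W"
  shows "(smear k f has_real_derivative - smear k' f y) (at y)"
proof -
  have kc: "continuous_on UNIV k" using k(1) by (meson DERIV_isCont continuous_at_imp_continuous_on)
  obtain A where A: "\<And>x. \<bar>k x\<bar> \<le> A" using periodic_bounded[OF kc k(3)] by blast
  obtain B where B: "\<And>x. \<bar>k' x\<bar> \<le> B" using periodic_bounded[OF k(2) periodic_deriv[OF k(1,3)]] by blast
  \<comment> \<open>The variable y enters through the reflected kernel, whence the minus sign in the
    derivative.\<close>
  have d: "((\<lambda>z. k (- z)) has_real_derivative - k' (- z)) (at z)" for z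
    using DERIV_chain2[OF k(1) DERIV_minus[OF DERIV_ident]] by simp
  have m: "(\<lambda>x. k (- (z - x)) * f x) \<in> borel_measurable unit_interval" for z
    by (intro continuous_measurable_unit_interval continuous_on_mult f continuous_on_compose2[OF kc] continuous_intros) auto
  have "((\<lambda>z. LINT x|unit_interval. k (- (z - x)) * f x) has_real_derivative (LINT x|unit_interval. - k' (- (y - x)) * f x)) (at y)"
    by (rule convolution_deriv[OF prob_space.finite_measure[OF prob_space_unit_interval] d m, of A B W]) (use A B f in auto)
  then show ?thesis unfolding smear_def[abs_def] by simp
qed

lemma smear_by_parts:
  assumes k: "\<And>x. (k has_real_derivative k' x) (at x)" "continuous_on UNIV k'" "\<And>x. k (x + 1) = k x"
    and f: "\<And>x. (f has_real_derivative f' x) (at x)" "continuous_on UNIV f'" "\<And>x. f (x + 1) = f x"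
  shows "smear k f' y = - smear k' f y"
proof -
  have kc: "continuous_on UNIV k" "continuous_on UNIV f"
    using k(1) f(1) by (meson DERIV_isCont continuous_at_imp_continuous_on)+
  have c: "continuous_on UNIV (\<lambda>x. k (x - y) * f' x)" "continuous_on UNIV (\<lambda>x. k' (x - y) * f x)"
    by (intro continuous_on_mult f kc continuous_on_compose2[OF kc(1)] continuous_on_compose2[OF k(2)] continuous_intros; simp)+
  have "(LINT x|unit_interval. k' (x - y) * f x + k (x - y) * f' x) = 0"
  proof (rule integral_periodic_deriv)
    fix x
    have "((\<lambda>x. k (x - y)) has_real_derivative k' (x - y)) (at x)"
    proof -
      have "((\<lambda>x. x - y) has_real_derivative 1) (at x)" by (auto intro!: derivative_eq_intros)
      from DERIV_chain2[OF k(1) this] show ?thesis by simp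
    qed
    from DERIV_mult[OF this f(1)] show "((\<lambda>x. k (x - y) * f x) has_real_derivative k' (x - y) * f x + k (x - y) * f' x) (at x)"
      by (simp add: mult.commute add.commute)
    show "k (x + 1 - y) * f (x + 1) = k (x - y) * f x" using k(3)[of "x - y"] f(3)[of x] by (simp add: diff_add_eq[symmetric])
  qed (intro continuous_on_add c)
  then show ?thesis unfolding smear_def using integrable_unit_interval[OF c(1)] integrable_unit_interval[OF c(2)] by simp
qed

lemma kernel_measurable_circle:
  assumes "continuous_on UNIV k" "\<And>x. k (x + 1) = (k x :: real)" "sets m = sets borel"
  shows "(\<lambda>y. k (x - rep_circle y)) \<in> borel_measurable m"
proof -
  have "continuous_on UNIV (\<lambda>y. k (x - y))"
    by (intro continuous_on_compose2[OF assms(1)] continuous_intros) auto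
  then have "continuous_on UNIV (\<lambda>p. k (x - rep_circle p))"
    by (rule continuous_periodic_circle) (rule periodic_shift, rule assms(2))
  then have "(\<lambda>y. k (x - rep_circle y)) \<in> borel_measurable borel" by (rule borel_measurable_continuous_onI)
  then show ?thesis using measurable_cong_sets[OF assms(3) refl] by blast
qed

lemma mollify_deriv:
  assumes m: "prob_space m" "sets m = sets borel"
    and k: "\<And>x. (k has_real_derivative k' x) (at x)" "continuous_on UNIV k'" "\<And>x. k (x + 1) = k x"
  shows "(mollify k m has_real_derivative mollify k' m x) (at x)"
proof -
  have kc: "continuous_on UNIV k" using k(1) by (meson DERIV_isCont continuous_at_imp_continuous_on)
  obtain A where A: "\<And>x. \<bar>k x\<bar> \<le> A" using periodic_bounded[OF kc k(3)] by blast
  obtain B where B: "\<And>x. \<bar>k' x\<bar> \<le> B" using periodic_bounded[OF k(2) periodic_deriv[OF k(1,3)]] by blast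
  have "((\<lambda>x. LINT y|m. k (x - rep_circle y) * 1) has_real_derivative (LINT y|m. k' (x - rep_circle y) * 1)) (at x)"
    by (rule convolution_deriv[OF prob_space.finite_measure[OF m(1)] k(1), of _ _ A B 1])
      (use A B kernel_measurable_circle[OF kc k(3) m(2)] in auto)
  then show ?thesis unfolding mollify_def[abs_def] by simp
qed

lemma mollify_bound:
  assumes m: "prob_space m" "sets m = sets borel"
    and k: "continuous_on UNIV k" "\<And>x. k (x + 1) = k x"
  shows "(\<And>x. a \<le> k x) \<Longrightarrow> a \<le> mollify k m x" "(\<And>x. k x \<le> b) \<Longrightarrow> mollify k m x \<le> b"
proof -
  interpret prob_space m by fact
  obtain B where B: "\<And>x. \<bar>k x\<bar> \<le> B" using periodic_bounded[OF k] by blast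
  have i: "integrable m (\<lambda>y. k (x - rep_circle y))"
    by (rule integrable_bounded[OF finite_measure_axioms kernel_measurable_circle[OF k m(2)] B])
  show "a \<le> mollify k m x" if "\<And>x. a \<le> k x"
    using integral_mono[of m "\<lambda>_. a" "\<lambda>y. k (x - rep_circle y)"] i that by (simp add: mollify_def prob_space)
  show "mollify k m x \<le> b" if "\<And>x. k x \<le> b"
    using integral_mono[of m "\<lambda>y. k (x - rep_circle y)" "\<lambda>_. b"] i that by (simp add: mollify_def prob_space)
qed

lemma mollify_fubini:
  assumes m: "prob_space m" "sets m = sets borel"
    and k: "continuous_on UNIV k" "\<And>x. k (x + 1) = k x"
    and f: "continuous_on UNIV f" "\<And>x. \<bar>f x\<bar> \<le> W"
  shows "(LINT y|m. smear k f (rep_circle y)) = (LINT x|unit_interval. mollify k m x * f x)"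
proof -
  interpret I: prob_space unit_interval by (rule prob_space_unit_interval)
  interpret m: prob_space m by fact
  interpret pair_prob_space unit_interval m ..
  obtain B where B: "\<And>x. \<bar>k x\<bar> \<le> B" using periodic_bounded[OF k] by blast
  have B0: "B \<ge> 0" using B[of 0] by linarith
  \<comment> \<open>Continuity is checked on the lift, where periodicity of k removes
    \<open>rep_circle\<close>; it yields the joint measurability needed for Fubini.\<close>
  have c: "continuous_on UNIV (\<lambda>(x, y). k (x - rep_circle y) * f x)"
  proof (rule continuous_on_prod_circle)
    have "continuous_on UNIV (\<lambda>z :: real \<times> real. k (fst z - snd z) * f (fst z))"
      by (intro continuous_on_mult continuous_on_compose2[OF k(1)] continuous_on_compose2[OF f(1)] continuous_intros) auto
    moreover have "k (x - rep_circle (abs_circle y)) = k (x - y)" for x y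
      by (rule periodic_rep_abs[of "\<lambda>y. k (x - y)"]) (rule periodic_shift, rule k(2))
    ultimately show "continuous_on UNIV (\<lambda>(t, x). case (t, abs_circle x) of (x, y) \<Rightarrow> k (x - rep_circle y) * f x)"
      by (simp add: case_prod_beta)
  qed
  have "id \<in> measurable (unit_interval \<Otimes>\<^sub>M m) (borel \<Otimes>\<^sub>M (borel :: circle measure))"
  proof (rule measurable_pair)
    show "fst \<circ> id \<in> measurable (unit_interval \<Otimes>\<^sub>M m) borel"
      using measurable_compose[OF measurable_fst measurable_restrict_space1[of "\<lambda>x. x" lborel borel]] by (simp add: comp_def)
    show "snd \<circ> id \<in> measurable (unit_interval \<Otimes>\<^sub>M m) borel"
      using measurable_snd[of unit_interval m] measurable_cong_sets[OF refl m(2)] by auto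
  qed
  from measurable_compose[OF this[unfolded borel_prod] borel_measurable_continuous_onI[OF c]]
  have meas: "(\<lambda>(x, y). k (x - rep_circle y) * f x) \<in> borel_measurable (unit_interval \<Otimes>\<^sub>M m)" by simp
  have i: "integrable (unit_interval \<Otimes>\<^sub>M m) (\<lambda>(x, y). k (x - rep_circle y) * f x)"
    by (rule integrable_bounded[OF P.finite_measure_axioms meas, of "B * W"])
      (use B B0 f in \<open>auto simp: abs_mult intro!: mult_mono\<close>)
  have "(LINT y|m. (LINT x|unit_interval. k (x - rep_circle y) * f x)) = (LINT x|unit_interval. (LINT y|m. k (x - rep_circle y) * f x))"
    by (rule Fubini_integral[OF i])
  then show ?thesis unfolding smear_def mollify_def by simp
qed

lemma smear_continuous:
  assumes k: "continuous_on UNIV k" "\<And>x. k (x + 1) = k x" and f: "continuous_on UNIV f" "\<And>x. \<bar>f x\<bar> \<le> W"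
  shows "continuous_on UNIV (smear k f)"
proof -
  obtain B where B: "\<And>x. \<bar>k x\<bar> \<le> B" using periodic_bounded[OF k] by blast
  have B0: "B \<ge> 0" using B[of 0] by linarith
  have "continuous_on UNIV (\<lambda>y. LINT x|unit_interval. k (x - y) * f x)"
  proof (rule parametric_integral_continuous[OF prob_space.finite_measure[OF prob_space_unit_interval], where B = "B * W"])
    show "(\<lambda>x. k (x - y) * f x) \<in> borel_measurable unit_interval" for y
      by (intro continuous_measurable_unit_interval continuous_on_mult f continuous_on_compose2[OF k(1)] continuous_intros) auto
    show "continuous_on UNIV (\<lambda>y. k (x - y) * f x)" for x
      by (intro continuous_on_mult continuous_on_compose2[OF k(1)] continuous_intros) auto
    show "\<bar>k (x - y) * f x\<bar> \<le> B * W" for x y using B B0 f(2) by (auto simp: abs_mult intro!: mult_mono)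
  qed
  then show ?thesis unfolding smear_def[abs_def] .
qed

section \<open>Positive mollifiers and Jensen inequalities\<close>

locale mollifier =
  fixes \<eta> \<eta>' \<eta>'' :: "real \<Rightarrow> real" and \<delta> :: real
  assumes periodic: "\<eta> (x + 1) = \<eta> x"
    and deriv: "(\<eta> has_real_derivative \<eta>' x) (at x)" "(\<eta>' has_real_derivative \<eta>'' x) (at x)"
    and cont'': "continuous_on UNIV \<eta>''"
    and lower: "\<delta> > 0" "\<eta> x \<ge> \<delta>"
    and mass1: "(LINT x|unit_interval. \<eta> x) = 1"
begin

lemma cont: "continuous_on UNIV \<eta>" "continuous_on UNIV \<eta>'"
  using deriv by (meson DERIV_isCont continuous_at_imp_continuous_on)+

lemma periodic': "\<eta>' (x + 1) = \<eta>' x"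
  by (rule periodic_deriv[OF deriv(1) periodic])

text \<open>Integration by parts against the constant 1 shows that the integral of a translate of
  the kernel has zero derivative in the translation, so it equals its value at y = 0.\<close>

lemma smear_one: "smear \<eta> (\<lambda>x. 1) y = 1"
proof -
  have "(smear \<eta> (\<lambda>x. 1) has_real_derivative - smear \<eta>' (\<lambda>x. 1) y) (at y)" for y
    by (rule smear_deriv[OF deriv(1) cont(2) periodic, of _ 1]) auto
  moreover have "smear \<eta> (\<lambda>x. 0) y = - smear \<eta>' (\<lambda>x. 1) y" for y
    by (rule smear_by_parts[OF deriv(1) cont(2) periodic]) auto
  then have "smear \<eta>' (\<lambda>x. 1) y = 0" for y by (simp add: smear_def)
  ultimately have "(smear \<eta> (\<lambda>x. 1) has_real_derivative 0) (at y)" for y by simp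
  then have "smear \<eta> (\<lambda>x. 1) y = smear \<eta> (\<lambda>x. 1) 0" using DERIV_isconst_all by blast
  then show ?thesis by (simp add: smear_def mass1)
qed

lemma smear_mono_ineq:
  assumes f: "continuous_on UNIV f" "continuous_on UNIV g" and le: "\<And>x. f x \<le> g x"
  shows "smear \<eta> f y \<le> smear \<eta> g y"
proof -
  have i: "integrable unit_interval (\<lambda>x. \<eta> (x - y) * h x)" if "continuous_on UNIV h" for h
    by (intro integrable_unit_interval continuous_on_mult that continuous_on_compose2[OF cont(1)] continuous_intros) auto
  show ?thesis
    unfolding smear_def
  proof (rule integral_mono[OF i[OF f(1)] i[OF f(2)]])
    fix x show "\<eta> (x - y) * f x \<le> \<eta> (x - y) * g x"
      using le lower(2)[of "x - y"] lower(1) by (intro mult_left_mono) auto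
  qed
qed

lemma smear_affine:
  assumes f: "continuous_on UNIV f"
  shows "smear \<eta> (\<lambda>x. a * f x + b) y = a * smear \<eta> f y + b"
proof -
  have i: "integrable unit_interval (\<lambda>x. \<eta> (x - y) * h x)" if "continuous_on UNIV h" for h
    by (intro integrable_unit_interval continuous_on_mult that continuous_on_compose2[OF cont(1)] continuous_intros) auto
  have "smear \<eta> (\<lambda>x. a * f x + b) y = (LINT x|unit_interval. a * (\<eta> (x - y) * f x) + b * (\<eta> (x - y) * 1))"
    unfolding smear_def by (intro Bochner_Integration.integral_cong) (auto simp: algebra_simps)
  also have "... = a * smear \<eta> f y + b * smear \<eta> (\<lambda>x. 1) y"
    unfolding smear_def using i[OF f] i[of "\<lambda>x. 1"] by simp
  finally show ?thesis by (simp add: smear_one)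
qed

lemma smear_square_le:
  assumes f: "continuous_on UNIV f"
  shows "(smear \<eta> f y)\<^sup>2 \<le> smear \<eta> (\<lambda>x. (f x)\<^sup>2) y"
proof -
  define c where "c = smear \<eta> f y"
  have "smear \<eta> (\<lambda>x. 2 * c * f x + - c\<^sup>2) y \<le> smear \<eta> (\<lambda>x. (f x)\<^sup>2) y"
  proof (rule smear_mono_ineq)
    fix x have "0 \<le> (f x - c)\<^sup>2" by simp
    then show "2 * c * f x + - c\<^sup>2 \<le> (f x)\<^sup>2" by (simp add: power2_eq_square algebra_simps)
  qed (intro continuous_intros f)+
  then show ?thesis unfolding smear_affine[OF f] c_def[symmetric] by (simp add: power2_eq_square)
qed

text \<open>The same argument with the tangent line of exp at the mean c.\<close>

lemma smear_exp_le:
  assumes f: "continuous_on UNIV f"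
  shows "exp (smear \<eta> f y) \<le> smear \<eta> (\<lambda>x. exp (f x)) y"
proof -
  define c where "c = smear \<eta> f y"
  have "smear \<eta> (\<lambda>x. exp c * f x + exp c * (1 - c)) y \<le> smear \<eta> (\<lambda>x. exp (f x)) y"
  proof (rule smear_mono_ineq)
    fix x
    have "exp c * (1 + (f x - c)) \<le> exp c * exp (f x - c)"
      using exp_ge_add_one_self[of "f x - c"] by (intro mult_left_mono) auto
    also have "... = exp (f x)" by (simp add: exp_add[symmetric])
    finally show "exp c * f x + exp c * (1 - c) \<le> exp (f x)" by (simp add: algebra_simps)
  qed (intro continuous_intros f)+
  then show ?thesis unfolding smear_affine[OF f] c_def[symmetric] by (simp add: algebra_simps)
qed

lemma smear_bound:
  assumes f: "continuous_on UNIV f" "\<And>x. \<bar>f x\<bar> \<le> W"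
  shows "\<bar>smear \<eta> f y\<bar> \<le> W"
proof -
  have "smear \<eta> f y \<le> smear \<eta> (\<lambda>x. 0 * f x + W) y" "smear \<eta> (\<lambda>x. 0 * f x + - W) y \<le> smear \<eta> f y"
    using f(2) by (auto intro!: smear_mono_ineq continuous_intros f(1) simp: abs_le_iff) (metis minus_le_iff)+
  then show ?thesis unfolding smear_affine[OF f(1)] by (simp add: abs_le_iff)
qed

end

section \<open>A smooth approximate identity bounded away from zero\<close>

definition bump :: "real \<Rightarrow> real \<Rightarrow> real"
  where "bump d x = flat 0 (cos (2 * pi * x) - cos (2 * pi * d))"

lemma bump_smooth: "bump d \<in> smooth_real"
  unfolding bump_def[abs_def]
  using smooth_cos_scaled[of 0] by (intro smooth_real.comp[OF smooth_real.flat] smooth_real_diff smooth_real.const) simp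

lemma bump_periodic: "bump d (x + 1) = bump d x"
  using cos_periodic_1[of x 0] by (simp add: bump_def)

lemma bump_nonneg: "0 \<le> bump d x"
  by (simp add: bump_def flat_0_bounds)

text \<open>A nonnegative function with zero integral vanishes almost everywhere, but the bump is
  positive on [0, d). Positivity of the integral is what permits normalisation.\<close>

lemma integral_bump_pos:
  assumes d: "0 < d" "d < 1 / 2"
  shows "0 < (LINT x|unit_interval. bump d x)"
proof -
  have c: "continuous_on UNIV (bump d)" by (rule smooth_real_continuous[OF bump_smooth])
  have i: "integrable unit_interval (bump d)" by (rule integrable_unit_interval[OF c])
  have e: "cos (2 * pi * x) > cos (2 * pi * d)" if "x \<in> {0..<d}" for x
    using that d cos_gt_iff_small[of x d] by simp
  have ne: "\<not> (AE x in unit_interval. bump d x = 0)"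
  proof
    assume "AE x in unit_interval. bump d x = 0"
    then have "AE x in lborel. x \<in> {0..1} \<longrightarrow> bump d x = 0" by (simp add: AE_restrict_space_iff)
    then have "AE x in lborel. x \<notin> {0..<d}"
    proof eventually_elim
      case (elim x)
      show ?case
      proof
        assume x: "x \<in> {0..<d}"
        then have "bump d x > 0" using e[OF x] by (simp add: bump_def flat_def)
        then show False using elim x d by auto
      qed
    qed
    then have "{0..<d} \<in> null_sets lborel" by (subst AE_iff_null_sets) auto
    then show False using d by (simp add: null_sets_def)
  qed
  have "0 \<le> (LINT x|unit_interval. bump d x)" by (simp add: bump_nonneg)
  moreover have "(LINT x|unit_interval. bump d x) \<noteq> 0"
    using ne integral_nonneg_eq_0_iff_AE[OF i] by (simp add: bump_nonneg)
  ultimately show ?thesis by simp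
qed

text \<open>The additive constant keeps mollified densities away from 0, so that their logarithm is
  smooth.\<close>
definition bump_kernel :: "real \<Rightarrow> real \<Rightarrow> real"
  where "bump_kernel d x = (1 - d) / (LINT x|unit_interval. bump d x) * bump d x + d"

lemma mollifier_bump_kernel:
  assumes d: "0 < d" "d < 1 / 2"
  obtains \<eta>' \<eta>'' where "mollifier (bump_kernel d) \<eta>' \<eta>'' d"
proof -
  have "bump_kernel d \<in> smooth_real"
    unfolding bump_kernel_def[abs_def] by (intro smooth_real.add smooth_real_scale bump_smooth smooth_real.const)
  then obtain D where D: "D 0 = bump_kernel d" "\<And>n. D n \<in> smooth_real" "\<And>n x. (D n has_real_derivative D (Suc n) x) (at x)"
    using smooth_real_derivs by blast
  have i: "integrable unit_interval (bump d)" by (rule integrable_unit_interval[OF smooth_real_continuous[OF bump_smooth]])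
  have "mollifier (bump_kernel d) (D 1) (D 2) d"
  proof
    show "bump_kernel d (x + 1) = bump_kernel d x" for x by (simp add: bump_kernel_def bump_periodic)
    show "(bump_kernel d has_real_derivative D 1 x) (at x)" for x using D(3)[of 0 x] D(1) by simp
    show "(D 1 has_real_derivative D 2 x) (at x)" for x using D(3)[of 1 x] by (simp add: numeral_2_eq_2)
    show "continuous_on UNIV (D 2)" by (rule smooth_real_continuous[OF D(2)])
    show "d > 0" by (rule d)
    show "d \<le> bump_kernel d x" for x
      unfolding bump_kernel_def using d bump_nonneg[of d x] integral_bump_pos[OF d] by simp
    interpret prob_space unit_interval by (rule prob_space_unit_interval)
    show "(LINT x|unit_interval. bump_kernel d x) = 1"
      unfolding bump_kernel_def using i integral_bump_pos[OF d] prob_space by simp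
  qed
  then show thesis by (rule that)
qed

text \<open>Two errors: the normalised bump sees f only within distance d of y modulo 1, where
  continuity applies, and the added constant d contributes at most 2 B d.\<close>

lemma bump_kernel_approx:
  assumes f: "continuous_on UNIV f" "\<And>x. f (x + 1) = f x" and d: "\<And>n. 0 < d n" "\<And>n. d n < 1 / 2" "d \<longlonglongrightarrow> 0"
  shows "(\<lambda>n. smear (bump_kernel (d n)) f y) \<longlonglongrightarrow> f y"
proof -
  obtain B where B: "B > 0" "\<And>x. \<bar>f x\<bar> \<le> B" using periodic_bounded[OF f] by blast
  show ?thesis
  proof (rule LIMSEQ_I)
    fix r :: real assume r: "r > 0"
    have "isCont f y" using f(1) by (simp add: continuous_on_eq_continuous_at)
    then obtain s where s: "s > 0" "\<And>x. \<bar>x - y\<bar> < s \<Longrightarrow> \<bar>f x - f y\<bar> < r / 4"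
      using r unfolding continuous_at_eps_delta dist_real_def by (metis zero_less_divide_iff zero_less_numeral)
    \<comment> \<open>The bound r / (8 B) makes the contribution of the additive constant at most r
      / 4, so the total error is at most r / 2.\<close>
    have "eventually (\<lambda>n. d n < min s (r / (8 * B))) sequentially"
      using d(3) s r B by (intro order_tendstoD(2)[OF d(3)]) auto
    then obtain N where N: "\<And>n. n \<ge> N \<Longrightarrow> d n < s" "\<And>n. n \<ge> N \<Longrightarrow> d n < r / (8 * B)"
      unfolding eventually_sequentially by auto
    have "norm (smear (bump_kernel (d n)) f y - f y) < r" if n: "n \<ge> N" for n
    proof -
      obtain \<eta>' \<eta>'' where "mollifier (bump_kernel (d n)) \<eta>' \<eta>'' (d n)" using mollifier_bump_kernel[OF d(1,2)] by blast
      then interpret mollifier "bump_kernel (d n)" \<eta>' \<eta>'' "d n" .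
      let ?c = "(1 - d n) / (LINT x|unit_interval. bump (d n) x)"
      have ipos: "(LINT x|unit_interval. bump (d n) x) > 0" by (rule integral_bump_pos[OF d(1,2)])
      have pt: "\<bar>bump_kernel (d n) (x - y) * (f x - f y)\<bar> \<le> bump_kernel (d n) (x - y) * (r / 4) + d n * (2 * B)" for x
      proof -
        have fb: "\<bar>f x - f y\<bar> \<le> 2 * B" using B(2)[of x] B(2)[of y] by linarith
        have k0: "?c * bump (d n) (x - y) \<ge> 0" using d(1,2)[of n] ipos bump_nonneg[of "d n"] by simp
        have "?c * bump (d n) (x - y) * \<bar>f x - f y\<bar> \<le> ?c * bump (d n) (x - y) * (r / 4)"
        proof (cases "bump (d n) (x - y) = 0")
          case False
          then have cs: "cos (2 * pi * (x - y)) > cos (2 * pi * d n)" by (auto simp: bump_def flat_def split: if_splits)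
          \<comment> \<open>x need not be close to y on the line; the nearest integer translate z
            is, and f takes the same value there.\<close>
          define k where "k = round (x - y)"
          define z where "z = x - of_int k"
          have z: "\<bar>z - y\<bar> \<le> 1 / 2"
            unfolding z_def k_def using of_int_round_abs_le[of "x - y"] by (simp add: abs_minus_commute diff_diff_eq add.commute)
          have "cos (2 * pi * (x - y)) = cos (2 * pi * (z - y))"
            using periodic_int[of "\<lambda>x. cos (2 * pi * (x - y))" x "- k", OF cos_periodic_1] by (simp add: z_def)
          then have "\<bar>z - y\<bar> < d n" using cs cos_gt_iff_small[OF z d(1,2)] by simp
          then have "\<bar>f z - f y\<bar> < r / 4" using N(1)[OF n] by (intro s(2)) simp
          moreover have "f z = f x" using periodic_int[of f x "- k", OF f(2)] by (simp add: z_def)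
          ultimately show ?thesis using k0 by (intro mult_left_mono) auto
        qed simp
        moreover have "d n * \<bar>f x - f y\<bar> \<le> d n * (2 * B)" using d(1)[of n] fb by (intro mult_left_mono) auto
        moreover have "0 \<le> d n * (r / 4)" using d(1)[of n] r by simp
        moreover have "\<bar>bump_kernel (d n) (x - y) * (f x - f y)\<bar> = ?c * bump (d n) (x - y) * \<bar>f x - f y\<bar> + d n * \<bar>f x - f y\<bar>"
          unfolding bump_kernel_def abs_mult abs_of_nonneg[OF add_nonneg_nonneg[OF k0 less_imp_le[OF d(1)]]]
          by (rule distrib_right)
        moreover have "bump_kernel (d n) (x - y) * (r / 4) = ?c * bump (d n) (x - y) * (r / 4) + d n * (r / 4)"
          by (simp add: bump_kernel_def distrib_right)
        ultimately show ?thesis by linarith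
      qed
      have cc: "continuous_on UNIV (\<lambda>x. bump_kernel (d n) (x - y))"
        by (intro continuous_on_compose2[OF cont(1)] continuous_intros) auto
      interpret I: prob_space unit_interval by (rule prob_space_unit_interval)
      have "smear (bump_kernel (d n)) f y - f y = smear (bump_kernel (d n)) (\<lambda>x. 1 * f x + - f y) y"
        unfolding smear_affine[OF f(1)] by simp
      also have "... = (LINT x|unit_interval. bump_kernel (d n) (x - y) * (f x - f y))" by (simp add: smear_def)
      finally have "\<bar>smear (bump_kernel (d n)) f y - f y\<bar> \<le> (LINT x|unit_interval. \<bar>bump_kernel (d n) (x - y) * (f x - f y)\<bar>)" by simp
      also have "... \<le> (LINT x|unit_interval. bump_kernel (d n) (x - y) * (r / 4) + d n * (2 * B))"
        by (rule integral_mono[OF _ _ pt]; intro integrable_unit_interval continuous_intros cc f)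
      also have "... = r / 4 * smear (bump_kernel (d n)) (\<lambda>x. 1) y + d n * (2 * B)"
        using integrable_unit_interval[OF cc] I.prob_space by (simp add: smear_def space_restrict_space mult.commute)
      also have "... = r / 4 + d n * (2 * B)" by (simp add: smear_one)
      also have "d n * (2 * B) \<le> r / (8 * B) * (2 * B)" using N(2)[OF n] B by (intro mult_right_mono) auto
      also have "r / 4 + r / (8 * B) * (2 * B) = r / 2" using B by simp
      finally show ?thesis using r by simp
    qed
    then show "\<exists>N. \<forall>n\<ge>N. norm (smear (bump_kernel (d n)) f y - f y) < r" by blast
  qed
qed

section \<open>The Fisher information estimate\<close>

lemma integral_lebesgue_circle:
  fixes f :: "real \<Rightarrow> real"
  assumes f: "continuous_on UNIV f" "\<And>x. f (x + 1) = f x"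
  shows "(LINT x|lebesgue_circle. f (rep_circle x)) = (LINT x|unit_interval. f x)"
proof -
  have "abs_circle \<in> measurable (restrict_space lborel {0..<1}) borel"
    using borel_measurable_continuous_onI[OF continuous_abs_circle] by (intro measurable_restrict_space1) simp
  moreover have "(\<lambda>x. f (rep_circle x)) \<in> borel_measurable borel"
    by (intro borel_measurable_continuous_onI continuous_periodic_circle f)
  ultimately have "(LINT x|lebesgue_circle. f (rep_circle x)) = (LINT x|restrict_space lborel {0..<1}. f x)"
    unfolding lebesgue_circle_def by (subst integral_distr) (simp_all add: periodic_rep_abs[of f, OF f(2)])
  also have "... = (LINT x|unit_interval. f x)"
  proof -
    have "AE x in lborel. x \<noteq> (1::real)" by (rule AE_lborel_singleton)
    then have ae: "AE x in lborel. indicator {0..<1} x *\<^sub>R f x = indicator {0..1} x *\<^sub>R f x"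
      by eventually_elim (auto simp: indicator_def)
    have [measurable]: "f \<in> borel_measurable borel" using f(1) by (rule borel_measurable_continuous_onI)
    have "(LINT x|lborel. indicator {0..<1} x *\<^sub>R f x) = (LINT x|lborel. indicator {0..1} x *\<^sub>R f x)"
      by (rule integral_cong_AE[OF _ _ ae]; measurable)
    then show ?thesis by (simp add: integral_restrict_space)
  qed
  finally show ?thesis .
qed

text \<open>The derivative is the integral of a periodic derivative, hence 0; the constant value is
  fixed by Fubini and \<open>smear_one\<close>. It ensures that \<open>smear\<close> preserves
  Lebesgue means, which normalises the initial entropy bound.\<close>

lemma (in mollifier) mollify_lebesgue: "mollify \<eta> lebesgue_circle x = 1"
proof -
  note L = prob_space_lebesgue_circle sets_lebesgue_circle
  have "mollify \<eta>' lebesgue_circle x = 0" for x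
  proof -
    have c: "continuous_on UNIV (\<lambda>y. \<eta>' (x - y))"
      by (intro continuous_on_compose2[OF cont(2)] continuous_intros) auto
    have "mollify \<eta>' lebesgue_circle x = (LINT y|unit_interval. \<eta>' (x - y))"
      unfolding mollify_def by (rule integral_lebesgue_circle[OF c]) (rule periodic_shift, rule periodic')
    also have "... = 0"
    proof (rule integral_periodic_deriv[OF _ c])
      fix y
      have "((\<lambda>y. x - y) has_real_derivative - 1) (at y)" by (auto intro!: derivative_eq_intros)
      from DERIV_minus[OF DERIV_chain2[OF deriv(1) this]]
      show "((\<lambda>y. - \<eta> (x - y)) has_real_derivative \<eta>' (x - y)) (at y)" by simp
      show "- \<eta> (x - (y + 1)) = - \<eta> (x - y)" using periodic_shift[of \<eta>, OF periodic] by simp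
    qed
    finally show ?thesis .
  qed
  then have "(mollify \<eta> lebesgue_circle has_real_derivative 0) (at x)" for x
    using mollify_deriv[OF L deriv(1) cont(2) periodic, of x] by simp
  then have const: "mollify \<eta> lebesgue_circle y = mollify \<eta> lebesgue_circle x" for y
    using DERIV_isconst_all by blast
  have "(LINT y|lebesgue_circle. smear \<eta> (\<lambda>x. 1) (rep_circle y)) = (LINT x|unit_interval. mollify \<eta> lebesgue_circle x * 1)"
    by (rule mollify_fubini[OF L cont(1) periodic, of _ 1]) auto
  moreover have "(LINT z|unit_interval. mollify \<eta> lebesgue_circle z * 1) = (LINT z|unit_interval. mollify \<eta> lebesgue_circle x)"
    by (intro Bochner_Integration.integral_cong refl) (simp only: mult_1_right, rule const)
  ultimately show ?thesis
    using prob_space.prob_space[OF L(1)] prob_space.prob_space[OF prob_space_unit_interval] by (simp add: smear_one)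
qed

lemma continuous_on_slices:
  fixes f :: "real \<times> real \<Rightarrow> real"
  assumes "continuous_on UNIV f"
  shows "continuous_on UNIV (\<lambda>x. f (t, x))" "continuous_on UNIV (\<lambda>t. f (t, x))"
  by (rule continuous_on_compose2[OF assms]; auto intro!: continuous_intros)+

abbreviation jointly_continuous :: "(real \<Rightarrow> real \<Rightarrow> real) \<Rightarrow> bool"
  where "jointly_continuous F \<equiv> continuous_on UNIV (\<lambda>z. F (fst z) (snd z))"

lemma smear_joint_continuous:
  assumes k: "continuous_on UNIV k" "\<And>x. k (x + 1) = k x"
    and f: "jointly_continuous f" "\<And>t x. \<bar>f t x\<bar> \<le> W"
  shows "jointly_continuous (\<lambda>t. smear k (f t))"
  unfolding smear_def
proof -
  obtain B where B: "\<And>x. \<bar>k x\<bar> \<le> B" using periodic_bounded[OF k] by blast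
  have B0: "B \<ge> 0" using B[of 0] by linarith
  show "continuous_on UNIV (\<lambda>z :: real \<times> real. \<integral>x. k (x - snd z) * f (fst z) x \<partial>unit_interval)"
  proof (rule parametric_integral_continuous[OF prob_space.finite_measure[OF prob_space_unit_interval], where B = "B * W"])
    fix z :: "real \<times> real"
    show "(\<lambda>x. k (x - snd z) * f (fst z) x) \<in> borel_measurable unit_interval"
      using continuous_on_slices(1)[OF f(1), of "fst z"]
      by (intro continuous_measurable_unit_interval continuous_on_mult continuous_on_compose2[OF k(1)] continuous_intros) auto
    fix x
    show "\<bar>k (x - snd z) * f (fst z) x\<bar> \<le> B * W" using B B0 f(2) by (auto simp: abs_mult intro!: mult_mono)
    have "continuous_on UNIV (\<lambda>z :: real \<times> real. f (fst z) x)"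
      using continuous_on_compose2[OF continuous_on_slices(2)[OF f(1), of x] continuous_on_fst[OF continuous_on_id]] by simp
    then show "continuous_on UNIV (\<lambda>z :: real \<times> real. k (x - snd z) * f (fst z) x)"
      by (intro continuous_on_mult continuous_on_compose2[OF k(1)] continuous_intros) auto
  qed
qed

abbreviation on_circle :: "(real \<Rightarrow> real \<Rightarrow> real) \<Rightarrow> real \<times> circle \<Rightarrow> real"
  where "on_circle F \<equiv> (\<lambda>z. F (fst z) (rep_circle (snd z)))"

lemma lift_strip_measurable:
  fixes F :: "real \<Rightarrow> real \<Rightarrow> real"
  assumes c: "jointly_continuous F" and per: "\<And>t x. F t (x + 1) = F t x"
    and B: "\<And>t x. \<bar>F t x\<bar> \<le> B"
  shows "bounded_measurable (cyl T) (on_circle F)"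
proof (rule continuous_bounded_measurable_strip)
  show "continuous_on UNIV (on_circle F)"
  proof (rule continuous_on_prod_circle)
    have "F t (rep_circle (abs_circle x)) = F t x" for t x by (rule periodic_rep_abs[of "F t", OF per])
    then show "continuous_on UNIV (\<lambda>(t, x). F (fst (t, abs_circle x)) (rep_circle (snd (t, abs_circle x))))"
      using c by (simp add: case_prod_beta)
  qed
qed (rule B)

text \<open>Convexity of x ln x, as the tangent line at b. Placing the tangent at the later value is
  what makes the entropy increment an upper bound with the later logarithm as test function.\<close>

lemma xlnx_convex:
  fixes a b :: real
  assumes "a > 0" "b > 0"
  shows "b * ln b - a * ln a \<le> (1 + ln b) * (b - a)"
proof -
  have "ln (b / a) \<le> b / a - 1" using assms by (intro ln_le_minus_one) auto
  then have "a * (ln b - ln a) \<le> a * (b / a - 1)" using assms by (intro mult_left_mono) (auto simp: ln_div)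
  also have "... = b - a" using assms by (simp add: field_simps)
  finally show ?thesis by (simp add: algebra_simps)
qed

text \<open>Weak form of the Fokker-Planck equation in which the time derivative of \<rho> is
  \<alpha> times its second space derivative minus the divergence of b \<rho>. The last assumption
  is the dual form of an entropy bound C for the initial slice.\<close>

locale drift_diffusion =
  fixes T \<alpha> C :: real and \<rho> :: "real \<Rightarrow> circle measure" and b :: "real \<times> circle \<Rightarrow> real"
  assumes T: "T > 0" and \<alpha>: "\<alpha> > 0" and \<rho>: "narrow_curve T \<rho>"
    and b: "integrable (curve_measure T \<rho>) b" "integrable (curve_measure T \<rho>) (\<lambda>z. (b z)\<^sup>2)"
    and weak: "\<And>g s t. circle_C1 g \<Longrightarrow> circle_C1 (circle_deriv g) \<Longrightarrow> 0 \<le> s \<Longrightarrow> s \<le> t \<Longrightarrow> t \<le> T \<Longrightarrow>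
      (LINT x|\<rho> t. g x) - (LINT x|\<rho> s. g x) = (LINT z|curve_measure T \<rho>. indicator {s<..t} (fst z) *
        (circle_deriv g (snd z) * b z + \<alpha> * circle_deriv (circle_deriv g) (snd z)))"
    and ent: "\<And>g. continuous_on UNIV g \<Longrightarrow> (LINT x|\<rho> 0. g x) \<le> C + (LINT x|lebesgue_circle. exp (g x) - 1)"

locale fisher = mollifier \<eta> \<eta>' \<eta>'' \<delta> + drift_diffusion T \<alpha> C \<rho> b
  for \<eta> \<eta>' \<eta>'' :: "real \<Rightarrow> real" and \<delta> T \<alpha> C :: real and \<rho> b
begin

abbreviation (input) R :: "(real \<times> circle) measure"
  where "R \<equiv> curve_measure T \<rho>"

text \<open>Extends the curve by its end values, so that the mollified density is defined and
  continuous on the whole plane.\<close>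

definition clamp :: "real \<Rightarrow> real"
  where "clamp t = max 0 (min T t)"

lemma clamp_in: "clamp t \<in> {0..T}"
  using T by (auto simp: clamp_def)

lemma clamp_id: "t \<in> {0..T} \<Longrightarrow> clamp t = t"
  by (auto simp: clamp_def)

lemma clamp_continuous: "continuous_on S clamp"
  unfolding clamp_def by (intro continuous_intros)

lemma slice: "prob_space (\<rho> (clamp t))" "sets (\<rho> (clamp t)) = sets borel"
  by (rule narrow_curveD[OF \<rho> clamp_in])+

text \<open>Narrow continuity gives continuity in t for each fixed x. The Lipschitz bound in x is
  uniform in t, because it depends only on the kernel, and upgrades this to joint
  continuity.\<close>

lemma mollify_joint_continuous:
  assumes k: "\<And>x. (k has_real_derivative k' x) (at x)" "continuous_on UNIV k'" "\<And>x. k (x + 1) = k x"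
  shows "continuous_on UNIV (\<lambda>z :: real \<times> real. mollify k (\<rho> (clamp (fst z))) (snd z))"
  unfolding continuous_on_sequentially
proof (intro ballI allI impI)
  fix z :: "real \<times> real" and X assume "(\<forall>n. X n \<in> UNIV) \<and> X \<longlonglongrightarrow> z"
  then have X: "(\<lambda>n. fst (X n)) \<longlonglongrightarrow> fst z" "(\<lambda>n. snd (X n)) \<longlonglongrightarrow> snd z"
    by (auto intro: tendsto_fst tendsto_snd)
  have kc: "continuous_on UNIV k" using k(1) by (meson DERIV_isCont continuous_at_imp_continuous_on)
  obtain B where B: "\<And>x. \<bar>k' x\<bar> \<le> B" using periodic_bounded[OF k(2) periodic_deriv[OF k(1,3)]] by blast
  define F where "F t x = mollify k (\<rho> (clamp t)) x" for t x
  have lip: "\<bar>F t x - F t y\<bar> \<le> B * \<bar>x - y\<bar>" for t x y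
  proof -
    have "norm (F t x - F t y) \<le> B * norm (x - y)"
    proof (rule field_differentiable_bound[of UNIV _ "mollify k' (\<rho> (clamp t))"])
      fix z show "(F t has_field_derivative mollify k' (\<rho> (clamp t)) z) (at z within UNIV)"
        unfolding F_def[abs_def] by (simp add: mollify_deriv[OF slice k])
      have "\<bar>mollify k' (\<rho> (clamp t)) z\<bar> \<le> B"
        using mollify_bound(1)[OF slice k(2) periodic_deriv[OF k(1,3)], where a = "-B"]
          mollify_bound(2)[OF slice k(2) periodic_deriv[OF k(1,3)], where b = B] B by (simp add: abs_le_iff minus_le_iff)
      then show "norm (mollify k' (\<rho> (clamp t)) z) \<le> B" by simp
    qed auto
    then show ?thesis by simp
  qed
  have "continuous_on UNIV (\<lambda>t. F t x)" for x
  proof -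
    have "continuous_on UNIV (\<lambda>y. k (x - y))"
      by (intro continuous_on_compose2[OF kc] continuous_intros) auto
    then have c: "continuous_on UNIV (\<lambda>p. k (x - rep_circle p))"
      by (rule continuous_periodic_circle) (rule periodic_shift, rule k(3))
    then obtain D where "\<And>p. \<bar>k (x - rep_circle p)\<bar> \<le> D" using circle_continuous_bounded by blast
    then have "bounded (range (\<lambda>p. k (x - rep_circle p)))" by (intro boundedI) auto
    then have "continuous_on {0..T} (\<lambda>t. LINT p|\<rho> t. k (x - rep_circle p))"
      using \<rho> c unfolding narrow_curve_def by blast
    then show ?thesis
      unfolding F_def mollify_def by (rule continuous_on_compose2[OF _ clamp_continuous]) (use clamp_in in auto)
  qed
  then have 1: "(\<lambda>n. F (fst (X n)) (snd z)) \<longlonglongrightarrow> F (fst z) (snd z)"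
    using X(1) unfolding continuous_on_sequentially comp_def by blast
  have 2: "(\<lambda>n. F (fst (X n)) (snd (X n)) - F (fst (X n)) (snd z)) \<longlonglongrightarrow> 0"
  proof (rule Lim_null_comparison)
    show "\<forall>\<^sub>F n in sequentially. norm (F (fst (X n)) (snd (X n)) - F (fst (X n)) (snd z)) \<le> B * \<bar>snd (X n) - snd z\<bar>"
      using lip by simp
    have "(\<lambda>n. B * \<bar>snd (X n) - snd z\<bar>) \<longlonglongrightarrow> B * \<bar>snd z - snd z\<bar>" by (intro tendsto_intros X)
    then show "(\<lambda>n. B * \<bar>snd (X n) - snd z\<bar>) \<longlonglongrightarrow> 0" by simp
  qed
  from tendsto_add[OF 2 1] show "((\<lambda>z. mollify k (\<rho> (clamp (fst z))) (snd z)) \<circ> X) \<longlonglongrightarrow> mollify k (\<rho> (clamp (fst z))) (snd z)"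
    by (simp add: F_def comp_def)
qed

text \<open>\<open>P\<close> mollifies \<open>ln (\<eta> * \<rho>)\<close> once more. It is a legitimate test function, and by convexity of
  \<open>x ln x\<close> testing \<open>\<rho>\<^sub>t - \<rho>\<^sub>s\<close> with it dominates the increment of the entropy of \<open>\<eta> * \<rho>\<close>.\<close>
definition U :: "real \<Rightarrow> real \<Rightarrow> real" where "U t x = mollify \<eta> (\<rho> (clamp t)) x"
definition U' :: "real \<Rightarrow> real \<Rightarrow> real" where "U' t x = mollify \<eta>' (\<rho> (clamp t)) x"
definition L :: "real \<Rightarrow> real \<Rightarrow> real" where "L t x = ln (U t x)"
definition L' :: "real \<Rightarrow> real \<Rightarrow> real" where "L' t x = U' t x / U t x"
definition P :: "real \<Rightarrow> real \<Rightarrow> real" where "P t = smear \<eta> (L t)"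
definition P' :: "real \<Rightarrow> real \<Rightarrow> real" where "P' t = smear \<eta> (L' t)"
definition P'' :: "real \<Rightarrow> real \<Rightarrow> real" where "P'' t y = - smear \<eta>' (L' t) y"

lemma U_pos: "U t x \<ge> \<delta>" "U t x > 0"
proof -
  show "U t x \<ge> \<delta>" unfolding U_def by (rule mollify_bound(1)[OF slice cont(1) periodic lower(2)])
  then show "U t x > 0" using lower(1) by linarith
qed

lemma U_deriv: "(U t has_real_derivative U' t x) (at x)"
  unfolding U_def[abs_def] U'_def by (rule mollify_deriv[OF slice deriv(1) cont(2) periodic])

lemma U_periodic: "U t (x + 1) = U t x" "U' t (x + 1) = U' t x"
  unfolding U_def U'_def by (rule mollify_periodic, rule periodic, rule mollify_periodic, rule periodic')

lemma U_continuous: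
  "jointly_continuous U" "jointly_continuous U'"
  unfolding U_def U'_def
  by (rule mollify_joint_continuous[OF deriv(1) cont(2) periodic], rule mollify_joint_continuous[OF deriv(2) cont'' periodic'])

lemma L_continuous:
  "jointly_continuous L" "jointly_continuous L'"
proof -
  have ne: "U t x \<noteq> 0" for t x using U_pos(2)[of t x] by simp
  show "jointly_continuous L" "jointly_continuous L'"
    unfolding L_def L'_def by (intro continuous_on_ln continuous_on_divide U_continuous ballI ne)+
qed

lemma slices_continuous:
  "continuous_on UNIV (U t)" "continuous_on UNIV (U' t)" "continuous_on UNIV (L t)" "continuous_on UNIV (L' t)"
  using continuous_on_slices(1)[OF U_continuous(1)] continuous_on_slices(1)[OF U_continuous(2)]
    continuous_on_slices(1)[OF L_continuous(1)] continuous_on_slices(1)[OF L_continuous(2)] by simp_all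

lemma L_deriv: "(L t has_real_derivative L' t x) (at x)"
  unfolding L_def[abs_def] L'_def using DERIV_ln_divide[OF U_pos(2)[of t x]] U_deriv[of t x]
  by (auto intro!: derivative_eq_intros simp: U_pos)

lemma L_periodic: "L t (x + 1) = L t x" "L' t (x + 1) = L' t x"
  by (simp_all add: L_def L'_def U_periodic)

lemma uniform_bounds:
  obtains W where "W > 0" "\<And>t x. \<bar>U t x\<bar> \<le> W" "\<And>t x. \<bar>U' t x\<bar> \<le> W" "\<And>t x. \<bar>L t x\<bar> \<le> W" "\<And>t x. \<bar>L' t x\<bar> \<le> W" "\<And>t x. \<bar>P' t x\<bar> \<le> W" "\<And>t x. \<bar>P'' t x\<bar> \<le> W"
proof -
  obtain A where A: "A > 0" "\<And>x. \<bar>\<eta> x\<bar> \<le> A" using periodic_bounded[OF cont(1) periodic] by blast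
  obtain B where B: "B > 0" "\<And>x. \<bar>\<eta>' x\<bar> \<le> B" using periodic_bounded[OF cont(2) periodic'] by blast
  have UA: "\<bar>U t x\<bar> \<le> A" for t x
    using mollify_bound(2)[OF slice cont(1) periodic, where b = A] A(2) U_pos(2)[of t x] by (simp add: U_def abs_le_iff)
  have UB: "\<bar>U' t x\<bar> \<le> B" for t x
    using mollify_bound(1)[OF slice cont(2) periodic', where a = "-B"] mollify_bound(2)[OF slice cont(2) periodic', where b = B] B(2)
    by (simp add: U'_def abs_le_iff minus_le_iff)
  have LW: "\<bar>L t x\<bar> \<le> \<bar>ln \<delta>\<bar> + \<bar>ln A\<bar>" for t x
  proof -
    have "ln \<delta> \<le> ln (U t x)" using U_pos[of t x] lower(1) by simp
    moreover have "ln (U t x) \<le> ln A" using UA[of t x] U_pos(2)[of t x] A(1) by simp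
    ultimately show ?thesis unfolding L_def by linarith
  qed
  have L'W: "\<bar>L' t x\<bar> \<le> B / \<delta>" for t x
    unfolding L'_def abs_divide using UB[of t x] U_pos[of t x] lower(1) B(1) by (intro frac_le) auto
  have P'W: "\<bar>P' t x\<bar> \<le> B / \<delta>" for t x
    unfolding P'_def by (rule smear_bound[OF slices_continuous(4) L'W])
  have P''W: "\<bar>P'' t y\<bar> \<le> B * (B / \<delta>)" for t y
    unfolding P''_def smear_def abs_minus_cancel
  proof (rule integral_abs_le_const[OF prob_space_unit_interval])
    show "(\<lambda>x. \<eta>' (x - y) * L' t x) \<in> borel_measurable unit_interval"
      by (intro continuous_measurable_unit_interval continuous_on_mult slices_continuous continuous_on_compose2[OF cont(2)] continuous_intros) auto
    show "\<bar>\<eta>' (x - y) * L' t x\<bar> \<le> B * (B / \<delta>)" for x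
      unfolding abs_mult using B L'W by (intro mult_mono) auto
  qed
  define W where "W = A + B + \<bar>ln \<delta>\<bar> + \<bar>ln A\<bar> + B / \<delta> + B * (B / \<delta>)"
  have "B / \<delta> \<ge> 0" "B * (B / \<delta>) \<ge> 0" using B(1) lower(1) by auto
  then have W: "W > 0" "A \<le> W" "B \<le> W" "\<bar>ln \<delta>\<bar> + \<bar>ln A\<bar> \<le> W" "B / \<delta> \<le> W" "B * (B / \<delta>) \<le> W"
    unfolding W_def using A B by linarith+
  show thesis
    by (rule that[OF W(1)])
      (fact order_trans[OF UA W(2)] order_trans[OF UB W(3)] order_trans[OF LW W(4)] order_trans[OF L'W W(5)]
        order_trans[OF P'W W(5)] order_trans[OF P''W W(6)])+
qed

lemma P_periodic: "P t (y + 1) = P t y" "P' t (y + 1) = P' t y" "P'' t (y + 1) = P'' t y"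
  unfolding P_def P'_def P''_def
  by (rule smear_periodic, rule periodic, rule smear_periodic, rule periodic, subst smear_periodic, rule periodic', rule refl)

text \<open>Differentiation falls on the kernel and is moved to L by parts, so that P' is an average
  of L' and Jensen applies to its square. The second derivative stays on the kernel, which makes its
  integral against \<rho> dual to U'.\<close>

lemma P_deriv: "(P t has_real_derivative P' t y) (at y)" "(P' t has_real_derivative P'' t y) (at y)"
proof -
  obtain W where W: "\<And>t x. \<bar>L t x\<bar> \<le> W" "\<And>t x. \<bar>L' t x\<bar> \<le> W" using uniform_bounds by metis
  have "P' t y = - smear \<eta>' (L t) y"
    unfolding P'_def by (rule smear_by_parts[OF deriv(1) cont(2) periodic L_deriv slices_continuous(4) L_periodic(1)])
  then show "(P t has_real_derivative P' t y) (at y)"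
    using smear_deriv[OF deriv(1) cont(2) periodic slices_continuous(3) W(1)] by (simp add: P_def)
  show "(P' t has_real_derivative P'' t y) (at y)"
    using smear_deriv[OF deriv(1) cont(2) periodic slices_continuous(4) W(2)] by (simp add: P'_def P''_def)
qed

lemma P_continuous:
  "jointly_continuous P'" "jointly_continuous P''"
proof -
  obtain W where W: "\<And>t x. \<bar>L' t x\<bar> \<le> W" using uniform_bounds by metis
  show "jointly_continuous P'"
    unfolding P'_def by (rule smear_joint_continuous[OF cont(1) periodic L_continuous(2) W])
  show "jointly_continuous P''"
    unfolding P''_def by (intro continuous_on_minus smear_joint_continuous[OF cont(2) periodic' L_continuous(2) W])
qed

lemma P_circle:
  shows "circle_C1 (\<lambda>p. P t (rep_circle p))" "circle_deriv (\<lambda>p. P t (rep_circle p)) = (\<lambda>p. P' t (rep_circle p))"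
    "circle_C1 (\<lambda>p. P' t (rep_circle p))" "circle_deriv (\<lambda>p. P' t (rep_circle p)) = (\<lambda>p. P'' t (rep_circle p))"
    "continuous_on UNIV (\<lambda>p. P t (rep_circle p))"
proof -
  have lift: "P t (rep_circle (abs_circle x)) = P t x" "P' t (rep_circle (abs_circle x)) = P' t x" for x
    using periodic_rep_abs[of "P t", OF P_periodic(1)] periodic_rep_abs[of "P' t", OF P_periodic(2)] by auto
  have d1: "((\<lambda>x. P t (rep_circle (abs_circle x))) has_real_derivative P' t x) (at x)" for x
    unfolding lift by (rule P_deriv(1))
  have d2: "((\<lambda>x. P' t (rep_circle (abs_circle x))) has_real_derivative P'' t x) (at x)" for x
    unfolding lift by (rule P_deriv(2))
  have c: "continuous_on UNIV (P' t)" "continuous_on UNIV (P'' t)"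
    using continuous_on_slices(1)[OF P_continuous(1)] continuous_on_slices(1)[OF P_continuous(2)] by simp_all
  note C1 = circle_C1I[of "\<lambda>p. P t (rep_circle p)" "P' t", OF d1 c(1)]
  note C2 = circle_C1I[of "\<lambda>p. P' t (rep_circle p)" "P'' t", OF d2 c(2)]
  show "circle_C1 (\<lambda>p. P t (rep_circle p))" "circle_deriv (\<lambda>p. P t (rep_circle p)) = (\<lambda>p. P' t (rep_circle p))"
    "circle_C1 (\<lambda>p. P' t (rep_circle p))" "circle_deriv (\<lambda>p. P' t (rep_circle p)) = (\<lambda>p. P'' t (rep_circle p))"
    using C1(1,2) C2(1,2) by auto
  have "continuous_on UNIV (P t)" using P_deriv(1) by (meson DERIV_isCont continuous_at_imp_continuous_on)
  then show "continuous_on UNIV (\<lambda>p. P t (rep_circle p))" by (rule continuous_periodic_circle) (rule P_periodic)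
qed

section \<open>Entropy dissipation of the mollified density\<close>

definition E :: "real \<Rightarrow> real"
  where "E t = (LINT x|unit_interval. U t x * ln (U t x))"

text \<open>The Fisher information of the mollified density: L' is U' / U, so the integrand is
  (U')^2 / U.\<close>

definition FI :: "real \<Rightarrow> real"
  where "FI t = (LINT x|unit_interval. U' t x * L' t x)"

lemma smear_slice:
  assumes f: "continuous_on UNIV f" "\<And>x. \<bar>f x\<bar> \<le> W" and t: "t \<in> {0..T}"
  shows "(LINT y|\<rho> t. smear \<eta> f (rep_circle y)) = (LINT x|unit_interval. U t x * f x)"
    and "(LINT y|\<rho> t. smear \<eta>' f (rep_circle y)) = (LINT x|unit_interval. U' t x * f x)"
  using mollify_fubini[OF slice[of t] cont(1) periodic f] mollify_fubini[OF slice[of t] cont(2) periodic' f]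
  unfolding U_def U'_def clamp_id[OF t] by auto

lemma U_mass: "t \<in> {0..T} \<Longrightarrow> (LINT x|unit_interval. U t x) = 1"
  using smear_slice(1)[of "\<lambda>x. 1" 1 t] prob_space.prob_space[OF narrow_curveD(1)[OF \<rho>, of t]] narrow_curveD(3)[OF \<rho>, of t]
  by (simp add: smear_one)

text \<open>Convexity bounds the increment by the tangent at time t. Its constant part vanishes
  since U has mass 1 at both times, and duality of \<open>smear\<close> and \<open>mollify\<close>
  moves the logarithm onto \<rho> as P t.\<close>

lemma entropy_step:
  assumes s: "s \<in> {0..T}" and t: "t \<in> {0..T}"
  shows "E t - E s \<le> (LINT y|\<rho> t. P t (rep_circle y)) - (LINT y|\<rho> s. P t (rep_circle y))"
proof -
  obtain W where W: "\<And>t x. \<bar>L t x\<bar> \<le> W" using uniform_bounds by metis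
  have i: "integrable unit_interval (\<lambda>x. U r x * L q x)" "integrable unit_interval (U r)" for r q
    by (intro integrable_unit_interval continuous_on_mult slices_continuous)+
  have iE: "integrable unit_interval (\<lambda>x. U r x * ln (U r x))" for r
    using i(1)[of r r] by (simp add: L_def)
  have "E t - E s = (LINT x|unit_interval. U t x * ln (U t x) - U s x * ln (U s x))"
    unfolding E_def by (rule Bochner_Integration.integral_diff[symmetric, OF iE iE])
  also have "... \<le> (LINT x|unit_interval. (U t x - U s x) + (U t x * L t x - U s x * L t x))"
  proof (rule integral_mono)
    fix x
    have "U t x * ln (U t x) - U s x * ln (U s x) \<le> (1 + ln (U t x)) * (U t x - U s x)"
      by (rule xlnx_convex) (rule U_pos)+
    then show "U t x * ln (U t x) - U s x * ln (U s x) \<le> (U t x - U s x) + (U t x * L t x - U s x * L t x)"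
      by (simp add: L_def algebra_simps)
  qed (intro Bochner_Integration.integrable_diff Bochner_Integration.integrable_add i iE)+
  also have "... = ((LINT x|unit_interval. U t x) - (LINT x|unit_interval. U s x))
      + ((LINT x|unit_interval. U t x * L t x) - (LINT x|unit_interval. U s x * L t x))"
    using i by simp
  also have "... = (LINT y|\<rho> t. P t (rep_circle y)) - (LINT y|\<rho> s. P t (rep_circle y))"
    unfolding P_def smear_slice(1)[OF slices_continuous(3) W t] smear_slice(1)[OF slices_continuous(3) W s] U_mass[OF t] U_mass[OF s]
    by simp
  finally show ?thesis .
qed

lemma P_bounded_measurable:
  "bounded_measurable (cyl T) (on_circle P')"
  "bounded_measurable (cyl T) (on_circle P'')"
proof -
  obtain W where W: "\<And>t x. \<bar>P' t x\<bar> \<le> W" "\<And>t x. \<bar>P'' t x\<bar> \<le> W" using uniform_bounds by metis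
  show "bounded_measurable (cyl T) (on_circle P')"
    by (rule lift_strip_measurable[of P', OF P_continuous(1) P_periodic(2) W(1)])
  show "bounded_measurable (cyl T) (on_circle P'')"
    by (rule lift_strip_measurable[of P'', OF P_continuous(2) P_periodic(3) W(2)])
qed

lemma integrable_R: "bounded_measurable (cyl T) f \<Longrightarrow> integrable R f"
  by (rule integrable_bounded_measurable[OF finite_curve_measure[OF T \<rho>] sets_curve_measure[OF T \<rho>]])

lemma integrable_R_mult:
  assumes f: "bounded_measurable (cyl T) f" and h: "integrable R h"
  shows "integrable R (\<lambda>z. f z * h z)"
  by (rule integrable_mult_bounded[OF h sets_curve_measure[OF T \<rho>] f])

lemma entropy_total:
  "E T - E 0 \<le> (LINT z|R. P' (fst z) (rep_circle (snd z)) * b z + \<alpha> * P'' (fst z) (rep_circle (snd z)))"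
proof -
  obtain W where W: "W > 0" "\<And>t x. \<bar>P' t x\<bar> \<le> W" "\<And>t x. \<bar>P'' t x\<bar> \<le> W" using uniform_bounds by metis
  define tk where "tk n k = real k * T / real (Suc n)" for n k :: nat
  have tk01: "tk n k \<in> {0..T}" if "k \<le> Suc n" for n k unfolding tk_def by (rule grid_points(1)[OF T that])
  have tkm: "tk n k \<le> tk n (Suc k)" for n k unfolding tk_def by (rule grid_points(2)[OF T])
  define c where "c t z = P' t (rep_circle (snd z)) * b z + \<alpha> * P'' t (rep_circle (snd z))" for t and z :: "real \<times> circle"
  define Y where "Y n z = (\<Sum>k<Suc n. indicator {tk n k<..tk n (Suc k)} (fst z) * c (tk n (Suc k)) z)" for n and z :: "real \<times> circle"
  have grid: "Y n z = c (tk n (Suc (nat (\<lceil>fst z * real (Suc n) / T\<rceil> - 1)))) z" if "z \<in> space R" for n z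
    using grid_sum[of "fst z" T "Suc n" "\<lambda>k. c (tk n (Suc k)) z"] that
    unfolding Y_def tk_def space_curve_measure[OF T \<rho>] by auto
  have sm: "bounded_measurable (cyl T) (\<lambda>z. indicator {s<..t} (fst z) * P' u (rep_circle (snd z)))"
    "bounded_measurable (cyl T) (\<lambda>z. indicator {s<..t} (fst z) * P'' u (rep_circle (snd z)))" for s t u
  proof -
    have "bounded_measurable borel (\<lambda>p. P' u (rep_circle p))" "bounded_measurable borel (\<lambda>p. P'' u (rep_circle p))"
      using W P_circle(3)[of u] circle_C1D(2)[OF P_circle(1)[of u]] circle_C1D(2)[OF P_circle(3)[of u]]
      unfolding P_circle(2,4)
      by (auto intro!: bounded_measurableI borel_measurable_continuous_onI)
    then show "bounded_measurable (cyl T) (\<lambda>z. indicator {s<..t} (fst z) * P' u (rep_circle (snd z)))"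
      "bounded_measurable (cyl T) (\<lambda>z. indicator {s<..t} (fst z) * P'' u (rep_circle (snd z)))"
      by (auto intro!: strip_product_bounded[where A = 1] simp: indicator_def)
  qed
  have cell: "integrable R (\<lambda>z. indicator {s<..t} (fst z) * c u z)" for s t u
  proof -
    have "integrable R (\<lambda>z. (indicator {s<..t} (fst z) * P' u (rep_circle (snd z))) * b z + \<alpha> * (indicator {s<..t} (fst z) * P'' u (rep_circle (snd z))))"
      by (intro Bochner_Integration.integrable_add integrable_R_mult sm b integrable_mult_right integrable_R)
    then show ?thesis by (simp add: c_def algebra_simps)
  qed
  have iY: "integrable R (Y n)" for n unfolding Y_def by (intro Bochner_Integration.integrable_sum cell)
  have le: "E T - E 0 \<le> (LINT z|R. Y n z)" for n
  proof -
    have "E T - E 0 = E (tk n (Suc n)) - E (tk n 0)" by (simp add: tk_def)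
    also have "... = (\<Sum>k<Suc n. E (tk n (Suc k)) - E (tk n k))" by (rule sum_lessThan_telescope[symmetric])
    also have "... \<le> (\<Sum>k<Suc n. \<integral>z. indicator {tk n k<..tk n (Suc k)} (fst z) * c (tk n (Suc k)) z \<partial>R)"
    proof (rule sum_mono)
      fix k assume "k \<in> {..<Suc n}"
      then have t: "tk n k \<in> {0..T}" "tk n (Suc k) \<in> {0..T}" using tk01[of k n] tk01[of "Suc k" n] by auto
      have "E (tk n (Suc k)) - E (tk n k) \<le> (LINT y|\<rho> (tk n (Suc k)). P (tk n (Suc k)) (rep_circle y)) - (LINT y|\<rho> (tk n k). P (tk n (Suc k)) (rep_circle y))"
        by (rule entropy_step[OF t])
      also have "... = (LINT z|R. indicator {tk n k<..tk n (Suc k)} (fst z) * c (tk n (Suc k)) z)"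
        unfolding c_def using weak[OF P_circle(1)[of "tk n (Suc k)"], unfolded P_circle(2,4), OF P_circle(3), of "tk n k" "tk n (Suc k)"] t tkm[of n k]
        by simp
      finally show "E (tk n (Suc k)) - E (tk n k) \<le> (LINT z|R. indicator {tk n k<..tk n (Suc k)} (fst z) * c (tk n (Suc k)) z)" .
    qed
    also have "... = (LINT z|R. Y n z)" unfolding Y_def by (rule Bochner_Integration.integral_sum[symmetric]) (rule cell)
    finally show ?thesis .
  qed
  have "(\<lambda>n. LINT z|R. Y n z) \<longlonglongrightarrow> (LINT z|R. c (fst z) z)"
  proof (rule integral_dominated_convergence[where w = "\<lambda>z. W * \<bar>b z\<bar> + \<alpha> * W"])
    have "integrable R (\<lambda>z. c (fst z) z)"
      unfolding c_def
      by (intro Bochner_Integration.integrable_add integrable_R_mult b integrable_mult_right integrable_R P_bounded_measurable)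
    then show "(\<lambda>z. c (fst z) z) \<in> borel_measurable R" by auto
    show "Y n \<in> borel_measurable R" for n using iY by auto
    interpret finite_measure R by (rule finite_curve_measure[OF T \<rho>])
    show "integrable R (\<lambda>z. W * \<bar>b z\<bar> + \<alpha> * W)" using b(1) by simp
    have cb: "\<bar>c t z\<bar> \<le> W * \<bar>b z\<bar> + \<alpha> * W" for t z
    proof -
      have "\<bar>c t z\<bar> \<le> \<bar>P' t (rep_circle (snd z))\<bar> * \<bar>b z\<bar> + \<alpha> * \<bar>P'' t (rep_circle (snd z))\<bar>"
        unfolding c_def using \<alpha> by (metis abs_mult abs_of_pos abs_triangle_ineq)
      also have "... \<le> W * \<bar>b z\<bar> + \<alpha> * W" using W \<alpha> by (intro add_mono mult_right_mono mult_left_mono) auto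
      finally show ?thesis .
    qed
    show "AE z in R. norm (Y n z) \<le> W * \<bar>b z\<bar> + \<alpha> * W" for n
      by (rule AE_I2) (simp add: grid cb)
    show "AE z in R. (\<lambda>n. Y n z) \<longlonglongrightarrow> c (fst z) z"
    proof (rule AE_I2)
      fix z assume z: "z \<in> space R"
      then have r: "0 < fst z" "fst z < T" by (auto simp: space_curve_measure[OF T \<rho>])
      have lim: "(\<lambda>n. tk n (Suc (nat (\<lceil>fst z * real (Suc n) / T\<rceil> - 1)))) \<longlonglongrightarrow> fst z"
        unfolding tk_def of_nat_Suc using grid_tendsto(2)[OF r] by (simp add: add.commute)
      have "isCont (\<lambda>t. P' t y) (fst z)" "isCont (\<lambda>t. P'' t y) (fst z)" for y
        using continuous_on_slices(2)[OF P_continuous(1), of y] continuous_on_slices(2)[OF P_continuous(2), of y]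
        by (auto simp: continuous_on_eq_continuous_at)
      then have "(\<lambda>n. c (tk n (Suc (nat (\<lceil>fst z * real (Suc n) / T\<rceil> - 1)))) z) \<longlonglongrightarrow> c (fst z) z"
        unfolding c_def by (intro tendsto_intros isCont_tendsto_compose[OF _ lim])
      then show "(\<lambda>n. Y n z) \<longlonglongrightarrow> c (fst z) z" by (simp add: grid[OF z])
    qed
  qed
  from LIMSEQ_le_const[OF this] have "E T - E 0 \<le> (LINT z|R. c (fst z) z)" using le by blast
  then show ?thesis unfolding c_def .
qed

lemma finite_time: "finite_measure (time T)"
  by (rule finite_measureI) (use T in \<open>simp add: emeasure_restrict_space\<close>)

lemma FI_integrable: "integrable (time T) FI"
proof -
  obtain W where W: "W > 0" "\<And>t x. \<bar>U' t x\<bar> \<le> W" "\<And>t x. \<bar>L' t x\<bar> \<le> W" using uniform_bounds by metis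
  have b: "\<bar>U' t x * L' t x\<bar> \<le> W * W" for t x unfolding abs_mult using W by (intro mult_mono) auto
  have c: "continuous_on UNIV FI"
    unfolding FI_def
  proof (rule parametric_integral_continuous[OF prob_space.finite_measure[OF prob_space_unit_interval], where B = "W * W"])
    show "(\<lambda>x. U' t x * L' t x) \<in> borel_measurable unit_interval" for t
      by (intro continuous_measurable_unit_interval continuous_on_mult slices_continuous)
    show "continuous_on UNIV (\<lambda>t. U' t x * L' t x)" for x
      using continuous_on_slices(2)[OF U_continuous(2)] continuous_on_slices(2)[OF L_continuous(2)]
      by (intro continuous_on_mult) auto
  qed (rule b)
  show ?thesis
  proof (rule integrable_bounded[OF finite_time])
    show "FI \<in> borel_measurable (time T)"
      unfolding measurable_time_measure by (intro measurable_restrict_space1 borel_measurable_continuous_onI c)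
    show "\<bar>FI t\<bar> \<le> W * W" for t
      unfolding FI_def
      by (rule integral_abs_le_const[OF prob_space_unit_interval])
        (auto intro!: continuous_measurable_unit_interval continuous_on_mult slices_continuous b)
  qed
qed

lemma fubini_R:
  assumes "bounded_measurable (cyl T) f"
  shows "integrable (time T) (\<lambda>t. LINT x|\<rho> t. f (t, x))"
    "(LINT z|R. f z) = (LINT t|time T. (LINT x|\<rho> t. f (t, x)))"
  using curve_measure_fubini(2,3)[OF T \<rho> integrable_R[OF assms]] by simp_all

lemma FI_eq: "FI t = (LINT x|unit_interval. U t x * (L' t x)\<^sup>2)"
  unfolding FI_def by (rule Bochner_Integration.integral_cong) (auto simp: L'_def power2_eq_square U_pos less_imp_neq[OF U_pos(2), symmetric])

text \<open>Diffusion contributes -\<alpha> times the integrated Fisher information. Jensen bounds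
  the square of P' by the same quantity, so Young's inequality lets half of the dissipation absorb
  the drift; the other half is bounded by the drift energy and the initial entropy.\<close>

lemma fisher_integral:
  "(LINT t|time T. FI t) \<le> 2 / \<alpha> * (1 / (2 * \<alpha>) * (LINT z|R. (b z)\<^sup>2) + C)"
proof -
  let ?P' = "on_circle P'" and ?P'' = "on_circle P''"
  obtain W where W: "W > 0" "\<And>t x. \<bar>L t x\<bar> \<le> W" "\<And>t x. \<bar>L' t x\<bar> \<le> W" using uniform_bounds by metis
  note PM = P_bounded_measurable
  have 2: "(LINT z|R. ?P'' z) = - (LINT t|time T. FI t)"
  proof -
    have "(LINT z|R. ?P'' z) = (LINT t|time T. - FI t)"
      unfolding fubini_R(2)[OF PM(2)]
    proof (rule Bochner_Integration.integral_cong[OF refl])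
      fix t assume "t \<in> space (time T)"
      then have t: "t \<in> {0..T}" by auto
      show "(LINT x|\<rho> t. P'' (fst (t, x)) (rep_circle (snd (t, x)))) = - FI t"
        using smear_slice(2)[OF slices_continuous(4) W(3) t, of t] by (simp add: P''_def FI_def)
    qed
    then show ?thesis by simp
  qed
  have 1: "(LINT z|R. (?P' z)\<^sup>2) \<le> (LINT t|time T. FI t)"
    unfolding fubini_R(2)[OF bounded_measurable_power2[OF PM(1)]]
  proof (rule integral_mono[OF fubini_R(1)[OF bounded_measurable_power2[OF PM(1)]] FI_integrable])
    fix t assume "t \<in> space (time T)"
    then have t: "t \<in> {0..T}" by auto
    have c2: "continuous_on UNIV (\<lambda>x. (L' t x)\<^sup>2)" by (intro continuous_intros slices_continuous)
    have b2: "\<bar>(L' t x)\<^sup>2\<bar> \<le> W * W" for x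
      unfolding power2_eq_square abs_mult using W by (intro mult_mono) auto
    have meas: "(\<lambda>y. f (rep_circle y)) \<in> borel_measurable (\<rho> t)" if "continuous_on UNIV f" "\<And>x. f (x + 1) = f x" for f :: "real \<Rightarrow> real"
      using borel_measurable_continuous_onI[OF continuous_periodic_circle[OF that]] measurable_cong_sets[OF narrow_curveD(2)[OF \<rho> t] refl] by blast
    have cP: "continuous_on UNIV (P' t)" using continuous_on_slices(1)[OF P_continuous(1)] by simp
    have sb: "\<bar>smear \<eta> (\<lambda>x. (L' t x)\<^sup>2) y\<bar> \<le> W * W" for y by (rule smear_bound[OF c2 b2])
    have Pb: "\<bar>(P' t y)\<^sup>2\<bar> \<le> W * W" for y
      unfolding power2_eq_square abs_mult using W smear_bound[OF slices_continuous(4) W(3), of t y]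
      by (intro mult_mono) (auto simp: P'_def)
    have fm: "finite_measure (\<rho> t)" by (rule prob_space.finite_measure[OF narrow_curveD(1)[OF \<rho> t]])
    have "(LINT y|\<rho> t. (P' t (rep_circle y))\<^sup>2) \<le> (LINT y|\<rho> t. smear \<eta> (\<lambda>x. (L' t x)\<^sup>2) (rep_circle y))"
    proof (rule integral_mono)
      show "integrable (\<rho> t) (\<lambda>y. (P' t (rep_circle y))\<^sup>2)"
        by (rule integrable_bounded[OF fm _ Pb]) (intro borel_measurable_power meas cP P_periodic)
      show "integrable (\<rho> t) (\<lambda>y. smear \<eta> (\<lambda>x. (L' t x)\<^sup>2) (rep_circle y))"
        by (rule integrable_bounded[OF fm _ sb]) (intro meas smear_continuous[OF cont(1) periodic c2 b2] smear_periodic periodic)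
      show "(P' t (rep_circle y))\<^sup>2 \<le> smear \<eta> (\<lambda>x. (L' t x)\<^sup>2) (rep_circle y)" for y
        unfolding P'_def by (rule smear_square_le[OF slices_continuous(4)])
    qed
    also have "... = FI t" unfolding smear_slice(1)[OF c2 b2 t] FI_eq ..
    finally show "(LINT x|\<rho> t. (P' (fst (t, x)) (rep_circle (snd (t, x))))\<^sup>2) \<le> FI t" by simp
  qed
  have 3: "(LINT z|R. ?P' z * b z) \<le> 1 / (2 * \<alpha>) * (LINT z|R. (b z)\<^sup>2) + \<alpha> / 2 * (LINT z|R. (?P' z)\<^sup>2)"
  proof -
    have iP2: "integrable R (\<lambda>z. (?P' z)\<^sup>2)" by (rule integrable_R[OF bounded_measurable_power2[OF PM(1)]])
    have "(LINT z|R. ?P' z * b z) \<le> (LINT z|R. 1 / (2 * \<alpha>) * (b z)\<^sup>2 + \<alpha> / 2 * (?P' z)\<^sup>2)"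
    proof (rule integral_mono[OF integrable_R_mult[OF PM(1) b(1)]])
      show "integrable R (\<lambda>z. 1 / (2 * \<alpha>) * (b z)\<^sup>2 + \<alpha> / 2 * (?P' z)\<^sup>2)"
        by (intro Bochner_Integration.integrable_add integrable_mult_right b iP2)
      fix z
      \<comment> \<open>The weight \<alpha> is chosen so that exactly \<alpha> / 2 falls on the
        square of P'.\<close>
      have "0 \<le> (b z - \<alpha> * ?P' z)\<^sup>2" by simp
      then have "2 * \<alpha> * (?P' z * b z) \<le> (b z)\<^sup>2 + \<alpha>\<^sup>2 * (?P' z)\<^sup>2" by (simp add: power2_eq_square algebra_simps)
      then have "(2 * \<alpha> * (?P' z * b z)) / (2 * \<alpha>) \<le> ((b z)\<^sup>2 + \<alpha>\<^sup>2 * (?P' z)\<^sup>2) / (2 * \<alpha>)"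
        using \<alpha> by (intro divide_right_mono) auto
      then show "?P' z * b z \<le> 1 / (2 * \<alpha>) * (b z)\<^sup>2 + \<alpha> / 2 * (?P' z)\<^sup>2"
        using \<alpha> by (simp add: add_divide_distrib power2_eq_square)
    qed
    also have "... = 1 / (2 * \<alpha>) * (LINT z|R. (b z)\<^sup>2) + \<alpha> / 2 * (LINT z|R. (?P' z)\<^sup>2)"
      using b(2) iP2 by simp
    finally show ?thesis .
  qed
  \<comment> \<open>U is a probability density on the unit interval, and u ln u \<ge> u - 1
    pointwise.\<close>
  have 4: "E T \<ge> 0"
  proof -
    have "(LINT x|unit_interval. U T x - 1) \<le> E T"
      unfolding E_def
    proof (rule integral_mono)
      show "integrable unit_interval (\<lambda>x. U T x - 1)" by (intro integrable_unit_interval continuous_intros slices_continuous)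
      show "integrable unit_interval (\<lambda>x. U T x * ln (U T x))"
        using integrable_unit_interval[OF continuous_on_mult[OF slices_continuous(1,3)]] by (simp add: L_def)
      fix x show "U T x - 1 \<le> U T x * ln (U T x)"
        using entropy_young(2)[of "U T x"] U_pos(2)[of T x] by simp
    qed
    moreover have "(LINT x|unit_interval. U T x - 1) = 0"
    proof -
      interpret I: prob_space unit_interval by (rule prob_space_unit_interval)
      have "(LINT x|unit_interval. U T x - 1) = (LINT x|unit_interval. U T x) - (LINT x|unit_interval. 1)"
        by (rule Bochner_Integration.integral_diff[OF integrable_unit_interval[OF slices_continuous(1)]]) simp
      then show ?thesis using U_mass[of T] T I.prob_space by simp
    qed
    ultimately show ?thesis by simp
  qed
  \<comment> \<open>The initial bound is tested with g = P 0, whose integral is the mollified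
    entropy itself. By Jensen exp (P 0) lies below the smeared density U 0, which has Lebesgue mean
    1, so the exponential correction is nonpositive and the constant stays C.\<close>
  have 5: "E 0 \<le> C"
  proof -
    have T0: "0 \<in> {0..T}" using T by simp
    have "E 0 = (LINT y|\<rho> 0. P 0 (rep_circle y))"
      unfolding P_def smear_slice(1)[OF slices_continuous(3) W(2) T0] E_def L_def ..
    also have "... \<le> C + (LINT x|lebesgue_circle. exp (P 0 (rep_circle x)) - 1)"
      by (rule ent[OF P_circle(5)])
    also have "(LINT x|lebesgue_circle. exp (P 0 (rep_circle x)) - 1) \<le> (LINT y|lebesgue_circle. smear \<eta> (U 0) (rep_circle y) - 1)"
    proof (rule integral_mono)
      obtain V where V: "\<And>t x. \<bar>U t x\<bar> \<le> V" using uniform_bounds by metis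
      have lc: "integrable lebesgue_circle g" if g: "continuous_on UNIV g" for g :: "circle \<Rightarrow> real"
      proof -
        obtain B where B: "\<And>p. \<bar>g p\<bar> \<le> B" using circle_continuous_bounded[OF g] by blast
        show ?thesis
          by (rule integrable_bounded[OF prob_space.finite_measure[OF prob_space_lebesgue_circle] _ B])
            (use borel_measurable_continuous_onI[OF g] in \<open>simp add: lebesgue_circle_def\<close>)
      qed
      show "integrable lebesgue_circle (\<lambda>x. exp (P 0 (rep_circle x)) - 1)" by (intro lc continuous_intros P_circle(5))
      show "integrable lebesgue_circle (\<lambda>y. smear \<eta> (U 0) (rep_circle y) - 1)"
        by (intro lc continuous_on_diff continuous_on_const continuous_periodic_circle
            smear_continuous[OF cont(1) periodic slices_continuous(1) V] smear_periodic periodic)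
      fix x
      have "exp (smear \<eta> (L 0) (rep_circle x)) \<le> smear \<eta> (\<lambda>x. exp (L 0 x)) (rep_circle x)" by (rule smear_exp_le[OF slices_continuous(3)])
      also have "(\<lambda>x. exp (L 0 x)) = U 0" using U_pos(2) by (auto simp: L_def)
      finally show "exp (P 0 (rep_circle x)) - 1 \<le> smear \<eta> (U 0) (rep_circle x) - 1" by (simp add: P_def)
    qed
    also have "... = 0"
    proof -
      obtain V where V: "\<And>t x. \<bar>U t x\<bar> \<le> V" using uniform_bounds by metis
      interpret Lc: prob_space lebesgue_circle by (rule prob_space_lebesgue_circle)
      obtain B where B: "\<And>p. \<bar>smear \<eta> (U 0) (rep_circle p)\<bar> \<le> B"
        using smear_bound[OF slices_continuous(1) V] by blast
      have "continuous_on UNIV (\<lambda>y. smear \<eta> (U 0) (rep_circle y))"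
        by (intro continuous_periodic_circle smear_continuous[OF cont(1) periodic slices_continuous(1) V] smear_periodic periodic)
      then have "integrable lebesgue_circle (\<lambda>y. smear \<eta> (U 0) (rep_circle y))"
        by (intro integrable_bounded[OF Lc.finite_measure_axioms _ B])
          (use borel_measurable_continuous_onI in \<open>auto simp: lebesgue_circle_def\<close>)
      then have "(LINT y|lebesgue_circle. smear \<eta> (U 0) (rep_circle y) - 1) = (LINT y|lebesgue_circle. smear \<eta> (U 0) (rep_circle y)) - 1"
        using Lc.prob_space by simp
      also have "(LINT y|lebesgue_circle. smear \<eta> (U 0) (rep_circle y)) = (LINT x|unit_interval. mollify \<eta> lebesgue_circle x * U 0 x)"
        by (rule mollify_fubini[OF prob_space_lebesgue_circle sets_lebesgue_circle cont(1) periodic slices_continuous(1) V])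
      also have "... = 1" using U_mass[OF T0] by (simp add: mollify_lebesgue)
      finally show ?thesis by simp
    qed
    finally show ?thesis by simp
  qed
  have "E T - E 0 \<le> (LINT z|R. ?P' z * b z) + \<alpha> * (LINT z|R. ?P'' z)"
    using entropy_total integrable_R_mult[OF PM(1) b(1)] integrable_R[OF PM(2)] by simp
  also have "... \<le> 1 / (2 * \<alpha>) * (LINT z|R. (b z)\<^sup>2) + \<alpha> / 2 * (LINT t|time T. FI t) - \<alpha> * (LINT t|time T. FI t)"
  proof -
    have "\<alpha> / 2 * (LINT z|R. (?P' z)\<^sup>2) \<le> \<alpha> / 2 * (LINT t|time T. FI t)"
      using \<alpha> by (intro mult_left_mono 1) simp
    then show ?thesis using 3 unfolding 2 by linarith
  qed
  finally have "\<alpha> / 2 * (LINT t|time T. FI t) \<le> 1 / (2 * \<alpha>) * (LINT z|R. (b z)\<^sup>2) + C"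
    using 4 5 by (simp add: field_simps)
  then have "2 / \<alpha> * (\<alpha> / 2 * (LINT t|time T. FI t)) \<le> 2 / \<alpha> * (1 / (2 * \<alpha>) * (LINT z|R. (b z)\<^sup>2) + C)"
    using \<alpha> by (intro mult_left_mono) auto
  then show ?thesis using \<alpha> by simp
qed

text \<open>At each time the derivative is moved from \<phi> to U, and Young's inequality separates
  the Fisher information from the square of \<phi>. The estimate is phrased with
  \<open>smear\<close> so that it lives on \<rho> itself and the mollification can be
  removed.\<close>

lemma smeared_estimate:
  assumes \<phi>: "lipschitz_C1 \<phi> \<phi>x"
  shows "- (LINT z|R. smear \<eta> (\<lambda>x. \<phi>x (fst z, abs_circle x)) (rep_circle (snd z)))
    \<le> 1 / \<alpha> * (1 / (2 * \<alpha>) * (LINT z|R. (b z)\<^sup>2) + C)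
      + 1 / 2 * (LINT z|R. smear \<eta> (\<lambda>x. (\<phi> (fst z, abs_circle x))\<^sup>2) (rep_circle (snd z)))" (is ?est)
    and "bounded_measurable (cyl T) (\<lambda>z. smear \<eta> (\<lambda>x. \<phi>x (fst z, abs_circle x)) (rep_circle (snd z)))" (is ?m1)
    and "bounded_measurable (cyl T) (\<lambda>z. smear \<eta> (\<lambda>x. (\<phi> (fst z, abs_circle x))\<^sup>2) (rep_circle (snd z)))" (is ?m2)
proof -
  have c: "continuous_on UNIV \<phi>" "continuous_on UNIV \<phi>x" using \<phi> unfolding lipschitz_C1_def by auto
  obtain B where B: "\<And>z. \<bar>\<phi> z\<bar> \<le> B" "\<And>z. \<bar>\<phi>x z\<bar> \<le> B" using \<phi> unfolding lipschitz_C1_def by blast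
  have lift: "continuous_on UNIV (\<lambda>z :: real \<times> real. f (fst z, abs_circle (snd z)))" if "continuous_on UNIV f" for f :: "real \<times> circle \<Rightarrow> real"
    by (rule continuous_on_compose2[OF that]) (auto intro!: continuous_intros)
  have j: "jointly_continuous (\<lambda>t x. \<phi>x (t, abs_circle x))"
    "continuous_on UNIV (\<lambda>z :: real \<times> real. (\<lambda>t x. (\<phi> (t, abs_circle x))\<^sup>2) (fst z) (snd z))"
    using lift[OF c(2)] continuous_on_power[OF lift[OF c(1)], of 2] by auto
  have B2: "\<bar>(\<phi> z)\<^sup>2\<bar> \<le> B * B" for z
    unfolding power2_eq_square abs_mult using B(1)[of z] by (intro mult_mono) auto
  have sl: "continuous_on UNIV (\<lambda>x. \<phi>x (t, abs_circle x))" "continuous_on UNIV (\<lambda>x. (\<phi> (t, abs_circle x))\<^sup>2)"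
    "continuous_on UNIV (\<lambda>x. \<phi> (t, abs_circle x))" for t
    using continuous_on_slices(1)[OF j(1), of t] continuous_on_slices(1)[OF j(2), of t] continuous_on_slices(1)[OF lift[OF c(1)], of t] by auto
  show m1: ?m1
    by (rule lift_strip_measurable[of "\<lambda>t. smear \<eta> (\<lambda>x. \<phi>x (t, abs_circle x))", OF smear_joint_continuous[OF cont(1) periodic j(1)]])
      (auto intro: B smear_periodic periodic smear_bound[OF sl(1)])
  show m2: ?m2
    by (rule lift_strip_measurable[of "\<lambda>t. smear \<eta> (\<lambda>x. (\<phi> (t, abs_circle x))\<^sup>2)", OF smear_joint_continuous[OF cont(1) periodic j(2)]])
      (rule B2, rule smear_periodic, rule periodic, rule smear_bound[OF sl(2) B2])
  have pt: "- (LINT y|\<rho> t. smear \<eta> (\<lambda>x. \<phi>x (t, abs_circle x)) (rep_circle y))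
    \<le> 1 / 2 * FI t + 1 / 2 * (LINT y|\<rho> t. smear \<eta> (\<lambda>x. (\<phi> (t, abs_circle x))\<^sup>2) (rep_circle y))" if t: "t \<in> {0..T}" for t
  proof -
    let ?h = "\<lambda>x. \<phi> (t, abs_circle x)" and ?h' = "\<lambda>x. \<phi>x (t, abs_circle x)"
    have C1: "circle_C1 (\<lambda>p. \<phi> (t, p))" "circle_deriv (\<lambda>p. \<phi> (t, p)) = (\<lambda>p. \<phi>x (t, p))" using \<phi> unfolding lipschitz_C1_def by auto
    have d: "(?h has_real_derivative ?h' x) (at x)" for x using circle_C1D(1)[OF C1(1)] unfolding C1(2) .
    have i: "integrable unit_interval (\<lambda>x. U t x * ?h' x)" "integrable unit_interval (\<lambda>x. U' t x * ?h x)"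
      "integrable unit_interval (\<lambda>x. U' t x * L' t x)" "integrable unit_interval (\<lambda>x. U t x * (?h x)\<^sup>2)"
      by (intro integrable_unit_interval continuous_on_mult slices_continuous sl)+
    have "(LINT x|unit_interval. U t x * ?h' x + U' t x * ?h x) = 0"
    proof (rule integral_periodic_deriv)
      fix x
      show "((\<lambda>x. U t x * ?h x) has_real_derivative U t x * ?h' x + U' t x * ?h x) (at x)"
        using DERIV_mult[OF U_deriv d] by (simp add: mult.commute add.commute)
      show "U t (x + 1) * ?h (x + 1) = U t x * ?h x" by (simp add: U_periodic abs_circle_plus_1)
    qed (intro continuous_on_add continuous_on_mult slices_continuous sl)
    then have "- (LINT x|unit_interval. U t x * ?h' x) = (LINT x|unit_interval. U' t x * ?h x)" using i by simp
    also have "... \<le> (LINT x|unit_interval. 1 / 2 * (U' t x * L' t x) + 1 / 2 * (U t x * (?h x)\<^sup>2))"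
    proof (rule integral_mono)
      fix x
      have eq: "U' t x = U t x * L' t x" using U_pos(2)[of t x] by (simp add: L'_def)
      \<comment> \<open>With U' = U L', Young's inequality is the square of L' - \<phi> weighted by
        the density; the weight 1/2 is the constant of the dual bound.\<close>
      have "0 \<le> U t x * (L' t x - ?h x)\<^sup>2" using U_pos(2)[of t x] by simp
      then show "U' t x * ?h x \<le> 1 / 2 * (U' t x * L' t x) + 1 / 2 * (U t x * (?h x)\<^sup>2)"
        unfolding eq by (simp add: power2_eq_square algebra_simps)
    qed (use i in auto)
    also have "... = 1 / 2 * FI t + 1 / 2 * (LINT x|unit_interval. U t x * (?h x)\<^sup>2)"
      unfolding FI_def using i by simp
    finally show ?thesis unfolding smear_slice(1)[OF sl(1) B(2) t] smear_slice(1)[OF sl(2) B2 t] .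
  qed
  have "- (LINT z|R. smear \<eta> (\<lambda>x. \<phi>x (fst z, abs_circle x)) (rep_circle (snd z)))
    = (LINT t|time T. - (LINT y|\<rho> t. smear \<eta> (\<lambda>x. \<phi>x (t, abs_circle x)) (rep_circle y)))"
    unfolding fubini_R(2)[OF m1] by simp
  also have "... \<le> (LINT t|time T. 1 / 2 * FI t + 1 / 2 * (LINT y|\<rho> t. smear \<eta> (\<lambda>x. (\<phi> (t, abs_circle x))\<^sup>2) (rep_circle y)))"
    using fubini_R(1)[OF m1] fubini_R(1)[OF m2] FI_integrable pt by (intro integral_mono) auto
  also have "... = 1 / 2 * (LINT t|time T. FI t) + 1 / 2 * (LINT z|R. smear \<eta> (\<lambda>x. (\<phi> (fst z, abs_circle x))\<^sup>2) (rep_circle (snd z)))"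
    unfolding fubini_R(2)[OF m2] using fubini_R(1)[OF m2] FI_integrable by simp
  finally have main: "- (LINT z|R. smear \<eta> (\<lambda>x. \<phi>x (fst z, abs_circle x)) (rep_circle (snd z)))
    \<le> 1 / 2 * (LINT t|time T. FI t) + 1 / 2 * (LINT z|R. smear \<eta> (\<lambda>x. (\<phi> (fst z, abs_circle x))\<^sup>2) (rep_circle (snd z)))" .
  have "1 / 2 * (LINT t|time T. FI t) \<le> 1 / 2 * (2 / \<alpha> * (1 / (2 * \<alpha>) * (LINT z|R. (b z)\<^sup>2) + C))"
    by (intro mult_left_mono fisher_integral) simp
  also have "1 / 2 * (2 / \<alpha> * (1 / (2 * \<alpha>) * (LINT z|R. (b z)\<^sup>2) + C)) = 1 / \<alpha> * (1 / (2 * \<alpha>) * (LINT z|R. (b z)\<^sup>2) + C)"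
    using \<alpha> by (simp add: field_simps)
  finally show ?est using main by linarith
qed

end

text \<open>The constant in \<open>smeared_estimate\<close> depends neither on the kernel nor on its
  positive floor, so the kernel may concentrate. The limit bounds the pairing of \<phi> with the
  distributional derivative up to half of its squared L2 norm.\<close>

lemma (in drift_diffusion) fisher_estimate:
  assumes \<phi>: "lipschitz_C1 \<phi> \<phi>x"
  shows "- (LINT z|curve_measure T \<rho>. \<phi>x z) - 1 / 2 * (LINT z|curve_measure T \<rho>. (\<phi> z)\<^sup>2)
    \<le> 1 / \<alpha> * (1 / (2 * \<alpha>) * (LINT z|curve_measure T \<rho>. (b z)\<^sup>2) + C)"
proof -
  let ?R = "curve_measure T \<rho>"
  \<comment> \<open>The shift by 3 keeps every d below 1 / 2, as the kernels require.\<close>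
  define d where "d n = 1 / (real n + 3)" for n :: nat
  have d: "0 < d n" "d n < 1 / 2" for n unfolding d_def by (auto simp: field_simps)
  have dl: "d \<longlonglongrightarrow> 0" unfolding d_def[abs_def] by real_asymp
  let ?S = "\<lambda>f n z. smear (bump_kernel (d n)) (\<lambda>x. f (fst z, abs_circle x)) (rep_circle (snd z))"
  obtain B where B: "\<And>z. \<bar>\<phi> z\<bar> \<le> B" "\<And>z. \<bar>\<phi>x z\<bar> \<le> B" using \<phi> unfolding lipschitz_C1_def by blast
  have B2: "\<bar>(\<phi> z)\<^sup>2\<bar> \<le> B * B" for z
    unfolding power2_eq_square abs_mult using B(1)[of z] by (intro mult_mono) auto
  have c: "continuous_on UNIV \<phi>x" "continuous_on UNIV (\<lambda>z. (\<phi> z)\<^sup>2)"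
    using \<phi> unfolding lipschitz_C1_def by (auto intro!: continuous_intros)
  have sl: "continuous_on UNIV (\<lambda>x. f (t, abs_circle x))" if "continuous_on UNIV f" for f :: "real \<times> circle \<Rightarrow> real" and t
    by (rule continuous_on_compose2[OF that]) (auto intro!: continuous_intros continuous_on_compose2[OF continuous_abs_circle])
  have est: "- (LINT z|?R. ?S \<phi>x n z) \<le> 1 / \<alpha> * (1 / (2 * \<alpha>) * (LINT z|?R. (b z)\<^sup>2) + C) + 1 / 2 * (LINT z|?R. ?S (\<lambda>z. (\<phi> z)\<^sup>2) n z)
    \<and> bounded_measurable (cyl T) (?S \<phi>x n) \<and> bounded_measurable (cyl T) (?S (\<lambda>z. (\<phi> z)\<^sup>2) n)" for n
  proof -
    obtain \<eta>' \<eta>'' where m: "mollifier (bump_kernel (d n)) \<eta>' \<eta>'' (d n)" by (rule mollifier_bump_kernel[OF d])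
    interpret mollifier "bump_kernel (d n)" \<eta>' \<eta>'' "d n" by (rule m)
    interpret fisher "bump_kernel (d n)" \<eta>' \<eta>'' "d n" T \<alpha> C \<rho> b ..
    show ?thesis using smeared_estimate[OF \<phi>] by blast
  qed
  have lim: "(\<lambda>n. LINT z|?R. ?S f n z) \<longlonglongrightarrow> (LINT z|?R. f z)"
    if f: "continuous_on UNIV f" "\<And>z. \<bar>f z\<bar> \<le> W" and meas: "\<And>n. bounded_measurable (cyl T) (?S f n)" for f W
  proof (rule integral_dominated_convergence[where w = "\<lambda>_. W"])
    have ms: "measurable ?R borel = measurable (cyl T) borel" by (rule measurable_cong_sets) (simp_all add: sets_curve_measure[OF T \<rho>])
    show "f \<in> borel_measurable ?R"
      using continuous_bounded_measurable_strip[OF f] unfolding ms by (rule bounded_measurableD)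
    show "?S f n \<in> borel_measurable ?R" for n
      using meas unfolding ms by (rule bounded_measurableD)
    interpret finite_measure ?R by (rule finite_curve_measure[OF T \<rho>])
    show "integrable ?R (\<lambda>_. W)" by simp
    show "AE z in ?R. (\<lambda>n. ?S f n z) \<longlonglongrightarrow> f z"
    proof (rule AE_I2)
      fix z
      have "(\<lambda>n. ?S f n z) \<longlonglongrightarrow> f (fst z, abs_circle (rep_circle (snd z)))"
        by (rule bump_kernel_approx[OF sl[OF f(1)] _ d dl]) (simp add: abs_circle_plus_1)
      then show "(\<lambda>n. ?S f n z) \<longlonglongrightarrow> f z" by (simp add: abs_rep_circle)
    qed
    fix n
    obtain \<eta>' \<eta>'' where m: "mollifier (bump_kernel (d n)) \<eta>' \<eta>'' (d n)" by (rule mollifier_bump_kernel[OF d])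
    show "AE z in ?R. norm (?S f n z) \<le> W"
      unfolding real_norm_def by (intro AE_I2 mollifier.smear_bound[OF m sl] f)
  qed
  have "- (LINT z|?R. \<phi>x z) \<le> 1 / \<alpha> * (1 / (2 * \<alpha>) * (LINT z|?R. (b z)\<^sup>2) + C) + 1 / 2 * (LINT z|?R. (\<phi> z)\<^sup>2)"
  proof (rule LIMSEQ_le)
    show "(\<lambda>n. - (LINT z|?R. ?S \<phi>x n z)) \<longlonglongrightarrow> - (LINT z|?R. \<phi>x z)"
      using est by (intro tendsto_minus lim[OF c(1) B(2)]) blast
    show "(\<lambda>n. 1 / \<alpha> * (1 / (2 * \<alpha>) * (LINT z|?R. (b z)\<^sup>2) + C) + 1 / 2 * (LINT z|?R. ?S (\<lambda>z. (\<phi> z)\<^sup>2) n z))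
      \<longlonglongrightarrow> 1 / \<alpha> * (1 / (2 * \<alpha>) * (LINT z|?R. (b z)\<^sup>2) + C) + 1 / 2 * (LINT z|?R. (\<phi> z)\<^sup>2)"
      using est by (intro tendsto_add tendsto_const tendsto_mult lim[OF c(2) B2]) blast
  qed (use est in blast)
  then show ?thesis by linarith
qed

section \<open>The limit\<close>

lemma ramp_lipschitz:
  assumes "\<epsilon> > 0"
  shows "\<bar>ramp s t \<epsilon> r - ramp s t \<epsilon> r'\<bar> \<le> 2 / \<epsilon> * \<bar>r - r'\<bar>"
proof -
  have "\<bar>clamp01 x - clamp01 y\<bar> \<le> \<bar>x - y\<bar>" for x y by (auto simp: clamp01_def max_def min_def)
  then have "\<bar>clamp01 ((r - q) / \<epsilon>) - clamp01 ((r' - q) / \<epsilon>)\<bar> \<le> \<bar>(r - q) / \<epsilon> - (r' - q) / \<epsilon>\<bar>" for q .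
  moreover have "(r - q) / \<epsilon> - (r' - q) / \<epsilon> = (r - r') / \<epsilon>" for q by (simp add: diff_divide_distrib)
  ultimately have *: "\<bar>clamp01 ((r - q) / \<epsilon>) - clamp01 ((r' - q) / \<epsilon>)\<bar> \<le> \<bar>r - r'\<bar> / \<epsilon>" for q
    using assms by (metis abs_divide abs_of_pos)
  have "\<bar>ramp s t \<epsilon> r - ramp s t \<epsilon> r'\<bar> \<le> \<bar>r - r'\<bar> / \<epsilon> + \<bar>r - r'\<bar> / \<epsilon>"
    unfolding ramp_def using *[of s] *[of t] by linarith
  then show ?thesis by simp
qed

lemma narrow_curve_average_integrand:
  fixes g :: "circle \<Rightarrow> real"
  assumes \<rho>: "narrow_curve T \<rho>" and g: "continuous_on UNIV g" "\<And>p. \<bar>g p\<bar> \<le> B"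
    and st: "0 \<le> s" "s \<le> t" "\<epsilon> > 0" "t + \<epsilon> \<le> T"
  shows "(\<lambda>u. indicator {0..1} u * ((LINT x|\<rho> (t + \<epsilon> * u). g x) - (LINT x|\<rho> (s + \<epsilon> * u). g x))) \<in> borel_measurable lborel"
    and "\<bar>indicator {0..1} u * ((LINT x|\<rho> (t + \<epsilon> * u). g x) - (LINT x|\<rho> (s + \<epsilon> * u). g x))\<bar> \<le> 2 * B * indicator {0..1} u"
    and "u \<in> {0..1} \<Longrightarrow> t + \<epsilon> * u \<in> {0..T} \<and> s + \<epsilon> * u \<in> {0..T}"
proof -
  define F where "F t = (LINT x|\<rho> t. g x)" for t
  have gm: "g \<in> borel_measurable borel" by (rule borel_measurable_continuous_onI[OF g(1)])
  have FB: "\<bar>F t\<bar> \<le> B" if "t \<in> {0..T}" for t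
    unfolding F_def
  proof (rule integral_abs_le_const[OF narrow_curveD(1)[OF \<rho> that]])
    show "g \<in> borel_measurable (\<rho> t)" using gm measurable_cong_sets[OF narrow_curveD(2)[OF \<rho> that] refl] by blast
  qed (rule g)
  have "bounded (range g)" using g(2) by (intro boundedI[where B = B]) auto
  then have Fc: "continuous_on {0..T} F" using \<rho> g(1) unfolding narrow_curve_def F_def[abs_def] by blast
  show in_T: "t + \<epsilon> * u \<in> {0..T} \<and> s + \<epsilon> * u \<in> {0..T}" if "u \<in> {0..1}" for u
  proof -
    have "0 \<le> \<epsilon> * u" "\<epsilon> * u \<le> \<epsilon>" using st that by (auto intro: mult_left_le)
    then show ?thesis using st unfolding atLeastAtMost_iff by linarith
  qed
  have "continuous_on {0..1} (\<lambda>u. F (t + \<epsilon> * u) - F (s + \<epsilon> * u))"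
    by (intro continuous_on_diff continuous_on_compose2[OF Fc] continuous_intros) (use in_T in blast)+
  from borel_measurable_continuous_on_indicator[OF _ this]
  show "(\<lambda>u. indicator {0..1} u * ((LINT x|\<rho> (t + \<epsilon> * u). g x) - (LINT x|\<rho> (s + \<epsilon> * u). g x))) \<in> borel_measurable lborel"
    by (simp add: F_def)
  show "\<bar>indicator {0..1} u * ((LINT x|\<rho> (t + \<epsilon> * u). g x) - (LINT x|\<rho> (s + \<epsilon> * u). g x))\<bar> \<le> 2 * B * indicator {0..1} u"
  proof (cases "u \<in> {0..1}")
    case True
    have "\<bar>F (t + \<epsilon> * u)\<bar> \<le> B" "\<bar>F (s + \<epsilon> * u)\<bar> \<le> B" using in_T[OF True] by (simp_all add: FB)
    then show ?thesis unfolding F_def[symmetric] using True by simp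
  qed simp
qed

section \<open>From averaged to sharp time cutoffs\<close>

context
  fixes T :: real and \<rho> :: "real \<Rightarrow> circle measure"
  assumes T: "T > 0" and \<rho>: "narrow_curve T \<rho>"
begin

text \<open>As the averaging window shrinks, the left side converges by continuity of the slice
  integrals and the right side by dominated convergence with |k|. The window reaches past t, so this
  covers t < T; the final time is approached from below.\<close>

lemma narrow_curve_average_limit:
  assumes g: "continuous_on UNIV g" and k: "integrable (curve_measure T \<rho>) k"
    and avg: "\<And>s t \<epsilon>. 0 \<le> s \<Longrightarrow> s \<le> t \<Longrightarrow> \<epsilon> > 0 \<Longrightarrow> t + \<epsilon> \<le> T \<Longrightarrow>
      (LINT u|lborel. indicator {0..1} u * ((LINT x|\<rho> (t + \<epsilon> * u). g x) - (LINT x|\<rho> (s + \<epsilon> * u). g x)))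
        = (LINT z|curve_measure T \<rho>. ramp s t \<epsilon> (fst z) * k z)"
    and st: "0 \<le> s" "s \<le> t" "t \<le> T"
  shows "(LINT x|\<rho> t. g x) - (LINT x|\<rho> s. g x) = (LINT z|curve_measure T \<rho>. indicator {s<..t} (fst z) * k z)"
proof -
  let ?R = "curve_measure T \<rho>"
  have km: "k \<in> borel_measurable (cyl T)" using k measurable_curve_measure[OF T \<rho>] by blast
  define F where "F t = (LINT x|\<rho> t. g x)" for t
  obtain B where B: "\<And>p. \<bar>g p\<bar> \<le> B" using circle_continuous_bounded[OF g] by blast
  have Fc: "continuous_on {0..T} F"
  proof -
    have "bounded (range g)" using B by (intro boundedI[where B = B]) auto
    then show ?thesis using \<rho> g unfolding narrow_curve_def F_def[abs_def] by blast
  qed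
  have tm: "(\<lambda>z. h (fst z) * k z) \<in> borel_measurable ?R" if "h \<in> borel_measurable borel" for h :: "real \<Rightarrow> real"
    unfolding measurable_curve_measure[OF T \<rho>]
    using strip_product_measurable[OF that, of "\<lambda>_. 1" T] km by (intro borel_measurable_times) simp_all
  have kabs: "integrable ?R (\<lambda>z. \<bar>k z\<bar>)" using k by simp
  have lt: "F t - F s = (LINT z|?R. indicator {s<..t} (fst z) * k z)" if st: "0 \<le> s" "s \<le> t" "t < T" for s t
  proof (rule LIMSEQ_unique)
    define e where "e n = (T - t) / real (Suc n)" for n
    have e: "e n > 0" "t + e n \<le> T" for n
    proof -
      show "e n > 0" using st by (simp add: e_def)
      have "(T - t) / real (Suc n) \<le> (T - t) / 1" using st by (intro divide_left_mono) auto
      then have "e n \<le> T - t" unfolding e_def by simp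
      then show "t + e n \<le> T" by simp
    qed
    have e0: "e \<longlonglongrightarrow> 0"
      unfolding e_def[abs_def] using LIMSEQ_inverse_real_of_nat[THEN tendsto_mult_left, of "T - t"] by (simp add: divide_inverse)
    note avg_int = narrow_curve_average_integrand[OF \<rho> g B st(1,2) e, folded F_def]
    let ?G = "\<lambda>n u. indicator {0..1} u * (F (t + e n * u) - F (s + e n * u))"
    have "(\<lambda>n. LINT u|lborel. ?G n u) \<longlonglongrightarrow> (LINT u|lborel. indicator {0..1::real} u * (F t - F s))"
    proof (rule integral_dominated_convergence[where w = "\<lambda>u :: real. 2 * B * indicator {0..1} u"])
      show "?G n \<in> borel_measurable lborel" for n by (rule avg_int(1))
      show "AE u in lborel. (\<lambda>n. ?G n u) \<longlonglongrightarrow> indicator {0..1} u * (F t - F s)"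
      proof (rule AE_I2)
        fix u :: real
        have c: "(\<lambda>n. F (q + e n * u)) \<longlonglongrightarrow> F q" if q: "q \<in> {0..T}" "\<And>n. q + e n * u \<in> {0..T}" for q
        proof -
          have "(\<lambda>n. q + e n * u) \<longlonglongrightarrow> q + 0 * u" by (intro tendsto_intros e0)
          then show ?thesis
            using continuous_on_tendsto_compose[OF Fc, of "\<lambda>n. q + e n * u" q] q by simp
        qed
        show "(\<lambda>n. ?G n u) \<longlonglongrightarrow> indicator {0..1} u * (F t - F s)"
        proof (cases "u \<in> {0..1}")
          case True
          show ?thesis
            by (intro tendsto_mult tendsto_diff tendsto_const c) (use avg_int(3)[OF True] st in auto)
        qed simp
      qed
      fix n
      show "AE u in lborel. norm (?G n u) \<le> 2 * B * indicator {0..1} u"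
        unfolding real_norm_def by (intro AE_I2) (rule avg_int(2))
    qed simp_all
    then show "(\<lambda>n. LINT u|lborel. ?G n u) \<longlonglongrightarrow> F t - F s" by simp
    have "(\<lambda>n. LINT z|?R. ramp s t (e n) (fst z) * k z) \<longlonglongrightarrow> (LINT z|?R. indicator {s<..t} (fst z) * k z)"
    proof (rule integral_dominated_convergence[OF _ _ kabs])
      show "(\<lambda>z. indicator {s<..t} (fst z) * k z) \<in> borel_measurable ?R" by (rule tm) simp
      show "(\<lambda>z. ramp s t (e n) (fst z) * k z) \<in> borel_measurable ?R" for n
        by (intro tm borel_measurable_continuous_onI ramp_continuous e)
      show "AE z in ?R. (\<lambda>n. ramp s t (e n) (fst z) * k z) \<longlonglongrightarrow> indicator {s<..t} (fst z) * k z"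
        unfolding e_def using st by (intro AE_I2 tendsto_mult tendsto_const ramp_tendsto) auto
      show "AE z in ?R. norm (ramp s t (e n) (fst z) * k z) \<le> \<bar>k z\<bar>" for n
        using ramp_bound by (intro AE_I2) (simp add: abs_mult mult_left_le_one_le)
    qed
    then show "(\<lambda>n. LINT u|lborel. ?G n u) \<longlonglongrightarrow> (LINT z|?R. indicator {s<..t} (fst z) * k z)"
      using avg[OF st(1,2) e] by (simp add: F_def)
  qed
  show ?thesis
  proof (cases "t < T \<or> s = t")
    case True
    then show ?thesis using lt[OF st(1,2)] unfolding F_def by auto
  next
    \<comment> \<open>At t = T there is no room for the averaging window. Times q n increase to T
      instead; points of the open strip lie before T and are eventually inside the interval.\<close>
    case False
    then have sT: "s < T" "t = T" using st by auto
    define q where "q n = T - (T - s) / real (Suc n)" for n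
    have q: "s \<le> q n" "q n < T" for n
    proof -
      have "(T - s) / real (Suc n) \<le> (T - s) / 1" using sT by (intro divide_left_mono) auto
      then have "(T - s) / real (Suc n) \<le> T - s" by simp
      then show "s \<le> q n" unfolding q_def by simp
      show "q n < T" unfolding q_def using sT by simp
    qed
    have "(\<lambda>n. (T - s) / real (Suc n)) \<longlonglongrightarrow> 0"
      using LIMSEQ_inverse_real_of_nat[THEN tendsto_mult_left, of "T - s"] by (simp add: divide_inverse)
    then have q0: "q \<longlonglongrightarrow> T" unfolding q_def[abs_def] using tendsto_diff[OF tendsto_const, of _ 0 sequentially T] by simp
    have "F T - F s = (LINT z|?R. indicator {s<..T} (fst z) * k z)"
    proof (rule LIMSEQ_unique)
      show "(\<lambda>n. F (q n) - F s) \<longlonglongrightarrow> F T - F s"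
        using q st T by (intro tendsto_diff tendsto_const continuous_on_tendsto_compose[OF Fc q0])
          (auto simp: less_imp_le intro!: always_eventually order_trans[OF st(1)])
      have "(\<lambda>n. LINT z|?R. indicator {s<..q n} (fst z) * k z) \<longlonglongrightarrow> (LINT z|?R. indicator {s<..T} (fst z) * k z)"
      proof (rule integral_dominated_convergence[OF _ _ kabs])
        show "(\<lambda>z. indicator {s<..T} (fst z) * k z) \<in> borel_measurable ?R"
          "(\<lambda>z. indicator {s<..q n} (fst z) * k z) \<in> borel_measurable ?R" for n by (rule tm, simp)+
        show "AE z in ?R. (\<lambda>n. indicator {s<..q n} (fst z) * k z) \<longlonglongrightarrow> indicator {s<..T} (fst z) * k z"
        proof (rule AE_I2)
          fix z assume "z \<in> space ?R"
          then have z: "fst z < T" unfolding space_curve_measure[OF T \<rho>] by auto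
          have "eventually (\<lambda>n. indicator {s<..q n} (fst z) * k z = indicator {s<..T} (fst z) * k z) sequentially"
            using order_tendstoD(1)[OF q0 z] by eventually_elim (use z in \<open>auto simp: indicator_def\<close>)
          then show "(\<lambda>n. indicator {s<..q n} (fst z) * k z) \<longlonglongrightarrow> indicator {s<..T} (fst z) * k z" by (rule tendsto_eventually)
        qed
        show "AE z in ?R. norm (indicator {s<..q n} (fst z) * k z) \<le> \<bar>k z\<bar>" for n
          by (intro AE_I2) (simp add: indicator_def)
      qed
      then show "(\<lambda>n. F (q n) - F s) \<longlonglongrightarrow> (LINT z|?R. indicator {s<..T} (fst z) * k z)"
        using lt[OF st(1) q] by simp
    qed
    then show ?thesis unfolding F_def sT .
  qed
qed

text \<open>Disintegration: a density b of \<omega> with respect to \<rho> provides the slices b(t,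
  x) \<rho> t(dx), and integrability of b is exactly the integrability of their total variations in
  time.\<close>

lemma CE_circle_density:
  assumes b: "integrable (curve_measure T \<rho>) b"
    and \<omega>: "\<And>A. A \<in> sets (cyl T) \<Longrightarrow> \<omega> A = (LINT z|curve_measure T \<rho>. indicator A z * b z)"
    and weak: "\<And>\<psi> s t. circle_C1 \<psi> \<Longrightarrow> 0 \<le> s \<Longrightarrow> s \<le> t \<Longrightarrow> t \<le> T \<Longrightarrow> (LINT x|\<rho> t. \<psi> x) - (LINT x|\<rho> s. \<psi> x)
      = (LINT z|curve_measure T \<rho>. indicator {s<..t} (fst z) * (circle_deriv \<psi> (snd z) * b z))"
  shows "CE_circle T \<rho> \<omega>"
proof -
  let ?R = "curve_measure T \<rho>"
  have bm: "b \<in> borel_measurable (cyl T)" using b measurable_curve_measure[OF T \<rho>] by blast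
  \<comment> \<open>Slices on which b is not integrable form a null set of times. They are replaced
    by the zero measure, because an integrable family must consist of vector measures at every
    time.\<close>
  define G where "G = {t \<in> space (time T). (\<integral>\<^sup>+x. ennreal \<bar>b (t, x)\<bar> \<partial>\<rho> t) < \<infinity>}"
  define w where "w t A = (if t \<in> G then \<integral>x. indicator A x * b (t, x) \<partial>\<rho> t else 0)" for t A
  have abm: "(\<lambda>z. ennreal \<bar>b z\<bar>) \<in> borel_measurable (cyl T)" using bm by measurable
  have nm: "(\<lambda>t. \<integral>\<^sup>+x. ennreal \<bar>b (t, x)\<bar> \<partial>\<rho> t) \<in> borel_measurable (time T)"
    by (rule nn_integral_slice_measurable[OF T \<rho> abm])
  have Gm: "G \<in> sets (time T)"
    unfolding G_def using borel_measurable_less[OF nm borel_measurable_const[of \<infinity>]] by (simp only: pred_def)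
  have GT: "t \<in> {0<..<T}" if "t \<in> G" for t using that by (auto simp: G_def)
  have slm: "(\<lambda>x. f (t, x)) \<in> borel_measurable (\<rho> t)" if "f \<in> borel_measurable (cyl T)" "t \<in> {0<..<T}" for f :: "_ \<Rightarrow> real" and t
    using measurable_compose[OF slice_measurable[OF T \<rho> that(2)] that(1)] .
  have Gi: "integrable (\<rho> t) (\<lambda>x. b (t, x))" if "t \<in> G" for t
    using that slm[OF bm GT[OF that]] by (intro integrableI_bounded) (auto simp: G_def)
  have sr: "sets (\<rho> t) = sets borel" if "t \<in> {0<..<T}" for t using narrow_curveD(2)[OF \<rho>, of t] that by auto
  have wv: "vector_measure borel (w t)" for t
  proof (cases "t \<in> G")
    case True
    then show ?thesis
      unfolding w_def using vector_measure_density[OF Gi[OF True] sr[OF GT[OF True]]] by simp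
  qed (simp add: w_def vector_measure_def)
  have AE_G: "AE t in time T. t \<in> G"
    using curve_measure_fubini(1)[OF T \<rho> b] AE_space
  proof eventually_elim
    case (elim t)
    have "(\<integral>\<^sup>+x. ennreal (norm (b (t, x))) \<partial>\<rho> t) < \<infinity>" using elim(1) unfolding integrable_iff_bounded by blast
    then show ?case using elim(2) unfolding G_def real_norm_def by blast
  qed
  have sv: "signed_integral borel (w t) f = (LINT x|\<rho> t. f x * b (t, x))" if "t \<in> G" "bounded_measurable borel f" for t f
    by (rule signed_integral_density[OF Gi[OF that(1)] sr[OF GT[OF that(1)]] _ that(2)]) (simp add: w_def that(1))
  have fam: "integrable_family T w"
    unfolding integrable_family_def
  proof (intro conjI ballI)
    show "vector_measure borel (w t)" for t by (rule wv)
    fix A :: "circle set" assume A: "A \<in> sets borel"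
    have "(\<lambda>z. indicator A (snd z) :: real) \<in> borel_measurable (cyl T)"
      using strip_product_measurable[of "\<lambda>_. 1" "indicator A" T] A by simp
    then have "(\<lambda>t. LINT x|\<rho> t. (\<lambda>z. indicator A (snd z) * b z) (t, x)) \<in> borel_measurable (time T)"
      by (intro integral_curve_slice_measurable[OF T \<rho>] borel_measurable_times bm)
    then have "(\<lambda>t. if t \<in> G then \<integral>x. indicator A x * b (t, x) \<partial>\<rho> t else 0) \<in> borel_measurable (time T)"
      using sets.Int_space_eq2[OF Gm] Gm by (intro measurable_If_set) simp_all
    then show "(\<lambda>t. w t A) \<in> borel_measurable (restrict_space borel {0<..<T})"
      unfolding w_def measurable_time_measure .
  next
    have tv: "tv_norm borel (w t) \<le> (\<integral>\<^sup>+x. ennreal \<bar>b (t, x)\<bar> \<partial>\<rho> t)" for t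
    proof (cases "t \<in> G")
      case True
      note s = sr[OF GT[OF True]]
      have i: "integrable (\<rho> t) (\<lambda>x. \<bar>b (t, x)\<bar>)" using Gi[OF True] by simp
      let ?P = "density (\<rho> t) (\<lambda>x. ennreal \<bar>b (t, x)\<bar>)"
      have mP: "(\<lambda>x. ennreal \<bar>b (t, x)\<bar>) \<in> borel_measurable (\<rho> t)" using slm[OF bm GT[OF True]] by simp
      have P: "emeasure ?P A = ennreal (LINT x|\<rho> t. indicator A x * \<bar>b (t, x)\<bar>)" if "A \<in> sets borel" for A
      proof -
        have As: "A \<in> sets (\<rho> t)" using that s by simp
        have "emeasure ?P A = (\<integral>\<^sup>+x. ennreal (indicator A x * \<bar>b (t, x)\<bar>) \<partial>\<rho> t)"
          unfolding emeasure_density[OF mP As] by (intro nn_integral_cong) (simp add: indicator_def)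
        also have "... = ennreal (LINT x|\<rho> t. indicator A x * \<bar>b (t, x)\<bar>)"
          using integrable_mult_indicator[OF As i] by (intro nn_integral_eq_integral) auto
        finally show ?thesis .
      qed
      have fP: "finite_measure ?P"
        using P[of UNIV] sets_eq_imp_space_eq[OF s] by (intro finite_measureI) simp
      have "tv_norm borel (w t) \<le> ennreal (1 * (measure ?P (space borel) + measure (null_measure borel) (space (borel :: circle measure))))"
      proof (rule tv_norm_leI[OF fP])
        show "finite_measure (null_measure (borel :: circle measure))" by (intro finite_measureI) simp
        fix A :: "circle set" assume A: "A \<in> sets borel"
        have "\<bar>w t A\<bar> \<le> (LINT x|\<rho> t. \<bar>indicator A x * b (t, x)\<bar>)" unfolding w_def using True by simp
        also have "... = measure ?P A" unfolding measure_def P[OF A] by (simp add: abs_mult)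
        finally show "\<bar>w t A\<bar> \<le> 1 * (measure ?P A + measure (null_measure borel) A)" by simp
      qed (simp_all add: s)
      also have "... = emeasure ?P UNIV" using finite_measure.emeasure_eq_measure[OF fP] by simp
      also have "... = (\<integral>\<^sup>+x. ennreal \<bar>b (t, x)\<bar> \<partial>\<rho> t)"
        using emeasure_density[OF mP, of UNIV] sets.top[of "\<rho> t"] sets_eq_imp_space_eq[OF s] by simp
      finally show ?thesis .
    next
      case False
      then have "tv_norm borel (w t) \<le> 0" unfolding tv_norm_def w_def by (intro SUP_least) simp
      then show ?thesis by simp
    qed
    have "(\<integral>\<^sup>+t\<in>{0<..<T}. tv_norm borel (w t) \<partial>lborel) \<le> (\<integral>\<^sup>+t. (\<integral>\<^sup>+x. ennreal \<bar>b (t, x)\<bar> \<partial>\<rho> t) \<partial>time T)"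
      unfolding set_nn_integral_time by (intro nn_integral_mono tv)
    also have "... = (\<integral>\<^sup>+z. ennreal \<bar>b z\<bar> \<partial>?R)" by (rule nn_integral_curve_measure[OF T \<rho> abm, symmetric])
    also have "... < \<infinity>" using b unfolding integrable_iff_bounded real_norm_def by blast
    finally show "(\<integral>\<^sup>+t\<in>{0<..<T}. tv_norm borel (w t) \<partial>lborel) < \<infinity>" .
  qed
  have slice_eq: "(LINT z|?R. f z * b z) = (LINT t|time T. signed_integral borel (w t) (\<lambda>x. f (t, x)))"
    if f: "bounded_measurable (cyl T) f" for f
  proof -
    have "integrable ?R (\<lambda>z. f z * b z)" by (rule integrable_mult_bounded[OF b sets_curve_measure[OF T \<rho>] f])
    from curve_measure_fubini(3)[OF T \<rho> this, symmetric]
    have "(LINT z|?R. f z * b z) = (LINT t|time T. (LINT x|\<rho> t. f (t, x) * b (t, x)))" .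
    also have "... = (LINT t|time T. signed_integral borel (w t) (\<lambda>x. f (t, x)))"
    proof (rule integral_cong_AE)
      show "(\<lambda>t. LINT x|\<rho> t. f (t, x) * b (t, x)) \<in> borel_measurable (time T)"
        using integral_curve_slice_measurable[OF T \<rho> borel_measurable_times[OF bounded_measurableD[OF f] bm]] by simp
      show "(\<lambda>t. signed_integral borel (w t) (\<lambda>x. f (t, x))) \<in> borel_measurable (time T)"
        using family_integral_measurable[OF fam] f unfolding cyl_eq_strip by blast
      show "AE t in time T. (LINT x|\<rho> t. f (t, x) * b (t, x)) = signed_integral borel (w t) (\<lambda>x. f (t, x))"
        using AE_G
      proof eventually_elim
        case (elim t)
        then show ?case using sv[OF elim] bounded_measurable_section[OF f[unfolded cyl_eq_strip] GT[OF elim]] by simp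
      qed
    qed
    finally show ?thesis .
  qed
  show ?thesis
    unfolding CE_circle_def
  proof (intro conjI exI[of _ w] allI impI ballI \<rho> fam)
    fix A assume A: "A \<in> sets (cyl T)"
    note i = bounded_measurable_indicator[OF A]
    have "\<omega> A = (LBINT t:{0<..<T}. signed_integral borel (w t) (\<lambda>x. indicator A (t, x)))"
      unfolding \<omega>[OF A] slice_eq[OF i] set_integral_time ..
    also have "... = signed_integral (cyl T) (signed_curve_measure T w) (indicator A)"
      by (rule signed_integral_curve_measure[OF fam i, symmetric])
    finally show "\<omega> A = signed_curve_measure T w A"
      by (simp add: signed_integral_indicator[OF signed_curve_measure_vector_measure[OF fam] A])
  next
    fix \<psi> s t assume \<psi>: "circle_C1 \<psi>" and st: "(0::real) \<le> s" "s \<le> t" "t \<le> T"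
    note d = circle_C1_bounded(2)[OF \<psi>]
    have f: "bounded_measurable (cyl T) (\<lambda>z. indicator {s<..t} (fst z) * circle_deriv \<psi> (snd z))"
      by (rule strip_product_bounded[OF _ _ d, of _ 1]) (auto simp: indicator_def)
    let ?H = "\<lambda>r. signed_integral borel (w r) (circle_deriv \<psi>)"
    have Hm: "?H \<in> borel_measurable (time T)"
      using family_integral_measurable[OF fam, of "\<lambda>z. 1 * circle_deriv \<psi> (snd z)"] strip_product_bounded[OF _ _ d, of "\<lambda>_. 1" 1 T]
      unfolding cyl_eq_strip by simp
    have "(LINT x|\<rho> t. \<psi> x) - (LINT x|\<rho> s. \<psi> x) = (LINT z|?R. (indicator {s<..t} (fst z) * circle_deriv \<psi> (snd z)) * b z)"
      using weak[OF \<psi> st] by (simp add: mult.assoc)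
    also have "... = (LINT r|time T. signed_integral borel (w r) (\<lambda>x. indicator {s<..t} r * circle_deriv \<psi> x))"
      using slice_eq[OF f] by simp
    also have "... = (LINT r|time T. indicator {s<..t} r * ?H r)"
      by (intro Bochner_Integration.integral_cong refl) (rule bounded_functional_scale[OF bounded_functional_signed_integral[OF wv] d])
    also have "... = (LINT r|time T. indicator {s<..<t} r * ?H r)"
    proof (rule integral_cong_AE)
      have i: "indicator A \<in> borel_measurable (time T)" if "A \<in> sets borel" for A :: "real set"
        using that by (intro measurable_restrict_space1) simp
      show "(\<lambda>r. indicator {s<..t} r * ?H r) \<in> borel_measurable (time T)"
        "(\<lambda>r. indicator {s<..<t} r * ?H r) \<in> borel_measurable (time T)"
        by (intro borel_measurable_times i Hm; simp)+
      \<comment> \<open>The weak equation uses the interval closed at t, the continuity equation the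
        open one; they differ by one instant.\<close>
      have "AE r in lborel. r \<in> {0<..<T} \<longrightarrow> r \<noteq> t" by (rule eventually_mono[OF AE_lborel_singleton[of t]]) simp
      then have "AE r in time T. r \<noteq> t" by (subst AE_restrict_space_iff) auto
      then show "AE r in time T. indicator {s<..t} r * ?H r = indicator {s<..<t} r * ?H r"
        by eventually_elim (auto simp: indicator_def)
    qed
    also have "... = (LBINT r:{s<..<t}. ?H r)" by (rule set_integral_subinterval[OF st(1,3), symmetric])
    finally show "(LINT x|\<rho> t. \<psi> x) - (LINT x|\<rho> s. \<psi> x) = (LBINT r:{s<..<t}. ?H r)" .
  qed
qed

end

section \<open>Passage to the limit V to infinity\<close>

context
  fixes \<alpha> T C :: real
    and \<sigma> :: "real \<Rightarrow> real \<Rightarrow> omega1 measure" and j :: "real \<Rightarrow> real \<Rightarrow> omega1 set \<Rightarrow> real \<times> real"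
    and \<rho> :: "real \<Rightarrow> circle measure" and \<omega> J :: "(real \<times> circle) set \<Rightarrow> real"
  assumes \<alpha>: "\<alpha> > 0" and T: "T > 0" and C: "C > 0"
    and CE: "\<And>V. V \<ge> 1 \<Longrightarrow> CE_omega1 T (\<sigma> V) (j V)"
    and bound: "(SUP V\<in>{1..}. Ent (measure (\<sigma> V 0)) pi_omega1 + rate_functional \<alpha> T V (\<sigma> V) (j V)) \<le> ennreal C"
    and \<rho>: "narrow_curve T \<rho>"
    and \<omega>: "vector_measure (cyl T) \<omega>" and J: "vector_measure (cyl T) J"
    and \<rho>_lim: "narrow_tendsto (\<lambda>V. density_measure T (\<sigma> V)) (curve_measure T \<rho>) at_top"
    and \<omega>_lim: "signed_narrow_tendsto (cyl T) (\<lambda>V. momentum_measure T V (\<sigma> V)) \<omega> at_top"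
    and J_lim: "signed_narrow_tendsto (cyl T) (\<lambda>V. jump_measure T V (j V)) J at_top"
    and slice_lim: "\<And>t. t \<in> {0..T} \<Longrightarrow> narrow_tendsto (\<lambda>V. density_slice (\<sigma> V) t) (\<rho> t) at_top"
begin

abbreviation (input) R :: "(real \<times> circle) measure"
  where "R \<equiv> curve_measure T \<rho>"

abbreviation (input) rate :: "real \<Rightarrow> ennreal"
  where "rate V \<equiv> rate_functional \<alpha> T V (\<sigma> V) (j V)"

lemma uniform_bound:
  assumes "V \<ge> 1"
  shows "Ent (measure (\<sigma> V 0)) pi_omega1 \<le> ennreal C" "rate V \<le> ennreal C" "rate V < \<infinity>"
proof -
  have "Ent (measure (\<sigma> V 0)) pi_omega1 + rate V \<le> (SUP V\<in>{1..}. Ent (measure (\<sigma> V 0)) pi_omega1 + rate V)"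
    by (rule SUP_upper) (use assms in simp)
  also note bound
  finally have le: "Ent (measure (\<sigma> V 0)) pi_omega1 + rate V \<le> ennreal C" .
  show "Ent (measure (\<sigma> V 0)) pi_omega1 \<le> ennreal C" by (rule order_trans[OF _ le]) simp
  show r: "rate V \<le> ennreal C" by (rule order_trans[OF _ le]) simp
  show "rate V < \<infinity>" using r by (rule order.strict_trans1) simp
qed

lemma liminf_rate:
  obtains M where "M \<ge> 0" "Liminf at_top rate = ennreal M"
proof -
  have "Liminf at_top rate \<le> Liminf (at_top :: real filter) (\<lambda>_. ennreal C)"
    by (intro Liminf_mono eventually_mono[OF eventually_ge_at_top[of 1]] uniform_bound(2))
  also have "... = ennreal C" by (rule Liminf_const) simp
  finally show thesis using that by (cases "Liminf at_top rate") (auto simp: top_unique)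
qed

lemma limits:
  assumes f: "continuous_on UNIV f" "\<And>z. \<bar>f z\<bar> \<le> B"
  shows "((\<lambda>V. LINT z|density_measure T (\<sigma> V). f z) \<longlongrightarrow> (LINT z|R. f z)) at_top" (is ?r)
    and "((\<lambda>V. signed_integral (cyl T) (momentum_measure T V (\<sigma> V)) f) \<longlongrightarrow> signed_integral (cyl T) \<omega> f) at_top" (is ?w)
    and "((\<lambda>V. signed_integral (cyl T) (jump_measure T V (j V)) f) \<longlongrightarrow> signed_integral (cyl T) J f) at_top" (is ?j)
proof -
  have "continuous_on S f" "bounded (f ` S)" for S
    using f by (auto intro: continuous_on_subset boundedI[where B = B])
  then show ?r ?w ?j
    using \<rho>_lim \<omega>_lim J_lim unfolding narrow_tendsto_def signed_narrow_tendsto_def by blast+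
qed

text \<open>For fixed continuous \<psi> every term of \<open>rate_functional_lower\<close>
  converges, and the cubic error is O(1 / V). The bound thus holds with the liminf, and \<psi> may
  be optimised afterwards.\<close>

lemma limit_dual_bound:
  assumes \<psi>: "continuous_on UNIV \<psi>" "\<And>z. \<bar>\<psi> z\<bar> \<le> B" and M: "M \<ge> 0" "Liminf at_top rate = ennreal M"
  shows "signed_integral (cyl T) J \<psi> - 1 / (2 * \<alpha>) * signed_integral (cyl T) \<omega> \<psi> - 1 / (4 * \<alpha>) * (LINT z|R. (\<psi> z)\<^sup>2) \<le> M"
    (is "?x \<le> M")
proof -
  define X where "X V = signed_integral (cyl T) (jump_measure T V (j V)) \<psi>
      - 1 / (2 * \<alpha>) * signed_integral (cyl T) (momentum_measure T V (\<sigma> V)) \<psi>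
      - 1 / (4 * \<alpha>) * (LINT z|density_measure T (\<sigma> V). (\<psi> z)\<^sup>2)
      - T * (exp B * B ^ 3 / (2 * \<alpha> * V))" for V
  have B2: "\<bar>(\<psi> z)\<^sup>2\<bar> \<le> B * B" for z
    unfolding power2_eq_square abs_mult using \<psi>(2)[of z] by (intro mult_mono) auto
  have rest: "((\<lambda>V. T * (exp B * B ^ 3 / (2 * \<alpha> * V))) \<longlongrightarrow> T * 0) at_top"
    using \<alpha> by (intro tendsto_mult tendsto_const tendsto_divide_0[OF tendsto_const]
        filterlim_at_top_imp_at_infinity filterlim_tendsto_pos_mult_at_top[OF tendsto_const] filterlim_ident) simp
  have "(X \<longlongrightarrow> ?x - T * 0) at_top"
    unfolding X_def by (rule tendsto_diff[OF _ rest])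
      (intro tendsto_diff tendsto_mult tendsto_const limits[OF \<psi>] limits(1)[OF _ B2] continuous_intros \<psi>(1))
  then have "((\<lambda>V. ennreal (X V)) \<longlongrightarrow> ennreal ?x) at_top" by (intro tendsto_ennrealI) simp
  \<comment> \<open>\<open>ennreal\<close> sends negative values to 0; this loses nothing because M
    \<ge> 0.\<close>
  then have "ennreal ?x = Liminf at_top (\<lambda>V. ennreal (X V))" by (intro lim_imp_Liminf[symmetric]) simp_all
  also have "... \<le> Liminf at_top rate"
  proof (intro Liminf_mono eventually_mono[OF eventually_ge_at_top[of 1]])
    fix V :: real assume V: "V \<ge> 1"
    show "ennreal (X V) \<le> rate V"
      unfolding X_def by (rule rate_functional_lower[OF \<alpha> T V CE[OF V] continuous_bounded_measurable_strip[OF \<psi>] \<psi>(2)])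
  qed
  finally show ?thesis using M by (simp add: ennreal_le_iff)
qed

text \<open>The right side of \<open>jump_divergence\<close> is O(1 / V), so the limit is an
  identity. On test functions it says that the distributional space derivative of \<rho> is -2
  J.\<close>

lemma limit_jump_divergence:
  assumes \<phi>: "lipschitz_C1 \<phi> \<phi>x"
  shows "(LINT z|R. \<phi>x z) = 2 * signed_integral (cyl T) J \<phi>"
proof -
  obtain B where B: "\<And>z. \<bar>\<phi> z\<bar> \<le> B" "\<And>z. \<bar>\<phi>x z\<bar> \<le> B" using \<phi> unfolding lipschitz_C1_def by blast
  obtain L where L: "\<And>s t p. \<bar>\<phi> (t, p) - \<phi> (s, p)\<bar> \<le> L * \<bar>t - s\<bar>" "L \<ge> 0" using \<phi> unfolding lipschitz_C1_def by blast
  have c: "continuous_on UNIV \<phi>" "continuous_on UNIV \<phi>x" using \<phi> unfolding lipschitz_C1_def by auto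
  have "\<bar>(LINT z|R. \<phi>x z) - 2 * signed_integral (cyl T) J \<phi>\<bar> \<le> 0"
  proof (rule tendsto_le[OF trivial_limit_at_top_linorder])
    show "((\<lambda>V. \<bar>(LINT z|density_measure T (\<sigma> V). \<phi>x z)
        - 2 * signed_integral (cyl T) (jump_measure T V (j V)) \<phi>\<bar>)
      \<longlongrightarrow> \<bar>(LINT z|R. \<phi>x z) - 2 * signed_integral (cyl T) J \<phi>\<bar>) at_top"
      by (intro tendsto_rabs tendsto_diff tendsto_mult tendsto_const limits(1)[OF c(2) B(2)] limits(3)[OF c(1) B(1)])
    show "((\<lambda>V. (L * T + 2 * B) / V) \<longlongrightarrow> 0) (at_top :: real filter)"
      by (intro tendsto_divide_0[OF tendsto_const] filterlim_at_top_imp_at_infinity filterlim_ident)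
    show "\<forall>\<^sub>F V in at_top. \<bar>(LINT z|density_measure T (\<sigma> V). \<phi>x z)
        - 2 * signed_integral (cyl T) (jump_measure T V (j V)) \<phi>\<bar> \<le> (L * T + 2 * B) / V"
      using jump_divergence[OF \<alpha> T _ CE uniform_bound(3) \<phi> B(1) L]
      by (intro eventually_mono[OF eventually_ge_at_top[of 1]]) blast
  qed
  then show ?thesis by simp
qed

lemma limit_slice:
  fixes g :: "circle \<Rightarrow> real"
  assumes "continuous_on UNIV g" "\<And>p. \<bar>g p\<bar> \<le> B" "t \<in> {0..T}"
  shows "((\<lambda>V. LINT x|density_slice (\<sigma> V) t. g x) \<longlongrightarrow> (LINT x|\<rho> t. g x)) at_top"
proof -
  have "bounded (range g)" using assms(2) by (intro boundedI[where B = B]) auto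
  then show ?thesis
    using slice_lim[OF assms(3)] assms(1) unfolding narrow_tendsto_def narrow_curveD(3)[OF \<rho> assms(3)] by blast
qed

lemma limit_initial_entropy:
  assumes g: "continuous_on UNIV g"
  shows "(LINT x|\<rho> 0. g x) \<le> C + (LINT x|lebesgue_circle. exp (g x) - 1)"
proof -
  obtain B where B: "\<And>p. \<bar>g p\<bar> \<le> B" using circle_continuous_bounded[OF g] by blast
  have T0: "0 \<in> {0..T}" using T by simp
  have ev: "\<forall>\<^sub>F V in at_top. (LINT x|density_slice (\<sigma> V) 0. g x) \<le> C + (LINT x|lebesgue_circle. exp (g x) - 1)"
  proof (rule eventually_mono[OF eventually_ge_at_top[of 1]])
    fix V :: real assume V: "V \<ge> 1"
    show "(LINT x|density_slice (\<sigma> V) 0. g x) \<le> C + (LINT x|lebesgue_circle. exp (g x) - 1)"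
      by (rule initial_entropy[OF \<alpha> T V CE[OF V] uniform_bound(3)[OF V] uniform_bound(1)[OF V] less_imp_le[OF C] g])
  qed
  show ?thesis by (rule tendsto_upperbound[OF limit_slice[OF g B T0] ev]) simp
qed

text \<open>The test function that feeds the flux of the continuity equation into
  \<open>limit_jump_divergence\<close>: it contains g', so its space derivative contains g'', and g
  must be twice continuously differentiable.\<close>

lemma lipschitz_ramp:
  assumes g: "circle_C1 g" "circle_C1 (circle_deriv g)" and e: "\<epsilon> > 0"
  shows "lipschitz_C1 (\<lambda>z. ramp s t \<epsilon> (fst z) * circle_deriv g (snd z))
    (\<lambda>z. ramp s t \<epsilon> (fst z) * circle_deriv (circle_deriv g) (snd z))"
proof -
  have gc: "continuous_on UNIV (circle_deriv g)" "continuous_on UNIV (circle_deriv (circle_deriv g))"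
    by (rule circle_C1D(2)[OF g(1)], rule circle_C1D(2)[OF g(2)])
  obtain A where A: "A \<ge> 0" "\<And>p. \<bar>circle_deriv g p\<bar> \<le> A" using circle_continuous_bounded[OF gc(1)] by blast
  obtain A' where A': "A' \<ge> 0" "\<And>p. \<bar>circle_deriv (circle_deriv g) p\<bar> \<le> A'" using circle_continuous_bounded[OF gc(2)] by blast
  have c: "continuous_on UNIV (\<lambda>z :: real \<times> circle. ramp s t \<epsilon> (fst z) * h (snd z))" if h: "continuous_on UNIV h" for h :: "circle \<Rightarrow> real"
    by (intro continuous_on_mult continuous_on_compose2[OF ramp_continuous[OF e, of UNIV]] continuous_on_compose2[OF h]
        continuous_on_fst continuous_on_snd continuous_on_id) auto
  have bd: "\<bar>ramp s t \<epsilon> r * h\<bar> \<le> A + A'" if "\<bar>h\<bar> \<le> A \<or> \<bar>h\<bar> \<le> A'" for r h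
  proof -
    have "\<bar>ramp s t \<epsilon> r * h\<bar> \<le> 1 * \<bar>h\<bar>" unfolding abs_mult by (intro mult_right_mono ramp_bound) simp
    then show ?thesis using that A A' by linarith
  qed
  have "\<bar>ramp s t \<epsilon> r * circle_deriv g p - ramp s t \<epsilon> r' * circle_deriv g p\<bar> \<le> (2 / \<epsilon> * A) * \<bar>r - r'\<bar>" for r r' p
  proof -
    have "\<bar>ramp s t \<epsilon> r * circle_deriv g p - ramp s t \<epsilon> r' * circle_deriv g p\<bar> = \<bar>ramp s t \<epsilon> r - ramp s t \<epsilon> r'\<bar> * \<bar>circle_deriv g p\<bar>"
      by (simp add: left_diff_distrib[symmetric] abs_mult)
    also have "... \<le> (2 / \<epsilon> * \<bar>r - r'\<bar>) * A" using e A by (intro mult_mono ramp_lipschitz) auto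
    finally show ?thesis by (simp add: mult.commute mult.left_commute)
  qed
  moreover have "2 / \<epsilon> * A \<ge> 0" using e A by simp
  ultimately have lip: "\<exists>L\<ge>0. \<forall>r' r p. \<bar>ramp s t \<epsilon> r * circle_deriv g p - ramp s t \<epsilon> r' * circle_deriv g p\<bar> \<le> L * \<bar>r - r'\<bar>" by blast
  show ?thesis
    unfolding lipschitz_C1_def
  proof (intro conjI c gc allI)
    show "\<exists>B. \<forall>z :: real \<times> circle. \<bar>ramp s t \<epsilon> (fst z) * circle_deriv g (snd z)\<bar> \<le> B \<and>
        \<bar>ramp s t \<epsilon> (fst z) * circle_deriv (circle_deriv g) (snd z)\<bar> \<le> B"
      using bd A(2) A'(2) by blast
  qed (use lip circle_C1_scale[OF g(2)] in simp_all)
qed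

text \<open>The left side converges because the slices do at every time, with a bound uniform in V;
  the right side because the ramp makes the test function continuous. With a sharp interval the
  right side would not be covered by narrow convergence.\<close>

lemma limit_averaged:
  assumes g: "circle_C1 g" and st: "0 \<le> s" "s \<le> t" "\<epsilon> > 0" "t + \<epsilon> \<le> T"
  shows "(LINT u|lborel. indicator {0..1} u * ((LINT x|\<rho> (t + \<epsilon> * u). g x) - (LINT x|\<rho> (s + \<epsilon> * u). g x)))
    = signed_integral (cyl T) \<omega> (\<lambda>z. ramp s t \<epsilon> (fst z) * circle_deriv g (snd z))"
proof -
  note gc = circle_C1_continuous[OF g]
  obtain B where B: "\<And>p. \<bar>g p\<bar> \<le> B" using circle_continuous_bounded[OF gc] by blast
  obtain A where A: "\<And>p. \<bar>circle_deriv g p\<bar> \<le> A" using circle_continuous_bounded[OF circle_C1D(2)[OF g]] by blast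
  have c: "continuous_on UNIV (\<lambda>z :: real \<times> circle. ramp s t \<epsilon> (fst z) * circle_deriv g (snd z))"
    by (intro continuous_on_mult continuous_on_compose2[OF ramp_continuous[OF st(3), of UNIV]]
        continuous_on_compose2[OF circle_C1D(2)[OF g]] continuous_on_fst continuous_on_snd continuous_on_id) auto
  have cb: "\<bar>ramp s t \<epsilon> (fst z) * circle_deriv g (snd z)\<bar> \<le> 1 * A" for z :: "real \<times> circle"
    unfolding abs_mult by (intro mult_mono ramp_bound A) auto
  \<comment> \<open>Dominated convergence needs a sequence, and n + 1 keeps the velocity at least
    1.\<close>
  let ?V = "\<lambda>n. real (Suc n)"
  have V: "filterlim ?V at_top sequentially" by (rule filterlim_compose[OF filterlim_real_sequentially filterlim_Suc])
  have V1: "?V n \<ge> 1" for n by simp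
  have dc: "narrow_curve T (density_slice (\<sigma> (?V n)))" for n by (rule CE_density_curve[OF \<alpha> T V1 CE[OF V1]])
  let ?G = "\<lambda>\<rho> u. indicator {0..1} u * ((LINT x|\<rho> (t + \<epsilon> * u). g x) - (LINT x|\<rho> (s + \<epsilon> * u). g x))"
  have "(\<lambda>n. LINT u|lborel. ?G (density_slice (\<sigma> (?V n))) u) \<longlonglongrightarrow> (LINT u|lborel. ?G \<rho> u)"
  proof (rule integral_dominated_convergence[where w = "\<lambda>u :: real. 2 * B * indicator {0..1} u"])
    show "?G \<rho> \<in> borel_measurable lborel" by (rule narrow_curve_average_integrand(1)[OF \<rho> gc B st])
    show "?G (density_slice (\<sigma> (?V n))) \<in> borel_measurable lborel" for n
      by (rule narrow_curve_average_integrand(1)[OF dc gc B st])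
    show "AE u in lborel. norm (?G (density_slice (\<sigma> (?V n))) u) \<le> 2 * B * indicator {0..1} u" for n
      unfolding real_norm_def by (intro AE_I2) (rule narrow_curve_average_integrand(2)[OF dc gc B st])
    show "AE u in lborel. (\<lambda>n. ?G (density_slice (\<sigma> (?V n))) u) \<longlonglongrightarrow> ?G \<rho> u"
    proof (rule AE_I2)
      fix u :: real
      show "(\<lambda>n. ?G (density_slice (\<sigma> (?V n))) u) \<longlonglongrightarrow> ?G \<rho> u"
      proof (cases "u \<in> {0..1}")
        case True
        note * = narrow_curve_average_integrand(3)[OF \<rho> gc B st True]
        show ?thesis
          by (intro tendsto_mult tendsto_diff tendsto_const filterlim_compose[OF limit_slice[OF gc B] V]) (use * in blast)+
      qed simp
    qed
  qed simp_all
  moreover have "(LINT u|lborel. ?G (density_slice (\<sigma> (?V n))) u)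
    = signed_integral (cyl T) (momentum_measure T (?V n) (\<sigma> (?V n))) (\<lambda>z. ramp s t \<epsilon> (fst z) * circle_deriv g (snd z))" for n
    by (rule CE_space_averaged[OF \<alpha> T V1 CE[OF V1] uniform_bound(3)[OF V1] g st])
  ultimately show ?thesis
    using LIMSEQ_unique filterlim_compose[OF limits(2)[OF c cb] V] by simp
qed

lemma limit_functional_le: "limit_functional \<alpha> T \<rho> \<omega> \<le> Liminf at_top rate"
proof -
  obtain M where M: "M \<ge> 0" "Liminf at_top rate = ennreal M" by (rule liminf_rate)
  note sR = sets_curve_measure[OF T \<rho>]
  have fR: "finite_measure R" by (rule finite_curve_measure[OF T \<rho>])
  have vR: "vector_measure R \<mu>" if "vector_measure (cyl T) \<mu>" for \<mu> :: "(real \<times> circle) set \<Rightarrow> real"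
    using that vector_measure_cong[OF sR, of \<mu> \<mu>] by blast

  \<comment> \<open>The measure paired with \<psi> in \<open>limit_dual_bound\<close>; its density
    \<beta> will carry the whole cost.\<close>
  define \<mu> where "\<mu> A = 1 * J A + (- 1 / (2 * \<alpha>)) * \<omega> A" for A
  have \<mu>: "vector_measure (cyl T) \<mu>" unfolding \<mu>_def by (rule vector_measure_lincomb[OF J \<omega>])
  have SI\<mu>: "signed_integral (cyl T) \<mu> f = 1 * signed_integral (cyl T) J f + (- 1 / (2 * \<alpha>)) * signed_integral (cyl T) \<omega> f"
    if "bounded_measurable (cyl T) f" for f
    unfolding \<mu>_def[abs_def] by (rule signed_integral_lincomb[OF J \<omega> that])
  have dual\<mu>: "signed_integral (cyl T) \<mu> \<phi> - 1 / (4 * \<alpha>) * (LINT z|R. (\<phi> z)\<^sup>2) \<le> M" if \<phi>: "test_function T \<phi>" for \<phi>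
  proof -
    have "continuous_on UNIV \<phi>" "\<exists>B. \<forall>z. \<bar>\<phi> z\<bar> \<le> B"
      using test_function_lipschitz_C1[OF \<phi>] unfolding lipschitz_C1_def by blast+
    then show ?thesis
      using limit_dual_bound[OF _ _ M, of \<phi>] SI\<mu>[OF test_function_bounded_measurable[OF \<phi>]] by auto
  qed
  have a: "1 / (4 * \<alpha>) > 0" using \<alpha> by simp
  have ac\<mu>: "signed_ac R \<mu>" by (rule duality_ac[OF \<mu> fR sR less_imp_le[OF a] dual\<mu>])
  define \<beta> where "\<beta> = signed_RN_deriv R \<mu>"
  have \<beta>: "integrable R \<beta>" "\<And>A. A \<in> sets (cyl T) \<Longrightarrow> \<mu> A = (LINT z|R. indicator A z * \<beta> z)"
    unfolding \<beta>_def using signed_RN_deriv[OF fR vR[OF \<mu>] ac\<mu>] sR by auto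
  have \<beta>sq: "(\<integral>\<^sup>+z. ennreal ((\<beta> z)\<^sup>2) \<partial>R) \<le> ennreal (4 * (1 / (4 * \<alpha>)) * M)"
    by (rule duality_density[OF \<mu> fR sR a dual\<mu> \<beta>])
  have \<beta>sqi: "integrable R (\<lambda>z. (\<beta> z)\<^sup>2)"
    using \<beta>(1) order.strict_trans1[OF \<beta>sq ennreal_less_top] by (intro integrableI_nonneg) auto

  \<comment> \<open>The drift: \<mu> = \<beta> \<rho> rewrites as \<omega> = b \<rho> + 2 \<alpha>
    J, that is, b \<rho> minus \<alpha> times the space derivative of \<rho>. Its square
    integrability is the bound on \<beta>.\<close>
  define b where "b z = (- 2 * \<alpha>) * \<beta> z" for z
  have b: "integrable R b" "integrable R (\<lambda>z. (b z)\<^sup>2)"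
    unfolding b_def using \<beta>(1) \<beta>sqi by (auto simp: power_mult_distrib)
  have SI\<omega>: "signed_integral (cyl T) \<omega> f = (LINT z|R. f z * b z) + 2 * \<alpha> * signed_integral (cyl T) J f"
    if f: "bounded_measurable (cyl T) f" for f
  proof -
    have "(LINT z|R. f z * b z) = (LINT z|R. (- 2 * \<alpha>) * (f z * \<beta> z))"
      by (intro Bochner_Integration.integral_cong) (auto simp: b_def)
    also have "... = (- 2 * \<alpha>) * signed_integral (cyl T) \<mu> f"
      using signed_integral_density[OF \<beta>(1) sR \<beta>(2) f] by (simp only: Bochner_Integration.integral_mult_right_zero)
    also have "... = signed_integral (cyl T) \<omega> f - 2 * \<alpha> * signed_integral (cyl T) J f"
      unfolding SI\<mu>[OF f] using \<alpha> by (simp add: right_diff_distrib)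
    finally show ?thesis by simp
  qed
  have weak: "(LINT x|\<rho> t. g x) - (LINT x|\<rho> s. g x) = (LINT z|R. indicator {s<..t} (fst z) *
      (circle_deriv g (snd z) * b z + \<alpha> * circle_deriv (circle_deriv g) (snd z)))"
    if g: "circle_C1 g" "circle_C1 (circle_deriv g)" and st: "0 \<le> s" "s \<le> t" "t \<le> T" for g s t
  proof (rule narrow_curve_average_limit[OF T \<rho> circle_C1_continuous[OF g(1)] _ _ st])
    have sb: "bounded_measurable (cyl T) (\<lambda>z. 1 * h (snd z))" if "bounded_measurable borel h" for h :: "circle \<Rightarrow> real"
      by (rule strip_product_bounded[OF _ _ that, of _ 1]) auto
    note d = circle_C1_bounded(2)[OF g(1)] and d' = circle_C1_bounded(2)[OF g(2)]
    have i: "integrable R (\<lambda>z. circle_deriv g (snd z) * b z)" "integrable R (\<lambda>z. \<alpha> * circle_deriv (circle_deriv g) (snd z))"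
      using integrable_mult_bounded[OF b(1) sR sb[OF d]] integrable_bounded_measurable[OF fR sR sb[OF d']] by simp_all
    show "integrable R (\<lambda>z. circle_deriv g (snd z) * b z + \<alpha> * circle_deriv (circle_deriv g) (snd z))"
      by (intro Bochner_Integration.integrable_add i)
    fix s t \<epsilon> :: real assume st: "0 \<le> s" "s \<le> t" "\<epsilon> > 0" "t + \<epsilon> \<le> T"
    \<comment> \<open>Tested with the ramp times g', the summand 2 \<alpha> J of \<omega> becomes
      \<alpha> times the integral of the ramp times g'', which is the diffusion term.\<close>
    note L = lipschitz_ramp[OF g st(3), of s t]
    let ?f = "\<lambda>z. ramp s t \<epsilon> (fst z) * circle_deriv g (snd z)" and ?h = "\<lambda>z. ramp s t \<epsilon> (fst z) * circle_deriv (circle_deriv g) (snd z)"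
    have "(LINT u|lborel. indicator {0..1} u * ((LINT x|\<rho> (t + \<epsilon> * u). g x) - (LINT x|\<rho> (s + \<epsilon> * u). g x)))
      = (LINT z|R. ?f z * b z) + \<alpha> * (2 * signed_integral (cyl T) J ?f)"
      unfolding limit_averaged[OF g(1) st] SI\<omega>[OF lipschitz_C1_bounded_measurable(1)[OF L]] by simp
    also have "... = (LINT z|R. ?f z * b z) + (LINT z|R. \<alpha> * ?h z)"
      unfolding limit_jump_divergence[OF L, symmetric] by simp
    also have "... = (LINT z|R. ?f z * b z + \<alpha> * ?h z)"
      using integrable_mult_bounded[OF b(1) sR lipschitz_C1_bounded_measurable(1)[OF L]]
        integrable_bounded_measurable[OF fR sR lipschitz_C1_bounded_measurable(2)[OF L]]
      by (intro Bochner_Integration.integral_add[symmetric] integrable_mult_right)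
    also have "... = (LINT z|R. ramp s t \<epsilon> (fst z) * (circle_deriv g (snd z) * b z + \<alpha> * circle_deriv (circle_deriv g) (snd z)))"
      by (intro Bochner_Integration.integral_cong refl) (simp add: algebra_simps)
    finally show "(LINT u|lborel. indicator {0..1} u * ((LINT x|\<rho> (t + \<epsilon> * u). g x) - (LINT x|\<rho> (s + \<epsilon> * u). g x)))
      = (LINT z|R. ramp s t \<epsilon> (fst z) * (circle_deriv g (snd z) * b z + \<alpha> * circle_deriv (circle_deriv g) (snd z)))" .
  qed

  define D\<^sub>0 where "D\<^sub>0 A = - 2 * J A + 0 * J A" for A
  have D\<^sub>0: "vector_measure (cyl T) D\<^sub>0" unfolding D\<^sub>0_def by (rule vector_measure_lincomb[OF J J])
  \<comment> \<open>Up to sign, the limiting jump identity is the definition of the distributional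
    derivative, so -2 J qualifies as that derivative.\<close>
  have SID: "signed_integral (cyl T) D\<^sub>0 \<phi> = - (LINT (t, x)|R. circle_deriv (\<lambda>y. \<phi> (t, y)) x)" if \<phi>: "test_function T \<phi>" for \<phi>
    unfolding limit_jump_divergence[OF test_function_lipschitz_C1[OF \<phi>]] D\<^sub>0_def[abs_def]
      signed_integral_lincomb[OF J J test_function_bounded_measurable[OF \<phi>]] by simp
  have dx: "has_distributional_dx T R D\<^sub>0" unfolding has_distributional_dx_def using D\<^sub>0 SID by blast
  have acD\<^sub>0: "signed_ac R D\<^sub>0"
  proof (rule duality_ac[OF D\<^sub>0 fR sR, of "1 / 2"])
    \<comment> \<open>The Fisher information bound is precisely the hypothesis of
      \<open>duality_ac\<close> with a = 1 / 2; the constant on the right only has to be independent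
      of \<phi>.\<close>
    fix \<phi> assume \<phi>: "test_function T \<phi>"
    show "signed_integral (cyl T) D\<^sub>0 \<phi> - 1 / 2 * (LINT z|R. (\<phi> z)\<^sup>2) \<le> 1 / \<alpha> * (1 / (2 * \<alpha>) * (LINT z|R. (b z)\<^sup>2) + C)"
      unfolding SID[OF \<phi>]
      by (rule drift_diffusion.fisher_estimate[OF drift_diffusion.intro[OF T \<alpha> \<rho> b weak limit_initial_entropy]
            test_function_lipschitz_C1[OF \<phi>]])
  qed simp
  \<comment> \<open>With the derivative of \<rho> known to be absolutely continuous, J follows, and
    then \<omega> as 2 \<alpha> (J - \<mu>). This is where the combination controlled by the rate
    splits into its two parts.\<close>
  have acJ: "signed_ac R J" using acD\<^sub>0 unfolding signed_ac_def D\<^sub>0_def by simp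
  have ac\<omega>: "signed_ac R \<omega>" using acJ ac\<mu> \<alpha> unfolding signed_ac_def \<mu>_def by simp

  define \<gamma> where "\<gamma> = signed_RN_deriv R J"
  have \<gamma>: "integrable R \<gamma>" "\<And>A. A \<in> sets R \<Longrightarrow> J A = (LINT z|R. indicator A z * \<gamma> z)"
    unfolding \<gamma>_def using signed_RN_deriv[OF fR vR[OF J] acJ] by auto
  have ind: "integrable R (\<lambda>z. indicator A z * h z)" if "A \<in> sets R" "integrable R h" for A and h :: "_ \<Rightarrow> real"
    using integrable_mult_indicator[OF that] by simp
  \<comment> \<open>The density of \<omega>, obtained by solving the definition of \<mu> for
    \<omega>; it supplies the slices of the limiting continuity equation.\<close>
  define k where "k z = 2 * \<alpha> * (\<gamma> z - \<beta> z)" for z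
  have k: "integrable R k" unfolding k_def using \<gamma>(1) \<beta>(1) by simp
  have \<omega>k: "\<omega> A = (LINT z|R. indicator A z * k z)" if A: "A \<in> sets R" for A
  proof -
    have "(LINT z|R. indicator A z * k z) = (LINT z|R. 2 * \<alpha> * (indicator A z * \<gamma> z - indicator A z * \<beta> z))"
      by (intro Bochner_Integration.integral_cong) (auto simp: k_def algebra_simps)
    also have "... = 2 * \<alpha> * (J A - \<mu> A)"
      using ind[OF A \<gamma>(1)] ind[OF A \<beta>(1)] \<gamma>(2)[OF A] \<beta>(2)[of A] A sR by simp
    also have "... = \<omega> A" unfolding \<mu>_def using \<alpha> by simp
    finally show ?thesis ..
  qed
  have ce: "CE_circle T \<rho> \<omega>"
  proof (rule CE_circle_density[OF T \<rho> k])
    show "\<omega> A = (LINT z|R. indicator A z * k z)" if "A \<in> sets (cyl T)" for A using \<omega>k that sR by simp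
    fix \<psi> s t assume \<psi>: "circle_C1 \<psi>" and st: "0 \<le> s" "s \<le> t" "t \<le> T"
    have d: "bounded_measurable (cyl T) (\<lambda>z. h (fst z) * circle_deriv \<psi> (snd z))" if "continuous_on UNIV h" "\<And>r. \<bar>h r\<bar> \<le> 1" for h
      by (rule strip_product_bounded[OF borel_measurable_continuous_onI[OF that(1)] that(2) circle_C1_bounded(2)[OF \<psi>]])
    show "(LINT x|\<rho> t. \<psi> x) - (LINT x|\<rho> s. \<psi> x) = (LINT z|R. indicator {s<..t} (fst z) * (circle_deriv \<psi> (snd z) * k z))"
    proof (rule narrow_curve_average_limit[OF T \<rho> circle_C1_continuous[OF \<psi>] _ _ st])
      show "integrable R (\<lambda>z. circle_deriv \<psi> (snd z) * k z)"
        using integrable_mult_bounded[OF k sR d[of "\<lambda>_. 1"]] by simp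
      fix s t \<epsilon> :: real assume st: "0 \<le> s" "s \<le> t" "\<epsilon> > 0" "t + \<epsilon> \<le> T"
      show "(LINT u|lborel. indicator {0..1} u * ((LINT x|\<rho> (t + \<epsilon> * u). \<psi> x) - (LINT x|\<rho> (s + \<epsilon> * u). \<psi> x)))
        = (LINT z|R. ramp s t \<epsilon> (fst z) * (circle_deriv \<psi> (snd z) * k z))"
        unfolding limit_averaged[OF \<psi> st] mult.assoc[symmetric]
        by (rule signed_integral_density[OF k sR _ d[OF ramp_continuous[OF st(3)] ramp_bound]]) (use \<omega>k sR in simp)
    qed
  qed
  let ?D = "distributional_dx T R"
  \<comment> \<open>\<open>distributional_dx\<close> is a choice among all representatives;
    existence of one makes the chosen one a representative as well.\<close>
  have hD: "has_distributional_dx T R ?D" unfolding distributional_dx_def by (rule someI[of "has_distributional_dx T R", OF dx])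
  then have D: "vector_measure (cyl T) ?D" unfolding has_distributional_dx_def by blast
  \<comment> \<open>Test functions determine the measure, so the chosen representative agrees with
    -2 J on the measurable sets of the strip.\<close>
  have D_eq: "?D A = D\<^sub>0 A" if "A \<in> sets (cyl T)" for A
    by (rule vector_measure_unique[OF D D\<^sub>0 _ that]) (use hD SID in \<open>simp add: has_distributional_dx_def\<close>)
  have acD: "signed_ac R ?D" using acD\<^sub>0 D_eq sR unfolding signed_ac_def by (metis null_setsD2)
  have AE\<omega>: "AE z in R. signed_RN_deriv R \<omega> z = k z" by (rule signed_RN_deriv_unique[OF fR vR[OF \<omega>] k \<omega>k])
  have AED: "AE z in R. signed_RN_deriv R ?D z = - 2 * \<gamma> z"
  proof (rule signed_RN_deriv_unique[OF fR vR[OF D]])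
    show "integrable R (\<lambda>z. - 2 * \<gamma> z)" using \<gamma>(1) by simp
    fix A assume A: "A \<in> sets R"
    have "(LINT z|R. indicator A z * (- 2 * \<gamma> z)) = (LINT z|R. - 2 * (indicator A z * \<gamma> z))"
      by (intro Bochner_Integration.integral_cong) auto
    also have "... = - 2 * J A" unfolding \<gamma>(2)[OF A] by (rule Bochner_Integration.integral_mult_right_zero)
    also have "... = ?D A" using D_eq[of A] A sR by (simp add: D\<^sub>0_def)
    finally show "?D A = (LINT z|R. indicator A z * (- 2 * \<gamma> z))" ..
  qed
  let ?F = "\<lambda>z. ennreal (\<bar>\<alpha> * signed_RN_deriv R ?D z + signed_RN_deriv R \<omega> z\<bar>\<^sup>2)"
  have "(\<integral>\<^sup>+t\<in>{0<..<T}. (\<integral>\<^sup>+x. ?F (t, x) \<partial>\<rho> t) \<partial>lborel) = (\<integral>\<^sup>+z. ?F z \<partial>R)"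
  proof -
    have "signed_RN_deriv R ?D \<in> borel_measurable R" "signed_RN_deriv R \<omega> \<in> borel_measurable R"
      using signed_RN_deriv(1)[OF fR vR[OF D] acD] signed_RN_deriv(1)[OF fR vR[OF \<omega>] ac\<omega>] by auto
    then have "?F \<in> borel_measurable R" by measurable
    then have "?F \<in> borel_measurable (cyl T)" unfolding measurable_curve_measure[OF T \<rho>] .
    from nn_integral_curve_measure[OF T \<rho> this] show ?thesis unfolding set_nn_integral_time by simp
  qed
  also have "... = (\<integral>\<^sup>+z. ennreal (4 * \<alpha>\<^sup>2) * ennreal ((\<beta> z)\<^sup>2) \<partial>R)"
  proof (rule nn_integral_cong_AE)
    show "AE z in R. ?F z = ennreal (4 * \<alpha>\<^sup>2) * ennreal ((\<beta> z)\<^sup>2)"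
      using AE\<omega> AED
    proof eventually_elim
      case (elim z)
      \<comment> \<open>The density \<gamma> of J cancels between \<alpha> times the derivative and
        \<omega>; only \<beta> remains.\<close>
      have "\<alpha> * (- 2 * \<gamma> z) + k z = - 2 * \<alpha> * \<beta> z" by (simp add: k_def algebra_simps)
      then show ?case unfolding elim by (simp add: ennreal_mult[symmetric] power_mult_distrib)
    qed
  qed
  also have "... = ennreal (4 * \<alpha>\<^sup>2) * (\<integral>\<^sup>+z. ennreal ((\<beta> z)\<^sup>2) \<partial>R)" using \<beta>(1) by (intro nn_integral_cmult) auto
  also have "... \<le> ennreal (4 * \<alpha>\<^sup>2) * ennreal (4 * (1 / (4 * \<alpha>)) * M)" by (intro mult_left_mono \<beta>sq) simp
  \<comment> \<open>The duality bound gives M / \<alpha> for the integral of \<beta>^2. Multiplied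
    by 4 \<alpha>^2 this is 4 \<alpha> M, which the prefactor 1 / (4 \<alpha>) of the functional
    reduces to M exactly.\<close>
  also have "... = ennreal (4 * \<alpha> * M)" using \<alpha> M(1) by (simp add: ennreal_mult[symmetric] power2_eq_square)
  finally have "ennreal (1 / (4 * \<alpha>)) * (\<integral>\<^sup>+t\<in>{0<..<T}. (\<integral>\<^sup>+x. ?F (t, x) \<partial>\<rho> t) \<partial>lborel) \<le> ennreal (1 / (4 * \<alpha>)) * ennreal (4 * \<alpha> * M)"
    by (intro mult_left_mono) simp_all
  also have "... = Liminf at_top rate" using \<alpha> M by (simp add: ennreal_mult[symmetric])
  finally have "ennreal (1 / (4 * \<alpha>)) * (\<integral>\<^sup>+t\<in>{0<..<T}. (\<integral>\<^sup>+x. ?F (t, x) \<partial>\<rho> t) \<partial>lborel) \<le> Liminf at_top rate" .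
  then show ?thesis unfolding limit_functional_def Let_def using ac\<omega> acD dx ce by auto
qed

end

theorem theorem4p7:
  fixes \<alpha> T C :: real
    and \<sigma> :: "real \<Rightarrow> real \<Rightarrow> omega1 measure"
    and j :: "real \<Rightarrow> real \<Rightarrow> omega1 set \<Rightarrow> real \<times> real"
    and \<rho> :: "real \<Rightarrow> circle measure"
    and \<omega> J :: "(real \<times> circle) set \<Rightarrow> real"
  assumes "\<alpha> > 0" and "T > 0" and "C > 0"
    and "\<And>V. V \<ge> 1 \<Longrightarrow> CE_omega1 T (\<sigma> V) (j V)"
    and "(SUP V\<in>{1..}. Ent (measure (\<sigma> V 0)) pi_omega1 + rate_functional \<alpha> T V (\<sigma> V) (j V))
           \<le> ennreal C"
    and "narrow_curve T \<rho>"
    and "vector_measure (cyl T) \<omega>" and "vector_measure (cyl T) J"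
    and "narrow_tendsto (\<lambda>V. curve_measure T (density_slice (\<sigma> V))) (curve_measure T \<rho>) at_top"
    and "signed_narrow_tendsto (cyl T)
           (\<lambda>V. signed_curve_measure T (momentum_slice V (\<sigma> V))) \<omega> at_top"
    and "signed_narrow_tendsto (cyl T)
           (\<lambda>V. signed_curve_measure T (jump_slice V (j V))) J at_top"
    and "\<And>t. t \<in> {0..T} \<Longrightarrow> narrow_tendsto (\<lambda>V. density_slice (\<sigma> V) t) (\<rho> t) at_top"
  shows "limit_functional \<alpha> T \<rho> \<omega> \<le> Liminf at_top (\<lambda>V. rate_functional \<alpha> T V (\<sigma> V) (j V))"
  by (rule limit_functional_le[OF assms])

end
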